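(* Let $M\subset\mathbb C^n$ be a smooth pseudoconvex CR manifold of hypersurface type, $S\subset M$ a submanifold of CR dimension $0$, and $z_o\in S$. Let $F$ be a smooth, real, strictly increasing function with $F(d)/d^2\searrow 0$ as $d\searrow 0$, let $F^*$ be its inverse, and set $f(t):=\big(F^*(t^{-1})\big)^{-1}$. Assume that $M$ has type $F$ along $S$ in a neighborhood $U$ of $z_o$, that is, $(c_{ij})\gtrsim \frac{F(d_S)}{d_S^2}\,\mathrm{Id}$ on $U$. Then there is a uniformly bounded family of smooth real weights $\{\phi^k\}_{k\ge1}$ such that, for smooth forms $v$ compactly supported in $M\cap U$: $$\|f(\Lambda)v\|^2\lesssim \int_M(c_{ij})(\Lambda^{\frac12}v,\overline{\Lambda^{\frac12}v})\,dV+\sum_{k=1}^{+\infty}\int_M(\phi_{ij}^k)(\Gamma_kv,\overline{\Gamma_kv})\,dV+\|v\|_0^2$$ for any $v$ of degree $h\in[1,\dim_{CR}(M)]$, and $$\|f(\Lambda)v\|^2\lesssim \int_M\Big(\mathrm{Trace}(c_{ij})\mathrm{Id}-(c_{ij})\Big)(\Lambda^{\frac12}v,\overline{\Lambda^{\frac12}v})\,dV+\sum_{k=1}^{+\infty}\int_M\Big(\mathrm{Trace}(\phi^k_{ij})\mathrm{Id}-(\phi^k_{ij})\Big)(\Gamma_kv,\overline{\Gamma_kv})\,dV+\|v\|_0^2$$ for any $v$ of degree $h\in[0,\dim_{CR}(M)-1]$.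
   Context: The setting is local: near $z_o$, $M$ is identified by a local CR diffeomorphism with a smooth real hypersurface of $\mathbb C^n$, so $\dim_{CR}(M)=n-1$; $U$ is a small neighborhood of $z_o$. $A\lesssim B$ means $A\le CB$ with $C>0$ independent of $v$ (and of $k$). Frame. $T^{\mathbb C}M=TM\cap iTM$; $\mathrm{Id}$ is its identity. $\omega_1,\dots,\omega_{n-1}$ is a smooth orthonormal basis of $(1,0)$ forms, supplemented by a purely imaginary form $\gamma$; the dual vector fields are $\partial_{\omega_j}$, $\bar\partial_{\omega_j}$ ($j\le n-1$) and $T$. Define $c_{ij}^h$ by $[\partial_{\omega_i},\bar\partial_{\omega_j}]=c_{ij}T+\sum_{h=1}^{n-1}c_{ij}^h\partial_{\omega_h}-\sum_{h=1}^{n-1}\overline{c_{ji}^h}\,\bar\partial_{\omega_h}$. The matrix $(c_{ij})$ is the Levi form $d\gamma|_{T^{\mathbb C}M}$ of $M$; pseudoconvexity means $(c_{ij})\ge0$. Levi form of a weight. For a smooth real $\phi$, $(\phi_{ij})$ is the (Hermitian) matrix of the Levi form $\partial_b\bar\partial_b\phi$, i.e. $\phi_{ij}=\frac12\big((\partial_{\omega_i}\bar\partial_{\omega_j}+\bar\partial_{\omega_j}\partial_{\omega_i})\phi+\sum_h\overline{c_{ji}^h}\bar\partial_{\omega_h}\phi+\sum_hc_{ij}^h\partial_{\omega_h}\phi\big)$. Forms. A form of degree $h$ is $v=\sum'_{|J|=h}v_J\bar\omega_J$. For a matrix $A=(a_{ij})$, $A(v,\bar w)=\sum'_{|K|=h-1}\sum_{i,j}a_{ij}v_{iK}\overline{w_{jK}}$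 ($=0$ if $h=0$), while $\mathrm{Id}(v,\bar w)=\sum'_Jv_J\overline{w_J}$; thus $(\mathrm{Trace}(A)\mathrm{Id}-A)(v,\bar v)=\mathrm{Trace}(A)|v|^2-A(v,\bar v)$. Operators. $d_S$ is the Euclidean distance to $S$. In local coordinates $M\cap U\simeq\mathbb R^{2n-1}$ with dual variables $\xi$, $\Lambda$ and $f(\Lambda)$ are the pseudodifferential operators with symbols $\sqrt{1+|\xi|^2}$ and $f(\sqrt{1+|\xi|^2})$, acting on coefficients. $v=\sum_{k\ge1}\Gamma_kv$ is the dyadic (wavelet) decomposition: the $\Gamma_k$ are Fourier multipliers forming a smooth dyadic partition of unity, with the symbol of $\Gamma_k$ supported where $\sqrt{1+|\xi|^2}\sim2^k$. $\|\cdot\|=\|\cdot\|_0$ is the $L^2$ norm. *)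

theory Defs
  imports "HOL-Analysis.Analysis"
begin

section \<open>Smooth functions and submanifolds\<close>

primrec iter_deriv ::
  "'a list \<Rightarrow> ('a::real_normed_vector \<Rightarrow> 'b::real_normed_vector) \<Rightarrow> 'a \<Rightarrow> 'b" where
  "iter_deriv [] g = g"
| "iter_deriv (e # es) g = (\<lambda>x. frechet_derivative (iter_deriv es g) (at x) e)"

text \<open>\<open>C\<^sup>\<infinity>\<close> on \<open>A\<close>; meant for open \<open>A\<close>.\<close>

definition smooth_on ::
  "'a::real_normed_vector set \<Rightarrow> ('a \<Rightarrow> 'b::real_normed_vector) \<Rightarrow> bool" where
  "smooth_on A g \<longleftrightarrow> (\<forall>es. \<forall>x\<in>A. iter_deriv es g differentiable (at x))"

definition embedded_submanifold :: "nat \<Rightarrow> 'a::euclidean_space set \<Rightarrow> bool" where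
  "embedded_submanifold d S \<longleftrightarrow>
     (\<forall>p\<in>S. \<exists>W (W' :: 'a set) \<Phi> \<Psi> B.
        open W \<and> p \<in> W \<and> open W' \<and> homeomorphism W W' \<Phi> \<Psi> \<and>
        smooth_on W \<Phi> \<and> smooth_on W' \<Psi> \<and>
        subspace B \<and> dim B = d \<and> \<Phi> ` (S \<inter> W) = B \<inter> W')"

definition tangent_space :: "'a::euclidean_space set \<Rightarrow> 'a \<Rightarrow> 'a set" where
  "tangent_space S p =
     {w. \<exists>c. c 0 = p \<and> (\<forall>\<^sub>F t in at (0::real). c t \<in> S) \<and> (c has_vector_derivative w) (at 0)}"

text \<open>The complex tangent space \<open>TS \<inter> i TS\<close>; the CR dimension is its complex dimension,
  i.e. half of its real dimension.\<close>

definition complex_tangent_space :: "(complex^'n) set \<Rightarrow> complex^'n \<Rightarrow> (complex^'n) set" where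
  "complex_tangent_space S p = tangent_space S p \<inter> (\<lambda>w. \<i> *s w) ` tangent_space S p"

definition has_cr_dim :: "(complex^'n) set \<Rightarrow> nat \<Rightarrow> bool" where
  "has_cr_dim S d \<longleftrightarrow> (\<forall>p\<in>S. dim (complex_tangent_space S p) = 2 * d)"

text \<open>\<open>\<psi>\<close> is the inverse of a chart of \<open>M\<close>: a smooth parametrization, by the open set \<open>V\<close>, of a
  relatively open piece \<open>\<psi> ` V\<close> of \<open>M\<close>.\<close>

definition smooth_parametrization ::
  "(complex^'n) set \<Rightarrow> (real^'m) set \<Rightarrow> (real^'m \<Rightarrow> complex^'n) \<Rightarrow> bool" where
  "smooth_parametrization M V \<psi> \<longleftrightarrow>
     open V \<and> smooth_on V \<psi> \<and>
     (\<forall>x\<in>V. inj (frechet_derivative \<psi> (at x))) \<and>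
     (\<exists>\<kappa>. homeomorphism V (\<psi> ` V) \<psi> \<kappa>) \<and>
     openin (top_of_set M) (\<psi> ` V)"


section \<open>Vector fields and CR frames\<close>

text \<open>In the coordinates \<open>x \<in> V\<close>, a complex vector field is a map into \<open>complex^'m\<close> (its components
  along the coordinate fields), and so is a complex one-form.\<close>

definition partial :: "'m \<Rightarrow> (real^'m \<Rightarrow> 'b::real_normed_vector) \<Rightarrow> real^'m \<Rightarrow> 'b" where
  "partial l u x = frechet_derivative u (at x) (axis l 1)"

type_synonym 'm cfield = "real^'m \<Rightarrow> complex^'m"

definition vf_apply :: "'m::finite cfield \<Rightarrow> (real^'m \<Rightarrow> complex) \<Rightarrow> real^'m \<Rightarrow> complex" where
  "vf_apply X u x = (\<Sum>l\<in>UNIV. X x $ l * partial l u x)"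

definition vf_cnj :: "'m::finite cfield \<Rightarrow> 'm cfield" where
  "vf_cnj X x = (\<chi> l. cnj (X x $ l))"

definition lie_bracket :: "'m::finite cfield \<Rightarrow> 'm cfield \<Rightarrow> 'm cfield" where
  "lie_bracket X Y x =
     (\<chi> l. vf_apply X (\<lambda>y. Y y $ l) x - vf_apply Y (\<lambda>y. X y $ l) x)"

definition form_apply :: "'m::finite cfield \<Rightarrow> 'm cfield \<Rightarrow> real^'m \<Rightarrow> complex" where
  "form_apply \<alpha> X x = (\<Sum>l\<in>UNIV. \<alpha> x $ l * X x $ l)"

text \<open>The values of \<open>dz\<^sub>q\<close> and of \<open>dzbar\<^sub>q\<close> (the differential of the conjugate coordinate function) on the
  push-forward of \<open>X\<close> by \<open>\<psi>\<close>. So \<open>X\<close> is of type (1,0) iff all the \<open>dzbar_apply \<psi> X q x\<close> vanish,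
  and then \<open>(dz_apply \<psi> X q x)\<^sub>q\<close> are its components with respect to the \<open>\<partial>/\<partial>z\<^sub>q\<close>.\<close>

definition dz_apply ::
  "(real^'m \<Rightarrow> complex^'n) \<Rightarrow> 'm::finite cfield \<Rightarrow> 'n \<Rightarrow> real^'m \<Rightarrow> complex" where
  "dz_apply \<psi> X q x = (\<Sum>l\<in>UNIV. X x $ l * partial l \<psi> x $ q)"

definition dzbar_apply ::
  "(real^'m \<Rightarrow> complex^'n) \<Rightarrow> 'm::finite cfield \<Rightarrow> 'n \<Rightarrow> real^'m \<Rightarrow> complex" where
  "dzbar_apply \<psi> X q x = (\<Sum>l\<in>UNIV. X x $ l * cnj (partial l \<psi> x $ q))"

text \<open>\<open>\<omega> 0, \<dots>, \<omega> (r - 1)\<close> is the orthonormal basis of (1,0) forms, \<open>\<gamma>\<close> the purely imaginary form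
  completing them and their conjugates to a basis, and \<open>L 0, \<dots>, L (r - 1)\<close>, their conjugates and
  \<open>T\<close> form the dual basis of vector fields. The metric is induced from \<open>\<complex>\<^sup>n\<close>, with the \<open>dz\<^sub>q\<close>
  orthonormal; orthonormality of the \<open>\<omega> j\<close> is expressed on the dual basis \<open>L j\<close> of \<open>T\<^sup>1\<^sup>,\<^sup>0M\<close>.\<close>

definition cr_frame ::
  "nat \<Rightarrow> (real^'m) set \<Rightarrow> (real^'m \<Rightarrow> complex^'n) \<Rightarrow>
   (nat \<Rightarrow> 'm::finite cfield) \<Rightarrow> 'm cfield \<Rightarrow> (nat \<Rightarrow> 'm cfield) \<Rightarrow> 'm cfield \<Rightarrow> bool" where
  "cr_frame r V \<psi> \<omega> \<gamma> L T \<longleftrightarrow>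
     (\<forall>j<r. smooth_on V (\<omega> j) \<and> smooth_on V (L j)) \<and> smooth_on V \<gamma> \<and> smooth_on V T \<and>
     (\<forall>x\<in>V.
        (\<forall>j<r. \<forall>q. dzbar_apply \<psi> (L j) q x = 0) \<and>
        (\<forall>i<r. \<forall>j<r. (\<Sum>q\<in>UNIV. dz_apply \<psi> (L i) q x * cnj (dz_apply \<psi> (L j) q x))
                      = (if i = j then 1 else 0)) \<and>
        (\<forall>l. Re (\<gamma> x $ l) = 0) \<and>
        (\<forall>i<r. \<forall>j<r. form_apply (\<omega> i) (L j) x = (if i = j then 1 else 0)) \<and>
        (\<forall>i<r. \<forall>j<r. form_apply (\<omega> i) (vf_cnj (L j)) x = 0) \<and>
        (\<forall>i<r. form_apply (\<omega> i) T x = 0) \<and>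
        (\<forall>j<r. form_apply \<gamma> (L j) x = 0 \<and> form_apply \<gamma> (vf_cnj (L j)) x = 0) \<and>
        form_apply \<gamma> T x = 1)"

text \<open>The coefficients \<open>c\<^sub>i\<^sub>j\<close> and \<open>c\<^sub>i\<^sub>j\<^sup>h\<close> of \<open>T\<close> and \<open>L h\<close> in \<open>[L i, vf_cnj (L j)]\<close>, read off with the
  dual forms. For a frame, the coefficient of \<open>vf_cnj (L h)\<close> is then \<open>- cnj c\<^sub>j\<^sub>i\<^sup>h\<close>.\<close>

definition levi :: "'m::finite cfield \<Rightarrow> (nat \<Rightarrow> 'm cfield) \<Rightarrow> nat \<Rightarrow> nat \<Rightarrow> real^'m \<Rightarrow> complex" where
  "levi \<gamma> L i j x = form_apply \<gamma> (lie_bracket (L i) (vf_cnj (L j))) x"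

definition bracket_coeff ::
  "(nat \<Rightarrow> 'm::finite cfield) \<Rightarrow> (nat \<Rightarrow> 'm cfield) \<Rightarrow> nat \<Rightarrow> nat \<Rightarrow> nat \<Rightarrow> real^'m \<Rightarrow> complex" where
  "bracket_coeff \<omega> L h i j x = form_apply (\<omega> h) (lie_bracket (L i) (vf_cnj (L j))) x"

definition levi_weight ::
  "nat \<Rightarrow> (nat \<Rightarrow> 'm::finite cfield) \<Rightarrow> (nat \<Rightarrow> 'm cfield) \<Rightarrow> (real^'m \<Rightarrow> real) \<Rightarrow>
   nat \<Rightarrow> nat \<Rightarrow> real^'m \<Rightarrow> complex" where
  "levi_weight r \<omega> L \<phi> i j x =
     (let u = (\<lambda>y. complex_of_real (\<phi> y)) in
       (vf_apply (L i) (vf_apply (vf_cnj (L j)) u) x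
        + vf_apply (vf_cnj (L j)) (vf_apply (L i) u) x
        + (\<Sum>h<r. cnj (bracket_coeff \<omega> L h j i x) * vf_apply (vf_cnj (L h)) u x)
        + (\<Sum>h<r. bracket_coeff \<omega> L h i j x * vf_apply (L h) u x)) / 2)"

definition psd_matrix :: "nat \<Rightarrow> (nat \<Rightarrow> nat \<Rightarrow> complex) \<Rightarrow> bool" where
  "psd_matrix r A \<longleftrightarrow>
     (\<forall>i<r. \<forall>j<r. A j i = cnj (A i j)) \<and>
     (\<forall>a. 0 \<le> Re (\<Sum>i<r. \<Sum>j<r. A i j * a i * cnj (a j)))"

definition pseudoconvex_on ::
  "nat \<Rightarrow> (real^'m) set \<Rightarrow> 'm::finite cfield \<Rightarrow> (nat \<Rightarrow> 'm cfield) \<Rightarrow> bool" where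
  "pseudoconvex_on r V \<gamma> L \<longleftrightarrow> (\<forall>x\<in>V. psd_matrix r (\<lambda>i j. levi \<gamma> L i j x))"

text \<open>\<open>(c\<^sub>i\<^sub>j) \<ge> c F(d\<^sub>S)/d\<^sub>S\<^sup>2 Id\<close> for some \<open>c > 0\<close>, at the points of \<open>A\<close>. On \<open>S\<close> the quotient is \<open>0\<close> by
  the convention \<open>a / 0 = 0\<close>, which is also its limit as \<open>d\<^sub>S \<rightarrow> 0\<close>.\<close>

definition has_type_along ::
  "nat \<Rightarrow> (real \<Rightarrow> real) \<Rightarrow> (complex^'n) set \<Rightarrow> (real^'m) set \<Rightarrow> (real^'m \<Rightarrow> complex^'n) \<Rightarrow>
   'm::finite cfield \<Rightarrow> (nat \<Rightarrow> 'm cfield) \<Rightarrow> bool" where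
  "has_type_along r F S A \<psi> \<gamma> L \<longleftrightarrow>
     (\<exists>c>0. \<forall>x\<in>A. psd_matrix r (\<lambda>i j. levi \<gamma> L i j x
        - (if i = j then complex_of_real (c * (F (infdist (\<psi> x) S) / (infdist (\<psi> x) S)\<^sup>2)) else 0)))"

text \<open>The function \<open>f(t) = (F\<^sup>*(t\<^sup>-\<^sup>1))\<^sup>-\<^sup>1\<close>, with \<open>F\<^sup>*\<close> the inverse of \<open>F\<close> on \<open>(0,\<infinity>)\<close>. If \<open>t\<^sup>-\<^sup>1\<close> is not a
  value of \<open>F\<close> (possible for bounded \<open>t\<close> only), this is a constant independent of \<open>t\<close>.\<close>

definition type_gain :: "(real \<Rightarrow> real) \<Rightarrow> real \<Rightarrow> real" where
  "type_gain F t = inverse (the_inv_into {0<..} F (inverse t))"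

definition admissible_type :: "(real \<Rightarrow> real) \<Rightarrow> bool" where
  "admissible_type F \<longleftrightarrow>
     smooth_on {0<..} F \<and> strict_mono_on {0<..} F \<and>
     (\<exists>\<delta>>0. mono_on {0<..<\<delta>} (\<lambda>d. F d / d\<^sup>2)) \<and>
     ((\<lambda>d. F d / d\<^sup>2) \<longlongrightarrow> 0) (at_right 0)"


section \<open>Forms\<close>

text \<open>A form of degree \<open>h\<close> is given by its coefficients \<open>v J\<close> with respect to the conjugates of
  the \<open>\<omega>\<^sub>J\<close>, for the subsets \<open>J\<close> of \<open>{..<r}\<close> with \<open>h\<close> elements (taken in increasing order);
  its other values are irrelevant.\<close>

type_synonym 'm cform = "nat set \<Rightarrow> real^'m \<Rightarrow> complex"

definition multi_indices :: "nat \<Rightarrow> nat \<Rightarrow> nat set set" where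
  "multi_indices r h = {J. J \<subseteq> {..<r} \<and> card J = h}"

definition test_form :: "nat \<Rightarrow> nat \<Rightarrow> (real^'m) set \<Rightarrow> 'm::finite cform \<Rightarrow> bool" where
  "test_form r h A v \<longleftrightarrow>
     (\<forall>J\<in>multi_indices r h. smooth_on UNIV (v J) \<and>
        (\<exists>K. compact K \<and> K \<subseteq> A \<and> (\<forall>x. x \<notin> K \<longrightarrow> v J x = 0)))"

text \<open>The coefficient \<open>v\<^sub>i\<^sub>K\<close> of the alternating extension; the sign is that of the permutation
  ordering \<open>iK\<close>.\<close>

definition alt_coeff :: "'m::finite cform \<Rightarrow> nat \<Rightarrow> nat set \<Rightarrow> real^'m \<Rightarrow> complex" where
  "alt_coeff v i K x =
     (if i \<in> K then 0 else (-1) ^ card {k\<in>K. k < i} * v (insert i K) x)"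

text \<open>\<open>A(v, w)\<close> for \<open>w\<close> the conjugate of \<open>v\<close>; the sum over \<open>K\<close> is empty for \<open>h = 0\<close>. The real part is taken because the result is
  a real number: the matrices used are Hermitian.\<close>

definition matrix_form ::
  "nat \<Rightarrow> nat \<Rightarrow> (nat \<Rightarrow> nat \<Rightarrow> real^'m \<Rightarrow> complex) \<Rightarrow> 'm::finite cform \<Rightarrow> real^'m \<Rightarrow> real" where
  "matrix_form r h A v x =
     Re (\<Sum>K\<in>{K. K \<subseteq> {..<r} \<and> Suc (card K) = h}.
           \<Sum>i<r. \<Sum>j<r. A i j x * alt_coeff v i K x * cnj (alt_coeff v j K x))"

definition trace_minus_form ::
  "nat \<Rightarrow> nat \<Rightarrow> (nat \<Rightarrow> nat \<Rightarrow> real^'m \<Rightarrow> complex) \<Rightarrow> 'm::finite cform \<Rightarrow> real^'m \<Rightarrow> real" where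
  "trace_minus_form r h A v x =
     Re (\<Sum>i<r. A i i x) * (\<Sum>J\<in>multi_indices r h. (cmod (v J x))\<^sup>2) - matrix_form r h A v x"


section \<open>Fourier multipliers, norms and integrals\<close>

definition fourier :: "(real^'m \<Rightarrow> complex) \<Rightarrow> real^'m::finite \<Rightarrow> complex" where
  "fourier u \<xi> = (LINT x|lborel. cis (- (x \<bullet> \<xi>)) * u x)"

definition multiplier :: "(real^'m::finite \<Rightarrow> real) \<Rightarrow> (real^'m \<Rightarrow> complex) \<Rightarrow> real^'m \<Rightarrow> complex" where
  "multiplier \<sigma> u x =
     (LINT \<xi>|lborel. cis (x \<bullet> \<xi>) * complex_of_real (\<sigma> \<xi>) * fourier u \<xi>) / (2 * pi) ^ CARD('m)"

definition multiplier_form :: "(real^'m::finite \<Rightarrow> real) \<Rightarrow> 'm cform \<Rightarrow> 'm cform" where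
  "multiplier_form \<sigma> v = (\<lambda>J. multiplier \<sigma> (v J))"

definition Lambda_symbol :: "real^'m::finite \<Rightarrow> real" where
  "Lambda_symbol \<xi> = sqrt (1 + (norm \<xi>)\<^sup>2)"

text \<open>The symbols \<open>\<Gamma> k\<close>, \<open>k \<ge> 1\<close>, of a smooth dyadic partition of unity. The derivative bounds are
  those satisfied by dilations \<open>\<Gamma> k \<xi> = \<Theta> (2\<^sup>-\<^sup>k \<xi>)\<close> of one function.\<close>

definition dyadic_partition :: "(nat \<Rightarrow> real^'m::finite \<Rightarrow> real) \<Rightarrow> bool" where
  "dyadic_partition \<Gamma> \<longleftrightarrow>
     (\<forall>k\<ge>1. smooth_on UNIV (\<Gamma> k) \<and> (\<forall>\<xi>. 0 \<le> \<Gamma> k \<xi>)) \<and>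
     (\<forall>\<xi>. (\<lambda>k. \<Gamma> (Suc k) \<xi>) sums 1) \<and>
     (\<exists>A>0. \<forall>k\<ge>1. \<forall>\<xi>. \<Gamma> k \<xi> \<noteq> 0 \<longrightarrow>
        2 ^ k / A \<le> Lambda_symbol \<xi> \<and> Lambda_symbol \<xi> \<le> A * 2 ^ k) \<and>
     (\<forall>es. set es \<subseteq> Basis \<longrightarrow>
        (\<exists>C. \<forall>k\<ge>1. \<forall>\<xi>. \<bar>iter_deriv es (\<Gamma> k) \<xi>\<bar> \<le> C / 2 ^ (k * length es)))"

text \<open>The squared \<open>L\<^sup>2\<close> norm in the local coordinates.\<close>

definition form_norm_sq :: "nat \<Rightarrow> nat \<Rightarrow> 'm::finite cform \<Rightarrow> real" where
  "form_norm_sq r h v = (\<Sum>J\<in>multi_indices r h. LINT x|lborel. (cmod (v J x))\<^sup>2)"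

text \<open>The integral over \<open>\<psi> ` A\<close> with respect to the volume induced from \<open>\<complex>\<^sup>n\<close>, given by the
  Gram determinant of \<open>\<psi>\<close>.\<close>

definition volume_density :: "(real^'m \<Rightarrow> complex^'n) \<Rightarrow> real^'m::finite \<Rightarrow> real" where
  "volume_density \<psi> x =
     sqrt (det ((\<chi> l p. partial l \<psi> x \<bullet> partial p \<psi> x) :: real^'m^'m))"

definition integral_dV ::
  "(real^'m \<Rightarrow> complex^'n) \<Rightarrow> (real^'m) set \<Rightarrow> (real^'m::finite \<Rightarrow> real) \<Rightarrow> real" where
  "integral_dV \<psi> A g = (LINT x:A|lborel. g x * volume_density \<psi> x)"

end

theory Submission
  imports Defs "HOL-Probability.Probability"
begin

text \<open>Since the complex tangent space of \<open>S\<close> is trivial, a sum \<open>\<rho>\<close> of squares of defining functions of \<open>S\<close> has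
  positive definite Levi form near \<open>z\<close> and is bounded by \<open>d\<^sub>S\<^sup>2\<close>. With \<open>b\<^sub>k\<close> comparable to \<open>f(2\<^sup>k)\<close>, let \<open>\<phi>\<^sup>k\<close> be
  a bounded function of \<open>b\<^sub>k\<^sup>2 \<rho>\<close> that is linear for small arguments. Its Levi form is at least \<open>c b\<^sub>k\<^sup>2\<close> where
  \<open>d\<^sub>S < 1 / b\<^sub>k\<close>, and \<open>O(b\<^sub>k\<^sup>2)\<close> everywhere; where \<open>d\<^sub>S \<ge> 1 / b\<^sub>k\<close>, monotonicity of \<open>F(d) / d\<^sup>2\<close> gives
  \<open>2\<^sup>k (c\<^sub>i\<^sub>j) \<ge> c b\<^sub>k\<^sup>2 Id\<close>. So \<open>M 2\<^sup>k (c\<^sub>i\<^sub>j) + (\<phi>\<^sup>k\<^sub>i\<^sub>j) \<ge> c b\<^sub>k\<^sup>2 Id\<close> near \<open>z\<close>. Apply this to \<open>\<Gamma>\<^sub>k v\<close> and sum over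
  \<open>k\<close>: the sum of the \<open>2\<^sup>k (c\<^sub>i\<^sub>j)(\<Gamma>\<^sub>k v, \<Gamma>\<^sub>k v)\<close> is controlled by \<open>(c\<^sub>i\<^sub>j)(\<Lambda>\<^sup>1\<^sup>/\<^sup>2 v, \<Lambda>\<^sup>1\<^sup>/\<^sup>2 v)\<close> up to \<open>\<parallel>v\<parallel>\<^sup>2\<close>, because
  \<open>(c\<^sub>i\<^sub>j) \<ge> 0\<close> and the commutators of the square roots of the symbols are bounded on \<open>L\<^sup>2\<close>; outside a neighborhood
  of the support of \<open>v\<close>, \<open>\<Gamma>\<^sub>k v\<close> is \<open>O(2\<^sup>-\<^sup>k)\<close> in \<open>L\<^sup>2\<close>. Multiplying the weights by a small constant absorbs \<open>M\<close>.\<close>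

section \<open>Smooth functions\<close>

text \<open>Away from \<open>S\<close> the Levi forms of the weights have no sign, so the sum over
  \<open>k\<close> on the right may be negative and its constant cannot be raised separately from
  that of the \<open>c\<^sub>i\<^sub>j\<close> term. This is why the weights carry a small factor;
  one family must serve every degree and both estimates, so the factor is chosen jointly. The
  operators are nonlocal: \<open>\<Gamma>\<^sub>k v\<close> leaves the set where the pointwise
  inequality holds. Both this loss and the comparison with
  \<open>\<Lambda>\<^sup>1\<^sup>/\<^sup>2\<close> are settled without symbol calculus. A
  coefficient integrated against two multipliers is an integral over pairs of frequencies, and a
  two-variable symbol of size \<open>|\<xi> - \<eta>|\<^sup>2\<close> costs only
  \<open>\<parallel>v\<parallel>\<^sup>2\<close> by Schur's test. A sum of squares of symbols is
  completed to a multiple of \<open>\<Lambda>\<close> by one more square, whose contribution is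
  nonnegative and is dropped. The sums are cut at \<open>k \<le> K\<close> with constants
  independent of \<open>K\<close>. Symbols may be merely measurable, since \<open>f\<close> may jump
  where \<open>1 / t\<close> leaves the range of \<open>F\<close>.\<close>

lemma iter_deriv_snoc:
  "iter_deriv (es @ [e]) g = iter_deriv es (\<lambda>x. frechet_derivative g (at x) e)"
  by (induction es) auto

text \<open>The last entry of the list is the direction differentiated first, so splitting lists at
  their end isolates the first derivative.\<close>

lemma smooth_on_unfold:
  "smooth_on A g \<longleftrightarrow>
     (\<forall>x\<in>A. g differentiable (at x)) \<and> (\<forall>e. smooth_on A (\<lambda>x. frechet_derivative g (at x) e))"
  (is "?L \<longleftrightarrow> ?R")
proof
  assume L: ?L
  show ?R
    unfolding smooth_on_def
  proof (intro conjI allI ballI)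
    fix x assume "x \<in> A"
    then show "g differentiable (at x)"
      using L[unfolded smooth_on_def, rule_format, of x "[]"] by simp
  next
    fix e es x assume "x \<in> A"
    then show "iter_deriv es (\<lambda>x. frechet_derivative g (at x) e) differentiable at x"
      using L[unfolded smooth_on_def, rule_format, of x "es @ [e]"] by (simp add: iter_deriv_snoc)
  qed
next
  assume R: ?R
  show ?L
    unfolding smooth_on_def
  proof (intro allI ballI)
    fix es x assume x: "x \<in> A"
    show "iter_deriv es g differentiable at x"
    proof (cases es rule: rev_cases)
      case Nil
      then show ?thesis using R x by simp
    next
      case (snoc ys y)
      have "smooth_on A (\<lambda>x. frechet_derivative g (at x) y)" using R by blast
      then show ?thesis using x unfolding smooth_on_def snoc iter_deriv_snoc by blast
    qed
  qed
qed

lemma has_derivative_cong_open: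
  assumes "open A" "x \<in> A" "\<And>y. y \<in> A \<Longrightarrow> f y = g y"
  shows "(f has_derivative D) (at x) \<longleftrightarrow> (g has_derivative D) (at x)"
proof
  show "(g has_derivative D) (at x)" if "(f has_derivative D) (at x)"
    by (rule has_derivative_transform_within_open[OF that assms(1,2)]) (rule assms(3))
  show "(f has_derivative D) (at x)" if "(g has_derivative D) (at x)"
    by (rule has_derivative_transform_within_open[OF that assms(1,2)]) (rule assms(3)[symmetric])
qed

lemma frechet_derivative_cong_open:
  assumes "open A" "x \<in> A" "\<And>y. y \<in> A \<Longrightarrow> f y = g y"
  shows "frechet_derivative f (at x) = frechet_derivative g (at x)"
  unfolding frechet_derivative_def using has_derivative_cong_open[OF assms] by simp

lemma differentiable_cong_open:
  assumes "open A" "x \<in> A" "\<And>y. y \<in> A \<Longrightarrow> f y = g y"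
  shows "f differentiable (at x) \<longleftrightarrow> g differentiable (at x)"
  unfolding differentiable_def using has_derivative_cong_open[OF assms] by simp

text \<open>Every iterated derivative of \<open>g\<close> coincides on \<open>A\<close> with some
  member of \<open>P\<close>, and agreement on an open set is enough to differentiate once more.
  Closure properties of smooth functions follow by naming a class of functions that is stable under
  directional derivatives.\<close>

lemma smooth_on_coinduct:
  assumes "open A" and "P g"
    and step: "\<And>g. P g \<Longrightarrow> \<exists>D. (\<forall>x\<in>A. (g has_derivative D x) (at x)) \<and> (\<forall>e. P (\<lambda>x. D x e))"
  shows "smooth_on A g"
proof -
  have "\<exists>g'. P g' \<and> (\<forall>x\<in>A. iter_deriv es g x = g' x)" for es
  proof (induction es)
    case Nil
    show ?case using \<open>P g\<close> by auto
  next
    case (Cons e es)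
    then obtain g' where g': "P g'" "\<forall>x\<in>A. iter_deriv es g x = g' x" by blast
    obtain D where D: "\<forall>x\<in>A. (g' has_derivative D x) (at x)" "\<forall>e. P (\<lambda>x. D x e)"
      using step[OF g'(1)] by blast
    have "iter_deriv (e # es) g x = D x e" if "x \<in> A" for x
    proof -
      have "frechet_derivative (iter_deriv es g) (at x) = frechet_derivative g' (at x)"
        by (rule frechet_derivative_cong_open[OF \<open>open A\<close> that]) (use g'(2) in blast)
      also have "\<dots> = D x"
        by (rule frechet_derivative_at[symmetric]) (use D(1) that in blast)
      finally show ?thesis by simp
    qed
    then show ?case using D(2) by blast
  qed
  note * = this
  show ?thesis
    unfolding smooth_on_def
  proof (intro allI ballI)
    fix es x assume x: "x \<in> A"
    obtain g' where g': "P g'" "\<forall>x\<in>A. iter_deriv es g x = g' x" using * by blast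
    have "g' differentiable (at x)"
      using step[OF g'(1)] x unfolding differentiable_def by blast
    then show "iter_deriv es g differentiable (at x)"
      using differentiable_cong_open[OF assms(1) x, of "iter_deriv es g" g'] g'(2) by blast
  qed
qed

lemma smooth_on_cong:
  assumes "open A" "\<And>x. x \<in> A \<Longrightarrow> f x = g x" "smooth_on A g"
  shows "smooth_on A f"
proof -
  have "\<forall>x\<in>A. iter_deriv es f x = iter_deriv es g x" for es
  proof (induction es)
    case (Cons e es)
    show ?case
    proof
      fix x assume "x \<in> A"
      then have "frechet_derivative (iter_deriv es f) (at x) = frechet_derivative (iter_deriv es g) (at x)"
        by (rule frechet_derivative_cong_open[OF assms(1)]) (use Cons in blast)
      then show "iter_deriv (e # es) f x = iter_deriv (e # es) g x" by simp
    qed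
  qed (use assms in auto)
  note * = this
  show ?thesis
    unfolding smooth_on_def
  proof (intro allI ballI)
    fix es x assume x: "x \<in> A"
    have "iter_deriv es g differentiable (at x)"
      using assms(3) x unfolding smooth_on_def by blast
    then show "iter_deriv es f differentiable (at x)"
      using differentiable_cong_open[OF assms(1) x, of "iter_deriv es f" "iter_deriv es g"] * by blast
  qed
qed

lemma smooth_on_subset: "smooth_on A g \<Longrightarrow> B \<subseteq> A \<Longrightarrow> smooth_on B g"
  unfolding smooth_on_def by blast

lemma smooth_on_Un: "smooth_on A g \<Longrightarrow> smooth_on B g \<Longrightarrow> smooth_on (A \<union> B) g"
  unfolding smooth_on_def by blast

lemma smooth_on_has_derivative:
  "smooth_on A g \<Longrightarrow> x \<in> A \<Longrightarrow> (g has_derivative frechet_derivative g (at x)) (at x)"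
  using smooth_on_unfold frechet_derivative_works by blast

lemma smooth_on_frechet_derivative:
  "smooth_on A g \<Longrightarrow> smooth_on A (\<lambda>x. frechet_derivative g (at x) e)"
  using smooth_on_unfold by blast

lemma smooth_on_partial: "smooth_on A g \<Longrightarrow> smooth_on A (partial l g)"
  unfolding partial_def by (rule smooth_on_frechet_derivative)

lemma smooth_on_continuous_on: "smooth_on A g \<Longrightarrow> continuous_on A g"
  by (meson continuous_at_imp_continuous_on has_derivative_continuous smooth_on_has_derivative)

lemma smooth_on_const:
  assumes "open A"
  shows "smooth_on A (\<lambda>x. c)"
proof (rule smooth_on_coinduct[OF assms, where P="\<lambda>g. \<exists>c. g = (\<lambda>x. c)"])
  fix g :: "'a \<Rightarrow> 'b" assume "\<exists>c. g = (\<lambda>x. c)"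
  then have "(\<forall>x\<in>A. (g has_derivative (\<lambda>e. 0)) (at x)) \<and> (\<forall>e::'a. \<exists>c. (\<lambda>x::'a. 0::'b) = (\<lambda>x. c))"
    by auto
  then show "\<exists>D. (\<forall>x\<in>A. (g has_derivative D x) (at x)) \<and> (\<forall>e. \<exists>c. (\<lambda>x. D x e) = (\<lambda>x. c))"
    by (rule exI[where x="\<lambda>x e. 0"])
qed blast

lemma smooth_on_add:
  assumes "open A" "smooth_on A f" "smooth_on A g"
  shows "smooth_on A (\<lambda>x. f x + g x)"
proof (rule smooth_on_coinduct[OF assms(1), where
      P="\<lambda>u. \<exists>f g. u = (\<lambda>x. f x + g x) \<and> smooth_on A f \<and> smooth_on A g"])
  fix u :: "'a \<Rightarrow> 'b"
  assume "\<exists>f g. u = (\<lambda>x. f x + g x) \<and> smooth_on A f \<and> smooth_on A g"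
  then obtain f g where u: "u = (\<lambda>x. f x + g x)" "smooth_on A f" "smooth_on A g" by blast
  let ?D = "\<lambda>x e. frechet_derivative f (at x) e + frechet_derivative g (at x) e"
  have "\<forall>x\<in>A. (u has_derivative ?D x) (at x)"
    unfolding u(1) using u(2,3) by (intro ballI has_derivative_add smooth_on_has_derivative)
  moreover have "\<exists>f g. (\<lambda>x. ?D x e) = (\<lambda>x. f x + g x) \<and> smooth_on A f \<and> smooth_on A g" for e
    by (intro exI conjI, rule refl) (rule smooth_on_frechet_derivative, rule u)+
  ultimately show "\<exists>D. (\<forall>x\<in>A. (u has_derivative D x) (at x)) \<and>
        (\<forall>e. \<exists>f g. (\<lambda>x. D x e) = (\<lambda>x. f x + g x) \<and> smooth_on A f \<and> smooth_on A g)"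
    by (intro exI[of _ ?D] conjI allI)
qed (use assms in blast)

lemma smooth_on_sum:
  assumes "open A" "\<And>i. i \<in> I \<Longrightarrow> smooth_on A (f i)"
  shows "smooth_on A (\<lambda>x. \<Sum>i\<in>I. f i x)"
  using assms(2)
  by (induction I rule: infinite_finite_induct)
     (auto intro!: smooth_on_add smooth_on_const assms(1))

lemma smooth_on_bounded_linear:
  assumes "open A" "bounded_linear h" "smooth_on A f"
  shows "smooth_on A (\<lambda>x. h (f x))"
proof (rule smooth_on_coinduct[OF assms(1), where
      P="\<lambda>u. \<exists>f. u = (\<lambda>x. h (f x)) \<and> smooth_on A f"])
  fix u :: "'a \<Rightarrow> 'c"
  assume "\<exists>f. u = (\<lambda>x. h (f x)) \<and> smooth_on A f"
  then obtain f where u: "u = (\<lambda>x. h (f x))" "smooth_on A f" by blast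
  let ?D = "\<lambda>x e. h (frechet_derivative f (at x) e)"
  have "\<forall>x\<in>A. (u has_derivative ?D x) (at x)"
    unfolding u(1) using u(2) by (intro ballI bounded_linear.has_derivative[OF assms(2)] smooth_on_has_derivative)
  moreover have "\<exists>f. (\<lambda>x. ?D x e) = (\<lambda>x. h (f x)) \<and> smooth_on A f" for e
    by (intro exI conjI, rule refl) (rule smooth_on_frechet_derivative, rule u)
  ultimately show "\<exists>D. (\<forall>x\<in>A. (u has_derivative D x) (at x)) \<and>
        (\<forall>e. \<exists>f. (\<lambda>x. D x e) = (\<lambda>x. h (f x)) \<and> smooth_on A f)"
    by (intro exI[of _ ?D] conjI allI)
qed (use assms in blast)

lemma smooth_on_linear:
  assumes "open A" "bounded_linear h"
  shows "smooth_on A h"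
  unfolding smooth_on_unfold[of A h]
  using assms smooth_on_const[OF assms(1)]
  by (auto simp: linear_imp_differentiable bounded_linear.linear bounded_linear_imp_differentiable
      frechet_derivative_at[OF bounded_linear_imp_has_derivative[OF assms(2)], symmetric])

lemma smooth_on_id: "open A \<Longrightarrow> smooth_on A (\<lambda>x. x)"
  by (rule smooth_on_linear) auto

text \<open>Leibniz' rule turns one product into a sum of two, so single products are not stable
  under differentiation, while these finite sums are.\<close>

inductive bilinear_alg for h :: "'a::real_normed_vector \<Rightarrow> 'b::real_normed_vector \<Rightarrow> 'c::real_normed_vector"
    and A :: "'d::real_normed_vector set" where
  prod: "smooth_on A f \<Longrightarrow> smooth_on A g \<Longrightarrow> bilinear_alg h A (\<lambda>x. h (f x) (g x))"
| add: "bilinear_alg h A u \<Longrightarrow> bilinear_alg h A w \<Longrightarrow> bilinear_alg h A (\<lambda>x. u x + w x)"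

lemma smooth_on_bilinear:
  assumes "open A" "bounded_bilinear h" "smooth_on A f" "smooth_on A g"
  shows "smooth_on A (\<lambda>x. h (f x) (g x))"
proof (rule smooth_on_coinduct[OF assms(1), where P="bilinear_alg h A"])
  show "bilinear_alg h A (\<lambda>x. h (f x) (g x))"
    using assms by (intro bilinear_alg.prod)
next
  fix u
  assume "bilinear_alg h A u"
  then show "\<exists>D. (\<forall>x\<in>A. (u has_derivative D x) (at x)) \<and> (\<forall>e. bilinear_alg h A (\<lambda>x. D x e))"
  proof induction
    case (prod f g)
    then show ?case
      by (intro exI[where x="\<lambda>x e. h (f x) (frechet_derivative g (at x) e) + h (frechet_derivative f (at x) e) (g x)"])
         (auto intro!: bounded_bilinear.FDERIV[OF assms(2)] smooth_on_has_derivative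
            bilinear_alg.intros smooth_on_frechet_derivative)
  next
    case (add u w)
    then obtain D D' where "\<forall>x\<in>A. (u has_derivative D x) (at x)" "\<forall>e. bilinear_alg h A (\<lambda>x. D x e)"
      "\<forall>x\<in>A. (w has_derivative D' x) (at x)" "\<forall>e. bilinear_alg h A (\<lambda>x. D' x e)" by blast
    then show ?case
      by (intro exI[where x="\<lambda>x e. D x e + D' x e"])
         (auto intro!: has_derivative_add bilinear_alg.intros)
  qed
qed

lemma smooth_on_mult:
  fixes f g :: "'a::real_normed_vector \<Rightarrow> 'b::real_normed_algebra"
  shows "open A \<Longrightarrow> smooth_on A f \<Longrightarrow> smooth_on A g \<Longrightarrow> smooth_on A (\<lambda>x. f x * g x)"
  by (rule smooth_on_bilinear[OF _ bounded_bilinear_mult])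

lemma smooth_on_prod:
  fixes f :: "'i \<Rightarrow> 'a::real_normed_vector \<Rightarrow> 'b::real_normed_field"
  assumes "open A" "\<And>i. i \<in> I \<Longrightarrow> smooth_on A (f i)"
  shows "smooth_on A (\<lambda>x. \<Prod>i\<in>I. f i x)"
  using assms(2)
  by (induction I rule: infinite_finite_induct)
     (auto intro!: smooth_on_mult smooth_on_const assms(1))

lemma smooth_on_power:
  fixes f :: "'a::real_normed_vector \<Rightarrow> 'b::{real_normed_algebra, monoid_mult}"
  shows "open A \<Longrightarrow> smooth_on A f \<Longrightarrow> smooth_on A (\<lambda>x. f x ^ n)"
  by (induction n) (auto intro!: smooth_on_mult smooth_on_const)

lemma smooth_on_of_real:
  "open A \<Longrightarrow> smooth_on A f \<Longrightarrow> smooth_on A (\<lambda>x. of_real (f x) :: 'b::{real_normed_algebra_1})"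
  by (rule smooth_on_bounded_linear[OF _ bounded_linear_of_real])

lemma smooth_on_cnj: "open A \<Longrightarrow> smooth_on A f \<Longrightarrow> smooth_on A (\<lambda>x. cnj (f x))"
  by (rule smooth_on_bounded_linear[OF _ bounded_linear_cnj])

lemma smooth_on_vec_nth:
  fixes f :: "'a::real_normed_vector \<Rightarrow> 'b::real_normed_vector^'m::finite"
  shows "open A \<Longrightarrow> smooth_on A f \<Longrightarrow> smooth_on A (\<lambda>x. f x $ l)"
  by (rule smooth_on_bounded_linear[OF _ bounded_linear_vec_nth])

lemma smooth_on_minus: "open A \<Longrightarrow> smooth_on A f \<Longrightarrow> smooth_on A (\<lambda>x. - f x)"
  by (rule smooth_on_bounded_linear[OF _ bounded_linear_minus[OF bounded_linear_ident]])

lemma smooth_on_diff: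
  "open A \<Longrightarrow> smooth_on A f \<Longrightarrow> smooth_on A g \<Longrightarrow> smooth_on A (\<lambda>x. f x - g x)"
  using smooth_on_add[of A f "\<lambda>x. - g x"] smooth_on_minus[of A g] by simp

text \<open>Both the scalar factor \<open>w\<close> and the outer function \<open>h\<close> vary: by
  the chain rule a derivative of \<open>w\<close> times \<open>h \<circ> g\<close> is a sum of terms
  of the same kind, with derivatives of \<open>h\<close> and new scalar factors.\<close>

inductive compose_alg for A :: "'d::real_normed_vector set" and B :: "'a::euclidean_space set"
    and g :: "'d \<Rightarrow> 'a" and ty :: "'c::real_normed_vector itself" where
  base: "smooth_on B (h :: 'a \<Rightarrow> 'c) \<Longrightarrow> smooth_on A w \<Longrightarrow> compose_alg A B g ty (\<lambda>x. w x *\<^sub>R h (g x))"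
| add: "compose_alg A B g ty u \<Longrightarrow> compose_alg A B g ty w \<Longrightarrow> compose_alg A B g ty (\<lambda>x. u x + w x)"

lemma compose_alg_sum:
  assumes "finite I" "I \<noteq> {}" "\<And>i. i \<in> I \<Longrightarrow> compose_alg A B g ty (f i)"
  shows "compose_alg A B g ty (\<lambda>x. \<Sum>i\<in>I. f i x)"
  using assms
proof (induction I rule: finite_ne_induct)
  case (insert i I)
  then show ?case using compose_alg.add[of A B g ty "f i"] by simp
qed simp

lemma smooth_on_compose:
  fixes g :: "'d::real_normed_vector \<Rightarrow> 'a::euclidean_space" and h :: "'a \<Rightarrow> 'c::real_normed_vector"
  assumes "open A" "open B" "smooth_on A g" "smooth_on B h" "g ` A \<subseteq> B"
  shows "smooth_on A (\<lambda>x. h (g x))"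
proof (rule smooth_on_coinduct[OF assms(1), where P="compose_alg A B g TYPE('c)"])
  show "compose_alg A B g TYPE('c) (\<lambda>x. h (g x))"
    using compose_alg.base[OF assms(4) smooth_on_const[OF assms(1), of 1], of g "TYPE('c)"] by simp
next
  fix u
  assume "compose_alg A B g TYPE('c) u"
  then show "\<exists>D. (\<forall>x\<in>A. (u has_derivative D x) (at x)) \<and> (\<forall>e. compose_alg A B g TYPE('c) (\<lambda>x. D x e))"
  proof induction
    case (base h w)
    let ?g' = "\<lambda>x. frechet_derivative g (at x)" and ?h' = "\<lambda>y. frechet_derivative h (at y)"
    let ?w' = "\<lambda>x. frechet_derivative w (at x)"
    \<comment> \<open>The derivative of \<open>h\<close> is applied to the moving vector
      \<open>?g' x e\<close>. Expanding that vector in \<open>Basis\<close> leaves derivatives of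
      \<open>h\<close> in fixed directions, multiplied by smooth scalars.\<close>
    let ?D = "\<lambda>x e. ?w' x e *\<^sub>R h (g x) + (\<Sum>b\<in>Basis. (w x * (?g' x e \<bullet> b)) *\<^sub>R ?h' (g x) b)"
    have "((\<lambda>x. w x *\<^sub>R h (g x)) has_derivative ?D x) (at x)" if x: "x \<in> A" for x
    proof -
      have gx: "g x \<in> B" using x assms(5) by auto
      have h: "(h has_derivative ?h' (g x)) (at (g x))"
        by (rule smooth_on_has_derivative[OF base(1) gx])
      have lin: "linear (?h' (g x))" using h has_derivative_linear by blast
      have hg: "((\<lambda>x. h (g x)) has_derivative (\<lambda>e. ?h' (g x) (?g' x e))) (at x)"
        using diff_chain_at[OF smooth_on_has_derivative[OF assms(3) x] h] by (simp add: o_def)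
      have "((\<lambda>x. w x *\<^sub>R h (g x)) has_derivative (\<lambda>e. w x *\<^sub>R ?h' (g x) (?g' x e) + ?w' x e *\<^sub>R h (g x))) (at x)"
        by (rule has_derivative_scaleR[OF smooth_on_has_derivative[OF base(2) x] hg])
      moreover have "(\<Sum>b\<in>Basis. (y \<bullet> b) *\<^sub>R ?h' (g x) b) = ?h' (g x) y" for y
        using linear_sum[OF lin, of "\<lambda>b. (y \<bullet> b) *\<^sub>R b" Basis]
        by (simp add: linear_scale[OF lin] euclidean_representation)
      then have "?D x = (\<lambda>e. w x *\<^sub>R ?h' (g x) (?g' x e) + ?w' x e *\<^sub>R h (g x))"
        by (simp add: scaleR_scaleR[symmetric] scaleR_sum_right[symmetric] add.commute del: scaleR_scaleR)
      ultimately show ?thesis by simp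
    qed
    moreover have "compose_alg A B g TYPE('c) (\<lambda>x. ?D x e)" for e
    proof -
      have "smooth_on A (\<lambda>x. ?w' x e)" "smooth_on A (\<lambda>x. ?g' x e)"
        "smooth_on B (\<lambda>x. ?h' x b)" for b
        using base assms(3) smooth_on_frechet_derivative by blast+
      then show ?thesis
        using base
        by (intro compose_alg.add compose_alg_sum compose_alg.base
            smooth_on_mult[OF assms(1)] smooth_on_bounded_linear[OF assms(1) bounded_linear_inner_left]) auto
    qed
    ultimately show ?case by (intro exI[of _ ?D] conjI ballI allI)
  next
    case (add u w)
    then obtain D D' where "\<forall>x\<in>A. (u has_derivative D x) (at x)" "\<forall>e. compose_alg A B g TYPE('c) (\<lambda>x. D x e)"
      "\<forall>x\<in>A. (w has_derivative D' x) (at x)" "\<forall>e. compose_alg A B g TYPE('c) (\<lambda>x. D' x e)" by blast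
    then have "(\<forall>x\<in>A. ((\<lambda>x. u x + w x) has_derivative (\<lambda>e. D x e + D' x e)) (at x)) \<and>
        (\<forall>e. compose_alg A B g TYPE('c) (\<lambda>x. D x e + D' x e))"
      using has_derivative_add compose_alg.add by blast
    then show ?case by (rule exI[where x="\<lambda>x e. D x e + D' x e"])
  qed
qed

text \<open>A single coinduction, on the functions \<open>c * x powr a\<close>, provides both the
  reciprocal and the square root of positive smooth functions.\<close>

lemma smooth_on_powr: "smooth_on {0<..} (\<lambda>x::real. x powr a)"
proof (rule smooth_on_coinduct[where P="\<lambda>g. \<exists>c a. g = (\<lambda>x::real. c * x powr a)"])
  fix g :: "real \<Rightarrow> real" assume "\<exists>c a. g = (\<lambda>x::real. c * x powr a)"
  then obtain c a where g: "g = (\<lambda>x::real. c * x powr a)" by blast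
  show "\<exists>D. (\<forall>x\<in>{0<..}. (g has_derivative D x) (at x)) \<and> (\<forall>e. \<exists>c a. (\<lambda>x. D x e) = (\<lambda>x::real. c * x powr a))"
  proof (intro exI[where x="\<lambda>x e. e * (c * a) * x powr (a - 1)"] conjI ballI allI)
    fix x :: real assume "x \<in> {0<..}"
    then show "(g has_derivative (\<lambda>e. e * (c * a) * x powr (a - 1))) (at x)"
      unfolding g by (auto intro!: derivative_eq_intros simp: powr_diff)
  qed auto
qed (simp, rule exI[where x=1], rule exI[where x=a], simp)

lemma smooth_on_compose_powr:
  fixes g :: "'a::real_normed_vector \<Rightarrow> real"
  assumes "open A" "smooth_on A g" "\<And>x. x \<in> A \<Longrightarrow> g x > 0"
  shows "smooth_on A (\<lambda>x. g x powr a)"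
  using smooth_on_compose[OF assms(1) _ assms(2) smooth_on_powr[of a]] assms(3) by auto

lemma smooth_on_inverse:
  fixes g :: "'a::real_normed_vector \<Rightarrow> real"
  assumes "open A" "smooth_on A g" "\<And>x. x \<in> A \<Longrightarrow> g x > 0"
  shows "smooth_on A (\<lambda>x. inverse (g x))"
  by (rule smooth_on_cong[OF assms(1) _ smooth_on_compose_powr[OF assms, of "-1"]])
     (use assms(3) in \<open>force simp: powr_minus\<close>)+

lemma smooth_on_sqrt:
  fixes g :: "'a::real_normed_vector \<Rightarrow> real"
  assumes "open A" "smooth_on A g" "\<And>x. x \<in> A \<Longrightarrow> g x > 0"
  shows "smooth_on A (\<lambda>x. sqrt (g x))"
  by (rule smooth_on_cong[OF assms(1) _ smooth_on_compose_powr[OF assms, of "1/2"]])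
     (use assms(3) in \<open>force simp: powr_half_sqrt less_imp_le\<close>)+

section \<open>A flat function, cutoffs and bumps\<close>

definition flat_exp :: "real \<Rightarrow> real" where
  "flat_exp t = (if t > 0 then exp (- (1 / t)) else 0)"

lemma power_times_flat_exp_tendsto: "((\<lambda>t. (1 / t) ^ n * exp (- (1 / t))) \<longlongrightarrow> (0::real)) (at_right 0)"
proof -
  have "((\<lambda>x::real. x ^ n / exp x) \<longlongrightarrow> 0) at_top"
    by (rule tendsto_power_div_exp_0)
  moreover have "filterlim (\<lambda>t::real. 1 / t) at_top (at_right 0)"
    using filterlim_inverse_at_top_right by (simp add: inverse_eq_divide)
  ultimately have "((\<lambda>t::real. (1/t) ^ n / exp (1/t)) \<longlongrightarrow> 0) (at_right 0)"
    by (rule filterlim_compose)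
  then show ?thesis by (simp add: exp_minus field_simps)
qed

text \<open>With \<open>s = 1 / t\<close>, differentiation sends \<open>p(s) exp(-s)\<close> to
  \<open>s\<^sup>2 (p(s) - p'(s)) exp(-s)\<close>, so letting \<open>p\<close> range over all
  polynomials gives a stable class. The factor \<open>[:0,0,1:]\<close> is
  \<open>s\<^sup>2\<close>.\<close>

lemma smooth_flat_exp: "smooth_on UNIV flat_exp"
proof (rule smooth_on_coinduct[where P="\<lambda>g. \<exists>p. g = (\<lambda>t. if t > 0 then poly p (1 / t) * exp (- (1 / t)) else (0::real))"])
  show "\<exists>p. flat_exp = (\<lambda>t. if t > 0 then poly p (1 / t) * exp (- (1 / t)) else 0)"
    by (intro exI[where x="1"]) (auto simp: flat_exp_def)
next
  fix g :: "real \<Rightarrow> real"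
  assume "\<exists>p. g = (\<lambda>t. if t > 0 then poly p (1 / t) * exp (- (1 / t)) else 0)"
  then obtain p where g: "g = (\<lambda>t. if t > 0 then poly p (1 / t) * exp (- (1 / t)) else 0)" by blast
  let ?q = "[:0,0,1:] * (p - pderiv p)"
  let ?D = "\<lambda>x e. (if x > 0 then poly (smult e ?q) (1 / x) * exp (- (1 / x)) else (0::real))"
  have "(g has_derivative ?D x) (at x)" for x
  proof -
    consider "x > 0" | "x < 0" | "x = 0" by linarith
    then show ?thesis
    proof cases
      case 1
      have "((\<lambda>t. poly p (1 / t) * exp (- (1 / t))) has_derivative ?D x) (at x)"
        using 1
        by (auto intro!: derivative_eq_intros DERIV_compose_FDERIV[OF poly_DERIV] simp: field_simps power2_eq_square fun_eq_iff)
      then show ?thesis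
        by (rule has_derivative_transform_within_open[OF _ open_greaterThan[of 0]]) (use 1 in \<open>auto simp: g\<close>)
    next
      case 2
      have "((\<lambda>t. 0) has_derivative ?D x) (at x)" using 2 by auto
      then show ?thesis
        by (rule has_derivative_transform_within_open[OF _ open_lessThan[of 0]]) (use 2 in \<open>auto simp: g\<close>)
    next
      case 3
      have *: "((\<lambda>t. poly r (1/t) * exp (- (1 / t))) \<longlongrightarrow> (0::real)) (at_right 0)" for r
      proof -
        have "((\<lambda>t. \<Sum>i\<le>degree r. coeff r i * ((1 / t) ^ i * exp (- (1 / t)))) \<longlongrightarrow> (\<Sum>i\<le>degree r. coeff r i * 0)) (at_right 0)"
          by (intro tendsto_intros power_times_flat_exp_tendsto)
        then show ?thesis by (simp add: poly_altdef sum_distrib_right mult.assoc)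
      qed
      \<comment> \<open>From the right, the difference quotient at 0 is
        \<open>s p(s) exp(-s)\<close>, a member of the same family; \<open>pCons 0 p\<close> is
        \<open>p\<close> times its variable.\<close>
      have "((\<lambda>h. g h / h) \<longlongrightarrow> 0) (at_right 0)"
        by (rule Lim_transform_eventually[OF *[of "pCons 0 p"]])
           (auto simp: g eventually_at_right_field intro!: exI[where x=1])
      moreover have "((\<lambda>h. g h / h) \<longlongrightarrow> 0) (at_left 0)"
        by (rule Lim_transform_eventually[OF tendsto_const])
           (auto simp: g eventually_at_left_field intro!: exI[where x="-1"])
      ultimately have "((\<lambda>h. g h / h) \<longlongrightarrow> 0) (at 0)"
        by (simp add: filterlim_at_split)
      then have "(g has_field_derivative 0) (at 0)"
        by (simp add: DERIV_def g cong: if_cong)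
      then show ?thesis using 3 by (simp add: has_field_derivative_def fun_eq_iff lambda_zero)
    qed
  qed
  then show "\<exists>D. (\<forall>x\<in>UNIV. (g has_derivative D x) (at x)) \<and>
     (\<forall>e. \<exists>p. (\<lambda>x. D x e) = (\<lambda>t. if t > 0 then poly p (1 / t) * exp (- (1 / t)) else 0))"
    by (intro exI[of _ ?D] conjI ballI allI exI[of _ "smult e ?q" for e]) auto
qed auto

definition smooth_cutoff :: "real \<Rightarrow> real" where
  "smooth_cutoff t = flat_exp (2 - t) * inverse (flat_exp (2 - t) + flat_exp (t - 1))"

lemma flat_exp_sum_pos: "flat_exp (2 - t) + flat_exp (t - 1) > 0"
  by (auto simp: flat_exp_def intro!: add_pos_nonneg add_nonneg_pos)

lemma smooth_cutoff:
  shows "smooth_on UNIV smooth_cutoff" and "0 \<le> smooth_cutoff t" "smooth_cutoff t \<le> 1"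
    and "t \<le> 1 \<Longrightarrow> smooth_cutoff t = 1" and "t \<ge> 2 \<Longrightarrow> smooth_cutoff t = 0"
proof -
  have a: "smooth_on UNIV (\<lambda>t. flat_exp (2 - t))" "smooth_on UNIV (\<lambda>t. flat_exp (t - 1))"
    by (rule smooth_on_compose[OF _ _ _ smooth_flat_exp];
        auto intro!: smooth_on_diff smooth_on_const smooth_on_id)+
  then show "smooth_on UNIV smooth_cutoff"
    unfolding smooth_cutoff_def[abs_def]
    by (intro smooth_on_mult smooth_on_inverse smooth_on_add) (auto simp: flat_exp_sum_pos)
  have n: "flat_exp s \<ge> 0" for s by (simp add: flat_exp_def)
  show "0 \<le> smooth_cutoff t" using n by (simp add: smooth_cutoff_def)
  show "smooth_cutoff t \<le> 1" using n[of "t-1"] flat_exp_sum_pos[of t]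
    by (simp add: smooth_cutoff_def field_simps)
  show "t \<le> 1 \<Longrightarrow> smooth_cutoff t = 1"
    by (simp add: smooth_cutoff_def flat_exp_def)
  show "t \<ge> 2 \<Longrightarrow> smooth_cutoff t = 0"
    by (simp add: smooth_cutoff_def flat_exp_def)
qed

lemma smooth_bump:
  fixes x0 :: "'a::euclidean_space"
  assumes "0 < R"
  obtains \<eta> :: "'a \<Rightarrow> real" where "smooth_on UNIV \<eta>" "\<And>x. 0 \<le> \<eta> x" "\<And>x. \<eta> x \<le> 1"
    "\<And>x. dist x0 x \<le> R / 2 \<Longrightarrow> \<eta> x = 1" "\<And>x. R \<le> dist x0 x \<Longrightarrow> \<eta> x = 0"
proof
  \<comment> \<open>The squared distance is used because the distance itself is not smooth at
    \<open>x0\<close>. The factor \<open>4 / R\<^sup>2\<close> sends radius \<open>R / 2\<close> to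
    1 and radius \<open>R\<close> to 4, beyond the point 2 where the cutoff vanishes.\<close>
  define \<eta> where "\<eta> x = smooth_cutoff (4 / R\<^sup>2 * ((x - x0) \<bullet> (x - x0)))" for x
  have sm: "smooth_on UNIV (\<lambda>x. (x - x0) \<bullet> (x - x0))"
    by (intro smooth_on_bilinear[OF _ bounded_bilinear_inner] smooth_on_diff smooth_on_const smooth_on_id) auto
  show "smooth_on UNIV \<eta>"
    unfolding \<eta>_def
    by (intro smooth_on_compose[OF _ _ _ smooth_cutoff(1)] smooth_on_mult smooth_on_const sm) auto
  have d: "(x - x0) \<bullet> (x - x0) = (dist x0 x)\<^sup>2" for x
    by (simp add: dist_norm norm_minus_commute[of x0] power2_norm_eq_inner)
  show "0 \<le> \<eta> x" "\<eta> x \<le> 1" for x by (simp_all add: \<eta>_def smooth_cutoff)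
  show "\<eta> x = 1" if "dist x0 x \<le> R / 2" for x
  proof -
    have "(dist x0 x)\<^sup>2 \<le> (R/2)\<^sup>2" using that by (intro power_mono) auto
    then show ?thesis unfolding \<eta>_def d using assms
      by (intro smooth_cutoff) (auto simp: field_simps power2_eq_square)
  qed
  show "\<eta> x = 0" if "R \<le> dist x0 x" for x
  proof -
    have "R\<^sup>2 \<le> (dist x0 x)\<^sup>2" using that assms by (intro power_mono) auto
    then have "R\<^sup>2 \<le> 2 * (dist x0 x)\<^sup>2" using zero_le_power2[of "dist x0 x"] by linarith
    then show ?thesis unfolding \<eta>_def d using assms
      by (intro smooth_cutoff) (auto simp: field_simps power2_eq_square)
  qed
qed

lemma smooth_on_extend_zero:
  assumes "open V" "smooth_on V g" "closed K" "K \<subseteq> V" "\<And>x. x \<notin> K \<Longrightarrow> g x = 0"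
  shows "smooth_on UNIV g"
proof -
  have "smooth_on (- K) g"
    by (rule smooth_on_cong[OF _ _ smooth_on_const[where c=0]]) (use assms in auto)
  from smooth_on_Un[OF assms(2) this] show ?thesis
    by (rule smooth_on_subset) (use assms(4) in auto)
qed

section \<open>Fourier inversion and Plancherel\<close>

lemma integrable_tensor:
  fixes f :: "'a \<Rightarrow> 'c::{real_normed_field, banach, second_countable_topology}"
  assumes "sigma_finite_measure M" "sigma_finite_measure N" "integrable M f" "integrable N g"
  shows "integrable (M \<Otimes>\<^sub>M N) (\<lambda>p. f (fst p) * g (snd p))"
proof -
  interpret pair_sigma_finite M N using assms by (simp add: pair_sigma_finite_def)
  have [measurable]: "f \<in> borel_measurable M" "g \<in> borel_measurable N" using assms by auto
  show ?thesis
    by (rule Fubini_integrable) (use assms in \<open>auto simp: norm_mult\<close>)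
qed

lemma borel_measurable_cis_inner [measurable]:
  "(\<lambda>\<xi>::'a::euclidean_space. cis (x \<bullet> \<xi>)) \<in> borel_measurable borel"
  by (intro borel_measurable_continuous_onI continuous_intros)

lemma borel_measurable_cis_inner2 [measurable (raw)]:
  fixes f g :: "'b \<Rightarrow> 'a::euclidean_space"
  assumes [measurable]: "f \<in> borel_measurable M" "g \<in> borel_measurable M"
  shows "(\<lambda>p. cis (f p \<bullet> g p)) \<in> borel_measurable M"
proof -
  have "cis \<in> borel_measurable borel" by (intro borel_measurable_continuous_onI continuous_intros)
  then show ?thesis by measurable
qed

text \<open>The inverse Fourier integral without its constant. The transform itself is
  \<open>ift\<close> at \<open>- \<xi>\<close>, so one set of estimates serves both
  directions.\<close>

definition ift :: "('a::euclidean_space \<Rightarrow> complex) \<Rightarrow> 'a \<Rightarrow> complex" where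
  "ift g x = (LINT \<xi>|lborel. cis (x \<bullet> \<xi>) * g \<xi>)"

lemma integrable_cis_mult:
  assumes "integrable lborel g"
  shows "integrable lborel (\<lambda>\<xi>. cis (x \<bullet> \<xi>) * g \<xi>)"
  using assms by (rule Bochner_Integration.integrable_bound) (use assms in \<open>auto simp: norm_mult\<close>)

lemma norm_ift_le:
  assumes "integrable lborel g"
  shows "norm (ift g x) \<le> (LINT \<xi>|lborel. norm (g \<xi>))"
  unfolding ift_def
  using integral_norm_bound[of lborel "\<lambda>\<xi>. cis (x \<bullet> \<xi>) * g \<xi>"] by (simp add: norm_mult)

lemma continuous_on_ift:
  assumes "integrable lborel g"
  shows "continuous_on UNIV (ift g)"
proof -
  have "isCont (ift g) x" for x
    unfolding continuous_at_sequentially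
  proof (intro allI impI)
    fix X assume X: "X \<longlonglongrightarrow> x"
    have "(\<lambda>n. LINT \<xi>|lborel. cis (X n \<bullet> \<xi>) * g \<xi>) \<longlonglongrightarrow> (LINT \<xi>|lborel. cis (x \<bullet> \<xi>) * g \<xi>)"
    proof (rule integral_dominated_convergence)
      show "AE \<xi> in lborel. (\<lambda>n. cis (X n \<bullet> \<xi>) * g \<xi>) \<longlonglongrightarrow> cis (x \<bullet> \<xi>) * g \<xi>"
        using X by (intro always_eventually allI tendsto_intros)
      show "integrable lborel (\<lambda>\<xi>. norm (g \<xi>))" using assms by simp
    qed (use assms in \<open>auto simp: norm_mult\<close>)
    then show "(ift g \<circ> X) \<longlonglongrightarrow> ift g x" by (simp add: ift_def o_def)
  qed
  then show ?thesis by (simp add: continuous_at_imp_continuous_on)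
qed

lemma borel_measurable_ift: "integrable lborel g \<Longrightarrow> ift g \<in> borel_measurable borel"
  by (rule borel_measurable_continuous_onI[OF continuous_on_ift])

text \<open>The frequencies \<open>p\<close> live in an arbitrary measure space with a phase
  \<open>\<phi> p\<close>: the identity is applied with a single frequency, with a translated one,
  and with pairs of frequencies and the phase \<open>fst p - snd p\<close>.\<close>

lemma ift_fubini:
  fixes w :: "'a::euclidean_space \<Rightarrow> complex"
  assumes w: "integrable lborel w" and N: "sigma_finite_measure N" and G: "integrable N G"
    and \<phi>[measurable]: "\<phi> \<in> N \<rightarrow>\<^sub>M borel"
  shows "(LINT x|lborel. w x * (LINT p|N. G p * cis (x \<bullet> \<phi> p))) = (LINT p|N. G p * ift w (\<phi> p))"
proof -
  interpret N: sigma_finite_measure N by fact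
  interpret pair_sigma_finite lborel N ..
  have [measurable]: "w \<in> borel_measurable borel" "G \<in> borel_measurable N" using w G by auto
  have int: "integrable (lborel \<Otimes>\<^sub>M N) (case_prod (\<lambda>x p. w x * G p * cis (x \<bullet> \<phi> p)))"
    using integrable_tensor[OF sigma_finite_lborel N w G]
    by (rule Bochner_Integration.integrable_bound) (auto simp: norm_mult split_beta)
  have "(LINT x|lborel. w x * (LINT p|N. G p * cis (x \<bullet> \<phi> p))) = (LINT x|lborel. LINT p|N. w x * G p * cis (x \<bullet> \<phi> p))"
    by (simp add: mult.assoc)
  also have "\<dots> = (LINT p|N. LINT x|lborel. w x * G p * cis (x \<bullet> \<phi> p))"
    by (rule Fubini_integral[OF int, symmetric])
  also have "\<dots> = (LINT p|N. G p * ift w (\<phi> p))"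
  proof (rule Bochner_Integration.integral_cong)
    fix p
    have "(\<lambda>x. w x * G p * cis (x \<bullet> \<phi> p)) = (\<lambda>x. G p * (cis (\<phi> p \<bullet> x) * w x))"
      by (auto simp: inner_commute)
    then show "(LINT x|lborel. w x * G p * cis (x \<bullet> \<phi> p)) = G p * ift w (\<phi> p)"
      unfolding ift_def by simp
  qed simp
  finally show ?thesis .
qed

lemma ift_cnj: "ift (\<lambda>\<xi>. cnj (g \<xi>)) x = cnj (ift g (- x))"
proof -
  have "(\<lambda>\<xi>. cis (x \<bullet> \<xi>) * cnj (g \<xi>)) = (\<lambda>\<xi>. cnj (cis (- x \<bullet> \<xi>) * g \<xi>))"
    by (simp add: cis_cnj)
  then show ?thesis by (simp only: ift_def Bochner_Integration.integral_cnj)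
qed

lemma ift_multiplication_formula:
  assumes g: "integrable lborel g" and v: "integrable lborel v"
  shows "(LINT x|lborel. ift g x * cnj (v x)) = (LINT \<xi>|lborel. g \<xi> * cnj (ift v (- \<xi>)))"
proof -
  have "(LINT x|lborel. cnj (v x) * (LINT \<xi>|lborel. g \<xi> * cis (x \<bullet> \<xi>))) = (LINT \<xi>|lborel. g \<xi> * ift (\<lambda>x. cnj (v x)) \<xi>)"
    using v by (intro ift_fubini sigma_finite_lborel g) auto
  then show ?thesis unfolding ift_cnj by (simp add: ift_def mult.commute)
qed

text \<open>The integral over the product space exhibits the left-hand side as a quadratic form in
  frequency space with the convolution kernel \<open>ift w (\<xi> - \<eta>)\<close>.\<close>

lemma ift_weighted:
  fixes w :: "'a::euclidean_space \<Rightarrow> complex"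
  assumes w: "integrable lborel w" and g1: "integrable lborel g1" and g2: "integrable lborel g2"
  shows "(LINT x|lborel. w x * (ift g1 x * cnj (ift g2 x))) =
     (LINT p|(lborel \<Otimes>\<^sub>M lborel). g1 (fst p) * cnj (g2 (snd p)) * ift w (fst p - snd p))"
proof -
  have g2': "integrable lborel (\<lambda>x. cnj (g2 x))" using g2 by simp
  have G: "integrable (lborel \<Otimes>\<^sub>M lborel) (\<lambda>p. g1 (fst p) * cnj (g2 (snd p)))"
    by (rule integrable_tensor[OF sigma_finite_lborel sigma_finite_lborel g1 g2'])
  have sf: "sigma_finite_measure (lborel \<Otimes>\<^sub>M lborel :: ('a \<times> 'a) measure)"
    by (simp add: lborel_prod sigma_finite_lborel)
  have "ift g1 x * cnj (ift g2 x) =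
      (LINT p|(lborel \<Otimes>\<^sub>M lborel). g1 (fst p) * cnj (g2 (snd p)) * cis (x \<bullet> (fst p - snd p)))" for x
  proof -
    have i: "integrable (lborel \<Otimes>\<^sub>M lborel) (\<lambda>p. (cis (x \<bullet> fst p) * g1 (fst p)) * cnj (cis (x \<bullet> snd p) * g2 (snd p)))"
      by (rule integrable_tensor[OF sigma_finite_lborel sigma_finite_lborel integrable_cis_mult[OF g1],
            of "\<lambda>y. cnj (cis (x \<bullet> y) * g2 y)"])
         (subst complex_integrable_cnj, rule integrable_cis_mult[OF g2])
    have "ift g1 x * cnj (ift g2 x) =
        (LINT \<xi>|lborel. LINT \<eta>|lborel. (cis (x \<bullet> \<xi>) * g1 \<xi>) * cnj (cis (x \<bullet> \<eta>) * g2 \<eta>))"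
      unfolding ift_def by (simp flip: complex_cnj_mult)
    also have "\<dots> = (LINT p|(lborel \<Otimes>\<^sub>M lborel). (cis (x \<bullet> fst p) * g1 (fst p)) * cnj (cis (x \<bullet> snd p) * g2 (snd p)))"
      using lborel_pair.integral_fst'[OF i] by simp
    also have "\<dots> = (LINT p|(lborel \<Otimes>\<^sub>M lborel). g1 (fst p) * cnj (g2 (snd p)) * cis (x \<bullet> (fst p - snd p)))"
      by (rule Bochner_Integration.integral_cong)
         (auto simp: cis_cnj cis_mult inner_diff_right mult_ac)
    finally show ?thesis .
  qed
  then show ?thesis
    using ift_fubini[OF w sf G, of "\<lambda>p. fst p - snd p"] by simp
qed

lemma lborel_prod_integral:
  fixes f :: "'a::euclidean_space \<Rightarrow> real \<Rightarrow> 'c::{real_normed_field, banach, second_countable_topology}"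
  assumes "\<And>b. b \<in> Basis \<Longrightarrow> integrable lborel (f b)"
  shows "integrable lborel (\<lambda>x. \<Prod>b\<in>Basis. f b (x \<bullet> b))"
    and "(LINT x|lborel. (\<Prod>b\<in>Basis. f b (x \<bullet> b))) = (\<Prod>b\<in>Basis. (LINT t|lborel. f b t))"
proof -
  interpret product_sigma_finite "\<lambda>b::'a. lborel :: real measure" ..
  have [measurable]: "b \<in> Basis \<Longrightarrow> f b \<in> borel_measurable borel" for b
    using assms borel_measurable_integrable by fastforce
  have m: "(\<lambda>f. \<Sum>b\<in>Basis. f b *\<^sub>R b) \<in> (\<Pi>\<^sub>M b\<in>Basis. lborel) \<rightarrow>\<^sub>M (borel :: 'a measure)" by measurable
  have mf: "(\<lambda>x::'a. \<Prod>b\<in>Basis. f b (x \<bullet> b)) \<in> borel_measurable borel" by measurable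
  have eq: "(\<Prod>b\<in>Basis. f b ((\<Sum>b\<in>Basis. y b *\<^sub>R b) \<bullet> b)) = (\<Prod>b\<in>Basis. f b (y b))" for y :: "'a \<Rightarrow> real"
    by (intro prod.cong) auto
  show "integrable lborel (\<lambda>x. \<Prod>b\<in>Basis. f b (x \<bullet> b))"
    by (subst lborel_eq) (use product_integrable_prod[OF finite_Basis, of f] assms in
        \<open>simp add: integrable_distr_eq[OF m mf] eq\<close>)
  show "(LINT x|lborel. (\<Prod>b\<in>Basis. f b (x \<bullet> b))) = (\<Prod>b\<in>Basis. (LINT t|lborel. f b t))"
    by (subst lborel_eq) (use product_integral_prod[OF finite_Basis, of f] assms in
        \<open>simp add: integral_distr[OF m mf] eq\<close>)
qed

section \<open>The Gaussian, its transform and Fourier inversion\<close>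

definition gauss :: "'a::euclidean_space \<Rightarrow> real" where
  "gauss x = exp (- (norm x)\<^sup>2 / 2)"

lemma gauss_pos: "0 < gauss x" and gauss_le_1: "gauss x \<le> 1"
  by (auto simp: gauss_def)

lemma borel_measurable_gauss [measurable]: "gauss \<in> borel_measurable borel"
  unfolding gauss_def[abs_def] by measurable

lemma gauss_real: "gauss (t::real) = sqrt (2 * pi) * std_normal_density t"
  by (simp add: gauss_def std_normal_density_def)

lemma gauss_prod: "gauss x = (\<Prod>b\<in>Basis. gauss (x \<bullet> b))" for x :: "'a::euclidean_space"
proof -
  have "(norm x)\<^sup>2 = (\<Sum>b\<in>Basis. (x \<bullet> b)\<^sup>2)"
    unfolding power2_norm_eq_inner unfolding power2_eq_square by (rule euclidean_inner)
  then show ?thesis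
    by (simp add: gauss_def exp_sum[symmetric] sum_negf sum_divide_distrib)
qed

text \<open>Read off from the characteristic function of the standard normal law; the factor
  \<open>sqrt (2 * pi)\<close> is its normalization.\<close>

lemma gauss_real_fourier:
  "integrable lborel (\<lambda>t. cis (s * t) * complex_of_real (gauss t))" (is ?A)
  "(LINT t|lborel. cis (s * t) * complex_of_real (gauss t)) = complex_of_real (sqrt (2 * pi) * gauss s)" (is ?B)
proof -
  have i: "integrable lborel (gauss :: real \<Rightarrow> real)"
    unfolding gauss_real by simp
  then show ?A by (rule Bochner_Integration.integrable_bound)
      (auto simp: norm_mult intro!: borel_measurable_times borel_measurable_cis_inner[where 'a=real, unfolded inner_real_def])
  have "char std_normal_distribution s = complex_of_real (gauss s)"
    unfolding char_std_normal_distribution by (simp add: gauss_def)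
  moreover have "char std_normal_distribution s = (LINT t|lborel. std_normal_density t *\<^sub>R cis (s * t))"
    unfolding char_def by (subst integral_density) (auto simp: cis_conv_exp)
  ultimately have "complex_of_real (sqrt (2 * pi)) * (LINT t|lborel. std_normal_density t *\<^sub>R cis (s * t)) =
      complex_of_real (sqrt (2 * pi) * gauss s)" by simp
  then show ?B
    by (subst (asm) integral_mult_right_zero[symmetric]) (simp add: gauss_real scaleR_conv_of_real mult_ac)
qed

lemma integrable_gauss: "integrable lborel (gauss :: 'a::euclidean_space \<Rightarrow> real)"
proof -
  have "integrable lborel (\<lambda>x::'a. \<Prod>b\<in>Basis. gauss (x \<bullet> b))"
    by (rule lborel_prod_integral(1)[of "\<lambda>_. gauss"]) (simp add: gauss_real[abs_def])
  then show ?thesis by (simp only: gauss_prod[symmetric])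
qed

lemma ift_gauss:
  fixes x :: "'a::euclidean_space"
  shows "ift (\<lambda>\<xi>. complex_of_real (gauss \<xi>)) x = complex_of_real (sqrt (2 * pi) ^ DIM('a) * gauss x)"
proof -
  have c: "cis (sum h B) = (\<Prod>b\<in>B. cis (h b))" for h :: "'a \<Rightarrow> real" and B
    by (induction B rule: infinite_finite_induct) (auto simp: cis_mult[symmetric])
  have "cis (x \<bullet> \<xi>) * complex_of_real (gauss \<xi>) = (\<Prod>b\<in>Basis. cis ((x \<bullet> b) * (\<xi> \<bullet> b)) * complex_of_real (gauss (\<xi> \<bullet> b)))" for \<xi>
    by (subst euclidean_inner) (simp add: c gauss_prod[of \<xi>] prod.distrib)
  then have "ift (\<lambda>\<xi>. complex_of_real (gauss \<xi>)) x =
      (\<Prod>b\<in>Basis. (LINT t|lborel. cis ((x \<bullet> b) * t) * complex_of_real (gauss t)))"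
    unfolding ift_def using gauss_real_fourier(1)
    by (simp add: lborel_prod_integral(2)[of "\<lambda>b t. cis ((x \<bullet> b) * t) * complex_of_real (gauss t)"])
  also have "\<dots> = complex_of_real (sqrt (2 * pi) ^ DIM('a) * gauss x)"
    unfolding gauss_real_fourier(2) by (simp add: gauss_prod[of x] prod.distrib)
  finally show ?thesis .
qed

lemma integral_gauss: "(LINT \<zeta>|lborel. gauss (\<zeta>::'a::euclidean_space)) = sqrt (2 * pi) ^ DIM('a)"
proof -
  have "complex_of_real (LINT \<zeta>|lborel. gauss (\<zeta>::'a)) = ift (\<lambda>\<xi>::'a. complex_of_real (gauss \<xi>)) 0"
    by (simp add: ift_def)
  also have "\<dots> = complex_of_real (sqrt (2 * pi) ^ DIM('a))"
    unfolding ift_gauss by (simp add: gauss_def)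
  finally show ?thesis by (simp only: of_real_eq_iff)
qed

lemma nn_integral_affine:
  fixes f :: "'a::euclidean_space \<Rightarrow> ennreal"
  assumes [measurable]: "f \<in> borel_measurable borel" and c: "c \<noteq> 0"
  shows "(\<integral>\<^sup>+x. f x \<partial>lborel) = \<bar>c\<bar> ^ DIM('a) * (\<integral>\<^sup>+x. f (t + c *\<^sub>R x) \<partial>lborel)"
  by (subst lborel_affine[OF c, of t])
     (simp add: nn_integral_density nn_integral_distr nn_integral_cmult ennreal_power)

lemma integrable_affine:
  fixes f :: "'a::euclidean_space \<Rightarrow> 'b::{banach, second_countable_topology}"
  assumes f: "integrable lborel f" and c: "c \<noteq> 0"
  shows "integrable lborel (\<lambda>x. f (t + c *\<^sub>R x))"
proof -
  have [measurable]: "f \<in> borel_measurable borel" using f by auto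
  have "ennreal (\<bar>c\<bar> ^ DIM('a)) > 0" using c by simp
  then show ?thesis
    using f nn_integral_affine[of "\<lambda>x. ennreal (norm (f x))" c t] c
    unfolding integrable_iff_bounded by (auto simp: ennreal_mult_less_top)
qed

lemma integral_affine:
  fixes f :: "'a::euclidean_space \<Rightarrow> 'b::{banach, second_countable_topology}"
  assumes c: "c \<noteq> 0" and f[measurable]: "f \<in> borel_measurable borel"
  shows "(LINT x|lborel. f x) = \<bar>c\<bar> ^ DIM('a) *\<^sub>R (LINT x|lborel. f (t + c *\<^sub>R x))"
  by (subst lborel_affine[OF c, of t]) (simp add: integral_density integral_distr)

lemma ift_gauss_scaled:
  fixes \<zeta> :: "'a::euclidean_space"
  assumes e: "e > 0"
  shows "ift (\<lambda>x. complex_of_real (gauss (e *\<^sub>R x))) \<zeta> =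
    complex_of_real (sqrt (2 * pi) ^ DIM('a) / e ^ DIM('a) * gauss (\<zeta> /\<^sub>R e))"
proof -
  have "ift (\<lambda>x. complex_of_real (gauss (e *\<^sub>R x))) \<zeta> =
      (1 / e ^ DIM('a)) *\<^sub>R (LINT y|lborel. cis (\<zeta> \<bullet> (y /\<^sub>R e)) * complex_of_real (gauss (e *\<^sub>R (y /\<^sub>R e))))"
    unfolding ift_def
    by (subst integral_affine[of "inverse e" _ 0]) (use e in \<open>auto simp: power_inverse divide_simps\<close>)
  also have "(LINT y|lborel. cis (\<zeta> \<bullet> (y /\<^sub>R e)) * complex_of_real (gauss (e *\<^sub>R (y /\<^sub>R e)))) =
      ift (\<lambda>\<xi>. complex_of_real (gauss \<xi>)) (\<zeta> /\<^sub>R e)"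
    unfolding ift_def using e by simp
  finally show ?thesis unfolding ift_gauss by (simp add: scaleR_conv_of_real)
qed

lemma gauss_scaled_integrable:
  "e \<noteq> 0 \<Longrightarrow> integrable lborel (\<lambda>x::'a::euclidean_space. complex_of_real (gauss (e *\<^sub>R x)))"
  by (rule integrable_of_real) (use integrable_affine[OF integrable_gauss[where 'a='a], of e 0] in simp)

text \<open>Damping by a wide Gaussian in space is averaging at the small scale \<open>e\<close> in
  frequency. The powers of \<open>e\<close> cancel under the substitution
  \<open>\<eta> = \<xi> - e \<zeta>\<close>, which leaves a form ready for the limit
  \<open>e \<rightarrow> 0\<close>.\<close>

lemma gauss_convolution:
  fixes h :: "'a::euclidean_space \<Rightarrow> complex"
  assumes e: "e > 0" and [measurable]: "h \<in> borel_measurable borel"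
  shows "(LINT \<eta>|lborel. h \<eta> * ift (\<lambda>x. complex_of_real (gauss (e *\<^sub>R x))) (\<xi> - \<eta>)) =
    complex_of_real (sqrt (2 * pi) ^ DIM('a)) * (LINT \<zeta>|lborel. complex_of_real (gauss \<zeta>) * h (\<xi> - e *\<^sub>R \<zeta>))"
proof -
  have "(LINT \<eta>|lborel. h \<eta> * ift (\<lambda>x. complex_of_real (gauss (e *\<^sub>R x))) (\<xi> - \<eta>)) =
     e ^ DIM('a) *\<^sub>R (LINT \<zeta>|lborel. h (\<xi> + (- e) *\<^sub>R \<zeta>) *
        complex_of_real (sqrt (2 * pi) ^ DIM('a) / e ^ DIM('a) * gauss ((\<xi> - (\<xi> + (- e) *\<^sub>R \<zeta>)) /\<^sub>R e)))"
    unfolding ift_gauss_scaled[OF e]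
    by (subst integral_affine[of "- e" _ \<xi>]) (use e in auto)
  also have "\<dots> = (LINT \<zeta>|lborel. e ^ DIM('a) *\<^sub>R (h (\<xi> + (- e) *\<^sub>R \<zeta>) *
        complex_of_real (sqrt (2 * pi) ^ DIM('a) / e ^ DIM('a) * gauss ((\<xi> - (\<xi> + (- e) *\<^sub>R \<zeta>)) /\<^sub>R e))))"
    by simp
  also have "\<dots> = (LINT \<zeta>|lborel. complex_of_real (sqrt (2 * pi) ^ DIM('a)) * (complex_of_real (gauss \<zeta>) * h (\<xi> - e *\<^sub>R \<zeta>)))"
    using e by (intro Bochner_Integration.integral_cong) (auto simp: scaleR_conv_of_real)
  finally show ?thesis by simp
qed

lemma gauss_approximation:
  fixes h :: "'a::euclidean_space \<Rightarrow> complex"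
  assumes [measurable]: "h \<in> borel_measurable borel" and h: "isCont h x" and B: "\<And>y. norm (h y) \<le> B"
  shows "(\<lambda>n. LINT \<zeta>|lborel. complex_of_real (gauss \<zeta>) * h (x - (1 / real (Suc n)) *\<^sub>R \<zeta>))
     \<longlonglongrightarrow> complex_of_real (sqrt (2 * pi) ^ DIM('a)) * h x"
proof -
  have "(\<lambda>n. LINT \<zeta>|lborel. complex_of_real (gauss \<zeta>) * h (x - (1 / real (Suc n)) *\<^sub>R \<zeta>))
     \<longlonglongrightarrow> (LINT \<zeta>|lborel. complex_of_real (gauss (\<zeta>::'a)) * h x)"
  proof (rule integral_dominated_convergence)
    show "integrable lborel (\<lambda>\<zeta>::'a. gauss \<zeta> * B)" using integrable_gauss[where 'a='a] by simp
    show "AE \<zeta> in lborel. (\<lambda>n. complex_of_real (gauss \<zeta>) * h (x - (1 / real (Suc n)) *\<^sub>R \<zeta>)) \<longlonglongrightarrow> complex_of_real (gauss \<zeta>) * h x"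
    proof (intro always_eventually allI tendsto_intros isCont_tendsto_compose[OF h])
      fix \<zeta> :: 'a
      have "(\<lambda>n. x - (1 / real (Suc n)) *\<^sub>R \<zeta>) \<longlonglongrightarrow> x - 0 *\<^sub>R \<zeta>"
        using LIMSEQ_inverse_real_of_nat by (intro tendsto_intros) (simp add: inverse_eq_divide)
      then show "(\<lambda>n. x - (1 / real (Suc n)) *\<^sub>R \<zeta>) \<longlonglongrightarrow> x" by simp
    qed
    show "AE \<zeta> in lborel. norm (complex_of_real (gauss \<zeta>) * h (x - (1 / real (Suc n)) *\<^sub>R \<zeta>)) \<le> gauss \<zeta> * B" for n
      using B by (intro always_eventually allI)
        (auto simp: norm_mult abs_of_pos[OF gauss_pos] intro!: mult_left_mono less_imp_le[OF gauss_pos])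
  qed auto
  also have "(LINT \<zeta>|lborel. complex_of_real (gauss (\<zeta>::'a)) * h x) = complex_of_real (sqrt (2 * pi) ^ DIM('a)) * h x"
    using integral_gauss[where 'a='a] by simp
  finally show ?thesis .
qed

lemma gauss_scaled_tendsto: "(\<lambda>n. gauss ((1 / real (Suc n)) *\<^sub>R x)) \<longlonglongrightarrow> 1"
proof -
  have "(\<lambda>n. exp (- (norm ((1 / real (Suc n)) *\<^sub>R x))\<^sup>2 / 2)) \<longlonglongrightarrow> exp (- (norm (0 *\<^sub>R x))\<^sup>2 / 2)"
    using LIMSEQ_inverse_real_of_nat by (intro tendsto_intros) (simp_all add: inverse_eq_divide)
  then show ?thesis by (simp add: gauss_def)
qed

text \<open>A Gaussian factor makes the exchange of the two integrals legitimate. As it tends to 1,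
  one side converges because the transform is integrable, the other because the Gaussian averages
  form an approximate identity.\<close>

lemma fourier_inversion:
  fixes v :: "'a::euclidean_space \<Rightarrow> complex"
  assumes v: "integrable lborel v" "continuous_on UNIV v" "\<And>y. norm (v y) \<le> B"
    and hat: "integrable lborel (\<lambda>\<xi>. ift v (- \<xi>))"
  shows "ift (\<lambda>\<xi>. ift v (- \<xi>)) x = complex_of_real ((2 * pi) ^ DIM('a)) * v x"
proof -
  let ?S = "complex_of_real (sqrt (2 * pi) ^ DIM('a))"
  let ?G = "\<lambda>e (x::'a). complex_of_real (gauss (e *\<^sub>R x))"
  have [measurable]: "v \<in> borel_measurable borel" using v(1) by auto
  have *: "(LINT \<xi>|lborel. ?G e \<xi> * (cis (x \<bullet> \<xi>) * ift v (- \<xi>))) =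
     ?S * (LINT \<zeta>|lborel. complex_of_real (gauss \<zeta>) * v (x - e *\<^sub>R \<zeta>))" if e: "e > 0" for e
  proof -
    have "cis (x \<bullet> \<xi>) * ift v (- \<xi>) = (LINT p|lborel. v p * cis (\<xi> \<bullet> (x - p)))" for \<xi>
    proof -
      have "cis (x \<bullet> \<xi>) * ift v (- \<xi>) = (LINT p|lborel. cis (x \<bullet> \<xi>) * (cis ((- \<xi>) \<bullet> p) * v p))"
        unfolding ift_def by simp
      also have "\<dots> = (LINT p|lborel. v p * cis (\<xi> \<bullet> (x - p)))"
        by (intro Bochner_Integration.integral_cong)
           (auto simp: inner_diff_right inner_commute mult.commute mult.left_commute cis_mult)
      finally show ?thesis .
    qed
    then have "(LINT \<xi>|lborel. ?G e \<xi> * (cis (x \<bullet> \<xi>) * ift v (- \<xi>))) = (LINT p|lborel. v p * ift (?G e) (x - p))"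
      using ift_fubini[OF gauss_scaled_integrable sigma_finite_lborel v(1), of e "\<lambda>p. x - p"] e by simp
    also have "\<dots> = ?S * (LINT \<zeta>|lborel. complex_of_real (gauss \<zeta>) * v (x - e *\<^sub>R \<zeta>))"
      by (rule gauss_convolution[OF e]) measurable
    finally show ?thesis .
  qed
  have "(\<lambda>n. LINT \<xi>|lborel. ?G (1 / real (Suc n)) \<xi> * (cis (x \<bullet> \<xi>) * ift v (- \<xi>)))
      \<longlonglongrightarrow> (LINT \<xi>|lborel. cis (x \<bullet> \<xi>) * ift v (- \<xi>))"
  proof (rule integral_dominated_convergence)
    show "integrable lborel (\<lambda>\<xi>. norm (ift v (- \<xi>)))" using hat by simp
    show "AE \<xi> in lborel. (\<lambda>n. ?G (1 / real (Suc n)) \<xi> * (cis (x \<bullet> \<xi>) * ift v (- \<xi>))) \<longlonglongrightarrow> cis (x \<bullet> \<xi>) * ift v (- \<xi>)"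
    proof (intro always_eventually allI)
      fix \<xi>
      have "(\<lambda>n. ?G (1 / real (Suc n)) \<xi> * (cis (x \<bullet> \<xi>) * ift v (- \<xi>))) \<longlonglongrightarrow> complex_of_real 1 * (cis (x \<bullet> \<xi>) * ift v (- \<xi>))"
        by (intro tendsto_intros gauss_scaled_tendsto)
      then show "(\<lambda>n. ?G (1 / real (Suc n)) \<xi> * (cis (x \<bullet> \<xi>) * ift v (- \<xi>))) \<longlonglongrightarrow> cis (x \<bullet> \<xi>) * ift v (- \<xi>)"
        by simp
    qed
    show "AE \<xi> in lborel. norm (?G (1 / real (Suc n)) \<xi> * (cis (x \<bullet> \<xi>) * ift v (- \<xi>))) \<le> norm (ift v (- \<xi>))" for n
      by (intro always_eventually allI)
         (auto simp: norm_mult abs_of_pos[OF gauss_pos] intro!: mult_left_le_one_le less_imp_le[OF gauss_pos] gauss_le_1)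
  qed (use hat borel_measurable_integrable[OF hat] in measurable)
  moreover have "(\<lambda>n. LINT \<xi>|lborel. ?G (1 / real (Suc n)) \<xi> * (cis (x \<bullet> \<xi>) * ift v (- \<xi>))) \<longlonglongrightarrow> ?S * (?S * v x)"
  proof -
    have "isCont v x" using v(2) by (simp add: continuous_on_eq_continuous_at)
    have e: "(1 / real (Suc n)) > 0" for n by simp
    show ?thesis
      unfolding *[OF e]
      by (intro tendsto_mult_left gauss_approximation[OF _ \<open>isCont v x\<close> v(3)]) measurable
  qed
  ultimately have "(LINT \<xi>|lborel. cis (x \<bullet> \<xi>) * ift v (- \<xi>)) = ?S * (?S * v x)"
    by (rule LIMSEQ_unique)
  \<comment> \<open>One factor \<open>?S\<close> comes from the transform of the Gaussian and one
    from its total mass; together they give the power of \<open>2 * pi\<close>.\<close>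
  also have "\<dots> = (?S * ?S) * v x" by (rule mult.assoc[symmetric])
  also have "?S * ?S = complex_of_real ((2 * pi) ^ DIM('a))"
    unfolding of_real_mult[symmetric] power_mult_distrib[symmetric] by simp
  finally show ?thesis unfolding ift_def[of "\<lambda>\<xi>. ift v (- \<xi>)"] .
qed

lemma borel_measurable_cnj [measurable]: "cnj \<in> borel_measurable borel"
  by (intro borel_measurable_continuous_onI continuous_intros)

section \<open>Schur's test, Bessel inequality and Plancherel identity\<close>

lemma integral_reflect:
  fixes K :: "'a::euclidean_space \<Rightarrow> 'b::{banach, second_countable_topology}"
  assumes K: "integrable lborel K"
  shows "integrable lborel (\<lambda>y. K (x - y))" "(LINT y|lborel. K (x - y)) = (LINT y|lborel. K y)"
  using integrable_affine[OF K, of "-1" x] integral_affine[of "-1" K x] K by auto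

lemma schur_test_aux:
  fixes g :: "'a::euclidean_space \<Rightarrow> complex" and K :: "'a \<Rightarrow> real"
  assumes [measurable]: "g \<in> borel_measurable borel" and g: "integrable lborel (\<lambda>x. (norm (g x))\<^sup>2)"
    and K: "integrable lborel K" "\<And>z. 0 \<le> K z"
  shows "integrable (lborel \<Otimes>\<^sub>M lborel) (\<lambda>p. (norm (g (fst p)))\<^sup>2 * K (fst p - snd p))"
    and "(LINT p|(lborel \<Otimes>\<^sub>M lborel). (norm (g (fst p)))\<^sup>2 * K (fst p - snd p)) =
      (LINT x|lborel. (norm (g x))\<^sup>2) * (LINT x|lborel. K x)"
proof -
  have [measurable]: "K \<in> borel_measurable borel" using K by auto
  show i: "integrable (lborel \<Otimes>\<^sub>M lborel) (\<lambda>p. (norm (g (fst p)))\<^sup>2 * K (fst p - snd p))"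
    by (rule lborel_pair.Fubini_integrable)
       (use g K in \<open>auto simp: abs_mult integral_reflect\<close>)
  show "(LINT p|(lborel \<Otimes>\<^sub>M lborel). (norm (g (fst p)))\<^sup>2 * K (fst p - snd p)) =
      (LINT x|lborel. (norm (g x))\<^sup>2) * (LINT x|lborel. K x)"
    using lborel_pair.integral_fst'[OF i] by (simp add: integral_reflect K)
qed

text \<open>By \<open>a b \<le> (a\<^sup>2 + b\<^sup>2) / 2\<close> the kernel is integrated against
  one variable at a time, and translation invariance makes each such integral equal to the total
  mass of \<open>K\<close>.\<close>

lemma schur_test:
  fixes g1 g2 :: "'a::euclidean_space \<Rightarrow> complex" and K :: "'a \<Rightarrow> real"
  assumes m[measurable]: "g1 \<in> borel_measurable borel" "g2 \<in> borel_measurable borel"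
      "H \<in> borel_measurable (lborel \<Otimes>\<^sub>M lborel)"
    and g: "integrable lborel (\<lambda>x. (norm (g1 x))\<^sup>2)" "integrable lborel (\<lambda>x. (norm (g2 x))\<^sup>2)"
    and K: "integrable lborel K" "\<And>z. 0 \<le> K z"
    and H: "\<And>p. norm (H p) \<le> norm (g1 (fst p)) * norm (g2 (snd p)) * K (fst p - snd p)"
  shows "integrable (lborel \<Otimes>\<^sub>M lborel) (H :: _ \<Rightarrow> complex)"
    and "norm (LINT p|(lborel \<Otimes>\<^sub>M lborel). H p) \<le>
      ((LINT x|lborel. (norm (g1 x))\<^sup>2) + (LINT x|lborel. (norm (g2 x))\<^sup>2)) / 2 * (LINT x|lborel. K x)"
proof -
  \<comment> \<open>\<open>K\<close> is not assumed even. The term with \<open>g2\<close> sees the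
    kernel from the other variable, hence reflected, with the same mass.\<close>
  have K': "integrable lborel (\<lambda>z. K (- z))" "(LINT z|lborel. K (- z)) = (LINT z|lborel. K z)"
    using integral_reflect[OF K(1), of 0] by auto
  note R1 = schur_test_aux[OF m(1) g(1) K]
  note R2' = schur_test_aux[OF m(2) g(2) K'(1)]
  have R2: "integrable (lborel \<Otimes>\<^sub>M lborel) (\<lambda>p. (norm (g2 (snd p)))\<^sup>2 * K (fst p - snd p))"
    using lborel_pair.integrable_product_swap[OF R2'(1)] K(2) by (simp add: case_prod_beta')
  have R2i: "(LINT p|(lborel \<Otimes>\<^sub>M lborel). (norm (g2 (snd p)))\<^sup>2 * K (fst p - snd p)) =
      (LINT x|lborel. (norm (g2 x))\<^sup>2) * (LINT x|lborel. K x)"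
    using lborel_pair.integral_product_swap[of "\<lambda>p. (norm (g2 (snd p)))\<^sup>2 * K (fst p - snd p)"] R2 R2'(2) K K'(2)
    by (simp add: case_prod_beta')
  let ?R = "\<lambda>p. ((norm (g1 (fst p)))\<^sup>2 * K (fst p - snd p) + (norm (g2 (snd p)))\<^sup>2 * K (fst p - snd p)) / 2"
  have R: "integrable (lborel \<Otimes>\<^sub>M lborel) ?R" using R1(1) R2 by simp
  have le: "norm (H p) \<le> ?R p" for p
  proof -
    have "norm (g1 (fst p)) * norm (g2 (snd p)) \<le> ((norm (g1 (fst p)))\<^sup>2 + (norm (g2 (snd p)))\<^sup>2) / 2"
      using zero_le_power2[of "norm (g1 (fst p)) - norm (g2 (snd p))"] by (simp add: power2_diff)
    from mult_right_mono[OF this K(2)[of "fst p - snd p"]] H[of p] show ?thesis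
      by (simp add: algebra_simps add_divide_distrib)
  qed
  show I: "integrable (lborel \<Otimes>\<^sub>M lborel) H"
    by (rule Bochner_Integration.integrable_bound[OF R m(3)])
       (use le in \<open>intro always_eventually allI, metis abs_ge_self order_trans real_norm_def\<close>)
  have "norm (LINT p|(lborel \<Otimes>\<^sub>M lborel). H p) \<le> (LINT p|(lborel \<Otimes>\<^sub>M lborel). norm (H p))"
    by (rule integral_norm_bound)
  also have "\<dots> \<le> (LINT p|(lborel \<Otimes>\<^sub>M lborel). ?R p)"
    using I R le by (intro integral_mono) auto
  also have "\<dots> = ((LINT x|lborel. (norm (g1 x))\<^sup>2) + (LINT x|lborel. (norm (g2 x))\<^sup>2)) / 2 * (LINT x|lborel. K x)"
    using R1 R2 R2i by (simp add: distrib_right)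
  finally show "norm (LINT p|(lborel \<Otimes>\<^sub>M lborel). H p) \<le>
      ((LINT x|lborel. (norm (g1 x))\<^sup>2) + (LINT x|lborel. (norm (g2 x))\<^sup>2)) / 2 * (LINT x|lborel. K x)" .
qed

text \<open>The mass \<open>(2 * pi) ^ DIM('a)\<close> does not depend on \<open>e\<close>; this is
  what makes the damped energy bounds uniform and fixes the constant in the Bessel
  inequality.\<close>

lemma gauss_kernel:
  fixes e :: real
  assumes e: "e > 0"
  defines "K \<equiv> \<lambda>\<zeta>::'a::euclidean_space. sqrt (2 * pi) ^ DIM('a) / e ^ DIM('a) * gauss (\<zeta> /\<^sub>R e)"
  shows "integrable lborel K" "(LINT \<zeta>|lborel. K \<zeta>) = (2 * pi) ^ DIM('a)" "0 \<le> K \<zeta>"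
proof -
  show "integrable lborel K"
    unfolding K_def using integrable_affine[OF integrable_gauss[where 'a='a], of "inverse e" 0] e by simp
  have "sqrt (2 * pi) ^ DIM('a) = (LINT \<zeta>|lborel. gauss (\<zeta>::'a))" by (rule integral_gauss[symmetric])
  also have "\<dots> = inverse e ^ DIM('a) * (LINT \<zeta>|lborel. gauss ((\<zeta>::'a) /\<^sub>R e))"
    by (subst integral_affine[of "inverse e" _ 0]) (use e in auto)
  finally have "(LINT \<zeta>|lborel. K \<zeta>) = sqrt (2 * pi) ^ DIM('a) * sqrt (2 * pi) ^ DIM('a)"
    unfolding K_def using e by (simp add: field_simps)
  then show "(LINT \<zeta>|lborel. K \<zeta>) = (2 * pi) ^ DIM('a)"
    unfolding power_mult_distrib[symmetric] by simp
  show "0 \<le> K \<zeta>" unfolding K_def using e gauss_pos[of "\<zeta> /\<^sub>R e"] by simp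
qed

lemma gauss_damped:
  fixes g :: "'a::euclidean_space \<Rightarrow> complex"
  assumes g: "integrable lborel g" and e: "e > 0"
  shows "integrable lborel (\<lambda>x. gauss (e *\<^sub>R x) * (norm (ift g x))\<^sup>2)"
    and "complex_of_real (LINT x|lborel. gauss (e *\<^sub>R x) * (norm (ift g x))\<^sup>2) =
      (LINT p|(lborel \<Otimes>\<^sub>M lborel). g (fst p) * cnj (g (snd p)) *
         ift (\<lambda>x. complex_of_real (gauss (e *\<^sub>R x))) (fst p - snd p))"
proof -
  have [measurable]: "ift g \<in> borel_measurable borel" by (rule borel_measurable_ift[OF g])
  have b: "(norm (ift g x))\<^sup>2 \<le> (LINT \<xi>|lborel. norm (g \<xi>))\<^sup>2" for x
    using norm_ift_le[OF g] by (intro power_mono) auto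
  have "integrable lborel (\<lambda>x::'a. gauss (e *\<^sub>R x) * (LINT \<xi>|lborel. norm (g \<xi>))\<^sup>2)"
    using integrable_affine[OF integrable_gauss[where 'a='a], of e 0] e by simp
  then show "integrable lborel (\<lambda>x. gauss (e *\<^sub>R x) * (norm (ift g x))\<^sup>2)"
    by (rule Bochner_Integration.integrable_bound)
       (auto simp: abs_mult intro!: mult_left_mono b)
  have "complex_of_real (LINT x|lborel. gauss (e *\<^sub>R x) * (norm (ift g x))\<^sup>2) =
     (LINT x|lborel. complex_of_real (gauss (e *\<^sub>R x)) * (ift g x * cnj (ift g x)))"
    unfolding integral_complex_of_real[symmetric] of_real_mult complex_norm_square ..
  then show "complex_of_real (LINT x|lborel. gauss (e *\<^sub>R x) * (norm (ift g x))\<^sup>2) =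
      (LINT p|(lborel \<Otimes>\<^sub>M lborel). g (fst p) * cnj (g (snd p)) *
         ift (\<lambda>x. complex_of_real (gauss (e *\<^sub>R x))) (fst p - snd p))"
    using ift_weighted[OF gauss_scaled_integrable g g, of e] e by simp
qed

lemma gauss_schur:
  fixes g :: "'a::euclidean_space \<Rightarrow> complex"
  assumes [measurable]: "g \<in> borel_measurable borel" and g2: "integrable lborel (\<lambda>x. (norm (g x))\<^sup>2)"
    and e: "e > 0"
  defines "H \<equiv> \<lambda>p. g (fst p) * cnj (g (snd p)) * ift (\<lambda>x. complex_of_real (gauss (e *\<^sub>R x))) (fst p - snd p)"
  shows "integrable (lborel \<Otimes>\<^sub>M lborel) H"
    and "norm (LINT p|(lborel \<Otimes>\<^sub>M lborel). H p) \<le> (2 * pi) ^ DIM('a) * (LINT x|lborel. (norm (g x))\<^sup>2)"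
proof -
  have [measurable]: "(\<lambda>p::'a \<times> 'a. ift (\<lambda>x::'a. complex_of_real (gauss (e *\<^sub>R x))) (fst p - snd p)) \<in>
      borel_measurable (lborel \<Otimes>\<^sub>M lborel)"
    by (rule measurable_compose[OF _ borel_measurable_ift[OF gauss_scaled_integrable]]) (measurable, use e in simp)
  have n: "norm (ift (\<lambda>x. complex_of_real (gauss (e *\<^sub>R x))) \<zeta>) =
      sqrt (2 * pi) ^ DIM('a) / e ^ DIM('a) * gauss (\<zeta> /\<^sub>R e)" for \<zeta> :: 'a
    unfolding ift_gauss_scaled[OF e] norm_of_real by (rule abs_of_nonneg[OF gauss_kernel(3)[OF e]])
  have m: "H \<in> borel_measurable (lborel \<Otimes>\<^sub>M lborel)" unfolding H_def by measurable
  have b: "norm (H p) \<le> norm (g (fst p)) * norm (g (snd p)) *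
      (sqrt (2 * pi) ^ DIM('a) / e ^ DIM('a) * gauss ((fst p - snd p) /\<^sub>R e))" for p
    unfolding H_def norm_mult complex_mod_cnj n ..
  show "integrable (lborel \<Otimes>\<^sub>M lborel) H"
    by (rule schur_test(1)[OF assms(1,1) m g2 g2 gauss_kernel(1,3)[OF e] b])
  show "norm (LINT p|(lborel \<Otimes>\<^sub>M lborel). H p) \<le> (2 * pi) ^ DIM('a) * (LINT x|lborel. (norm (g x))\<^sup>2)"
    using schur_test(2)[OF assms(1,1) m g2 g2 gauss_kernel(1,3)[OF e] b] gauss_kernel(2)[OF e, where 'a='a]
    by (simp only: mult.commute) simp
qed

text \<open>The Gaussian-damped energy is a quadratic form with kernel of mass
  \<open>(2 * pi) ^ DIM('a)\<close>, so Schur's test bounds it uniformly in the damping. The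
  inequality holds without continuity of \<open>g\<close>, as wanted for the symbol of
  \<open>f(\<Lambda>)\<close>.\<close>

lemma ift_bessel:
  fixes g :: "'a::euclidean_space \<Rightarrow> complex"
  assumes g: "integrable lborel g" and g2: "integrable lborel (\<lambda>x. (norm (g x))\<^sup>2)"
  shows "integrable lborel (\<lambda>x. (norm (ift g x))\<^sup>2)"
    and "(LINT x|lborel. (norm (ift g x))\<^sup>2) \<le> (2 * pi) ^ DIM('a) * (LINT x|lborel. (norm (g x))\<^sup>2)"
proof -
  have [measurable]: "g \<in> borel_measurable borel" "ift g \<in> borel_measurable borel"
    using g borel_measurable_ift[OF g] by auto
  let ?B = "(2 * pi) ^ DIM('a) * (LINT x|lborel. (norm (g x))\<^sup>2)"
  have I: "(LINT x|lborel. gauss (e *\<^sub>R x) * (norm (ift g x))\<^sup>2) \<le> ?B" if e: "e > 0" for e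
  proof -
    have "norm (LINT p|(lborel \<Otimes>\<^sub>M lborel). g (fst p) * cnj (g (snd p)) *
         ift (\<lambda>x. complex_of_real (gauss (e *\<^sub>R x))) (fst p - snd p)) \<le> ?B"
      by (rule gauss_schur(2)[OF _ g2 e]) measurable
    then have "norm (complex_of_real (LINT x|lborel. gauss (e *\<^sub>R x) * (norm (ift g x))\<^sup>2)) \<le> ?B"
      unfolding gauss_damped(2)[OF g e] .
    then show ?thesis by simp
  qed
  have B0: "?B \<ge> 0" by (intro mult_nonneg_nonneg integral_nonneg_AE) auto
  have "(\<integral>\<^sup>+x. ennreal ((norm (ift g x))\<^sup>2) \<partial>lborel) =
      (\<integral>\<^sup>+x. liminf (\<lambda>n. ennreal (gauss ((1 / real (Suc n)) *\<^sub>R x) * (norm (ift g x))\<^sup>2)) \<partial>lborel)"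
  proof (rule nn_integral_cong)
    fix x
    have "(\<lambda>n. gauss ((1 / real (Suc n)) *\<^sub>R x) * (norm (ift g x))\<^sup>2) \<longlonglongrightarrow> 1 * (norm (ift g x))\<^sup>2"
      by (intro tendsto_intros gauss_scaled_tendsto)
    then have "(\<lambda>n. ennreal (gauss ((1 / real (Suc n)) *\<^sub>R x) * (norm (ift g x))\<^sup>2)) \<longlonglongrightarrow> ennreal ((norm (ift g x))\<^sup>2)"
      by (intro tendsto_ennrealI) simp
    from lim_imp_Liminf[OF _ this]
    show "ennreal ((norm (ift g x))\<^sup>2) = liminf (\<lambda>n. ennreal (gauss ((1 / real (Suc n)) *\<^sub>R x) * (norm (ift g x))\<^sup>2))"
      by simp
  qed
  \<comment> \<open>Fatou's lemma removes the damping; integrability of the undamped energy is part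
    of the conclusion, so dominated convergence is not yet available.\<close>
  also have "\<dots> \<le> liminf (\<lambda>n. \<integral>\<^sup>+x. ennreal (gauss ((1 / real (Suc n)) *\<^sub>R x) * (norm (ift g x))\<^sup>2) \<partial>lborel)"
    by (rule nn_integral_liminf) measurable
  also have "\<dots> \<le> liminf (\<lambda>n::nat. ennreal ?B)"
  proof (intro Liminf_mono always_eventually allI)
    fix n :: nat
    have e: "1 / real (Suc n) > 0" by simp
    show "(\<integral>\<^sup>+x. ennreal (gauss ((1 / real (Suc n)) *\<^sub>R x) * (norm (ift g x))\<^sup>2) \<partial>lborel) \<le> ennreal ?B"
      using I[OF e] by (subst nn_integral_eq_integral[OF gauss_damped(1)[OF g e]])
        (auto intro!: ennreal_leI always_eventually mult_nonneg_nonneg less_imp_le[OF gauss_pos])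
  qed
  also have "\<dots> = ennreal ?B" by (simp add: Liminf_const)
  finally have nn: "(\<integral>\<^sup>+x. ennreal ((norm (ift g x))\<^sup>2) \<partial>lborel) \<le> ennreal ?B" .
  show int: "integrable lborel (\<lambda>x. (norm (ift g x))\<^sup>2)"
    unfolding integrable_iff_bounded using le_less_trans[OF nn ennreal_less_top] by simp
  show "(LINT x|lborel. (norm (ift g x))\<^sup>2) \<le> ?B"
    using nn B0 unfolding nn_integral_eq_integral[OF int AE_I2, simplified] by (simp add: ennreal_le_iff)
qed

text \<open>The same damped identity, with the limit now also taken in frequency: continuity and
  boundedness of \<open>g\<close> let the Gaussian averages converge to \<open>g\<close>, which
  turns the inequality into an equality.\<close>

lemma plancherel:
  fixes g :: "'a::euclidean_space \<Rightarrow> complex"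
  assumes g: "integrable lborel g" and c: "continuous_on UNIV g" and b: "\<And>\<xi>. norm (g \<xi>) \<le> B"
  shows "(LINT x|lborel. (norm (ift g x))\<^sup>2) = (2 * pi) ^ DIM('a) * (LINT x|lborel. (norm (g x))\<^sup>2)"
proof -
  have [measurable]: "g \<in> borel_measurable borel" "ift g \<in> borel_measurable borel"
    using g borel_measurable_ift[OF g] by auto
  let ?S = "sqrt (2 * pi) ^ DIM('a)"
  let ?e = "\<lambda>n. 1 / real (Suc n)"
  let ?G = "\<lambda>e (x::'a). complex_of_real (gauss (e *\<^sub>R x))"
  have g2: "integrable lborel (\<lambda>x. (norm (g x))\<^sup>2)"
  proof (rule Bochner_Integration.integrable_bound)
    show "integrable lborel (\<lambda>x. B * norm (g x))" using g by simp
    show "AE x in lborel. norm ((norm (g x))\<^sup>2) \<le> norm (B * norm (g x))"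
      using b by (intro always_eventually allI) (auto simp: power2_eq_square abs_mult intro!: mult_right_mono order_trans[OF b abs_ge_self])
  qed measurable
  have e: "?e n > 0" for n by simp
  have L: "(\<lambda>n. LINT x|lborel. gauss (?e n *\<^sub>R x) * (norm (ift g x))\<^sup>2) \<longlonglongrightarrow> (LINT x|lborel. (norm (ift g x))\<^sup>2)"
  proof (rule integral_dominated_convergence)
    show "integrable lborel (\<lambda>x. (norm (ift g x))\<^sup>2)" by (rule ift_bessel[OF g g2])
    show "AE x in lborel. (\<lambda>n. gauss (?e n *\<^sub>R x) * (norm (ift g x))\<^sup>2) \<longlonglongrightarrow> (norm (ift g x))\<^sup>2"
    proof (intro always_eventually allI)
      fix x
      have "(\<lambda>n. gauss (?e n *\<^sub>R x) * (norm (ift g x))\<^sup>2) \<longlonglongrightarrow> 1 * (norm (ift g x))\<^sup>2"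
        by (intro tendsto_intros gauss_scaled_tendsto)
      then show "(\<lambda>n. gauss (?e n *\<^sub>R x) * (norm (ift g x))\<^sup>2) \<longlonglongrightarrow> (norm (ift g x))\<^sup>2" by simp
    qed
    show "AE x in lborel. norm (gauss (?e n *\<^sub>R x) * (norm (ift g x))\<^sup>2) \<le> (norm (ift g x))\<^sup>2" for n
      by (intro always_eventually allI)
         (auto simp: abs_mult abs_of_pos[OF gauss_pos] intro!: mult_left_le_one_le less_imp_le[OF gauss_pos] gauss_le_1)
  qed measurable
  have Req: "complex_of_real (LINT x|lborel. gauss (?e n *\<^sub>R x) * (norm (ift g x))\<^sup>2) =
    (LINT \<xi>|lborel. g \<xi> * (complex_of_real ?S * (LINT \<zeta>|lborel. complex_of_real (gauss \<zeta>) * cnj (g (\<xi> - ?e n *\<^sub>R \<zeta>)))))" for n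
  proof -
    have i: "integrable (lborel \<Otimes>\<^sub>M lborel) (\<lambda>p. g (fst p) * cnj (g (snd p)) * ift (?G (?e n)) (fst p - snd p))"
      by (rule gauss_schur(1)[OF _ g2 e]) measurable
    have "complex_of_real (LINT x|lborel. gauss (?e n *\<^sub>R x) * (norm (ift g x))\<^sup>2) =
       (LINT \<xi>|lborel. LINT \<eta>|lborel. g \<xi> * cnj (g \<eta>) * ift (?G (?e n)) (\<xi> - \<eta>))"
      unfolding gauss_damped(2)[OF g e[of n]] lborel_pair.integral_fst'[OF i, symmetric] by simp
    also have "\<dots> = (LINT \<xi>|lborel. g \<xi> * (LINT \<eta>|lborel. cnj (g \<eta>) * ift (?G (?e n)) (\<xi> - \<eta>)))"
      by (simp add: mult.assoc)
    finally show ?thesis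
      by (subst (asm) gauss_convolution[OF e[of n]]) measurable
  qed
  have R: "(\<lambda>n. complex_of_real (LINT x|lborel. gauss (?e n *\<^sub>R x) * (norm (ift g x))\<^sup>2)) \<longlonglongrightarrow>
    (LINT \<xi>|lborel. g \<xi> * (complex_of_real ?S * (complex_of_real ?S * cnj (g \<xi>))))"
    unfolding Req
  proof (rule integral_dominated_convergence)
    show "integrable lborel (\<lambda>\<xi>. norm (g \<xi>) * (?S * (?S * B)))" using g by simp
    show "AE \<xi> in lborel. (\<lambda>n. g \<xi> * (complex_of_real ?S * (LINT \<zeta>|lborel. complex_of_real (gauss \<zeta>) * cnj (g (\<xi> - ?e n *\<^sub>R \<zeta>)))))
        \<longlonglongrightarrow> g \<xi> * (complex_of_real ?S * (complex_of_real ?S * cnj (g \<xi>)))"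
    proof (intro always_eventually allI tendsto_mult_left)
      fix \<xi>
      have "isCont (\<lambda>\<xi>. cnj (g \<xi>)) \<xi>"
        using c by (intro continuous_intros) (simp add: continuous_on_eq_continuous_at)
      then show "(\<lambda>n. LINT \<zeta>|lborel. complex_of_real (gauss \<zeta>) * cnj (g (\<xi> - ?e n *\<^sub>R \<zeta>))) \<longlonglongrightarrow> complex_of_real ?S * cnj (g \<xi>)"
        using b by (intro gauss_approximation[where h="\<lambda>\<xi>. cnj (g \<xi>)" and B=B]) auto
    qed
    show "AE \<xi> in lborel. norm (g \<xi> * (complex_of_real ?S * (LINT \<zeta>|lborel. complex_of_real (gauss \<zeta>) * cnj (g (\<xi> - ?e n *\<^sub>R \<zeta>)))))
       \<le> norm (g \<xi>) * (?S * (?S * B))" for n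
    proof (intro always_eventually allI)
      fix \<xi>
      have "norm (LINT \<zeta>|lborel. complex_of_real (gauss \<zeta>) * cnj (g (\<xi> - ?e n *\<^sub>R \<zeta>))) \<le> (LINT \<zeta>|lborel. gauss (\<zeta>::'a) * B)"
      proof -
        have i: "integrable lborel (\<lambda>\<zeta>::'a. gauss \<zeta> * B)" using integrable_gauss[where 'a='a] by simp
        have le: "norm (complex_of_real (gauss \<zeta>) * cnj (g (\<xi> - ?e n *\<^sub>R \<zeta>))) \<le> gauss \<zeta> * B" for \<zeta>
          using b by (auto simp: norm_mult abs_of_pos[OF gauss_pos] intro!: mult_left_mono less_imp_le[OF gauss_pos])
        have "integrable lborel (\<lambda>\<zeta>. complex_of_real (gauss \<zeta>) * cnj (g (\<xi> - ?e n *\<^sub>R \<zeta>)))"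
          by (rule Bochner_Integration.integrable_bound[OF i])
             (use le in \<open>auto intro: order_trans[OF _ abs_ge_self]\<close>)
        then show ?thesis
          using i le by (intro order_trans[OF integral_norm_bound integral_mono]) auto
      qed
      also have "\<dots> = ?S * B" by (simp add: integral_gauss)
      finally show "norm (g \<xi> * (complex_of_real ?S * (LINT \<zeta>|lborel. complex_of_real (gauss \<zeta>) * cnj (g (\<xi> - ?e n *\<^sub>R \<zeta>)))))
         \<le> norm (g \<xi>) * (?S * (?S * B))"
        by (auto simp: norm_mult norm_power intro!: mult_left_mono)
    qed
  qed measurable
  have "complex_of_real (LINT x|lborel. (norm (ift g x))\<^sup>2) =
      (LINT \<xi>|lborel. g \<xi> * (complex_of_real ?S * (complex_of_real ?S * cnj (g \<xi>))))"
    by (rule LIMSEQ_unique[OF tendsto_of_real[OF L] R])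
  also have "\<dots> = (LINT \<xi>|lborel. complex_of_real (?S * ?S * (norm (g \<xi>))\<^sup>2))"
    unfolding of_real_mult complex_norm_square by (simp only: mult_ac)
  also have "\<dots> = complex_of_real (?S * ?S * (LINT \<xi>|lborel. (norm (g \<xi>))\<^sup>2))"
    by (subst integral_complex_of_real) simp
  also have "?S * ?S = (2 * pi) ^ DIM('a)"
    unfolding power_mult_distrib[symmetric] by simp
  finally show ?thesis by (simp only: of_real_eq_iff)
qed

section \<open>Rapid decay and transforms of test functions\<close>

definition rapid :: "('a::euclidean_space \<Rightarrow> complex) \<Rightarrow> bool" where
  "rapid g \<longleftrightarrow> g \<in> borel_measurable borel \<and> (\<forall>N. \<exists>C. \<forall>\<xi>. norm (g \<xi>) * (1 + norm \<xi>) ^ N \<le> C)"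

lemma integrable_inverse_one_plus_square: "integrable lborel (\<lambda>x::real. inverse (1 + x\<^sup>2))"
  using integrable_inverse_1_plus_square by (simp add: set_integrable_def einterval_def)

text \<open>Each factor \<open>1 + (\<xi> \<bullet> b)\<^sup>2\<close> is at most
  \<open>(1 + norm \<xi>)\<^sup>2\<close>, so a product of one-dimensional integrable functions
  dominates. Two powers per coordinate explain the exponent \<open>2 * DIM('a)\<close>.\<close>

lemma integrable_inverse_power:
  "integrable lborel (\<lambda>\<xi>::'a::euclidean_space. inverse ((1 + norm \<xi>) ^ (2 * DIM('a))))"
proof (rule Bochner_Integration.integrable_bound)
  show "integrable lborel (\<lambda>\<xi>::'a. \<Prod>b\<in>Basis. inverse (1 + (\<xi> \<bullet> b)\<^sup>2))"
    by (rule lborel_prod_integral(1)[of "\<lambda>_ t. inverse (1 + t\<^sup>2)"]) (rule integrable_inverse_one_plus_square)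
  show "AE \<xi>::'a in lborel. norm (inverse ((1 + norm \<xi>) ^ (2 * DIM('a)))) \<le> norm (\<Prod>b\<in>Basis. inverse (1 + (\<xi> \<bullet> b)\<^sup>2))"
  proof (intro always_eventually allI)
    fix \<xi> :: 'a
    have pos: "0 < 1 + (\<xi> \<bullet> b)\<^sup>2" for b by (simp add: add_pos_nonneg)
    have "(\<Prod>b\<in>Basis. 1 + (\<xi> \<bullet> b)\<^sup>2) \<le> (\<Prod>b\<in>(Basis::'a set). (1 + norm \<xi>)\<^sup>2)"
    proof (intro prod_mono conjI)
      fix b :: 'a assume "b \<in> Basis"
      then have "\<bar>\<xi> \<bullet> b\<bar> \<le> norm \<xi>" by (rule Basis_le_norm)
      then have "(\<xi> \<bullet> b)\<^sup>2 \<le> (norm \<xi>)\<^sup>2" using power_mono[of "\<bar>\<xi> \<bullet> b\<bar>" "norm \<xi>" 2] by simp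
      then show "1 + (\<xi> \<bullet> b)\<^sup>2 \<le> (1 + norm \<xi>)\<^sup>2" by (simp add: power2_sum add_increasing2)
      show "0 \<le> 1 + (\<xi> \<bullet> b)\<^sup>2" using pos less_imp_le by blast
    qed
    also have "\<dots> = (1 + norm \<xi>) ^ (2 * DIM('a))" by (simp add: power_mult)
    finally have le: "(\<Prod>b\<in>Basis. 1 + (\<xi> \<bullet> b)\<^sup>2) \<le> (1 + norm \<xi>) ^ (2 * DIM('a))" .
    have "0 < (\<Prod>b\<in>Basis. 1 + (\<xi> \<bullet> b)\<^sup>2)" by (intro prod_pos) (use pos in blast)
    from le_imp_inverse_le[OF le this]
    have "inverse ((1 + norm \<xi>) ^ (2 * DIM('a))) \<le> (\<Prod>b\<in>Basis. inverse (1 + (\<xi> \<bullet> b)\<^sup>2))"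
      by (simp only: prod_inversef[symmetric] o_def)
    moreover have "0 \<le> inverse ((1 + norm \<xi>) ^ (2 * DIM('a)))" by simp
    ultimately show "norm (inverse ((1 + norm \<xi>) ^ (2 * DIM('a)))) \<le> norm (\<Prod>b\<in>Basis. inverse (1 + (\<xi> \<bullet> b)\<^sup>2))"
      by simp
  qed
qed measurable

lemma integrable_of_decay:
  fixes g :: "'a::euclidean_space \<Rightarrow> 'b::{banach, second_countable_topology}"
  assumes [measurable]: "g \<in> borel_measurable borel"
    and C: "\<And>\<xi>. norm (g \<xi>) * (1 + norm \<xi>) ^ (2 * DIM('a)) \<le> C"
  shows "integrable lborel g"
proof (rule Bochner_Integration.integrable_bound)
  show "integrable lborel (\<lambda>\<xi>::'a. C * inverse ((1 + norm \<xi>) ^ (2 * DIM('a))))"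
    using integrable_inverse_power[where 'a='a] by simp
  show "AE \<xi> in lborel. norm (g \<xi>) \<le> norm (C * inverse ((1 + norm \<xi>) ^ (2 * DIM('a))))"
  proof (intro always_eventually allI)
    fix \<xi> :: 'a
    have "0 < (1 + norm \<xi>) ^ (2 * DIM('a))" by (intro zero_less_power) (simp add: add_pos_nonneg)
    then have "norm (g \<xi>) \<le> C * inverse ((1 + norm \<xi>) ^ (2 * DIM('a)))"
      using C[of \<xi>] by (simp add: field_simps)
    then show "norm (g \<xi>) \<le> norm (C * inverse ((1 + norm \<xi>) ^ (2 * DIM('a))))"
      by (simp only: real_norm_def abs_ge_self order_trans[OF _ abs_ge_self])
  qed
qed measurable

lemma rapid_integrable: "rapid g \<Longrightarrow> integrable lborel g"
  unfolding rapid_def using integrable_of_decay by metis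

lemma rapid_measurable: "rapid g \<Longrightarrow> g \<in> borel_measurable borel"
  by (simp add: rapid_def)

text \<open>The growth of \<open>\<sigma>\<close> is paid for by \<open>M\<close> of the available
  powers of decay. As \<open>rapid\<close> asks for decay without derivatives, the multiplier may be
  rough.\<close>

lemma rapid_mult:
  fixes g :: "'a::euclidean_space \<Rightarrow> complex"
  assumes g: "rapid g" and [measurable]: "\<sigma> \<in> borel_measurable borel"
    and \<sigma>: "\<And>\<xi>. norm (\<sigma> \<xi>) \<le> B * (1 + norm \<xi>) ^ M"
  shows "rapid (\<lambda>\<xi>. \<sigma> \<xi> * g \<xi>)"
  unfolding rapid_def
proof (intro conjI allI)
  have [measurable]: "g \<in> borel_measurable borel" using g by (rule rapid_measurable)
  show "(\<lambda>\<xi>. \<sigma> \<xi> * g \<xi>) \<in> borel_measurable borel" by measurable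
  fix N
  obtain C where C: "\<And>\<xi>. norm (g \<xi>) * (1 + norm \<xi>) ^ (M + N) \<le> C"
    using g unfolding rapid_def by blast
  have B: "0 \<le> B" using order_trans[OF norm_ge_zero \<sigma>[of 0]] by simp
  have "norm (\<sigma> \<xi> * g \<xi>) * (1 + norm \<xi>) ^ N \<le> B * C" for \<xi>
  proof -
    have "norm (\<sigma> \<xi> * g \<xi>) * (1 + norm \<xi>) ^ N \<le> (B * (1 + norm \<xi>) ^ M) * (norm (g \<xi>) * (1 + norm \<xi>) ^ N)"
      unfolding norm_mult mult.assoc[of "norm (\<sigma> \<xi>)"] by (intro mult_right_mono \<sigma>) auto
    also have "\<dots> = B * (norm (g \<xi>) * (1 + norm \<xi>) ^ (M + N))" by (simp add: power_add)
    also have "\<dots> \<le> B * C" by (intro mult_left_mono C B)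
    finally show ?thesis .
  qed
  then show "\<exists>C. \<forall>\<xi>. norm (\<sigma> \<xi> * g \<xi>) * (1 + norm \<xi>) ^ N \<le> C" by blast
qed

lemma rapid_bounded: "rapid g \<Longrightarrow> \<exists>C. \<forall>\<xi>. norm (g \<xi>) \<le> C"
  unfolding rapid_def by (metis mult.right_neutral power_0)

lemma rapid_square_integrable:
  assumes "rapid g"
  shows "integrable lborel (\<lambda>\<xi>. (norm (g \<xi>))\<^sup>2)"
proof -
  obtain C where C: "\<And>\<xi>. norm (g \<xi>) \<le> C" using rapid_bounded[OF assms] by blast
  have [measurable]: "g \<in> borel_measurable borel" using assms by (rule rapid_measurable)
  have "integrable lborel (\<lambda>\<xi>. C * norm (g \<xi>))" using rapid_integrable[OF assms] by simp
  then show ?thesis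
    by (rule Bochner_Integration.integrable_bound)
       (auto simp: power2_eq_square abs_mult intro!: mult_right_mono order_trans[OF C abs_ge_self])
qed

definition test_fun :: "('a::euclidean_space \<Rightarrow> 'b::real_normed_vector) \<Rightarrow> bool" where
  "test_fun u \<longleftrightarrow> smooth_on UNIV u \<and> (\<exists>K. compact K \<and> (\<forall>x. x \<notin> K \<longrightarrow> u x = 0))"

lemma test_fun_continuous: "test_fun u \<Longrightarrow> continuous_on UNIV u"
  unfolding test_fun_def using smooth_on_continuous_on by blast

lemma test_fun_bounded:
  assumes "test_fun u"
  shows "\<exists>B>0. \<forall>x. norm (u x) \<le> B"
proof -
  obtain K where K: "compact K" "\<And>x. x \<notin> K \<Longrightarrow> u x = 0" using assms unfolding test_fun_def by blast
  have "compact (u ` K)"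
    by (rule compact_continuous_image[OF continuous_on_subset[OF test_fun_continuous[OF assms]] K(1)]) simp
  then obtain B where B: "B > 0" "\<And>y. y \<in> u ` K \<Longrightarrow> norm y \<le> B"
    using bounded_pos compact_imp_bounded by metis
  then have "norm (u x) \<le> B" for x using K(2)[of x] by (cases "x \<in> K") auto
  then show ?thesis using B(1) by blast
qed

lemma integrable_bounded_compact_support:
  fixes u :: "'a::euclidean_space \<Rightarrow> 'b::{banach, second_countable_topology}"
  assumes [measurable]: "u \<in> borel_measurable borel" and K: "compact K" "\<And>x. x \<notin> K \<Longrightarrow> u x = 0"
    and B: "\<And>x. norm (u x) \<le> B"
  shows "integrable lborel u"
proof (rule Bochner_Integration.integrable_bound)
  have [measurable]: "K \<in> sets borel" using K(1) by (simp add: borel_compact)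
  show "integrable lborel (\<lambda>x. indicator K x * B)"
    using emeasure_compact_finite[OF K(1)] by simp
  show "AE x in lborel. norm (u x) \<le> norm (indicator K x * B)"
    using B K(2) order_trans[OF B abs_ge_self] by (intro always_eventually allI) (auto simp: indicator_def)
qed measurable

lemma test_fun_measurable:
  fixes u :: "'a::euclidean_space \<Rightarrow> 'b::{banach, second_countable_topology}"
  shows "test_fun u \<Longrightarrow> u \<in> borel_measurable borel"
  by (intro borel_measurable_continuous_onI test_fun_continuous)

lemma test_fun_integrable:
  fixes u :: "'a::euclidean_space \<Rightarrow> 'b::{banach, second_countable_topology}"
  assumes "test_fun u"
  shows "integrable lborel u"
  using integrable_bounded_compact_support[OF test_fun_measurable[OF assms]] test_fun_bounded[OF assms] assms
  unfolding test_fun_def by blast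

lemma frechet_derivative_zero_off_support:
  assumes "closed K" "\<And>x. x \<notin> K \<Longrightarrow> u x = 0" "x \<notin> K"
  shows "frechet_derivative u (at x) e = 0"
proof -
  have "frechet_derivative u (at x) = frechet_derivative (\<lambda>x. 0) (at x)"
    by (rule frechet_derivative_cong_open[of "- K"]) (use assms in auto)
  then show ?thesis by simp
qed

lemma test_fun_frechet:
  assumes "test_fun u"
  shows "test_fun (\<lambda>x. frechet_derivative u (at x) e)"
proof -
  obtain K where K: "compact K" "\<And>x. x \<notin> K \<Longrightarrow> u x = 0" and s: "smooth_on UNIV u"
    using assms unfolding test_fun_def by blast
  show ?thesis
    unfolding test_fun_def
    by (intro conjI exI[of _ K] allI impI smooth_on_frechet_derivative[OF s] K(1)
        frechet_derivative_zero_off_support[OF compact_imp_closed[OF K(1)] K(2)])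
qed

text \<open>The dimension enters by expanding the increment in \<open>Basis\<close>; the mean value
  inequality on the convex set does the rest.\<close>

lemma lipschitz_of_directional:
  fixes f :: "'a::euclidean_space \<Rightarrow> 'b::real_normed_vector"
  assumes "convex S" and D: "\<And>x. x \<in> S \<Longrightarrow> (f has_derivative D x) (at x within S)"
    and B: "\<And>x b. x \<in> S \<Longrightarrow> b \<in> Basis \<Longrightarrow> norm (D x b) \<le> B"
    and "x \<in> S" "y \<in> S"
  shows "norm (f x - f y) \<le> B * DIM('a) * norm (x - y)"
proof (rule differentiable_bound[OF assms(1) D])
  fix x assume x: "x \<in> S"
  show "onorm (D x) \<le> B * DIM('a)"
  proof (rule onorm_le)
    fix h :: 'a
    have lin: "linear (D x)" using D[OF x] has_derivative_linear by blast
    have "D x h = D x (\<Sum>b\<in>Basis. (h \<bullet> b) *\<^sub>R b)" by (simp add: euclidean_representation)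
    also have "\<dots> = (\<Sum>b\<in>Basis. (h \<bullet> b) *\<^sub>R D x b)"
      by (simp add: linear_sum[OF lin] linear_scale[OF lin])
    also have "norm \<dots> \<le> (\<Sum>b\<in>(Basis::'a set). norm h * B)"
      by (rule sum_norm_le) (auto intro!: mult_mono Basis_le_norm B[OF x])
    finally show "norm (D x h) \<le> B * DIM('a) * norm h" by (simp add: mult_ac)
  qed
qed (use assms in auto)

text \<open>Difference quotients have integral zero by translation invariance. They converge to the
  derivative, and the Lipschitz constant \<open>L\<close> on a common compact support dominates
  them.\<close>

lemma integral_directional_derivative_zero:
  fixes u :: "'a::euclidean_space \<Rightarrow> complex"
  assumes u: "test_fun u"
  shows "(LINT x|lborel. frechet_derivative u (at x) e) = 0"
proof -
  obtain K where K: "compact K" "\<And>x. x \<notin> K \<Longrightarrow> u x = 0" and s: "smooth_on UNIV u"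
    using u unfolding test_fun_def by blast
  note [measurable] = test_fun_measurable[OF u]
  have D: "(u has_derivative frechet_derivative u (at x)) (at x)" for x
    using smooth_on_has_derivative[OF s] by simp
  have "\<exists>B. \<forall>b. b \<in> Basis \<longrightarrow> (\<forall>x. norm (frechet_derivative u (at x) b) \<le> B b)"
    using test_fun_bounded[OF test_fun_frechet[OF u]] by (intro choice) blast
  then obtain B where B: "\<And>b x. b \<in> Basis \<Longrightarrow> norm (frechet_derivative u (at x) b) \<le> B b" by blast
  define L where "L = (\<Sum>b\<in>Basis. \<bar>B b\<bar>) * DIM('a)"
  have lip: "norm (u x - u y) \<le> L * norm (x - y)" for x y
    unfolding L_def
  proof (rule lipschitz_of_directional[of UNIV u "\<lambda>x. frechet_derivative u (at x)"])
    fix x b :: 'a assume "b \<in> Basis"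
    then show "norm (frechet_derivative u (at x) b) \<le> (\<Sum>b\<in>Basis. \<bar>B b\<bar>)"
      using B[of b x] member_le_sum[of b Basis "\<lambda>b. \<bar>B b\<bar>"] by fastforce
  qed (use D in auto)
  let ?f = "\<lambda>n x. real (Suc n) *\<^sub>R (u (x + (1 / real (Suc n)) *\<^sub>R e) - u x)"
  \<comment> \<open>The steps \<open>1 / real (Suc n)\<close> are at most 1, so every shifted copy
    of the support lies in \<open>K\<close> enlarged by \<open>norm e\<close>.\<close>
  let ?K = "{x + y |x y. x \<in> K \<and> y \<in> cball 0 (norm e)}"
  have cK: "compact ?K" by (rule compact_sums[OF K(1) compact_cball])
  have kB[measurable]: "?K \<in> sets borel" using cK by (rule borel_compact)
  have zero: "?f n x = 0" if "x \<notin> ?K" for n x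
  proof -
    have "x \<notin> K" using that by (force intro: exI[of _ x] exI[of _ 0])
    moreover have "x + (1 / real (Suc n)) *\<^sub>R e \<notin> K"
    proof
      assume a: "x + (1 / real (Suc n)) *\<^sub>R e \<in> K"
      have "norm (- ((1 / real (Suc n)) *\<^sub>R e)) \<le> norm e"
        by (simp add: divide_le_eq mult_left_le_one_le) (simp add: field_simps)
      then have "x \<in> ?K" using a
        by (intro CollectI exI[of _ "x + (1 / real (Suc n)) *\<^sub>R e"] exI[of _ "- ((1 / real (Suc n)) *\<^sub>R e)"]) auto
      with that show False by blast
    qed
    ultimately show ?thesis using K(2) by simp
  qed
  have bound: "norm (?f n x) \<le> L * norm e" for n x
  proof -
    have "norm (u (x + (1 / real (Suc n)) *\<^sub>R e) - u x) \<le> L * (norm e / real (Suc n))"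
      using lip[of "x + (1 / real (Suc n)) *\<^sub>R e" x] by simp
    then have "real (Suc n) * norm (u (x + (1 / real (Suc n)) *\<^sub>R e) - u x) \<le> real (Suc n) * (L * (norm e / real (Suc n)))"
      by (intro mult_left_mono) auto
    then show ?thesis by simp
  qed
  have "(\<lambda>n. LINT x|lborel. ?f n x) \<longlonglongrightarrow> (LINT x|lborel. frechet_derivative u (at x) e)"
  proof (rule integral_dominated_convergence)
    show "integrable lborel (\<lambda>x. indicator ?K x * (L * norm e))"
      by (intro integrable_mult_left integrable_real_indicator)
         (simp only: sets_lborel kB, rule emeasure_compact_finite[OF cK])
    show "AE x in lborel. norm (?f n x) \<le> indicator ?K x * (L * norm e)" for n
    proof (intro always_eventually allI)
      fix x show "norm (?f n x) \<le> indicator ?K x * (L * norm e)"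
        using bound[of n x] zero[of x n] by (cases "x \<in> ?K") (auto simp: indicator_def)
    qed
    show "AE x in lborel. (\<lambda>n. ?f n x) \<longlonglongrightarrow> frechet_derivative u (at x) e"
    proof (intro always_eventually allI)
      fix x
      have "((\<lambda>t. u (x + t *\<^sub>R e)) has_derivative (\<lambda>t. frechet_derivative u (at x) (t *\<^sub>R e))) (at 0)"
        by (rule has_derivative_compose[of "\<lambda>t. x + t *\<^sub>R e" "\<lambda>t. t *\<^sub>R e" 0 UNIV u, simplified])
           (use D[of x] in \<open>auto intro!: derivative_eq_intros\<close>)
      then have "((\<lambda>t. norm ((u (x + t *\<^sub>R e) - u x) - t *\<^sub>R frechet_derivative u (at x) e) / norm t) \<longlongrightarrow> 0) (at 0)"
        unfolding has_derivative_iff_norm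
        using linear_scale[OF has_derivative_linear[OF D[of x]]] by simp
      then have "((\<lambda>t. norm ((u (x + t *\<^sub>R e) - u x) /\<^sub>R t - frechet_derivative u (at x) e)) \<longlongrightarrow> 0) (at 0)"
      proof (rule Lim_transform_eventually)
        show "\<forall>\<^sub>F t in at 0. norm ((u (x + t *\<^sub>R e) - u x) - t *\<^sub>R frechet_derivative u (at x) e) / norm t =
            norm ((u (x + t *\<^sub>R e) - u x) /\<^sub>R t - frechet_derivative u (at x) e)"
          unfolding eventually_at_filter
        proof (intro always_eventually allI impI)
          fix t :: real assume t: "t \<noteq> 0"
          then have "(u (x + t *\<^sub>R e) - u x) /\<^sub>R t - frechet_derivative u (at x) e =
              ((u (x + t *\<^sub>R e) - u x) - t *\<^sub>R frechet_derivative u (at x) e) /\<^sub>R t"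
            by (simp add: scaleR_diff_right)
          then show "norm ((u (x + t *\<^sub>R e) - u x) - t *\<^sub>R frechet_derivative u (at x) e) / norm t =
            norm ((u (x + t *\<^sub>R e) - u x) /\<^sub>R t - frechet_derivative u (at x) e)"
            by (simp add: divide_inverse mult.commute)
        qed
      qed
      then have "((\<lambda>t. (u (x + t *\<^sub>R e) - u x) /\<^sub>R t) \<longlongrightarrow> frechet_derivative u (at x) e) (at 0)"
        by (rule LIM_zero_cancel[OF tendsto_norm_zero_cancel])
      moreover have "filterlim (\<lambda>n. 1 / real (Suc n)) (at 0) sequentially"
        unfolding filterlim_at using LIMSEQ_inverse_real_of_nat by (simp add: inverse_eq_divide)
      ultimately have "(\<lambda>n. (u (x + (1 / real (Suc n)) *\<^sub>R e) - u x) /\<^sub>R (1 / real (Suc n))) \<longlonglongrightarrow> frechet_derivative u (at x) e"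
        by (rule filterlim_compose)
      then show "(\<lambda>n. ?f n x) \<longlonglongrightarrow> frechet_derivative u (at x) e" by simp
    qed
  qed (use test_fun_measurable[OF test_fun_frechet[OF u]] in measurable)
  moreover have "(LINT x|lborel. ?f n x) = 0" for n
  proof -
    have i: "integrable lborel (\<lambda>x. u (x + (1 / real (Suc n)) *\<^sub>R e))"
      using integrable_affine[OF test_fun_integrable[OF u], of 1 "(1 / real (Suc n)) *\<^sub>R e"] by (simp add: add.commute)
    have "(LINT x|lborel. u (x + (1 / real (Suc n)) *\<^sub>R e)) = (LINT x|lborel. u x)"
      using integral_affine[of 1 u "(1 / real (Suc n)) *\<^sub>R e"] by (simp add: add.commute)
    then show ?thesis using i test_fun_integrable[OF u] by simp
  qed
  ultimately have "(\<lambda>n. 0) \<longlonglongrightarrow> (LINT x|lborel. frechet_derivative u (at x) e)" by simp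
  then show ?thesis by (simp add: LIMSEQ_const_iff)
qed

lemma cis_inner_has_derivative:
  "((\<lambda>x::'a::euclidean_space. cis (\<xi> \<bullet> x)) has_derivative (\<lambda>h. (\<i> * complex_of_real (\<xi> \<bullet> h)) * cis (\<xi> \<bullet> x))) (at x)"
proof -
  have "((\<lambda>x. \<i> * complex_of_real (\<xi> \<bullet> x)) has_derivative (\<lambda>h. \<i> * complex_of_real (\<xi> \<bullet> h))) (at x)"
    by (rule has_derivative_mult_right[OF has_derivative_of_real[OF has_derivative_inner_right[OF has_derivative_ident]]])
  from diff_chain_at[OF this DERIV_exp[unfolded has_field_derivative_def]] show ?thesis
    by (simp add: cis_conv_exp o_def mult.commute)
qed

lemma smooth_on_cis_inner: "smooth_on UNIV (\<lambda>x::'a::euclidean_space. cis (\<xi> \<bullet> x))"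
proof (rule smooth_on_coinduct[where P="\<lambda>g. \<exists>c. g = (\<lambda>x::'a. c * cis (\<xi> \<bullet> x))"])
  fix g :: "'a \<Rightarrow> complex" assume "\<exists>c. g = (\<lambda>x. c * cis (\<xi> \<bullet> x))"
  then obtain c where g: "g = (\<lambda>x. c * cis (\<xi> \<bullet> x))" by blast
  let ?D = "\<lambda>x e. (c * (\<i> * complex_of_real (\<xi> \<bullet> e))) * cis (\<xi> \<bullet> x)"
  have "(g has_derivative ?D x) (at x)" for x
    unfolding g using has_derivative_mult_right[OF cis_inner_has_derivative, of c \<xi> x] by (simp add: mult.assoc)
  then show "\<exists>D. (\<forall>x\<in>UNIV. (g has_derivative D x) (at x)) \<and> (\<forall>e. \<exists>c. (\<lambda>x. D x e) = (\<lambda>x. c * cis (\<xi> \<bullet> x)))"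
    by (intro exI[of _ ?D] conjI ballI allI) auto
qed (simp, rule exI[of _ 1], simp)

lemma test_fun_mult:
  fixes u :: "'a::euclidean_space \<Rightarrow> 'b::real_normed_algebra"
  assumes "test_fun u" "smooth_on UNIV g"
  shows "test_fun (\<lambda>x. g x * u x)"
proof -
  obtain K where K: "compact K" "\<And>x. x \<notin> K \<Longrightarrow> u x = 0" and s: "smooth_on UNIV u"
    using assms unfolding test_fun_def by blast
  show ?thesis
    unfolding test_fun_def
    by (intro conjI exI[of _ K] allI impI smooth_on_mult[OF open_UNIV assms(2) s] K(1)) (simp add: K(2))
qed

text \<open>Integration by parts: the directional derivative of the product of \<open>u\<close> with
  the exponential is again the derivative of a test function, hence has integral zero.\<close>

lemma ift_derivative:
  fixes u :: "'a::euclidean_space \<Rightarrow> complex"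
  assumes u: "test_fun u"
  shows "ift (\<lambda>x. frechet_derivative u (at x) e) \<xi> = - (\<i> * complex_of_real (\<xi> \<bullet> e)) * ift u \<xi>"
proof -
  let ?u' = "\<lambda>x. frechet_derivative u (at x) e"
  have s: "smooth_on UNIV u" using u unfolding test_fun_def by blast
  have D: "((\<lambda>x. cis (\<xi> \<bullet> x) * u x) has_derivative
      (\<lambda>h. cis (\<xi> \<bullet> x) * frechet_derivative u (at x) h + (\<i> * complex_of_real (\<xi> \<bullet> h)) * cis (\<xi> \<bullet> x) * u x)) (at x)" for x
  proof -
    from has_derivative_mult[OF cis_inner_has_derivative smooth_on_has_derivative[OF s UNIV_I]] show ?thesis by simp
  qed
  have "0 = (LINT x|lborel. frechet_derivative (\<lambda>x. cis (\<xi> \<bullet> x) * u x) (at x) e)"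
    by (rule integral_directional_derivative_zero[OF test_fun_mult[OF u smooth_on_cis_inner], symmetric])
  also have "\<dots> = (LINT x|lborel. cis (\<xi> \<bullet> x) * ?u' x + (\<i> * complex_of_real (\<xi> \<bullet> e)) * (cis (\<xi> \<bullet> x) * u x))"
    unfolding frechet_derivative_at[OF D, symmetric] by (simp add: mult.assoc)
  also have "\<dots> = ift ?u' \<xi> + (\<i> * complex_of_real (\<xi> \<bullet> e)) * ift u \<xi>"
    unfolding ift_def
    using integrable_cis_mult[OF test_fun_integrable[OF u], of \<xi>]
      integrable_cis_mult[OF test_fun_integrable[OF test_fun_frechet[OF u, of e]], of \<xi>] by simp
  finally show ?thesis by (simp add: eq_neg_iff_add_eq_0)
qed

lemma ift_directional_decay:
  fixes u :: "'a::euclidean_space \<Rightarrow> complex"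
  assumes u: "test_fun u"
  shows "\<exists>C. \<forall>\<xi>. \<bar>\<xi> \<bullet> e\<bar> ^ N * norm (ift u \<xi>) \<le> C"
  using u
proof (induction N arbitrary: u)
  case 0
  then show ?case using norm_ift_le[OF test_fun_integrable] by auto
next
  case (Suc N)
  from Suc.IH[OF test_fun_frechet[OF Suc.prems, of e]] show ?case
    by (auto simp: ift_derivative[OF Suc.prems] norm_mult mult_ac)
qed

lemma rapid_ift:
  fixes u :: "'a::euclidean_space \<Rightarrow> complex"
  assumes u: "test_fun u"
  shows "rapid (ift u)"
  unfolding rapid_def
proof (intro conjI allI)
  show "ift u \<in> borel_measurable borel" by (rule borel_measurable_ift[OF test_fun_integrable[OF u]])
  fix N
  have "\<exists>C. \<forall>b. \<forall>\<xi>. \<bar>\<xi> \<bullet> b\<bar> ^ N * norm (ift u \<xi>) \<le> C b"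
    using ift_directional_decay[OF u] by (intro choice) blast
  then obtain C where C: "\<And>b \<xi>. \<bar>\<xi> \<bullet> b\<bar> ^ N * norm (ift u \<xi>) \<le> C b" by blast
  obtain C0 where C0: "\<And>\<xi>. norm (ift u \<xi>) \<le> C0" using norm_ift_le[OF test_fun_integrable[OF u]] by blast
  let ?m = "1 + real (DIM('a))"
  have "norm (ift u \<xi>) * (1 + norm \<xi>) ^ N \<le> ?m ^ N * (C0 + (\<Sum>b\<in>Basis. C b))" for \<xi>
  proof -
    \<comment> \<open>The largest coordinate, or 1, controls \<open>1 + norm \<xi>\<close> up to the
      factor \<open>?m\<close>, so decay along one coordinate direction at a time suffices.\<close>
    define t where "t = Max (insert 1 ((\<lambda>b. \<bar>\<xi> \<bullet> b\<bar>) ` Basis))"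
    have t: "t \<in> insert 1 ((\<lambda>b. \<bar>\<xi> \<bullet> b\<bar>) ` Basis)" unfolding t_def by (intro Max_in) auto
    have t1: "1 \<le> t" unfolding t_def by (rule Max_ge) auto
    have tb: "\<bar>\<xi> \<bullet> b\<bar> \<le> t" if "b \<in> Basis" for b unfolding t_def by (rule Max_ge) (use that in auto)
    have "norm \<xi> \<le> (\<Sum>b\<in>Basis. \<bar>\<xi> \<bullet> b\<bar>)" by (rule norm_le_l1)
    also have "\<dots> \<le> real DIM('a) * t" using sum_bounded_above[of Basis "\<lambda>b. \<bar>\<xi> \<bullet> b\<bar>" t] tb by simp
    finally have "1 + norm \<xi> \<le> ?m * t" using t1 by (simp add: algebra_simps)
    then have "(1 + norm \<xi>) ^ N \<le> ?m ^ N * t ^ N"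
      using power_mono[of "1 + norm \<xi>" "?m * t" N] by (simp add: power_mult_distrib)
    then have "norm (ift u \<xi>) * (1 + norm \<xi>) ^ N \<le> norm (ift u \<xi>) * (?m ^ N * t ^ N)"
      by (rule mult_left_mono) simp
    also have "\<dots> = ?m ^ N * (t ^ N * norm (ift u \<xi>))" by (simp add: mult_ac)
    also have "t ^ N * norm (ift u \<xi>) \<le> C0 + (\<Sum>b\<in>Basis. C b)"
    proof -
      have Cp: "0 \<le> C b" for b using C[where \<xi>=\<xi> and b=b] by (meson order_trans mult_nonneg_nonneg zero_le_power abs_ge_zero norm_ge_zero)
      have C0p: "0 \<le> C0" using C0[of \<xi>] norm_ge_zero[of "ift u \<xi>"] by linarith
      from t consider "t = 1" | b where "b \<in> Basis" "t = \<bar>\<xi> \<bullet> b\<bar>" by blast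
      then show ?thesis
      proof cases
        case 1 then show ?thesis using C0[of \<xi>] sum_nonneg[of Basis C] Cp by simp
      next
        case 2
        then have "C b \<le> (\<Sum>b\<in>Basis. C b)" using Cp by (intro member_le_sum) auto
        then show ?thesis using C[of \<xi> b] 2 C0p by simp
      qed
    qed
    finally show ?thesis by (simp add: mult_left_mono)
  qed
  then show "\<exists>C. \<forall>\<xi>. norm (ift u \<xi>) * (1 + norm \<xi>) ^ N \<le> C" by blast
qed

lemma rapid_reflect:
  assumes "rapid g"
  shows "rapid (\<lambda>\<xi>. g (- \<xi>))"
proof -
  have [measurable]: "g \<in> borel_measurable borel" using assms by (rule rapid_measurable)
  have "\<exists>C. \<forall>\<xi>. norm (g (- \<xi>)) * (1 + norm \<xi>) ^ N \<le> C" for N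
    using assms unfolding rapid_def by (metis norm_minus_cancel)
  then show ?thesis unfolding rapid_def by simp
qed

section \<open>Fourier multipliers\<close>

lemma fourier_eq_ift: "fourier u = (\<lambda>\<xi>. ift u (- \<xi>))"
  by (simp add: fourier_def[abs_def] ift_def inner_commute)

lemma multiplier_eq_ift:
  fixes u :: "real^'m::finite \<Rightarrow> complex"
  shows "multiplier \<sigma> u x = ift (\<lambda>\<xi>. complex_of_real (\<sigma> \<xi>) * fourier u \<xi>) x / complex_of_real ((2 * pi) ^ CARD('m))"
  by (simp add: multiplier_def ift_def mult.assoc)

lemma rapid_fourier: "test_fun u \<Longrightarrow> rapid (fourier u)"
  unfolding fourier_eq_ift by (rule rapid_reflect[OF rapid_ift])

lemma continuous_on_fourier: "integrable lborel u \<Longrightarrow> continuous_on UNIV (fourier u)"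
  unfolding fourier_eq_ift
  using continuous_on_compose2[OF continuous_on_ift, of u UNIV uminus] by (simp add: continuous_intros)

definition poly_growth :: "(real^'m::finite \<Rightarrow> real) \<Rightarrow> bool" where
  "poly_growth \<sigma> \<longleftrightarrow> \<sigma> \<in> borel_measurable borel \<and> (\<exists>B M. \<forall>\<xi>. \<bar>\<sigma> \<xi>\<bar> \<le> B * (1 + norm \<xi>) ^ M)"

lemma poly_growth_measurable: "poly_growth \<sigma> \<Longrightarrow> \<sigma> \<in> borel_measurable borel"
  by (simp add: poly_growth_def)

lemma rapid_symbol:
  assumes "poly_growth \<sigma>" "test_fun u"
  shows "rapid (\<lambda>\<xi>. complex_of_real (\<sigma> \<xi>) * fourier u \<xi>)"
proof -
  obtain B M where B: "\<And>\<xi>. \<bar>\<sigma> \<xi>\<bar> \<le> B * (1 + norm \<xi>) ^ M" using assms(1) unfolding poly_growth_def by blast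
  have [measurable]: "\<sigma> \<in> borel_measurable borel" using assms(1) by (rule poly_growth_measurable)
  show ?thesis by (rule rapid_mult[OF rapid_fourier[OF assms(2)], of _ B M]) (use B in auto)
qed

lemma multiplier_measurable:
  assumes "poly_growth \<sigma>" "test_fun u"
  shows "multiplier \<sigma> u \<in> borel_measurable borel"
proof -
  have [measurable]: "ift (\<lambda>\<xi>. complex_of_real (\<sigma> \<xi>) * fourier u \<xi>) \<in> borel_measurable borel"
    by (rule borel_measurable_ift[OF rapid_integrable[OF rapid_symbol[OF assms]]])
  show ?thesis unfolding multiplier_eq_ift[abs_def] by measurable
qed

lemma symbol_square_integrable:
  assumes "poly_growth \<sigma>" "test_fun u"
  shows "integrable lborel (\<lambda>\<xi>. (\<sigma> \<xi>)\<^sup>2 * (norm (fourier u \<xi>))\<^sup>2)"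
  using rapid_square_integrable[OF rapid_symbol[OF assms]] by (simp add: norm_mult power_mult_distrib)

text \<open>The operator carries \<open>(2 * pi) ^ CARD('m)\<close> in its denominator, hence its
  square in the energy; the Bessel inequality gives one power back.\<close>

lemma multiplier_bessel:
  fixes u :: "real^'m::finite \<Rightarrow> complex"
  assumes "poly_growth \<sigma>" "test_fun u"
  shows "integrable lborel (\<lambda>x. (norm (multiplier \<sigma> u x))\<^sup>2)"
    and "(LINT x|lborel. (norm (multiplier \<sigma> u x))\<^sup>2) \<le>
      (LINT \<xi>|lborel. (\<sigma> \<xi>)\<^sup>2 * (norm (fourier u \<xi>))\<^sup>2) / (2 * pi) ^ CARD('m)"
proof -
  let ?g = "\<lambda>\<xi>. complex_of_real (\<sigma> \<xi>) * fourier u \<xi>"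
  let ?c = "(2 * pi) ^ CARD('m)"
  note r = rapid_symbol[OF assms]
  note b = ift_bessel[OF rapid_integrable[OF r] rapid_square_integrable[OF r]]
  have eq: "(norm (multiplier \<sigma> u x))\<^sup>2 = (norm (ift ?g x))\<^sup>2 / ?c\<^sup>2" for x
    by (simp add: multiplier_eq_ift norm_divide power_divide norm_mult norm_power)
  show "integrable lborel (\<lambda>x. (norm (multiplier \<sigma> u x))\<^sup>2)"
    unfolding eq using b(1) by simp
  have c: "?c > 0" by simp
  have "(LINT x|lborel. (norm (multiplier \<sigma> u x))\<^sup>2) = (LINT x|lborel. (norm (ift ?g x))\<^sup>2) / ?c\<^sup>2"
    unfolding eq by (rule integral_divide_zero)
  also have "\<dots> \<le> (?c * (LINT \<xi>|lborel. (norm (?g \<xi>))\<^sup>2)) / ?c\<^sup>2"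
    using b(2) by (intro divide_right_mono) auto
  also have "\<dots> = (LINT \<xi>|lborel. (norm (?g \<xi>))\<^sup>2) / ?c"
    using c by (simp add: power2_eq_square)
  finally show "(LINT x|lborel. (norm (multiplier \<sigma> u x))\<^sup>2) \<le>
      (LINT \<xi>|lborel. (\<sigma> \<xi>)\<^sup>2 * (norm (fourier u \<xi>))\<^sup>2) / (2 * pi) ^ CARD('m)"
    by (simp add: norm_mult power_mult_distrib)
qed

lemma multiplier_plancherel:
  fixes u :: "real^'m::finite \<Rightarrow> complex"
  assumes "poly_growth \<sigma>" "test_fun u" and c: "continuous_on UNIV \<sigma>"
  shows "(LINT x|lborel. (norm (multiplier \<sigma> u x))\<^sup>2) =
      (LINT \<xi>|lborel. (\<sigma> \<xi>)\<^sup>2 * (norm (fourier u \<xi>))\<^sup>2) / (2 * pi) ^ CARD('m)"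
proof -
  let ?g = "\<lambda>\<xi>. complex_of_real (\<sigma> \<xi>) * fourier u \<xi>"
  let ?c = "(2 * pi) ^ CARD('m)"
  note r = rapid_symbol[OF assms(1,2)]
  have eq: "(norm (multiplier \<sigma> u x))\<^sup>2 = (norm (ift ?g x))\<^sup>2 / ?c\<^sup>2" for x
    by (simp add: multiplier_eq_ift norm_divide power_divide norm_mult norm_power)
  obtain B where B: "\<And>\<xi>. norm (?g \<xi>) \<le> B" using rapid_bounded[OF r] by blast
  have cg: "continuous_on UNIV ?g"
    by (intro continuous_intros c continuous_on_fourier test_fun_integrable assms)
  have "(LINT x|lborel. (norm (multiplier \<sigma> u x))\<^sup>2) = (LINT x|lborel. (norm (ift ?g x))\<^sup>2) / ?c\<^sup>2"
    unfolding eq by (rule integral_divide_zero)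
  also have "\<dots> = (?c * (LINT \<xi>|lborel. (norm (?g \<xi>))\<^sup>2)) / ?c\<^sup>2"
    using plancherel[OF rapid_integrable[OF r] cg B] by simp
  also have "\<dots> = (LINT \<xi>|lborel. (norm (?g \<xi>))\<^sup>2) / ?c"
    by (simp add: power2_eq_square)
  finally show ?thesis
    by (simp add: norm_mult power_mult_distrib)
qed

lemma test_fun_square_integrable:
  fixes u :: "'a::euclidean_space \<Rightarrow> complex"
  assumes "test_fun u"
  shows "integrable lborel (\<lambda>x. (norm (u x))\<^sup>2)"
proof -
  obtain K where K: "compact K" "\<And>x. x \<notin> K \<Longrightarrow> u x = 0" using assms unfolding test_fun_def by blast
  obtain B where B: "\<And>x. norm (u x) \<le> B" using test_fun_bounded[OF assms] by blast
  have [measurable]: "u \<in> borel_measurable borel" by (rule test_fun_measurable[OF assms])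
  show ?thesis
    by (rule integrable_bounded_compact_support[OF _ K(1), of _ "B\<^sup>2"]) (use K(2) B in \<open>auto intro: power_mono\<close>)
qed

lemma fourier_bessel:
  fixes u :: "real^'m::finite \<Rightarrow> complex"
  assumes "test_fun u"
  shows "(LINT \<xi>|lborel. (norm (fourier u \<xi>))\<^sup>2) \<le> (2 * pi) ^ CARD('m) * (LINT x|lborel. (norm (u x))\<^sup>2)"
proof -
  have "(LINT \<xi>|lborel. (norm (fourier u \<xi>))\<^sup>2) = (LINT \<xi>|lborel. (norm (ift u \<xi>))\<^sup>2)"
    unfolding fourier_eq_ift
    using integral_affine[of "-1" "\<lambda>\<xi>. (norm (ift u \<xi>))\<^sup>2" 0] borel_measurable_ift[OF test_fun_integrable[OF assms]] by simp
  then show ?thesis using ift_bessel(2)[OF test_fun_integrable test_fun_square_integrable, OF assms assms] by simp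
qed

lemma multiplier_one:
  fixes u :: "real^'m::finite \<Rightarrow> complex"
  assumes "test_fun u"
  shows "multiplier (\<lambda>_. 1) u = u"
proof
  fix x
  obtain B where B: "\<And>x. norm (u x) \<le> B" using test_fun_bounded[OF assms] by blast
  have "ift (\<lambda>\<xi>. ift u (- \<xi>)) x = complex_of_real ((2 * pi) ^ DIM(real^'m)) * u x"
    by (rule fourier_inversion[OF test_fun_integrable[OF assms] test_fun_continuous[OF assms] B])
       (use rapid_integrable[OF rapid_fourier[OF assms]] in \<open>simp add: fourier_eq_ift\<close>)
  then show "multiplier (\<lambda>_. 1) u x = u x"
    by (simp add: multiplier_eq_ift fourier_eq_ift)
qed

section \<open>Weighted pairings of multipliers in frequency space\<close>

lemma multiplier_weighted:
  fixes u v :: "real^'m::finite \<Rightarrow> complex"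
  assumes w: "integrable lborel w" and \<sigma>: "poly_growth \<sigma>" "poly_growth \<tau>" and uv: "test_fun u" "test_fun v"
  shows "(LINT x|lborel. w x * multiplier \<sigma> u x * cnj (multiplier \<tau> v x)) =
    (LINT p|(lborel \<Otimes>\<^sub>M lborel). complex_of_real (\<sigma> (fst p) * \<tau> (snd p)) *
       (fourier u (fst p) * cnj (fourier v (snd p)) * ift w (fst p - snd p))) / (complex_of_real ((2 * pi) ^ CARD('m)))\<^sup>2"
proof -
  let ?g = "\<lambda>\<xi>. complex_of_real (\<sigma> \<xi>) * fourier u \<xi>" and ?h = "\<lambda>\<xi>. complex_of_real (\<tau> \<xi>) * fourier v \<xi>"
  let ?c = "complex_of_real ((2 * pi) ^ CARD('m))"
  have "(LINT x|lborel. w x * multiplier \<sigma> u x * cnj (multiplier \<tau> v x)) =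
      (LINT x|lborel. w x * (ift ?g x * cnj (ift ?h x)) / ?c\<^sup>2)"
    by (intro Bochner_Integration.integral_cong) (auto simp: multiplier_eq_ift power2_eq_square)
  also have "\<dots> = (LINT x|lborel. w x * (ift ?g x * cnj (ift ?h x))) / ?c\<^sup>2"
    by (rule integral_divide_zero)
  also have "(LINT x|lborel. w x * (ift ?g x * cnj (ift ?h x))) =
     (LINT p|(lborel \<Otimes>\<^sub>M lborel). ?g (fst p) * cnj (?h (snd p)) * ift w (fst p - snd p))"
    by (rule ift_weighted[OF w rapid_integrable[OF rapid_symbol[OF \<sigma>(1) uv(1)]] rapid_integrable[OF rapid_symbol[OF \<sigma>(2) uv(2)]]])
  also have "\<dots> = (LINT p|(lborel \<Otimes>\<^sub>M lborel). complex_of_real (\<sigma> (fst p) * \<tau> (snd p)) *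
       (fourier u (fst p) * cnj (fourier v (snd p)) * ift w (fst p - snd p)))"
    by (intro Bochner_Integration.integral_cong) (auto simp: mult_ac)
  finally show ?thesis .
qed

text \<open>For a product symbol \<open>\<sigma> (fst p) * \<tau> (snd p)\<close> this is, up to a
  power of \<open>2 * pi\<close>, the integral of \<open>w\<close> against the two multipliers. It
  is linear in \<open>s\<close> whenever the integrals exist, so an algebraic identity between
  two-variable symbols becomes one between integrals; general \<open>s\<close> corresponds to no
  product of operators.\<close>

definition symbol_pairing ::
  "(real^'m::finite \<Rightarrow> complex) \<Rightarrow> (real^'m \<Rightarrow> complex) \<Rightarrow> (real^'m \<Rightarrow> complex) \<Rightarrow> ((real^'m) \<times> (real^'m) \<Rightarrow> real) \<Rightarrow> complex" where
  "symbol_pairing w u v s = (LINT p|(lborel \<Otimes>\<^sub>M lborel). complex_of_real (s p) *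
       (fourier u (fst p) * cnj (fourier v (snd p)) * ift w (fst p - snd p)))"

lemma symbol_pairing_integrable:
  fixes u v w :: "real^'m::finite \<Rightarrow> complex"
  assumes w: "test_fun w" and s: "poly_growth \<sigma>" "poly_growth \<tau>" and uv: "test_fun u" "test_fun v"
  shows "integrable (lborel \<Otimes>\<^sub>M lborel) (\<lambda>p. complex_of_real (\<sigma> (fst p) * \<tau> (snd p)) *
       (fourier u (fst p) * cnj (fourier v (snd p)) * ift w (fst p - snd p)))"
proof -
  note [measurable] = borel_measurable_ift[OF test_fun_integrable[OF w]]
    rapid_measurable[OF rapid_fourier[OF uv(1)]] rapid_measurable[OF rapid_fourier[OF uv(2)]]
    poly_growth_measurable[OF s(1)] poly_growth_measurable[OF s(2)]
  obtain B where B: "\<And>\<xi>. norm (ift w \<xi>) \<le> B" using rapid_bounded[OF rapid_ift[OF w]] by blast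
  have t: "integrable lborel (\<lambda>x. cnj (complex_of_real (\<tau> x) * fourier v x))"
    using rapid_integrable[OF rapid_symbol[OF s(2) uv(2)]] by (intro integrable_cnj)
  have "integrable (lborel \<Otimes>\<^sub>M lborel) (\<lambda>p. (complex_of_real (\<sigma> (fst p)) * fourier u (fst p)) *
       cnj (complex_of_real (\<tau> (snd p)) * fourier v (snd p)) * complex_of_real B)"
    by (intro integrable_mult_left integrable_tensor[OF sigma_finite_lborel sigma_finite_lborel
          rapid_integrable[OF rapid_symbol[OF s(1) uv(1)]] t])
  then show ?thesis
  proof (rule Bochner_Integration.integrable_bound)
    show "AE p in lborel \<Otimes>\<^sub>M lborel. norm (complex_of_real (\<sigma> (fst p) * \<tau> (snd p)) *
       (fourier u (fst p) * cnj (fourier v (snd p)) * ift w (fst p - snd p)))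
       \<le> norm ((complex_of_real (\<sigma> (fst p)) * fourier u (fst p)) *
       cnj (complex_of_real (\<tau> (snd p)) * fourier v (snd p)) * complex_of_real B)"
    proof (intro always_eventually allI)
      fix p
      have "norm (ift w (fst p - snd p)) \<le> \<bar>B\<bar>" by (rule order_trans[OF B abs_ge_self])
      then have "(\<bar>\<sigma> (fst p)\<bar> * norm (fourier u (fst p)) * (\<bar>\<tau> (snd p)\<bar> * norm (fourier v (snd p)))) * norm (ift w (fst p - snd p))
          \<le> (\<bar>\<sigma> (fst p)\<bar> * norm (fourier u (fst p)) * (\<bar>\<tau> (snd p)\<bar> * norm (fourier v (snd p)))) * \<bar>B\<bar>"
        by (intro mult_left_mono) auto
      then show "norm (complex_of_real (\<sigma> (fst p) * \<tau> (snd p)) *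
       (fourier u (fst p) * cnj (fourier v (snd p)) * ift w (fst p - snd p)))
       \<le> norm ((complex_of_real (\<sigma> (fst p)) * fourier u (fst p)) *
       cnj (complex_of_real (\<tau> (snd p)) * fourier v (snd p)) * complex_of_real B)"
        by (simp add: norm_mult abs_mult mult_ac)
    qed
  qed measurable
qed

text \<open>A symbol vanishing to second order on the diagonal multiplies the transform of
  \<open>w\<close> by \<open>(norm \<zeta>)\<^sup>2\<close>, which keeps it integrable because
  \<open>w\<close> is a test function. Schur's test then gives a bound by \<open>L\<^sup>2\<close>
  norms alone, with \<open>D\<close> depending only on \<open>w\<close>.\<close>

lemma symbol_pairing_bound:
  fixes w :: "real^'m::finite \<Rightarrow> complex"
  assumes w: "test_fun w"
  shows "\<exists>D\<ge>0. \<forall>u v s E0. test_fun u \<longrightarrow> test_fun v \<longrightarrow> s \<in> borel_measurable (lborel \<Otimes>\<^sub>M lborel) \<longrightarrow>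
     0 \<le> E0 \<longrightarrow> (\<forall>p. \<bar>s p\<bar> \<le> E0 * (norm (fst p - snd p))\<^sup>2) \<longrightarrow>
     norm (symbol_pairing w u v s) \<le> D * E0 * ((LINT x|lborel. (norm (u x))\<^sup>2) + (LINT x|lborel. (norm (v x))\<^sup>2))"
proof -
  let ?K = "\<lambda>\<zeta>. norm (complex_of_real ((norm \<zeta>)\<^sup>2) * ift w \<zeta>)"
  let ?c = "(2 * pi) ^ CARD('m)"
  have pg: "norm (complex_of_real ((norm \<zeta>)\<^sup>2)) \<le> 1 * (1 + norm \<zeta>)\<^sup>2" for \<zeta> :: "real^'m"
    by (simp add: norm_power power2_sum)
  have K: "integrable lborel ?K"
    by (intro integrable_norm rapid_integrable rapid_mult[OF rapid_ift[OF w] _ pg]) measurable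
  have K0: "0 \<le> (LINT \<zeta>|lborel. ?K \<zeta>)" by (intro integral_nonneg_AE) auto
  show ?thesis
  proof (intro exI[of _ "?c * (LINT \<zeta>|lborel. ?K \<zeta>) / 2"] conjI allI impI)
    show "0 \<le> ?c * (LINT \<zeta>|lborel. ?K \<zeta>) / 2" using K0 by simp
  next
    fix u v :: "real^'m \<Rightarrow> complex" and s :: "(real^'m) \<times> (real^'m) \<Rightarrow> real" and E0 :: real
    assume uv: "test_fun u" "test_fun v" and sm[measurable]: "s \<in> borel_measurable (lborel \<Otimes>\<^sub>M lborel)"
      and E0: "0 \<le> E0" and s: "\<forall>p. \<bar>s p\<bar> \<le> E0 * (norm (fst p - snd p))\<^sup>2"
    note [measurable] = borel_measurable_ift[OF test_fun_integrable[OF w]]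
      rapid_measurable[OF rapid_fourier[OF uv(1)]] rapid_measurable[OF rapid_fourier[OF uv(2)]]
    have "norm (symbol_pairing w u v s) \<le>
       ((LINT x|lborel. (norm (fourier u x))\<^sup>2) + (LINT x|lborel. (norm (fourier v x))\<^sup>2)) / 2 * (LINT x|lborel. E0 * ?K x)"
      unfolding symbol_pairing_def
    proof (rule schur_test(2))
      show "integrable lborel (\<lambda>x. E0 * ?K x)" using K by (rule integrable_mult_right)
      fix p :: "(real^'m) \<times> (real^'m)"
      have "norm (complex_of_real (s p) * (fourier u (fst p) * cnj (fourier v (snd p)) * ift w (fst p - snd p))) =
          \<bar>s p\<bar> * (norm (fourier u (fst p)) * norm (fourier v (snd p)) * norm (ift w (fst p - snd p)))"
        by (simp add: norm_mult)
      also have "\<dots> \<le> (E0 * (norm (fst p - snd p))\<^sup>2) * (norm (fourier u (fst p)) * norm (fourier v (snd p)) * norm (ift w (fst p - snd p)))"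
        by (intro mult_right_mono s[rule_format]) simp
      also have "\<dots> = norm (fourier u (fst p)) * norm (fourier v (snd p)) * (E0 * ?K (fst p - snd p))"
        by (simp add: norm_mult norm_power mult_ac)
      finally show "norm (complex_of_real (s p) * (fourier u (fst p) * cnj (fourier v (snd p)) * ift w (fst p - snd p))) \<le>
          norm (fourier u (fst p)) * norm (fourier v (snd p)) * (E0 * ?K (fst p - snd p))" .
    qed (use E0 rapid_square_integrable[OF rapid_fourier[OF uv(1)]] rapid_square_integrable[OF rapid_fourier[OF uv(2)]] in \<open>auto\<close>)
    also have "\<dots> \<le> (?c * (LINT x|lborel. (norm (u x))\<^sup>2) + ?c * (LINT x|lborel. (norm (v x))\<^sup>2)) / 2 * (LINT x|lborel. E0 * ?K x)"
      using E0 K0 by (intro mult_right_mono divide_right_mono add_mono fourier_bessel uv) auto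
    also have "\<dots> = ?c * (LINT \<zeta>|lborel. ?K \<zeta>) / 2 * E0 * ((LINT x|lborel. (norm (u x))\<^sup>2) + (LINT x|lborel. (norm (v x))\<^sup>2))"
      by (simp add: algebra_simps)
    finally show "norm (symbol_pairing w u v s) \<le> ?c * (LINT \<zeta>|lborel. ?K \<zeta>) / 2 * E0 * ((LINT x|lborel. (norm (u x))\<^sup>2) + (LINT x|lborel. (norm (v x))\<^sup>2))" .
  qed
qed

section \<open>Dyadic symbols and quadratic forms\<close>

text \<open>Seen as a norm, the symbol is Lipschitz with constant 1 by the triangle
  inequality.\<close>

lemma Lambda_eq_norm: "Lambda_symbol \<xi> = norm (1::real, \<xi>)"
  by (simp add: Lambda_symbol_def norm_Pair)

lemma Lambda_ge_1: "1 \<le> Lambda_symbol \<xi>"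
  by (simp add: Lambda_symbol_def)

lemma Lambda_le: "Lambda_symbol \<xi> \<le> 1 + norm \<xi>"
  unfolding Lambda_eq_norm using norm_Pair_le[of "1::real" \<xi>] by simp

lemma Lambda_lipschitz: "\<bar>Lambda_symbol \<xi> - Lambda_symbol \<eta>\<bar> \<le> norm (\<xi> - \<eta>)"
  unfolding Lambda_eq_norm using norm_triangle_ineq3[of "(1::real, \<xi>)" "(1, \<eta>)"] by (simp add: norm_Pair)

lemma Lambda_continuous: "continuous_on UNIV Lambda_symbol"
  unfolding Lambda_symbol_def[abs_def] by (intro continuous_intros)

lemma Lambda_measurable [measurable]: "Lambda_symbol \<in> borel_measurable borel"
  by (rule borel_measurable_continuous_onI[OF Lambda_continuous])

lemma poly_growthI:
  assumes "\<sigma> \<in> borel_measurable borel" "\<And>\<xi>. \<bar>\<sigma> \<xi>\<bar> \<le> B * Lambda_symbol \<xi>"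
  shows "poly_growth \<sigma>"
proof -
  have B: "0 \<le> B" using order_trans[OF abs_ge_zero assms(2)[of 0]] Lambda_ge_1[of "0::real^'a"]
    by (simp add: zero_le_mult_iff)
  have "\<bar>\<sigma> \<xi>\<bar> \<le> B * (1 + norm \<xi>) ^ 1" for \<xi>
    using assms(2)[of \<xi>] mult_left_mono[OF Lambda_le[of \<xi>] B] by simp
  then show ?thesis unfolding poly_growth_def using assms(1) by blast
qed

text \<open>The symbol estimates enter through a Lipschitz constant \<open>L / 2 ^ k\<close>, and
  the localization through a single constant \<open>A\<close> bounding the ratio of
  \<open>2 ^ k\<close> to \<open>\<Lambda>\<close> from both sides.\<close>

locale dyadic_symbols =
  fixes \<Gamma> :: "nat \<Rightarrow> real^'m::finite \<Rightarrow> real" and A L :: real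
  assumes nonneg: "1 \<le> k \<Longrightarrow> 0 \<le> \<Gamma> k \<xi>"
    and sums_1: "(\<lambda>k. \<Gamma> (Suc k) \<xi>) sums 1"
    and cont: "1 \<le> k \<Longrightarrow> continuous_on UNIV (\<Gamma> k)"
    and supp: "1 \<le> k \<Longrightarrow> \<Gamma> k \<xi> \<noteq> 0 \<Longrightarrow> 2 ^ k \<le> A * Lambda_symbol \<xi>"
      "1 \<le> k \<Longrightarrow> \<Gamma> k \<xi> \<noteq> 0 \<Longrightarrow> Lambda_symbol \<xi> \<le> A * 2 ^ k"
    and lip: "1 \<le> k \<Longrightarrow> \<bar>\<Gamma> k \<xi> - \<Gamma> k \<eta>\<bar> \<le> L / 2 ^ k * norm (\<xi> - \<eta>)"
    and A: "1 \<le> A" and L: "0 \<le> L"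

lemma dyadic_partition_symbols:
  fixes \<Gamma> :: "nat \<Rightarrow> real^'m::finite \<Rightarrow> real"
  assumes "dyadic_partition \<Gamma>"
  shows "\<exists>A L. dyadic_symbols \<Gamma> A L"
proof -
  have sm: "\<And>k. 1 \<le> k \<Longrightarrow> smooth_on UNIV (\<Gamma> k)" and nn: "\<And>k \<xi>. 1 \<le> k \<Longrightarrow> 0 \<le> \<Gamma> k \<xi>"
    and su: "\<And>\<xi>. (\<lambda>k. \<Gamma> (Suc k) \<xi>) sums 1"
    using assms unfolding dyadic_partition_def by auto
  obtain A0 where A0: "A0 > 0" "\<And>k \<xi>. 1 \<le> k \<Longrightarrow> \<Gamma> k \<xi> \<noteq> 0 \<Longrightarrow> 2 ^ k / A0 \<le> Lambda_symbol \<xi> \<and> Lambda_symbol \<xi> \<le> A0 * 2 ^ k"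
    using assms unfolding dyadic_partition_def by blast
  have "\<forall>b\<in>Basis. \<exists>C. \<forall>k\<ge>1. \<forall>\<xi>. \<bar>iter_deriv [b] (\<Gamma> k) \<xi>\<bar> \<le> C / 2 ^ (k * length [b])"
    using assms unfolding dyadic_partition_def by (metis empty_subsetI insert_subset list.set(1) list.set(2))
  then obtain C where C: "\<And>b k \<xi>. b \<in> Basis \<Longrightarrow> 1 \<le> k \<Longrightarrow> \<bar>frechet_derivative (\<Gamma> k) (at \<xi>) b\<bar> \<le> C b / 2 ^ k"
    by (simp add: bchoice_iff) blast
  \<comment> \<open>\<open>L0\<close> bounds all coordinate derivatives at once; the extra factor
    \<open>CARD('m)\<close> below comes from passing from coordinate directions to arbitrary
    increments.\<close>
  define L0 where "L0 = (\<Sum>b\<in>Basis. \<bar>C b\<bar>)"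
  have L0: "0 \<le> L0" unfolding L0_def by (intro sum_nonneg) auto
  have C0: "\<bar>frechet_derivative (\<Gamma> k) (at \<xi>) b\<bar> \<le> L0 / 2 ^ k" if "b \<in> Basis" "1 \<le> k" for b k \<xi>
  proof -
    have "C b \<le> L0" unfolding L0_def
      using member_le_sum[of b Basis "\<lambda>b. \<bar>C b\<bar>"] that(1) by fastforce
    then have "C b / 2 ^ k \<le> L0 / 2 ^ k" by (simp add: divide_right_mono)
    then show ?thesis using C[OF that, of \<xi>] by linarith
  qed
  have "dyadic_symbols \<Gamma> (max A0 1) (L0 * CARD('m))"
  proof
    fix k :: nat and \<xi> \<eta> :: "real^'m" assume k: "1 \<le> k"
    show "0 \<le> \<Gamma> k \<xi>" by (rule nn[OF k])
    show "continuous_on UNIV (\<Gamma> k)" by (rule smooth_on_continuous_on[OF sm[OF k]])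
    have "norm (\<Gamma> k \<xi> - \<Gamma> k \<eta>) \<le> (L0 / 2 ^ k) * DIM(real^'m) * norm (\<xi> - \<eta>)"
      by (rule lipschitz_of_directional[of UNIV "\<Gamma> k" "\<lambda>\<xi>. frechet_derivative (\<Gamma> k) (at \<xi>)"])
         (use C0[OF _ k] smooth_on_has_derivative[OF sm[OF k]] in auto)
    then show "\<bar>\<Gamma> k \<xi> - \<Gamma> k \<eta>\<bar> \<le> L0 * CARD('m) / 2 ^ k * norm (\<xi> - \<eta>)" by simp
    assume nz: "\<Gamma> k \<xi> \<noteq> 0"
    have l0: "0 \<le> Lambda_symbol \<xi>" using Lambda_ge_1[of \<xi>] by linarith
    have "2 ^ k \<le> A0 * Lambda_symbol \<xi>" using A0(1) A0(2)[OF k nz] by (simp add: field_simps)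
    also have "\<dots> \<le> max A0 1 * Lambda_symbol \<xi>" using l0 by (intro mult_right_mono) auto
    finally show "2 ^ k \<le> max A0 1 * Lambda_symbol \<xi>" .
    have "Lambda_symbol \<xi> \<le> A0 * 2 ^ k" using A0(2)[OF k nz] by blast
    also have "\<dots> \<le> max A0 1 * 2 ^ k" by (intro mult_right_mono) auto
    finally show "Lambda_symbol \<xi> \<le> max A0 1 * 2 ^ k" .
  next
    fix \<xi> show "(\<lambda>k. \<Gamma> (Suc k) \<xi>) sums 1" by (rule su)
  qed (use L0 in auto)
  then show ?thesis by blast
qed

context dyadic_symbols
begin

lemma sum_le_1: "(\<Sum>k\<in>{1..K}. \<Gamma> k \<xi>) \<le> 1"
proof -
  have "(\<Sum>k\<in>{1..K}. \<Gamma> k \<xi>) = (\<Sum>k<K. \<Gamma> (Suc k) \<xi>)"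
    by (simp add: sum.atLeast1_atMost_eq)
  also have "\<dots> \<le> (\<Sum>k. \<Gamma> (Suc k) \<xi>)"
    by (intro sum_le_suminf sums_summable[OF sums_1]) (auto intro: nonneg)
  also have "\<dots> = 1" using sums_1 by (rule sums_unique[symmetric])
  finally show ?thesis .
qed

lemma le_1:
  assumes "1 \<le> k"
  shows "\<Gamma> k \<xi> \<le> 1"
proof -
  have "\<Gamma> k \<xi> \<le> (\<Sum>k\<in>{1..k}. \<Gamma> k \<xi>)" using assms by (intro member_le_sum) (auto intro: nonneg)
  then show ?thesis using sum_le_1[of \<xi> k] by linarith
qed

text \<open>On the support of \<open>\<Gamma> k\<close> one has
  \<open>2 ^ k \<le> A \<Lambda>\<close>; moreover
  \<open>\<Gamma>\<^sub>k\<^sup>2 \<le> \<Gamma>\<^sub>k\<close> and the partial sums of the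
  \<open>\<Gamma>\<^sub>k\<close> are at most 1.\<close>

lemma weighted_square_sum_le: "(\<Sum>k\<in>{1..K}. 2 ^ k * (\<Gamma> k \<xi>)\<^sup>2) \<le> A * Lambda_symbol \<xi>"
proof -
  have AL: "0 \<le> A * Lambda_symbol \<xi>" using A Lambda_ge_1[of \<xi>] by simp
  have "2 ^ k * (\<Gamma> k \<xi>)\<^sup>2 \<le> A * Lambda_symbol \<xi> * \<Gamma> k \<xi>" if "k \<in> {1..K}" for k
  proof (cases "\<Gamma> k \<xi> = 0")
    case False
    have k: "1 \<le> k" using that by simp
    have "2 ^ k * (\<Gamma> k \<xi>)\<^sup>2 \<le> (A * Lambda_symbol \<xi>) * (\<Gamma> k \<xi>)\<^sup>2"
      using supp(1)[OF k False] by (intro mult_right_mono) auto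
    also have "(\<Gamma> k \<xi>)\<^sup>2 \<le> \<Gamma> k \<xi>"
      using nonneg[OF k, of \<xi>] le_1[OF k, of \<xi>] by (simp add: power2_eq_square mult_left_le_one_le)
    finally show ?thesis using AL by (simp add: mult_left_mono)
  qed simp
  then have "(\<Sum>k\<in>{1..K}. 2 ^ k * (\<Gamma> k \<xi>)\<^sup>2) \<le> (\<Sum>k\<in>{1..K}. A * Lambda_symbol \<xi> * \<Gamma> k \<xi>)"
    by (rule sum_mono)
  also have "\<dots> = A * Lambda_symbol \<xi> * (\<Sum>k\<in>{1..K}. \<Gamma> k \<xi>)" by (simp add: sum_distrib_left)
  also have "\<dots> \<le> A * Lambda_symbol \<xi>" using mult_left_mono[OF sum_le_1 AL] by simp
  finally show ?thesis .
qed

lemma measurable_\<Gamma>: "1 \<le> k \<Longrightarrow> \<Gamma> k \<in> borel_measurable borel"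
  by (rule borel_measurable_continuous_onI[OF cont])

lemma poly_growth_\<Gamma>: "1 \<le> k \<Longrightarrow> poly_growth (\<Gamma> k)"
proof (rule poly_growthI[where B=1])
  fix \<xi> assume k: "1 \<le> k"
  show "\<bar>\<Gamma> k \<xi>\<bar> \<le> 1 * Lambda_symbol \<xi>"
    using nonneg[OF k, of \<xi>] le_1[OF k, of \<xi>] Lambda_ge_1[of \<xi>] by simp
qed (rule measurable_\<Gamma>)

lemma poly_growth_\<Gamma>_square: "1 \<le> k \<Longrightarrow> poly_growth (\<lambda>\<xi>. (\<Gamma> k \<xi>)\<^sup>2)"
proof (rule poly_growthI[where B=1])
  fix \<xi> assume k: "1 \<le> k"
  have "(\<Gamma> k \<xi>)\<^sup>2 \<le> 1" using nonneg[OF k, of \<xi>] le_1[OF k, of \<xi>] by (rule power_le_one)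
  then show "\<bar>(\<Gamma> k \<xi>)\<^sup>2\<bar> \<le> 1 * Lambda_symbol \<xi>" using Lambda_ge_1[of \<xi>] by simp
qed (use measurable_\<Gamma> in measurable)

lemma poly_growth_one: "poly_growth (\<lambda>_::real^'m. 1)"
  by (rule poly_growthI[where B=1]) (use Lambda_ge_1 in auto)

text \<open>The symbol that completes the sum of the \<open>2 ^ k \<Gamma>\<^sub>k\<^sup>2\<close>
  to a multiple of \<open>\<Lambda>\<close>. The constant \<open>A\<close> would make the radicand
  nonnegative; \<open>A + 1\<close> keeps it at least 1, away from the singularity of the square
  root, so that the root inherits Lipschitz bounds.\<close>

definition remainder :: "nat \<Rightarrow> real^'m \<Rightarrow> real" where
  "remainder K \<xi> = sqrt ((A + 1) * Lambda_symbol \<xi> - (\<Sum>k\<in>{1..K}. 2 ^ k * (\<Gamma> k \<xi>)\<^sup>2))"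

lemma remainder_square: "(remainder K \<xi>)\<^sup>2 = (A + 1) * Lambda_symbol \<xi> - (\<Sum>k\<in>{1..K}. 2 ^ k * (\<Gamma> k \<xi>)\<^sup>2)"
  and remainder_ge_1: "1 \<le> remainder K \<xi>"
proof -
  have "1 \<le> (A + 1) * Lambda_symbol \<xi> - (\<Sum>k\<in>{1..K}. 2 ^ k * (\<Gamma> k \<xi>)\<^sup>2)"
    using weighted_square_sum_le[of \<xi> K] Lambda_ge_1[of \<xi>] by (simp add: distrib_right)
  then show "(remainder K \<xi>)\<^sup>2 = (A + 1) * Lambda_symbol \<xi> - (\<Sum>k\<in>{1..K}. 2 ^ k * (\<Gamma> k \<xi>)\<^sup>2)" "1 \<le> remainder K \<xi>"
    unfolding remainder_def by simp_all
qed

lemma poly_growth_remainder: "poly_growth (remainder K)"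
proof (rule poly_growthI[where B="A + 1"])
  have "\<And>k. k \<in> {1..K} \<Longrightarrow> \<Gamma> k \<in> borel_measurable borel" by (simp add: measurable_\<Gamma>)
  then show "remainder K \<in> borel_measurable borel" unfolding remainder_def[abs_def] by measurable
  fix \<xi>
  have "remainder K \<xi> \<le> (remainder K \<xi>)\<^sup>2" using remainder_ge_1[of K \<xi>] by (simp add: power2_eq_square)
  also have "\<dots> \<le> (A + 1) * Lambda_symbol \<xi>" unfolding remainder_square by (simp add: sum_nonneg)
  finally show "\<bar>remainder K \<xi>\<bar> \<le> (A + 1) * Lambda_symbol \<xi>" using remainder_ge_1[of K \<xi>] by simp
qed

lemma poly_growth_Lambda_half: "poly_growth (\<lambda>\<xi>::real^'m. Lambda_symbol \<xi> powr (1/2))"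
proof (rule poly_growthI[where B=1])
  fix \<xi> :: "real^'m"
  have "sqrt (Lambda_symbol \<xi>) \<le> Lambda_symbol \<xi>"
    using Lambda_ge_1[of \<xi>] by (intro real_le_lsqrt) (auto simp: power2_eq_square)
  then show "\<bar>Lambda_symbol \<xi> powr (1/2)\<bar> \<le> 1 * Lambda_symbol \<xi>"
    using Lambda_ge_1[of \<xi>] by (simp add: powr_half_sqrt)
qed measurable

text \<open>Symmetrized products differ from the square of the total symbol only by squared differences
  of symbols, each of which is Lipschitz with a constant independent of the frequency. This
  replaces the calculus of double commutators.\<close>

lemma symbol_defect:
  "\<bar>(\<Sum>k\<in>{1..K}. 2 ^ k * (\<Gamma> k \<xi> * \<Gamma> k \<eta>)) + remainder K \<xi> * remainder K \<eta>
     - (A + 1) * (Lambda_symbol \<xi> powr (1/2) * Lambda_symbol \<eta> powr (1/2))\<bar>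
   \<le> (L\<^sup>2 + (A + 1 + 2 * L)\<^sup>2 + (A + 1)) * (norm (\<xi> - \<eta>))\<^sup>2"
proof -
  define n where "n = norm (\<xi> - \<eta>)"
  define a where "a = (\<Sum>k\<in>{1..K}. 2 ^ k * (\<Gamma> k \<xi> * \<Gamma> k \<eta>))"
  define P where "P = (\<Sum>k\<in>{1..K}. 2 ^ k * (\<Gamma> k \<xi>)\<^sup>2)"
  define P' where "P' = (\<Sum>k\<in>{1..K}. 2 ^ k * (\<Gamma> k \<eta>)\<^sup>2)"
  define D where "D = (\<Sum>k\<in>{1..K}. 2 ^ k * (\<Gamma> k \<xi> - \<Gamma> k \<eta>)\<^sup>2)"
  define s where "s = remainder K \<xi>"
  define s' where "s' = remainder K \<eta>"
  define l where "l = Lambda_symbol \<xi> powr (1/2)"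
  define l' where "l' = Lambda_symbol \<eta> powr (1/2)"
  have n: "0 \<le> n" by (simp add: n_def)
  have Dq: "D = P + P' - 2 * a"
    unfolding D_def P_def P'_def a_def
    by (simp add: sum.distrib[symmetric] sum_subtractf[symmetric] sum_distrib_left power2_diff algebra_simps)
  have l: "l\<^sup>2 = Lambda_symbol \<xi>" "l'\<^sup>2 = Lambda_symbol \<eta>" "1 \<le> l" "1 \<le> l'"
    unfolding l_def l'_def using Lambda_ge_1[of \<xi>] Lambda_ge_1[of \<eta>] by (auto simp: powr_half_sqrt)
  have s: "s\<^sup>2 = (A + 1) * l\<^sup>2 - P" "s'\<^sup>2 = (A + 1) * l'\<^sup>2 - P'" "1 \<le> s" "1 \<le> s'"
    unfolding s_def s'_def l P_def P'_def by (auto simp: remainder_square remainder_ge_1)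
  \<comment> \<open>Polarization: twice a product is the sum of the squares minus the square of the
    difference. The pure squares cancel because \<open>remainder\<close> completes the sum
    exactly.\<close>
  have eq: "2 * (a + s * s' - (A + 1) * (l * l')) = (A + 1) * (l - l')\<^sup>2 - D - (s - s')\<^sup>2"
    using s(1,2) Dq by (simp add: power2_diff algebra_simps)
  have D0: "0 \<le> D" unfolding D_def by (intro sum_nonneg) auto
  \<comment> \<open>Each square of a Lipschitz difference gains \<open>4 ^ k\<close> against the
    weight \<open>2 ^ k\<close>, which leaves a geometric series with sum below 1.\<close>
  have Dle: "D \<le> L\<^sup>2 * n\<^sup>2"
  proof -
    have "D \<le> (\<Sum>k\<in>{1..K}. L\<^sup>2 * n\<^sup>2 * (1 / 2) ^ k)"
      unfolding D_def
    proof (rule sum_mono)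
      fix k assume "k \<in> {1..K}"
      then have "\<bar>\<Gamma> k \<xi> - \<Gamma> k \<eta>\<bar>\<^sup>2 \<le> (L / 2 ^ k * n)\<^sup>2" unfolding n_def by (intro power_mono lip) auto
      then have "2 ^ k * (\<Gamma> k \<xi> - \<Gamma> k \<eta>)\<^sup>2 \<le> 2 ^ k * (L / 2 ^ k * n)\<^sup>2" by (intro mult_left_mono) auto
      also have "\<dots> = L\<^sup>2 * n\<^sup>2 * (1 / 2) ^ k" by (simp add: power_mult_distrib power_divide power2_eq_square)
      finally show "2 ^ k * (\<Gamma> k \<xi> - \<Gamma> k \<eta>)\<^sup>2 \<le> L\<^sup>2 * n\<^sup>2 * (1 / 2) ^ k" .
    qed
    also have "\<dots> = L\<^sup>2 * n\<^sup>2 * (\<Sum>k\<in>{1..K}. (1 / 2) ^ k)" by (simp add: sum_distrib_left)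
    also have "(\<Sum>k\<in>{1..K}. (1 / 2 :: real) ^ k) = 1 - (1 / 2) ^ K"
      by (induction K) (auto simp: field_simps)
    also have "L\<^sup>2 * n\<^sup>2 * (1 - (1 / 2) ^ K) \<le> L\<^sup>2 * n\<^sup>2" by (rule mult_left_le) auto
    finally show ?thesis .
  qed
  \<comment> \<open>The weight \<open>2 ^ k\<close> cancels against the Lipschitz constant of
    \<open>\<Gamma> k\<close>. What remains is a sum of the \<open>\<Gamma>\<^sub>k\<close>
    themselves, at most 1 at each of the two points, so the bound is uniform in
    \<open>K\<close>.\<close>
  have PP: "\<bar>P - P'\<bar> \<le> 2 * L * n"
  proof -
    have "\<bar>P - P'\<bar> \<le> (\<Sum>k\<in>{1..K}. \<bar>2 ^ k * (\<Gamma> k \<xi>)\<^sup>2 - 2 ^ k * (\<Gamma> k \<eta>)\<^sup>2\<bar>)"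
      unfolding P_def P'_def sum_subtractf[symmetric] by (rule sum_abs)
    also have "\<dots> \<le> (\<Sum>k\<in>{1..K}. L * n * (\<Gamma> k \<xi> + \<Gamma> k \<eta>))"
    proof (rule sum_mono)
      fix k assume "k \<in> {1..K}"
      then have k: "1 \<le> k" by simp
      have p: "0 \<le> \<Gamma> k \<xi> + \<Gamma> k \<eta>" using nonneg[OF k] by (simp add: add_nonneg_nonneg)
      have "\<bar>2 ^ k * (\<Gamma> k \<xi>)\<^sup>2 - 2 ^ k * (\<Gamma> k \<eta>)\<^sup>2\<bar> = 2 ^ k * (\<bar>\<Gamma> k \<xi> - \<Gamma> k \<eta>\<bar> * (\<Gamma> k \<xi> + \<Gamma> k \<eta>))"
        using p by (simp add: power2_eq_square square_diff_square_factored abs_mult flip: right_diff_distrib)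
      also have "\<dots> \<le> 2 ^ k * ((L / 2 ^ k * n) * (\<Gamma> k \<xi> + \<Gamma> k \<eta>))"
        unfolding n_def using p by (intro mult_left_mono mult_right_mono lip[OF k]) auto
      finally show "\<bar>2 ^ k * (\<Gamma> k \<xi>)\<^sup>2 - 2 ^ k * (\<Gamma> k \<eta>)\<^sup>2\<bar> \<le> L * n * (\<Gamma> k \<xi> + \<Gamma> k \<eta>)" by simp
    qed
    also have "\<dots> = L * n * ((\<Sum>k\<in>{1..K}. \<Gamma> k \<xi>) + (\<Sum>k\<in>{1..K}. \<Gamma> k \<eta>))"
      by (simp add: sum_distrib_left sum.distrib distrib_left)
    also have "\<dots> \<le> L * n * (1 + 1)"
      using L n by (intro mult_left_mono add_mono sum_le_1) auto
    finally show ?thesis by simp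
  qed
  \<comment> \<open>For numbers at least 1, \<open>x + y \<ge> 1\<close>, so taking square roots
    does not enlarge differences. This is where the lower bounds on \<open>remainder\<close> and on
    \<open>\<Lambda>\<close> enter.\<close>
  have diff_le: "\<bar>x - y\<bar> \<le> \<bar>x\<^sup>2 - y\<^sup>2\<bar>" if "1 \<le> x" "1 \<le> y" for x y :: real
  proof -
    have "\<bar>x - y\<bar> * 1 \<le> \<bar>x - y\<bar> * (x + y)" using that by (intro mult_left_mono) auto
    also have "\<dots> = \<bar>x\<^sup>2 - y\<^sup>2\<bar>" using that by (simp add: power2_eq_square square_diff_square_factored abs_mult)
    finally show ?thesis by simp
  qed
  have ll: "\<bar>l\<^sup>2 - l'\<^sup>2\<bar> \<le> n" unfolding l n_def by (rule Lambda_lipschitz)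
  have "\<bar>s - s'\<bar> \<le> \<bar>s\<^sup>2 - s'\<^sup>2\<bar>" by (rule diff_le[OF s(3,4)])
  also have "s\<^sup>2 - s'\<^sup>2 = (A + 1) * (l\<^sup>2 - l'\<^sup>2) - (P - P')" unfolding s by (simp add: algebra_simps)
  also have "\<bar>\<dots>\<bar> \<le> (A + 1) * \<bar>l\<^sup>2 - l'\<^sup>2\<bar> + \<bar>P - P'\<bar>"
    using abs_triangle_ineq4[of "(A + 1) * (l\<^sup>2 - l'\<^sup>2)" "P - P'"] A by (simp add: abs_mult)
  also have "\<dots> \<le> (A + 1) * n + 2 * L * n" using A ll PP by (intro add_mono mult_left_mono) auto
  finally have "\<bar>s - s'\<bar>\<^sup>2 \<le> ((A + 1) * n + 2 * L * n)\<^sup>2" by (intro power_mono) auto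
  then have ss: "(s - s')\<^sup>2 \<le> (A + 1 + 2 * L)\<^sup>2 * n\<^sup>2" by (simp flip: distrib_right power_mult_distrib)
  have "\<bar>l - l'\<bar>\<^sup>2 \<le> n\<^sup>2" using order_trans[OF diff_le[OF l(3,4)] ll] by (intro power_mono) auto
  then have l2: "(A + 1) * (l - l')\<^sup>2 \<le> (A + 1) * n\<^sup>2" using A by (intro mult_left_mono) auto
  have l0: "0 \<le> (A + 1) * (l - l')\<^sup>2" using A by simp
  have "\<bar>z\<bar> \<le> a + b + c" if "2 * z = x - D - y" "0 \<le> x" "x \<le> c" "0 \<le> D" "D \<le> a" "0 \<le> y" "y \<le> b"
    for z x D y a b c :: real using that by linarith
  from this[OF eq l0 l2 D0 Dle zero_le_power2 ss] have "\<bar>a + s * s' - (A + 1) * (l * l')\<bar> \<le> L\<^sup>2 * n\<^sup>2 + (A + 1 + 2 * L)\<^sup>2 * n\<^sup>2 + (A + 1) * n\<^sup>2" .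
  then show ?thesis
    unfolding a_def s_def s'_def l_def l'_def n_def by (simp only: distrib_right)
qed

end

text \<open>A list of terms \<open>t\<close>, each with a coefficient and the two components that it
  pairs. Being indexed by terms rather than by pairs of components, it allows several terms to share
  a pair, as happens for matrices acting on forms.\<close>

definition qform :: "'t set \<Rightarrow> ('t \<Rightarrow> 'j) \<Rightarrow> ('t \<Rightarrow> 'j) \<Rightarrow> ('t \<Rightarrow> complex) \<Rightarrow> ('j \<Rightarrow> complex) \<Rightarrow> real" where
  "qform T \<alpha> \<beta> G w = Re (\<Sum>t\<in>T. G t * w (\<alpha> t) * cnj (w (\<beta> t)))"

lemma qform_bound:
  assumes "finite T" "finite J" "\<alpha> ` T \<subseteq> J" "\<beta> ` T \<subseteq> J" and D: "\<And>t. t \<in> T \<Longrightarrow> norm (G t) \<le> D"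
  shows "\<bar>qform T \<alpha> \<beta> G w\<bar> \<le> D * card T * (\<Sum>j\<in>J. (norm (w j))\<^sup>2)"
proof -
  have "\<bar>qform T \<alpha> \<beta> G w\<bar> \<le> (\<Sum>t\<in>T. norm (G t * w (\<alpha> t) * cnj (w (\<beta> t))))"
    unfolding qform_def by (rule order_trans[OF abs_Re_le_cmod norm_sum])
  also have "\<dots> \<le> (\<Sum>t\<in>T. D * (\<Sum>j\<in>J. (norm (w j))\<^sup>2))"
  proof (rule sum_mono)
    fix t assume t: "t \<in> T"
    have "(norm (w j))\<^sup>2 \<le> (\<Sum>j\<in>J. (norm (w j))\<^sup>2)" if "j \<in> J" for j
      using that assms(2) by (intro member_le_sum) auto
    then have "(norm (w (\<alpha> t)))\<^sup>2 \<le> (\<Sum>j\<in>J. (norm (w j))\<^sup>2)" "(norm (w (\<beta> t)))\<^sup>2 \<le> (\<Sum>j\<in>J. (norm (w j))\<^sup>2)"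
      using t assms(3,4) by auto
    note w2 = this
    have w1: "norm (w (\<alpha> t)) * norm (w (\<beta> t)) \<le> ((norm (w (\<alpha> t)))\<^sup>2 + (norm (w (\<beta> t)))\<^sup>2) / 2"
      using zero_le_power2[of "norm (w (\<alpha> t)) - norm (w (\<beta> t))"] by (simp add: power2_diff)
    have "(x + y) / 2 \<le> s" if "x \<le> s" "y \<le> s" for x y s :: real using that by simp
    from order_trans[OF w1 this[OF w2]]
    have "norm (w (\<alpha> t)) * norm (w (\<beta> t)) \<le> (\<Sum>j\<in>J. (norm (w j))\<^sup>2)" .
    moreover have "0 \<le> D" using order_trans[OF norm_ge_zero D[OF t]] .
    ultimately have "norm (G t) * (norm (w (\<alpha> t)) * norm (w (\<beta> t))) \<le> D * (\<Sum>j\<in>J. (norm (w j))\<^sup>2)"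
      using D[OF t] by (intro mult_mono) auto
    then show "norm (G t * w (\<alpha> t) * cnj (w (\<beta> t))) \<le> D * (\<Sum>j\<in>J. (norm (w j))\<^sup>2)"
      by (simp add: norm_mult mult.assoc)
  qed
  finally show ?thesis by (simp add: mult_ac)
qed

lemma qform_integrable:
  fixes w :: "'j \<Rightarrow> 'a::euclidean_space \<Rightarrow> complex"
  assumes fin: "finite T" "finite J" "\<alpha> ` T \<subseteq> J" "\<beta> ` T \<subseteq> J"
    and G: "\<And>t. t \<in> T \<Longrightarrow> G t \<in> borel_measurable borel" "\<And>t x. t \<in> T \<Longrightarrow> norm (G t x) \<le> D"
    and w: "\<And>j. j \<in> J \<Longrightarrow> w j \<in> borel_measurable borel" "\<And>j. j \<in> J \<Longrightarrow> integrable lborel (\<lambda>x. (norm (w j x))\<^sup>2)"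
  shows "integrable lborel (\<lambda>x. qform T \<alpha> \<beta> (\<lambda>t. G t x) (\<lambda>j. w j x))"
proof (rule Bochner_Integration.integrable_bound)
  show "integrable lborel (\<lambda>x. D * card T * (\<Sum>j\<in>J. (norm (w j x))\<^sup>2))"
    using w by (intro integrable_mult_right integrable_sum) auto
  have [measurable]: "w (\<alpha> t) \<in> borel_measurable borel" "w (\<beta> t) \<in> borel_measurable borel" "G t \<in> borel_measurable borel"
    if "t \<in> T" for t using w G that fin by auto
  show "(\<lambda>x. qform T \<alpha> \<beta> (\<lambda>t. G t x) (\<lambda>j. w j x)) \<in> borel_measurable lborel"
    unfolding qform_def by measurable
  show "AE x in lborel. norm (qform T \<alpha> \<beta> (\<lambda>t. G t x) (\<lambda>j. w j x)) \<le> norm (D * card T * (\<Sum>j\<in>J. (norm (w j x))\<^sup>2))"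
    using qform_bound[OF fin, of "\<lambda>t. G t x" D "\<lambda>j. w j x" for x] G(2)
    by (intro always_eventually allI) (auto intro: order_trans[OF _ abs_ge_self])
qed

lemma multiplier_pairing:
  fixes w u v :: "real^'m::finite \<Rightarrow> complex"
  assumes "test_fun w" "poly_growth \<sigma>" "poly_growth \<tau>" "test_fun u" "test_fun v"
  shows "(LINT x|lborel. w x * multiplier \<sigma> u x * cnj (multiplier \<tau> v x)) =
    symbol_pairing w u v (\<lambda>p. \<sigma> (fst p) * \<tau> (snd p)) / (complex_of_real ((2 * pi) ^ CARD('m)))\<^sup>2"
  unfolding symbol_pairing_def by (rule multiplier_weighted[OF test_fun_integrable[OF assms(1)] assms(2-5)])

lemma multiplier_form_integrable:
  fixes w u v :: "real^'m::finite \<Rightarrow> complex"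
  assumes w: "w \<in> borel_measurable borel" "\<And>x. norm (w x) \<le> D"
    and u: "u \<in> borel_measurable borel" "integrable lborel (\<lambda>x. (norm (u x))\<^sup>2)"
    and v: "v \<in> borel_measurable borel" "integrable lborel (\<lambda>x. (norm (v x))\<^sup>2)"
  shows "integrable lborel (\<lambda>x. w x * u x * cnj (v x))"
proof (rule Bochner_Integration.integrable_bound)
  note [measurable] = w(1) u(1) v(1)
  show "integrable lborel (\<lambda>x. D * ((norm (u x))\<^sup>2 + (norm (v x))\<^sup>2))" using u v by simp
  show "AE x in lborel. norm (w x * u x * cnj (v x)) \<le> norm (D * ((norm (u x))\<^sup>2 + (norm (v x))\<^sup>2))"
  proof (intro always_eventually allI)
    fix x
    have D: "0 \<le> D" using order_trans[OF norm_ge_zero w(2)] .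
    have "2 * (norm (u x) * norm (v x)) \<le> (norm (u x))\<^sup>2 + (norm (v x))\<^sup>2"
      using zero_le_power2[of "norm (u x) - norm (v x)"] by (simp add: power2_diff)
    moreover have "0 \<le> norm (u x) * norm (v x)" by simp
    ultimately have "norm (u x) * norm (v x) \<le> (norm (u x))\<^sup>2 + (norm (v x))\<^sup>2" by linarith
    then have "norm (w x) * (norm (u x) * norm (v x)) \<le> D * ((norm (u x))\<^sup>2 + (norm (v x))\<^sup>2)"
      using w(2) D by (intro mult_mono) auto
    then show "norm (w x * u x * cnj (v x)) \<le> norm (D * ((norm (u x))\<^sup>2 + (norm (v x))\<^sup>2))"
      using D by (simp add: norm_mult mult.assoc)
  qed
  show "(\<lambda>x. w x * u x * cnj (v x)) \<in> borel_measurable lborel" by measurable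
qed

lemma qform_multiplier:
  fixes g :: "'t \<Rightarrow> real^'m::finite \<Rightarrow> complex" and v :: "'j \<Rightarrow> real^'m \<Rightarrow> complex"
  assumes g: "\<And>t. t \<in> T \<Longrightarrow> test_fun (g t)" and \<sigma>: "poly_growth \<sigma>"
    and v: "\<And>t. t \<in> T \<Longrightarrow> test_fun (v (\<alpha> t)) \<and> test_fun (v (\<beta> t))"
  shows "(LINT x|lborel. qform T \<alpha> \<beta> (\<lambda>t. g t x) (\<lambda>j. multiplier \<sigma> (v j) x)) =
    Re (\<Sum>t\<in>T. symbol_pairing (g t) (v (\<alpha> t)) (v (\<beta> t)) (\<lambda>p. \<sigma> (fst p) * \<sigma> (snd p))) / ((2 * pi) ^ CARD('m))\<^sup>2"
proof -
  have i: "integrable lborel (\<lambda>x. g t x * multiplier \<sigma> (v (\<alpha> t)) x * cnj (multiplier \<sigma> (v (\<beta> t)) x))" if t: "t \<in> T" for t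
  proof -
    obtain B where "\<And>x. norm (g t x) \<le> B" using test_fun_bounded[OF g[OF t]] by blast
    then show ?thesis
      by (rule multiplier_form_integrable[OF test_fun_measurable[OF g[OF t]]])
         (use v[OF t] \<sigma> multiplier_measurable multiplier_bessel(1) in blast)+
  qed
  have "(LINT x|lborel. qform T \<alpha> \<beta> (\<lambda>t. g t x) (\<lambda>j. multiplier \<sigma> (v j) x)) =
     Re (LINT x|lborel. (\<Sum>t\<in>T. g t x * multiplier \<sigma> (v (\<alpha> t)) x * cnj (multiplier \<sigma> (v (\<beta> t)) x)))"
    unfolding qform_def by (rule integral_Re) (intro Bochner_Integration.integrable_sum i)
  also have "(LINT x|lborel. (\<Sum>t\<in>T. g t x * multiplier \<sigma> (v (\<alpha> t)) x * cnj (multiplier \<sigma> (v (\<beta> t)) x))) =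
     (\<Sum>t\<in>T. symbol_pairing (g t) (v (\<alpha> t)) (v (\<beta> t)) (\<lambda>p. \<sigma> (fst p) * \<sigma> (snd p)) / (complex_of_real ((2 * pi) ^ CARD('m)))\<^sup>2)"
    by (subst Bochner_Integration.integral_sum[OF i], assumption)
       (intro sum.cong refl multiplier_pairing g \<sigma>, use v in auto)
  also have "\<dots> = (\<Sum>t\<in>T. symbol_pairing (g t) (v (\<alpha> t)) (v (\<beta> t)) (\<lambda>p. \<sigma> (fst p) * \<sigma> (snd p))) / complex_of_real (((2 * pi) ^ CARD('m))\<^sup>2)"
    by (simp add: sum_divide_distrib)
  finally show ?thesis by (simp only: Re_divide_of_real)
qed

section \<open>Comparison with the operator of order one half, and pseudolocality\<close>

context dyadic_symbols
begin

text \<open>In frequency space, the sum of the dyadic symbols plus that of \<open>remainder\<close>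
  equals \<open>A + 1\<close> times the symbol of \<open>\<Lambda>\<^sup>1\<^sup>/\<^sup>2\<close>,
  up to a defect of size \<open>(norm (\<xi> - \<eta>))\<^sup>2\<close>. The defect costs an
  \<open>L\<^sup>2\<close> norm, and the \<open>remainder\<close> term is nonnegative because the
  form is nonnegative at every point. The constant does not involve \<open>K\<close>, so infinite
  sums are within reach.\<close>

lemma garding:
  fixes g :: "'t \<Rightarrow> real^'m \<Rightarrow> complex" and J :: "'j set"
  assumes fin: "finite T" "finite J" "\<alpha> ` T \<subseteq> J" "\<beta> ` T \<subseteq> J"
    and g: "\<And>t. t \<in> T \<Longrightarrow> test_fun (g t)"
    and nn: "\<And>x w. 0 \<le> qform T \<alpha> \<beta> (\<lambda>t. g t x) w"
  shows "\<exists>C\<ge>0. \<forall>v. (\<forall>j\<in>J. test_fun (v j)) \<longrightarrow> (\<forall>K.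
     (\<Sum>k\<in>{1..K}. 2 ^ k * (LINT x|lborel. qform T \<alpha> \<beta> (\<lambda>t. g t x) (\<lambda>j. multiplier (\<Gamma> k) (v j) x)))
     \<le> C * ((LINT x|lborel. qform T \<alpha> \<beta> (\<lambda>t. g t x) (\<lambda>j. multiplier (\<lambda>\<xi>. Lambda_symbol \<xi> powr (1/2)) (v j) x))
        + (\<Sum>j\<in>J. LINT x|lborel. (norm (v j x))\<^sup>2)))"
proof -
  let ?l = "\<lambda>\<xi>::real^'m. Lambda_symbol \<xi> powr (1/2)"
  let ?c = "((2 * pi) ^ CARD('m))\<^sup>2 :: real"
  let ?ee = "L\<^sup>2 + (A + 1 + 2 * L)\<^sup>2 + (A + 1)"
  have E0: "0 \<le> ?ee" using A by simp
  have "\<forall>t\<in>T. \<exists>D\<ge>0. \<forall>u v s E0. test_fun u \<longrightarrow> test_fun v \<longrightarrow> s \<in> borel_measurable (lborel \<Otimes>\<^sub>M lborel) \<longrightarrow>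
     0 \<le> E0 \<longrightarrow> (\<forall>p. \<bar>s p\<bar> \<le> E0 * (norm (fst p - snd p))\<^sup>2) \<longrightarrow>
     norm (symbol_pairing (g t) u v s) \<le> D * E0 * ((LINT x|lborel. (norm (u x))\<^sup>2) + (LINT x|lborel. (norm (v x))\<^sup>2))"
    using symbol_pairing_bound[OF g] by blast
  then obtain D where D0: "\<And>t. t \<in> T \<Longrightarrow> 0 \<le> D t" and
    D: "\<And>t u v s E0. t \<in> T \<Longrightarrow> test_fun u \<Longrightarrow> test_fun v \<Longrightarrow> s \<in> borel_measurable (lborel \<Otimes>\<^sub>M lborel) \<Longrightarrow>
     0 \<le> E0 \<Longrightarrow> (\<And>p. \<bar>s p\<bar> \<le> E0 * (norm (fst p - snd p))\<^sup>2) \<Longrightarrow>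
     norm (symbol_pairing (g t) u v s) \<le> D t * E0 * ((LINT x|lborel. (norm (u x))\<^sup>2) + (LINT x|lborel. (norm (v x))\<^sup>2))"
    unfolding bchoice_iff by blast
  \<comment> \<open>The Schur constants of the coefficients, times the constant of the symbol
    defect. The factor 2 is for the two slots of each term, the denominator for the normalization of
    the multipliers.\<close>
  define C1 where "C1 = (\<Sum>t\<in>T. D t * ?ee * 2) / ?c"
  have C1: "0 \<le> C1" unfolding C1_def using D0 E0 by (intro divide_nonneg_nonneg sum_nonneg) auto
  show ?thesis
  proof (intro exI[of _ "max (A + 1) C1"] conjI allI impI)
    show "0 \<le> max (A + 1) C1" using A by simp
    fix v :: "'j \<Rightarrow> real^'m \<Rightarrow> complex" and K
    assume v: "\<forall>j\<in>J. test_fun (v j)"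
    let ?N = "\<Sum>j\<in>J. LINT x|lborel. (norm (v j x))\<^sup>2"
    let ?Q = "\<lambda>\<sigma>. LINT x|lborel. qform T \<alpha> \<beta> (\<lambda>t. g t x) (\<lambda>j. multiplier \<sigma> (v j) x)"
    have vt: "test_fun (v (\<alpha> t)) \<and> test_fun (v (\<beta> t))" if "t \<in> T" for t using v fin that by blast
    define S where "S = (\<lambda>t. symbol_pairing (g t) (v (\<alpha> t)) (v (\<beta> t)))"
    have Q: "?Q \<sigma> = Re (\<Sum>t\<in>T. S t (\<lambda>p. \<sigma> (fst p) * \<sigma> (snd p))) / ?c" if "poly_growth \<sigma>" for \<sigma>
      unfolding S_def by (rule qform_multiplier[OF g that vt])
    \<comment> \<open>The defect as a two-variable symbol. Its pairing is computed exactly by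
      linearity and estimated through its vanishing on the diagonal.\<close>
    let ?E = "\<lambda>p::(real^'m) \<times> (real^'m). (\<Sum>k\<in>{1..K}. 2 ^ k * (\<Gamma> k (fst p) * \<Gamma> k (snd p))) + remainder K (fst p) * remainder K (snd p)
     - (A + 1) * (?l (fst p) * ?l (snd p))"
    have S: "S t ?E = (\<Sum>k\<in>{1..K}. complex_of_real (2 ^ k) * S t (\<lambda>p. \<Gamma> k (fst p) * \<Gamma> k (snd p)))
        + S t (\<lambda>p. remainder K (fst p) * remainder K (snd p))
        - complex_of_real (A + 1) * S t (\<lambda>p. ?l (fst p) * ?l (snd p))" if t: "t \<in> T" for t
    proof -
      let ?U = "\<lambda>p. fourier (v (\<alpha> t)) (fst p) * cnj (fourier (v (\<beta> t)) (snd p)) * ift (g t) (fst p - snd p)"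
      have i: "integrable (lborel \<Otimes>\<^sub>M lborel) (\<lambda>p. complex_of_real (\<sigma> (fst p) * \<sigma> (snd p)) * ?U p)" if "poly_growth \<sigma>" for \<sigma>
        using symbol_pairing_integrable[OF g[OF t] that that, of "v (\<alpha> t)" "v (\<beta> t)"] vt[OF t] by blast
      have ik: "integrable (lborel \<Otimes>\<^sub>M lborel) (\<lambda>p. complex_of_real (2 ^ k) * (complex_of_real (\<Gamma> k (fst p) * \<Gamma> k (snd p)) * ?U p))" if "k \<in> {1..K}" for k
        using that by (intro integrable_mult_right i poly_growth_\<Gamma>) auto
      have i0: "integrable (lborel \<Otimes>\<^sub>M lborel) (\<lambda>p. \<Sum>k\<in>{1..K}. complex_of_real (2 ^ k) * (complex_of_real (\<Gamma> k (fst p) * \<Gamma> k (snd p)) * ?U p))"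
        by (rule Bochner_Integration.integrable_sum[OF ik])
      note ir = i[OF poly_growth_remainder] and il = integrable_mult_right[OF i[OF poly_growth_Lambda_half], of "complex_of_real (A + 1)"]
      have "S t ?E = (LINT p|(lborel \<Otimes>\<^sub>M lborel). (\<Sum>k\<in>{1..K}. complex_of_real (2 ^ k) * (complex_of_real (\<Gamma> k (fst p) * \<Gamma> k (snd p)) * ?U p))
        + complex_of_real (remainder K (fst p) * remainder K (snd p)) * ?U p
        - complex_of_real (A + 1) * (complex_of_real (?l (fst p) * ?l (snd p)) * ?U p))"
        unfolding S_def symbol_pairing_def
        by (intro Bochner_Integration.integral_cong refl)
           (simp only: of_real_add of_real_diff of_real_mult of_real_sum distrib_right left_diff_distrib sum_distrib_right mult.assoc)
      also have "\<dots> = (LINT p|(lborel \<Otimes>\<^sub>M lborel). (\<Sum>k\<in>{1..K}. complex_of_real (2 ^ k) * (complex_of_real (\<Gamma> k (fst p) * \<Gamma> k (snd p)) * ?U p)))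
        + (LINT p|(lborel \<Otimes>\<^sub>M lborel). complex_of_real (remainder K (fst p) * remainder K (snd p)) * ?U p)
        - (LINT p|(lborel \<Otimes>\<^sub>M lborel). complex_of_real (A + 1) * (complex_of_real (?l (fst p) * ?l (snd p)) * ?U p))"
        using Bochner_Integration.integral_diff[OF Bochner_Integration.integrable_add[OF i0 ir] il] Bochner_Integration.integral_add[OF i0 ir]
        by (simp only:)
      also have "(LINT p|(lborel \<Otimes>\<^sub>M lborel). (\<Sum>k\<in>{1..K}. complex_of_real (2 ^ k) * (complex_of_real (\<Gamma> k (fst p) * \<Gamma> k (snd p)) * ?U p)))
        = (\<Sum>k\<in>{1..K}. complex_of_real (2 ^ k) * S t (\<lambda>p. \<Gamma> k (fst p) * \<Gamma> k (snd p)))"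
        unfolding S_def symbol_pairing_def
        by (subst Bochner_Integration.integral_sum[OF ik], assumption) (intro sum.cong refl integral_mult_right_zero)
      finally show ?thesis
        unfolding S_def symbol_pairing_def integral_mult_right_zero .
    qed
    have "?c * ((\<Sum>k\<in>{1..K}. 2 ^ k * ?Q (\<Gamma> k)) + ?Q (remainder K) - (A + 1) * ?Q ?l) = Re (\<Sum>t\<in>T. S t ?E)"
    proof -
      have "(\<Sum>t\<in>T. S t ?E) = (\<Sum>k\<in>{1..K}. complex_of_real (2 ^ k) * (\<Sum>t\<in>T. S t (\<lambda>p. \<Gamma> k (fst p) * \<Gamma> k (snd p))))
        + (\<Sum>t\<in>T. S t (\<lambda>p. remainder K (fst p) * remainder K (snd p)))
        - complex_of_real (A + 1) * (\<Sum>t\<in>T. S t (\<lambda>p. ?l (fst p) * ?l (snd p)))"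
        by (simp only: S sum_subtractf sum.distrib sum_distrib_left sum.swap[of _ T] cong: sum.cong)
      then have R1: "Re (\<Sum>t\<in>T. S t ?E) = (\<Sum>k\<in>{1..K}. 2 ^ k * Re (\<Sum>t\<in>T. S t (\<lambda>p. \<Gamma> k (fst p) * \<Gamma> k (snd p))))
        + Re (\<Sum>t\<in>T. S t (\<lambda>p. remainder K (fst p) * remainder K (snd p)))
        - (A + 1) * Re (\<Sum>t\<in>T. S t (\<lambda>p. ?l (fst p) * ?l (snd p)))"
        by (simp only: minus_complex.simps plus_complex.simps Re_sum[of _ "{1..K}"] Re_complex_of_real Im_complex_of_real times_complex.simps mult_zero_left diff_zero)
      have R2: "Re (\<Sum>t\<in>T. S t (\<lambda>p. \<sigma> (fst p) * \<sigma> (snd p))) = ?c * ?Q \<sigma>" if "poly_growth \<sigma>" for \<sigma>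
        using Q[OF that] by (simp del: power_mult_distrib)
      have R3: "(\<Sum>k\<in>{1..K}. 2 ^ k * Re (\<Sum>t\<in>T. S t (\<lambda>p. \<Gamma> k (fst p) * \<Gamma> k (snd p)))) = ?c * (\<Sum>k\<in>{1..K}. 2 ^ k * ?Q (\<Gamma> k))"
        unfolding sum_distrib_left
      proof (rule sum.cong)
        fix k assume "k \<in> {1..K}"
        then have "Re (\<Sum>t\<in>T. S t (\<lambda>p. \<Gamma> k (fst p) * \<Gamma> k (snd p))) = ?c * ?Q (\<Gamma> k)"
          by (intro R2 poly_growth_\<Gamma>) auto
        then show "2 ^ k * Re (\<Sum>t\<in>T. S t (\<lambda>p. \<Gamma> k (fst p) * \<Gamma> k (snd p))) = ?c * (2 ^ k * ?Q (\<Gamma> k))" by simp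
      qed simp
      have "c * (a + q - d * l) = c * a + c * q - d * (c * l)" for a c d l q :: real by (simp add: algebra_simps)
      then show ?thesis unfolding R1 R3 R2[OF poly_growth_remainder] R2[OF poly_growth_Lambda_half] .
    qed
    also have "Re (\<Sum>t\<in>T. S t ?E) \<le> (\<Sum>t\<in>T. norm (S t ?E))"
      by (rule order_trans[OF complex_Re_le_cmod norm_sum])
    also have "\<dots> \<le> (\<Sum>t\<in>T. D t * ?ee * (2 * ?N))"
    proof (rule sum_mono)
      fix t assume t: "t \<in> T"
      have pm: "\<And>k. k \<in> {1..K} \<Longrightarrow> \<Gamma> k \<in> borel_measurable borel" "remainder K \<in> borel_measurable borel"
        by (simp_all add: measurable_\<Gamma> poly_growth_measurable[OF poly_growth_remainder])
      note [measurable] = pm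
      have "norm (S t ?E) \<le> D t * ?ee * ((LINT x|lborel. (norm (v (\<alpha> t) x))\<^sup>2) + (LINT x|lborel. (norm (v (\<beta> t) x))\<^sup>2))"
        unfolding S_def
      proof (rule D[OF t _ _ _ E0])
        show "?E \<in> borel_measurable (lborel \<Otimes>\<^sub>M lborel)" by measurable
      qed (use vt[OF t] symbol_defect in auto)
      also have "\<dots> \<le> D t * ?ee * (2 * ?N)"
      proof (rule mult_left_mono)
        have "(LINT x|lborel. (norm (v j x))\<^sup>2) \<le> ?N" if "j \<in> J" for j
          using that fin by (intro member_le_sum integral_nonneg_AE) auto
        from add_mono[OF this[of "\<alpha> t"] this[of "\<beta> t"]] show "(LINT x|lborel. (norm (v (\<alpha> t) x))\<^sup>2) + (LINT x|lborel. (norm (v (\<beta> t) x))\<^sup>2) \<le> 2 * ?N"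
          using fin t by auto
        show "0 \<le> D t * ?ee" using D0[OF t] E0 by simp
      qed
      finally show "norm (S t ?E) \<le> D t * ?ee * (2 * ?N)" .
    qed
    also have "\<dots> = ?c * (C1 * ?N)"
    proof -
      have "(\<Sum>t\<in>T. D t * e * (2 * N)) = c * ((\<Sum>t\<in>T. D t * e * 2) / c * N)" if "c \<noteq> 0" for c e N :: real
        using that by (simp add: sum_distrib_right mult.assoc)
      note gen = this
      have "?c \<noteq> 0" by simp
      then show ?thesis unfolding C1_def by (rule gen)
    qed
    finally have "(\<Sum>k\<in>{1..K}. 2 ^ k * ?Q (\<Gamma> k)) + ?Q (remainder K) - (A + 1) * ?Q ?l \<le> C1 * ?N"
      by (rule mult_left_le_imp_le) simp
    \<comment> \<open>Nonnegativity of the quadratic form at every point enters here, applied to the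
      functions produced by the extra symbol.\<close>
    moreover have "0 \<le> ?Q (remainder K)" by (intro integral_nonneg_AE) (use nn in auto)
    moreover have "(A + 1) * ?Q ?l \<le> max (A + 1) C1 * ?Q ?l"
      by (intro mult_right_mono integral_nonneg_AE) (use nn in auto)
    moreover have "C1 * ?N \<le> max (A + 1) C1 * ?N"
      by (intro mult_right_mono sum_nonneg integral_nonneg_AE) auto
    ultimately show "(\<Sum>k\<in>{1..K}. 2 ^ k * ?Q (\<Gamma> k)) \<le> max (A + 1) C1 * (?Q ?l + ?N)"
      unfolding distrib_left by linarith
  qed
qed

text \<open>The symbol of the integral of \<open>w |\<Gamma>\<^sub>k u|\<^sup>2\<close> is half of
  \<open>\<Gamma>\<^sub>k(\<xi>)\<^sup>2 + \<Gamma>\<^sub>k(\<eta>)\<^sup>2 -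
  (\<Gamma>\<^sub>k(\<xi>) - \<Gamma>\<^sub>k(\<eta>))\<^sup>2\<close>. Since
  \<open>w u = u\<close>, each of the first two parts yields the full energy of
  \<open>\<Gamma>\<^sub>k u\<close>, so the energy weighted by \<open>1 - w\<close> is only the
  squared difference, which is \<open>O(4\<^sup>-\<^sup>k)\<close>.\<close>

lemma pseudolocal:
  fixes w :: "real^'m \<Rightarrow> real"
  assumes w: "test_fun w"
  shows "\<exists>C\<ge>0. \<forall>u k. test_fun u \<longrightarrow> (\<forall>x. complex_of_real (w x) * u x = u x) \<longrightarrow> 1 \<le> k \<longrightarrow>
     (LINT x|lborel. (1 - w x) * (norm (multiplier (\<Gamma> k) u x))\<^sup>2) \<le> C / 4 ^ k * (LINT x|lborel. (norm (u x))\<^sup>2)"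
proof -
  let ?W = "\<lambda>x. complex_of_real (w x)"
  let ?c = "(2 * pi) ^ CARD('m) :: real"
  have W: "test_fun ?W"
    using w smooth_on_of_real[OF open_UNIV, of w] unfolding test_fun_def by fastforce
  obtain D where D0: "0 \<le> D" and D: "\<And>u v s E0. test_fun u \<Longrightarrow> test_fun v \<Longrightarrow> s \<in> borel_measurable (lborel \<Otimes>\<^sub>M lborel) \<Longrightarrow>
     0 \<le> E0 \<Longrightarrow> (\<And>p. \<bar>s p\<bar> \<le> E0 * (norm (fst p - snd p))\<^sup>2) \<Longrightarrow>
     norm (symbol_pairing ?W u v s) \<le> D * E0 * ((LINT x|lborel. (norm (u x))\<^sup>2) + (LINT x|lborel. (norm (v x))\<^sup>2))"
    using symbol_pairing_bound[OF W] by blast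
  show ?thesis
  proof (intro exI[of _ "D * L\<^sup>2 / ?c\<^sup>2"] conjI allI impI)
    show "0 \<le> D * L\<^sup>2 / ?c\<^sup>2" using D0 by simp
    fix u :: "real^'m \<Rightarrow> complex" and k :: nat
    assume u: "test_fun u" and wu: "\<forall>x. ?W x * u x = u x" and k: "1 \<le> k"
    let ?S = "symbol_pairing ?W u u"
    let ?G = "multiplier (\<Gamma> k) u" and ?G2 = "multiplier (\<lambda>\<xi>. (\<Gamma> k \<xi>)\<^sup>2) u"
    let ?I = "LINT \<xi>|lborel. (\<Gamma> k \<xi>)\<^sup>2 * (norm (fourier u \<xi>))\<^sup>2"
    note pg = poly_growth_\<Gamma>[OF k] and pg2 = poly_growth_\<Gamma>_square[OF k]
    note [measurable] = measurable_\<Gamma>[OF k] multiplier_measurable[OF pg u] test_fun_measurable[OF w]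
    obtain B where B: "\<And>x. norm (w x) \<le> B" using test_fun_bounded[OF w] by blast
    have iG: "integrable lborel (\<lambda>x. (norm (?G x))\<^sup>2)" by (rule multiplier_bessel(1)[OF pg u])
    have iwG: "integrable lborel (\<lambda>x. w x * (norm (?G x))\<^sup>2)"
    proof (rule Bochner_Integration.integrable_bound)
      show "integrable lborel (\<lambda>x. B * (norm (?G x))\<^sup>2)" using iG by simp
      show "AE x in lborel. norm (w x * (norm (?G x))\<^sup>2) \<le> norm (B * (norm (?G x))\<^sup>2)"
        using B order_trans[OF B abs_ge_self] by (intro always_eventually allI) (auto simp: abs_mult intro!: mult_right_mono)
    qed measurable
    have wG: "complex_of_real (LINT x|lborel. w x * (norm (?G x))\<^sup>2) = ?S (\<lambda>p. \<Gamma> k (fst p) * \<Gamma> k (snd p)) / (complex_of_real ?c)\<^sup>2"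
      unfolding multiplier_pairing[OF W pg pg u u, symmetric] integral_complex_of_real[symmetric] of_real_mult complex_norm_square mult.assoc ..
    \<comment> \<open>Moving the transform onto \<open>u\<close> identifies this pairing with the
      energy of \<open>\<Gamma>\<^sub>k u\<close> computed in frequency, so it is real.\<close>
    have G2u: "(LINT x|lborel. ?G2 x * cnj (u x)) = complex_of_real (?I / ?c)"
    proof -
      have "(LINT x|lborel. ?G2 x * cnj (u x)) =
          (LINT x|lborel. ift (\<lambda>\<xi>. complex_of_real ((\<Gamma> k \<xi>)\<^sup>2) * fourier u \<xi>) x * cnj (u x) / complex_of_real ?c)"
        unfolding multiplier_eq_ift by (intro Bochner_Integration.integral_cong) auto
      also have "\<dots> = (LINT x|lborel. ift (\<lambda>\<xi>. complex_of_real ((\<Gamma> k \<xi>)\<^sup>2) * fourier u \<xi>) x * cnj (u x)) / complex_of_real ?c"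
        by (rule integral_divide_zero)
      also have "(LINT x|lborel. ift (\<lambda>\<xi>. complex_of_real ((\<Gamma> k \<xi>)\<^sup>2) * fourier u \<xi>) x * cnj (u x)) =
          (LINT \<xi>|lborel. complex_of_real ((\<Gamma> k \<xi>)\<^sup>2) * fourier u \<xi> * cnj (ift u (- \<xi>)))"
        by (rule ift_multiplication_formula[OF rapid_integrable[OF rapid_symbol[OF pg2 u]] test_fun_integrable[OF u]])
      also have "\<dots> = (LINT \<xi>|lborel. complex_of_real ((\<Gamma> k \<xi>)\<^sup>2 * (norm (fourier u \<xi>))\<^sup>2))"
        unfolding of_real_mult complex_norm_square mult.assoc by (simp add: fourier_eq_ift)
      also have "\<dots> = complex_of_real ?I" by (rule integral_complex_of_real)
      finally show ?thesis by simp
    qed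
    \<comment> \<open>The trivial multiplier 1 reproduces \<open>u\<close>. Where \<open>u\<close>
      does not vanish \<open>w\<close> equals 1, so the weight disappears next to the unfiltered
      factor.\<close>
    have S1: "?S (\<lambda>p. (\<Gamma> k (fst p))\<^sup>2 * 1) / (complex_of_real ?c)\<^sup>2 = complex_of_real (?I / ?c)"
    proof -
      have "?W x * ?G2 x * cnj (multiplier (\<lambda>_. 1) u x) = ?G2 x * cnj (u x)" for x
      proof -
        show ?thesis
          using wu[rule_format, of x] by (cases "u x = 0") (auto simp: multiplier_one[OF u])
      qed
      then have e: "(LINT x|lborel. ?W x * ?G2 x * cnj (multiplier (\<lambda>_. 1) u x)) = (LINT x|lborel. ?G2 x * cnj (u x))"
        by (simp only:)
      show ?thesis
        unfolding multiplier_pairing[OF W pg2 poly_growth_one u u, symmetric] e G2u ..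
    qed
    have S2: "?S (\<lambda>p. 1 * (\<Gamma> k (snd p))\<^sup>2) / (complex_of_real ?c)\<^sup>2 = complex_of_real (?I / ?c)"
    proof -
      have "?W x * multiplier (\<lambda>_. 1) u x * cnj (?G2 x) = cnj (?G2 x * cnj (u x))"
        for x using wu[rule_format, of x] by (cases "u x = 0") (auto simp: multiplier_one[OF u])
      then have "(LINT x|lborel. ?W x * multiplier (\<lambda>_. 1) u x * cnj (?G2 x)) = cnj (LINT x|lborel. ?G2 x * cnj (u x))"
        by (simp only: Bochner_Integration.integral_cnj)
      then show ?thesis
        unfolding multiplier_pairing[OF W poly_growth_one pg2 u u, symmetric] G2u by simp
    qed
    let ?s = "\<lambda>p::(real^'m) \<times> (real^'m). (\<Gamma> k (fst p) - \<Gamma> k (snd p))\<^sup>2"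
    have Ss: "?S ?s = ?S (\<lambda>p. (\<Gamma> k (fst p))\<^sup>2 * 1) + ?S (\<lambda>p. 1 * (\<Gamma> k (snd p))\<^sup>2) - 2 * ?S (\<lambda>p. \<Gamma> k (fst p) * \<Gamma> k (snd p))"
    proof -
      let ?U = "\<lambda>p. fourier u (fst p) * cnj (fourier u (snd p)) * ift ?W (fst p - snd p)"
      note i1 = symbol_pairing_integrable[OF W pg2 poly_growth_one u u]
        and i2 = symbol_pairing_integrable[OF W poly_growth_one pg2 u u] and i3 = symbol_pairing_integrable[OF W pg pg u u]
      have "?S ?s = (LINT p|(lborel \<Otimes>\<^sub>M lborel). complex_of_real ((\<Gamma> k (fst p))\<^sup>2 * 1) * ?U p
          + complex_of_real (1 * (\<Gamma> k (snd p))\<^sup>2) * ?U p - 2 * (complex_of_real (\<Gamma> k (fst p) * \<Gamma> k (snd p)) * ?U p))"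
        unfolding symbol_pairing_def
        by (intro Bochner_Integration.integral_cong refl) (simp add: power2_diff algebra_simps)
      also have "\<dots> = (LINT p|(lborel \<Otimes>\<^sub>M lborel). complex_of_real ((\<Gamma> k (fst p))\<^sup>2 * 1) * ?U p)
          + (LINT p|(lborel \<Otimes>\<^sub>M lborel). complex_of_real (1 * (\<Gamma> k (snd p))\<^sup>2) * ?U p)
          - (LINT p|(lborel \<Otimes>\<^sub>M lborel). 2 * (complex_of_real (\<Gamma> k (fst p) * \<Gamma> k (snd p)) * ?U p))"
        using Bochner_Integration.integral_diff[OF Bochner_Integration.integrable_add[OF i1 i2] integrable_mult_right[OF i3, of 2]]
          Bochner_Integration.integral_add[OF i1 i2] by (simp only:)
      finally show ?thesis unfolding symbol_pairing_def integral_mult_right_zero .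
    qed
    have "complex_of_real (LINT x|lborel. w x * (norm (?G x))\<^sup>2) = complex_of_real (?I / ?c) - ?S ?s / (complex_of_real ?c)\<^sup>2 / 2"
    proof -
      have "s3 / q = i - s / q / 2" if "s1 / q = i" "s2 / q = i" "s = s1 + s2 - 2 * s3" for s1 s2 s3 s q i :: complex
      proof -
        have "s / q = s1 / q + s2 / q - 2 * (s3 / q)" unfolding that(3) by (simp add: add_divide_distrib diff_divide_distrib)
        then show ?thesis unfolding that(1,2) by (simp add: diff_divide_distrib)
      qed
      from this[OF S1 S2 Ss] show ?thesis unfolding wG .
    qed
    then have "(LINT x|lborel. w x * (norm (?G x))\<^sup>2) = Re (complex_of_real (?I / ?c) - ?S ?s / (complex_of_real ?c)\<^sup>2 / 2)"
      by (metis Re_complex_of_real)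
    also have "\<dots> = ?I / ?c - Re (?S ?s) / ?c\<^sup>2 / 2"
      by (simp only: minus_complex.simps Re_complex_of_real of_real_power[symmetric] Re_divide_of_real Re_divide_numeral)
    \<comment> \<open>The term \<open>?I / ?c\<close> is the unweighted energy by the Plancherel
      identity; it cancels exactly, and only the squared difference is left.\<close>
    finally have "(LINT x|lborel. (1 - w x) * (norm (?G x))\<^sup>2) = Re (?S ?s) / ?c\<^sup>2 / 2"
      using iG iwG multiplier_plancherel[OF pg u cont[OF k]] by (simp add: left_diff_distrib)
    also have "\<dots> \<le> norm (?S ?s) / ?c\<^sup>2 / 2"
      by (intro divide_right_mono complex_Re_le_cmod) auto
    also have "\<dots> \<le> (D * (L / 2 ^ k)\<^sup>2 * ((LINT x|lborel. (norm (u x))\<^sup>2) + (LINT x|lborel. (norm (u x))\<^sup>2))) / ?c\<^sup>2 / 2"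
    proof (intro divide_right_mono D[OF u u])
      fix p :: "(real^'m) \<times> (real^'m)"
      have "\<bar>\<Gamma> k (fst p) - \<Gamma> k (snd p)\<bar>\<^sup>2 \<le> (L / 2 ^ k * norm (fst p - snd p))\<^sup>2"
        by (intro power_mono lip[OF k]) auto
      then show "\<bar>?s p\<bar> \<le> (L / 2 ^ k)\<^sup>2 * (norm (fst p - snd p))\<^sup>2"
        by (simp only: power_mult_distrib power2_abs abs_power2)
    qed auto
    also have "\<dots> = D * L\<^sup>2 / ?c\<^sup>2 / 4 ^ k * (LINT x|lborel. (norm (u x))\<^sup>2)"
    proof -
      have "(2 ^ k)\<^sup>2 = (4 ^ k :: real)" by (simp flip: power_mult power_mult_distrib add: power2_eq_square)
      then show ?thesis by (simp add: power_divide mult_ac)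
    qed
    finally show "(LINT x|lborel. (1 - w x) * (norm (?G x))\<^sup>2) \<le> D * L\<^sup>2 / ?c\<^sup>2 / 4 ^ k * (LINT x|lborel. (norm (u x))\<^sup>2)" .
  qed
qed

end

lemma qform_scale: "qform T \<alpha> \<beta> (\<lambda>t. complex_of_real c * G t) w = c * qform T \<alpha> \<beta> G w"
proof -
  have "(\<Sum>t\<in>T. complex_of_real c * G t * w (\<alpha> t) * cnj (w (\<beta> t))) = complex_of_real c * (\<Sum>t\<in>T. G t * w (\<alpha> t) * cnj (w (\<beta> t)))"
    by (simp add: sum_distrib_left mult.assoc)
  then show ?thesis unfolding qform_def by simp
qed

section \<open>Summation over frequencies and the abstract weighted estimate\<close>

context dyadic_symbols
begin

text \<open>At a given frequency only boundedly many \<open>\<Gamma>\<^sub>k\<close> are nonzero and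
  they add up to 1, so one of them is bounded below, and its own term controls \<open>s\<close>. The
  condition on \<open>\<xi>\<close> ensures that every active index is at most
  \<open>K\<close>.\<close>

lemma symbol_bound_by_pieces:
  assumes \<xi>: "A * Lambda_symbol \<xi> \<le> 2 ^ K" and C1: "0 \<le> C1"
    and s: "\<And>k. 1 \<le> k \<Longrightarrow> \<Gamma> k \<xi> \<noteq> 0 \<Longrightarrow> s \<le> C1 * (1 + (b k)\<^sup>2)"
  shows "s \<le> C1 * (4 * A ^ 4) * (1 + (\<Sum>k\<in>{1..K}. (b k)\<^sup>2 * (\<Gamma> k \<xi>)\<^sup>2))"
proof -
  define act where "act = {k\<in>{1..K}. \<Gamma> k \<xi> \<noteq> 0}"
  have fa: "finite act" unfolding act_def by simp
  have l: "1 \<le> Lambda_symbol \<xi>" by (rule Lambda_ge_1)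
  have zero: "\<Gamma> (Suc k) \<xi> = 0" if "k \<notin> {..<K}" for k
  proof (rule ccontr)
    assume "\<Gamma> (Suc k) \<xi> \<noteq> 0"
    then have "(2::real) ^ Suc k \<le> A * Lambda_symbol \<xi>" by (intro supp) auto
    with \<xi> have "(2::real) ^ Suc k \<le> 2 ^ K" by linarith
    then have "Suc k \<le> K" by (rule power_le_imp_le_exp[rotated]) simp
    with that show False by simp
  qed
  have "(\<lambda>k. \<Gamma> (Suc k) \<xi>) sums (\<Sum>k<K. \<Gamma> (Suc k) \<xi>)"
    by (rule sums_finite) (use zero in auto)
  then have "(\<Sum>k\<in>{1..K}. \<Gamma> k \<xi>) = 1"
    using sums_unique2[OF sums_1] by (simp add: sum.atLeast1_atMost_eq)
  moreover have "(\<Sum>k\<in>{1..K}. \<Gamma> k \<xi>) = (\<Sum>k\<in>act. \<Gamma> k \<xi>)"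
    unfolding act_def by (rule sum.mono_neutral_right) auto
  ultimately have sum1: "(\<Sum>k\<in>act. \<Gamma> k \<xi>) = 1" by simp
  then have ne: "act \<noteq> {}" by auto
  then have card: "0 < card act" using fa by (simp add: card_gt_0_iff)
  \<comment> \<open>Active indices satisfy
    \<open>\<Lambda> / A \<le> 2 ^ k \<le> A \<Lambda>\<close>. A sum of distinct powers of 2 is at
    most twice the largest one, so \<open>card act\<close> times \<open>\<Lambda> / A\<close> is at
    most \<open>2 A \<Lambda>\<close>.\<close>
  have cb: "real (card act) \<le> 2 * A\<^sup>2"
  proof -
    have m: "Max act \<in> act" using fa ne by (rule Max_in)
    have "real (card act) * (Lambda_symbol \<xi> / A) \<le> (\<Sum>k\<in>act. 2 ^ k)"
    proof (rule sum_bounded_below)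
      fix k assume "k \<in> act"
      then have "Lambda_symbol \<xi> \<le> A * 2 ^ k" unfolding act_def by (intro supp(2)) auto
      then show "Lambda_symbol \<xi> / A \<le> 2 ^ k" using A by (simp add: field_simps)
    qed
    also have "\<dots> \<le> (\<Sum>k\<in>{..Max act}. 2 ^ k)" using fa by (intro sum_mono2) auto
    also have "(\<Sum>k\<in>{..n}. (2::real) ^ k) \<le> 2 * 2 ^ n" for n by (induction n) auto
    also have "(2::real) * 2 ^ Max act \<le> 2 * (A * Lambda_symbol \<xi>)"
      using m unfolding act_def by (intro mult_left_mono supp(1)) auto
    finally have "real (card act) * Lambda_symbol \<xi> \<le> 2 * A\<^sup>2 * Lambda_symbol \<xi>"
      using A by (simp add: field_simps power2_eq_square)
    then show ?thesis using l by (simp add: mult_le_cancel_right)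
  qed
  have "\<exists>k\<in>act. 1 / real (card act) \<le> \<Gamma> k \<xi>"
  proof (rule ccontr)
    assume "\<not> ?thesis"
    then have "(\<Sum>k\<in>act. \<Gamma> k \<xi>) < (\<Sum>k\<in>act. 1 / real (card act))"
      using fa ne by (intro sum_strict_mono) auto
    with sum1 card show False by simp
  qed
  then obtain k where k: "k \<in> act" "1 / real (card act) \<le> \<Gamma> k \<xi>" by blast
  have k1: "1 \<le> k" "k \<in> {1..K}" "\<Gamma> k \<xi> \<noteq> 0" using k(1) unfolding act_def by auto
  have G0: "0 \<le> \<Gamma> k \<xi>" by (rule nonneg[OF k1(1)])
  have "1 \<le> real (card act) * \<Gamma> k \<xi>" using k(2) card by (simp add: field_simps)
  also have "\<dots> \<le> 2 * A\<^sup>2 * \<Gamma> k \<xi>" using cb G0 by (rule mult_right_mono)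
  finally have "1\<^sup>2 \<le> (2 * A\<^sup>2 * \<Gamma> k \<xi>)\<^sup>2" by (intro power_mono) auto
  \<comment> \<open>The constant \<open>4 * A ^ 4\<close> is the square of the bound
    \<open>2 * A\<^sup>2\<close> on the number of active indices.\<close>
  then have G1: "1 \<le> 4 * A ^ 4 * (\<Gamma> k \<xi>)\<^sup>2" by (simp add: power_mult_distrib flip: power_mult)
  have A4: "1 \<le> 4 * A ^ 4" using one_le_power[OF A, of 4] by simp
  have "(b k)\<^sup>2 \<le> 4 * A ^ 4 * (\<Gamma> k \<xi>)\<^sup>2 * (b k)\<^sup>2" using mult_right_mono[OF G1, of "(b k)\<^sup>2"] by simp
  then have "1 + (b k)\<^sup>2 \<le> 4 * A ^ 4 * (1 + (b k)\<^sup>2 * (\<Gamma> k \<xi>)\<^sup>2)"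
    using A4 by (simp add: algebra_simps)
  also have "\<dots> \<le> 4 * A ^ 4 * (1 + (\<Sum>k\<in>{1..K}. (b k)\<^sup>2 * (\<Gamma> k \<xi>)\<^sup>2))"
    using A4 k1(2) by (intro mult_left_mono add_left_mono member_le_sum) auto
  finally have "C1 * (1 + (b k)\<^sup>2) \<le> C1 * (4 * A ^ 4 * (1 + (\<Sum>k\<in>{1..K}. (b k)\<^sup>2 * (\<Gamma> k \<xi>)\<^sup>2)))"
    using C1 by (rule mult_left_mono)
  then show ?thesis using s[OF k1(1,3)] by (simp add: mult.assoc)
qed

text \<open>The right-hand side is the energy of order one half, independent of \<open>K\<close> and
  finite for test functions. With \<open>(b k)\<^sup>2 \<le> 2 ^ k\<close> it makes the series over
  the weights absolutely convergent.\<close>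

lemma dyadic_pieces_summable_bound:
  assumes u: "test_fun u"
  shows "(\<Sum>k\<in>{1..K}. 2 ^ k * (LINT x|lborel. (norm (multiplier (\<Gamma> k) u x))\<^sup>2)) \<le>
    (LINT \<xi>|lborel. A * ((Lambda_symbol \<xi> powr (1/2))\<^sup>2 * (norm (fourier u \<xi>))\<^sup>2)) / (2 * pi) ^ CARD('m)"
proof -
  let ?c = "(2 * pi) ^ CARD('m) :: real"
  have i: "integrable lborel (\<lambda>\<xi>. 2 ^ k * ((\<Gamma> k \<xi>)\<^sup>2 * (norm (fourier u \<xi>))\<^sup>2))" if "k \<in> {1..K}" for k
    using that by (intro integrable_mult_right symbol_square_integrable[OF poly_growth_\<Gamma> u]) auto
  have "(\<Sum>k\<in>{1..K}. 2 ^ k * (LINT x|lborel. (norm (multiplier (\<Gamma> k) u x))\<^sup>2)) \<le>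
      (\<Sum>k\<in>{1..K}. 2 ^ k * ((LINT \<xi>|lborel. (\<Gamma> k \<xi>)\<^sup>2 * (norm (fourier u \<xi>))\<^sup>2) / ?c))"
    by (intro sum_mono mult_left_mono multiplier_bessel(2)[OF poly_growth_\<Gamma> u]) auto
  also have "\<dots> = (LINT \<xi>|lborel. (\<Sum>k\<in>{1..K}. 2 ^ k * ((\<Gamma> k \<xi>)\<^sup>2 * (norm (fourier u \<xi>))\<^sup>2))) / ?c"
    by (subst Bochner_Integration.integral_sum[OF i], assumption) (simp add: sum_divide_distrib)
  also have "\<dots> \<le> (LINT \<xi>|lborel. A * ((Lambda_symbol \<xi> powr (1/2))\<^sup>2 * (norm (fourier u \<xi>))\<^sup>2)) / ?c"
  proof (intro divide_right_mono integral_mono Bochner_Integration.integrable_sum i integrable_mult_right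
      symbol_square_integrable[OF poly_growth_Lambda_half u])
    fix \<xi> :: "real^'m"
    have "(\<Sum>k\<in>{1..K}. 2 ^ k * ((\<Gamma> k \<xi>)\<^sup>2 * (norm (fourier u \<xi>))\<^sup>2)) = (\<Sum>k\<in>{1..K}. 2 ^ k * (\<Gamma> k \<xi>)\<^sup>2) * (norm (fourier u \<xi>))\<^sup>2"
      by (simp add: sum_distrib_right mult.assoc)
    also have "\<dots> \<le> A * Lambda_symbol \<xi> * (norm (fourier u \<xi>))\<^sup>2"
      by (intro mult_right_mono weighted_square_sum_le) auto
    also have "\<dots> = A * ((Lambda_symbol \<xi> powr (1/2))\<^sup>2 * (norm (fourier u \<xi>))\<^sup>2)"
      using Lambda_ge_1[of \<xi>] by (simp add: powr_half_sqrt)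
    finally show "(\<Sum>k\<in>{1..K}. 2 ^ k * ((\<Gamma> k \<xi>)\<^sup>2 * (norm (fourier u \<xi>))\<^sup>2)) \<le> A * ((Lambda_symbol \<xi> powr (1/2))\<^sup>2 * (norm (fourier u \<xi>))\<^sup>2)" .
  qed auto
  finally show ?thesis .
qed

text \<open>Truncation to frequencies with \<open>A \<Lambda> \<le> 2 ^ K\<close> matches the
  truncation of the sum at \<open>K\<close>: below it the first \<open>K\<close> pieces already make
  up the whole partition of unity.\<close>

lemma symbol_energy_bound:
  assumes u: "test_fun u" and \<sigma>: "poly_growth \<sigma>" and C1: "0 \<le> C1"
    and s: "\<And>k \<xi>. 1 \<le> k \<Longrightarrow> \<Gamma> k \<xi> \<noteq> 0 \<Longrightarrow> (\<sigma> \<xi>)\<^sup>2 \<le> C1 * (1 + (b k)\<^sup>2)"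
  shows "(LINT \<xi>|lborel. indicator {\<xi>. A * Lambda_symbol \<xi> \<le> 2 ^ K} \<xi> * ((\<sigma> \<xi>)\<^sup>2 * (norm (fourier u \<xi>))\<^sup>2)) / (2 * pi) ^ CARD('m) \<le>
    C1 * (4 * A ^ 4) * ((LINT x|lborel. (norm (u x))\<^sup>2) + (\<Sum>k\<in>{1..K}. (b k)\<^sup>2 * (LINT x|lborel. (norm (multiplier (\<Gamma> k) u x))\<^sup>2)))"
proof -
  let ?c = "(2 * pi) ^ CARD('m) :: real"
  let ?C = "C1 * (4 * A ^ 4)"
  have C: "0 \<le> ?C" using C1 A by simp
  have i: "integrable lborel (\<lambda>\<xi>. (b k)\<^sup>2 * ((\<Gamma> k \<xi>)\<^sup>2 * (norm (fourier u \<xi>))\<^sup>2))" if "k \<in> {1..K}" for k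
    using that by (intro integrable_mult_right symbol_square_integrable[OF poly_growth_\<Gamma> u]) auto
  have i0: "integrable lborel (\<lambda>\<xi>. (norm (fourier u \<xi>))\<^sup>2)" by (rule rapid_square_integrable[OF rapid_fourier[OF u]])
  have i2: "integrable lborel (\<lambda>\<xi>. \<Sum>k\<in>{1..K}. (b k)\<^sup>2 * ((\<Gamma> k \<xi>)\<^sup>2 * (norm (fourier u \<xi>))\<^sup>2))"
    by (rule Bochner_Integration.integrable_sum[OF i])
  have "(LINT \<xi>|lborel. indicator {\<xi>. A * Lambda_symbol \<xi> \<le> 2 ^ K} \<xi> * ((\<sigma> \<xi>)\<^sup>2 * (norm (fourier u \<xi>))\<^sup>2))
    \<le> (LINT \<xi>|lborel. ?C * ((norm (fourier u \<xi>))\<^sup>2 + (\<Sum>k\<in>{1..K}. (b k)\<^sup>2 * ((\<Gamma> k \<xi>)\<^sup>2 * (norm (fourier u \<xi>))\<^sup>2))))"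
  proof (rule integral_mono_AE')
    show "integrable lborel (\<lambda>\<xi>. ?C * ((norm (fourier u \<xi>))\<^sup>2 + (\<Sum>k\<in>{1..K}. (b k)\<^sup>2 * ((\<Gamma> k \<xi>)\<^sup>2 * (norm (fourier u \<xi>))\<^sup>2))))"
      by (intro integrable_mult_right Bochner_Integration.integrable_add i0 i2)
    have le: "indicator {\<xi>. A * Lambda_symbol \<xi> \<le> 2 ^ K} \<xi> * ((\<sigma> \<xi>)\<^sup>2 * (norm (fourier u \<xi>))\<^sup>2) \<le>
        ?C * ((norm (fourier u \<xi>))\<^sup>2 + (\<Sum>k\<in>{1..K}. (b k)\<^sup>2 * ((\<Gamma> k \<xi>)\<^sup>2 * (norm (fourier u \<xi>))\<^sup>2)))" for \<xi>
    proof (cases "A * Lambda_symbol \<xi> \<le> 2 ^ K")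
      case True
      have "(\<sigma> \<xi>)\<^sup>2 * (norm (fourier u \<xi>))\<^sup>2 \<le> (?C * (1 + (\<Sum>k\<in>{1..K}. (b k)\<^sup>2 * (\<Gamma> k \<xi>)\<^sup>2))) * (norm (fourier u \<xi>))\<^sup>2"
        by (intro mult_right_mono symbol_bound_by_pieces[OF True C1] s) auto
      also have "\<dots> = ?C * ((norm (fourier u \<xi>))\<^sup>2 + (\<Sum>k\<in>{1..K}. (b k)\<^sup>2 * ((\<Gamma> k \<xi>)\<^sup>2 * (norm (fourier u \<xi>))\<^sup>2)))"
        by (simp only: distrib_right distrib_left mult.assoc mult_1_left sum_distrib_right)
      finally show ?thesis using True by simp
    next
      case False
      have "0 \<le> ?C * ((norm (fourier u \<xi>))\<^sup>2 + (\<Sum>k\<in>{1..K}. (b k)\<^sup>2 * ((\<Gamma> k \<xi>)\<^sup>2 * (norm (fourier u \<xi>))\<^sup>2)))"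
        by (intro mult_nonneg_nonneg[OF C] add_nonneg_nonneg sum_nonneg mult_nonneg_nonneg) auto
      then show ?thesis using False by simp
    qed
    show "AE \<xi> in lborel. indicator {\<xi>. A * Lambda_symbol \<xi> \<le> 2 ^ K} \<xi> * ((\<sigma> \<xi>)\<^sup>2 * (norm (fourier u \<xi>))\<^sup>2) \<le>
        ?C * ((norm (fourier u \<xi>))\<^sup>2 + (\<Sum>k\<in>{1..K}. (b k)\<^sup>2 * ((\<Gamma> k \<xi>)\<^sup>2 * (norm (fourier u \<xi>))\<^sup>2)))"
      using le by simp
    show "AE \<xi> in lborel. 0 \<le> ?C * ((norm (fourier u \<xi>))\<^sup>2 + (\<Sum>k\<in>{1..K}. (b k)\<^sup>2 * ((\<Gamma> k \<xi>)\<^sup>2 * (norm (fourier u \<xi>))\<^sup>2)))"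
      by (intro always_eventually allI mult_nonneg_nonneg[OF C] add_nonneg_nonneg sum_nonneg mult_nonneg_nonneg) auto
  qed
  also have "\<dots> = ?C * ((LINT \<xi>|lborel. (norm (fourier u \<xi>))\<^sup>2) + (\<Sum>k\<in>{1..K}. (b k)\<^sup>2 * (LINT \<xi>|lborel. (\<Gamma> k \<xi>)\<^sup>2 * (norm (fourier u \<xi>))\<^sup>2)))"
    unfolding integral_mult_right_zero Bochner_Integration.integral_add[OF i0 i2]
    by (subst Bochner_Integration.integral_sum[OF i], assumption) (simp only: integral_mult_right_zero)
  also have "(\<Sum>k\<in>{1..K}. (b k)\<^sup>2 * (LINT \<xi>|lborel. (\<Gamma> k \<xi>)\<^sup>2 * (norm (fourier u \<xi>))\<^sup>2)) =
      ?c * (\<Sum>k\<in>{1..K}. (b k)\<^sup>2 * (LINT x|lborel. (norm (multiplier (\<Gamma> k) u x))\<^sup>2))"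
    unfolding sum_distrib_left
    by (rule sum.cong[OF refl], subst multiplier_plancherel[OF poly_growth_\<Gamma> u cont]) auto
  also have "?C * ((LINT \<xi>|lborel. (norm (fourier u \<xi>))\<^sup>2) + \<dots>) \<le>
      ?C * (?c * (LINT x|lborel. (norm (u x))\<^sup>2) + ?c * (\<Sum>k\<in>{1..K}. (b k)\<^sup>2 * (LINT x|lborel. (norm (multiplier (\<Gamma> k) u x))\<^sup>2)))"
    by (intro mult_left_mono add_right_mono fourier_bessel u C)
  also have "\<dots> = (?C * ((LINT x|lborel. (norm (u x))\<^sup>2) + (\<Sum>k\<in>{1..K}. (b k)\<^sup>2 * (LINT x|lborel. (norm (multiplier (\<Gamma> k) u x))\<^sup>2)))) * ?c"
    by (simp only: distrib_left distrib_right mult_ac)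
  finally show ?thesis by (subst pos_divide_le_eq) auto
qed

text \<open>The analytic core, free of geometry. \<open>C\<close> and \<open>P k\<close> hold the
  coefficients of the Levi form and of the weights, and \<open>B\<close> is where the pointwise
  lower bound is known. The cutoff \<open>\<rho>\<close> makes the coefficients \<open>C\<close>
  test functions without changing them on \<open>B\<close>, and \<open>w\<close>, supported in
  \<open>B\<close> and neutral on \<open>v\<close>, measures how much of
  \<open>\<Gamma>\<^sub>k v\<close> escapes from \<open>B\<close>.\<close>

theorem weighted_estimate:
  fixes C :: "'t \<Rightarrow> real^'m \<Rightarrow> complex" and P :: "nat \<Rightarrow> 't \<Rightarrow> real^'m \<Rightarrow> complex" and J :: "'j set"
    and \<alpha> \<beta> :: "'t \<Rightarrow> 'j" and b :: "nat \<Rightarrow> real" and \<sigma> \<rho> w :: "real^'m \<Rightarrow> real"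
  assumes fin: "finite T" "finite J" "\<alpha> ` T \<subseteq> J" "\<beta> ` T \<subseteq> J"
    and C: "\<And>t. t \<in> T \<Longrightarrow> C t \<in> borel_measurable borel" "\<And>t x. t \<in> T \<Longrightarrow> norm (C t x) \<le> D"
      "\<And>x y. 0 \<le> qform T \<alpha> \<beta> (\<lambda>t. C t x) y"
    and P: "\<And>k t. 1 \<le> k \<Longrightarrow> t \<in> T \<Longrightarrow> P k t \<in> borel_measurable borel"
      "\<And>k t x. 1 \<le> k \<Longrightarrow> t \<in> T \<Longrightarrow> norm (P k t x) \<le> D * (b k)\<^sup>2"
    and D: "0 \<le> D"
    and b: "\<And>k. 1 \<le> k \<Longrightarrow> (b k)\<^sup>2 \<le> 2 ^ k"
    and B: "\<And>k x y. 1 \<le> k \<Longrightarrow> x \<in> B \<Longrightarrow> c0 * (b k)\<^sup>2 * (\<Sum>j\<in>J. (norm (y j))\<^sup>2)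
        \<le> M * 2 ^ k * qform T \<alpha> \<beta> (\<lambda>t. C t x) y + qform T \<alpha> \<beta> (\<lambda>t. P k t x) y"
    and c0: "0 < c0" and M: "0 \<le> M"
    and \<rho>: "\<And>x. 0 \<le> \<rho> x" "\<And>x. \<rho> x \<le> 1" "\<And>x. x \<in> B \<Longrightarrow> \<rho> x = 1"
      "\<And>t. t \<in> T \<Longrightarrow> test_fun (\<lambda>x. complex_of_real (\<rho> x) * C t x)"
    and w: "test_fun w" "\<And>x. 0 \<le> w x" "\<And>x. w x \<le> 1" "\<And>x. x \<notin> B \<Longrightarrow> w x = 0"
    and \<sigma>: "poly_growth \<sigma>" "\<And>k \<xi>. 1 \<le> k \<Longrightarrow> \<Gamma> k \<xi> \<noteq> 0 \<Longrightarrow> (\<sigma> \<xi>)\<^sup>2 \<le> C1 * (1 + (b k)\<^sup>2)" "0 < C1"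
  shows "\<exists>e0>0. \<forall>e. 0 < e \<longrightarrow> e \<le> e0 \<longrightarrow> (\<exists>C'>0. \<forall>v. (\<forall>j\<in>J. test_fun (v j) \<and> (\<forall>x. complex_of_real (w x) * v j x = v j x)) \<longrightarrow>
    summable (\<lambda>k. LINT x|lborel. qform T \<alpha> \<beta> (\<lambda>t. complex_of_real e * P (Suc k) t x) (\<lambda>j. multiplier (\<Gamma> (Suc k)) (v j) x)) \<and>
    (\<Sum>j\<in>J. LINT x|lborel. (norm (multiplier \<sigma> (v j) x))\<^sup>2) \<le>
      C' * ((LINT x|lborel. qform T \<alpha> \<beta> (\<lambda>t. C t x) (\<lambda>j. multiplier (\<lambda>\<xi>. Lambda_symbol \<xi> powr (1/2)) (v j) x))
        + (\<Sum>k. LINT x|lborel. qform T \<alpha> \<beta> (\<lambda>t. complex_of_real e * P (Suc k) t x) (\<lambda>j. multiplier (\<Gamma> (Suc k)) (v j) x))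
        + (\<Sum>j\<in>J. LINT x|lborel. (norm (v j x))\<^sup>2)))"
proof -
  let ?l = "\<lambda>\<xi>::real^'m. Lambda_symbol \<xi> powr (1/2)"
  let ?c = "(2 * pi) ^ CARD('m) :: real"
  let ?g = "\<lambda>t x. complex_of_real (\<rho> x) * C t x"
  let ?q = "\<lambda>G y. qform T \<alpha> \<beta> G y"
  have gnn: "0 \<le> ?q (\<lambda>t. ?g t x) y" for x y
    unfolding qform_scale by (intro mult_nonneg_nonneg \<rho> C)
  obtain C4 where C4: "0 \<le> C4" and gard: "\<And>v K. (\<And>j. j \<in> J \<Longrightarrow> test_fun (v j)) \<Longrightarrow>
     (\<Sum>k\<in>{1..K}. 2 ^ k * (LINT x|lborel. ?q (\<lambda>t. ?g t x) (\<lambda>j. multiplier (\<Gamma> k) (v j) x)))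
     \<le> C4 * ((LINT x|lborel. ?q (\<lambda>t. ?g t x) (\<lambda>j. multiplier ?l (v j) x)) + (\<Sum>j\<in>J. LINT x|lborel. (norm (v j x))\<^sup>2))"
    using garding[OF fin \<rho>(4) gnn] by blast
  obtain C2 where C2: "0 \<le> C2" and loc: "\<And>u k. test_fun u \<Longrightarrow> (\<And>x. complex_of_real (w x) * u x = u x) \<Longrightarrow> 1 \<le> k \<Longrightarrow>
     (LINT x|lborel. (1 - w x) * (norm (multiplier (\<Gamma> k) u x))\<^sup>2) \<le> C2 / 4 ^ k * (LINT x|lborel. (norm (u x))\<^sup>2)"
    using pseudolocal[OF w(1)] by blast
  \<comment> \<open>Off \<open>B\<close> nothing is known about the sign of the weight form: there
    \<open>D'\<close> pays both for the claimed lower bound \<open>c0\<close> and for the worst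
    negative value of that form.\<close>
  define D' where "D' = c0 + D * card T"
  have D': "0 \<le> D'" unfolding D'_def using c0 D by simp
  define E where "E = M * C4 + D' * C2"
  have E: "0 \<le> E" unfolding E_def using M C4 D' C2 by simp
  have pointwise: "c0 * (b k)\<^sup>2 * (\<Sum>j\<in>J. (norm (y j))\<^sup>2) - D' * (b k)\<^sup>2 * ((1 - w x) * (\<Sum>j\<in>J. (norm (y j))\<^sup>2))
        \<le> M * 2 ^ k * ?q (\<lambda>t. ?g t x) y + ?q (\<lambda>t. P k t x) y" if k: "1 \<le> k" for k x y
  proof (cases "x \<in> B")
    case True
    have "0 \<le> D' * (b k)\<^sup>2 * ((1 - w x) * (\<Sum>j\<in>J. (norm (y j))\<^sup>2))"
      using w(3)[of x] D' by (intro mult_nonneg_nonneg sum_nonneg) auto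
    then show ?thesis using B[OF k True, of y] \<rho>(3)[OF True] by simp
  next
    case False
    have "\<bar>?q (\<lambda>t. P k t x) y\<bar> \<le> D * (b k)\<^sup>2 * card T * (\<Sum>j\<in>J. (norm (y j))\<^sup>2)"
      by (rule qform_bound[OF fin P(2)[OF k]])
    moreover have "0 \<le> M * 2 ^ k * ?q (\<lambda>t. ?g t x) y" using M gnn by simp
    ultimately show ?thesis using w(4)[OF False] unfolding D'_def by (simp add: algebra_simps abs_le_iff)
  qed
  show ?thesis
  \<comment> \<open>With this bound on \<open>e\<close>, the term in
    \<open>\<Lambda>\<^sup>1\<^sup>/\<^sup>2 v\<close> gets coefficient at most 1 and the error in
    the norm at most one half, while the sum over the weights keeps coefficient exactly 1, as its
    missing sign demands.\<close>
  proof (rule exI[of _ "1 / (2 * E + 1)"], rule conjI, rule_tac[2] allI, rule_tac[2] impI, rule_tac[2] impI)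
    show "0 < 1 / (2 * E + 1)" using E by (simp add: add_nonneg_pos)
    fix e :: real assume e: "0 < e" "e \<le> 1 / (2 * E + 1)"
    have "e * (2 * E + 1) \<le> 1" using e(2) E by (simp add: field_simps)
    then have eE: "e * E \<le> 1 / 2" using e(1) by (simp add: algebra_simps)
    have eM: "e * M * C4 \<le> 1"
    proof -
      have "e * M * C4 \<le> e * E" unfolding E_def using e D' C2 by (simp add: distrib_left)
      then show ?thesis using eE by simp
    qed
    define C6 where "C6 = C1 * (4 * A ^ 4)"
    have C6: "0 < C6" unfolding C6_def using \<sigma>(3) A by simp
    show "\<exists>C'>0. \<forall>v. (\<forall>j\<in>J. test_fun (v j) \<and> (\<forall>x. complex_of_real (w x) * v j x = v j x)) \<longrightarrow>
    summable (\<lambda>k. LINT x|lborel. ?q (\<lambda>t. complex_of_real e * P (Suc k) t x) (\<lambda>j. multiplier (\<Gamma> (Suc k)) (v j) x)) \<and>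
    (\<Sum>j\<in>J. LINT x|lborel. (norm (multiplier \<sigma> (v j) x))\<^sup>2) \<le>
      C' * ((LINT x|lborel. ?q (\<lambda>t. C t x) (\<lambda>j. multiplier ?l (v j) x))
        + (\<Sum>k. LINT x|lborel. ?q (\<lambda>t. complex_of_real e * P (Suc k) t x) (\<lambda>j. multiplier (\<Gamma> (Suc k)) (v j) x))
        + (\<Sum>j\<in>J. LINT x|lborel. (norm (v j x))\<^sup>2))"
    proof (rule exI[of _ "C6 * (2 + 1 / (e * c0))"], rule conjI, rule_tac[2] allI, rule_tac[2] impI)
      show "0 < C6 * (2 + 1 / (e * c0))" using C6 e(1) c0 by (intro mult_pos_pos add_pos_pos) auto
      fix v :: "'j \<Rightarrow> real^'m \<Rightarrow> complex"
      assume v0: "\<forall>j\<in>J. test_fun (v j) \<and> (\<forall>x. complex_of_real (w x) * v j x = v j x)"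
      then have v: "\<And>j. j \<in> J \<Longrightarrow> test_fun (v j)" and wv: "\<And>j x. j \<in> J \<Longrightarrow> complex_of_real (w x) * v j x = v j x" by auto
      define N where "N = (\<Sum>j\<in>J. LINT x|lborel. (norm (v j x))\<^sup>2)"
      define X where "X = (LINT x|lborel. ?q (\<lambda>t. C t x) (\<lambda>j. multiplier ?l (v j) x))"
      define Ip where "Ip = (\<lambda>k. LINT x|lborel. ?q (\<lambda>t. P k t x) (\<lambda>j. multiplier (\<Gamma> k) (v j) x))"
      define n where "n = (\<lambda>k. \<Sum>j\<in>J. LINT x|lborel. (norm (multiplier (\<Gamma> k) (v j) x))\<^sup>2)"
      have N0: "0 \<le> N" unfolding N_def by (intro sum_nonneg integral_nonneg_AE) auto
      have X0: "0 \<le> X" unfolding X_def by (intro integral_nonneg_AE) (use C(3) in auto)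
      have n0: "0 \<le> n k" for k unfolding n_def by (intro sum_nonneg integral_nonneg_AE) auto
      have Ie: "(LINT x|lborel. ?q (\<lambda>t. complex_of_real e * P k t x) (\<lambda>j. multiplier (\<Gamma> k) (v j) x)) = e * Ip k" for k
        unfolding qform_scale Ip_def by (rule integral_mult_right_zero)
      have mG: "multiplier (\<Gamma> k) (v j) \<in> borel_measurable borel" "integrable lborel (\<lambda>x. (norm (multiplier (\<Gamma> k) (v j) x))\<^sup>2)"
        if "1 \<le> k" "j \<in> J" for k j
        using that multiplier_measurable[OF poly_growth_\<Gamma> v] multiplier_bessel(1)[OF poly_growth_\<Gamma> v] by auto
      have iP: "integrable lborel (\<lambda>x. ?q (\<lambda>t. P k t x) (\<lambda>j. multiplier (\<Gamma> k) (v j) x))" if k: "1 \<le> k" for k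
        by (rule qform_integrable[OF fin P(1)[OF k] P(2)[OF k] mG(1)[OF k] mG(2)[OF k]])
      have gb: "norm (?g t x) \<le> D" if "t \<in> T" for t x
        using mult_mono[OF \<rho>(2) C(2)[OF that] _ norm_ge_zero, of x x] \<rho>(1)[of x] by (simp add: norm_mult)
      have iq: "integrable lborel (\<lambda>x. ?q (\<lambda>t. ?g t x) (\<lambda>j. multiplier (\<Gamma> k) (v j) x))" if k: "1 \<le> k" for k
        by (rule qform_integrable[OF fin test_fun_measurable[OF \<rho>(4)] gb mG(1)[OF k] mG(2)[OF k]])
      have iX: "integrable lborel (\<lambda>x. ?q (\<lambda>t. C t x) (\<lambda>j. multiplier ?l (v j) x))"
        by (rule qform_integrable[OF fin C(1,2) multiplier_measurable[OF poly_growth_Lambda_half v] multiplier_bessel(1)[OF poly_growth_Lambda_half v]])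
      have XX: "(LINT x|lborel. ?q (\<lambda>t. ?g t x) (\<lambda>j. multiplier ?l (v j) x)) \<le> X"
        unfolding X_def
      proof (rule integral_mono_AE'[OF iX])
        show "AE x in lborel. ?q (\<lambda>t. ?g t x) (\<lambda>j. multiplier ?l (v j) x) \<le> ?q (\<lambda>t. C t x) (\<lambda>j. multiplier ?l (v j) x)"
          unfolding qform_scale using \<rho>(1,2) C(3) by (intro always_eventually allI mult_left_le_one_le) auto
      qed (use C(3) in auto)
      have lower: "c0 * ((b k)\<^sup>2 * n k) \<le> M * (2 ^ k * (LINT x|lborel. ?q (\<lambda>t. ?g t x) (\<lambda>j. multiplier (\<Gamma> k) (v j) x))) + Ip k + D' * C2 * N * (1 / 2) ^ k"
        if k: "1 \<le> k" for k
      proof -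
        let ?m = "\<lambda>x j. multiplier (\<Gamma> k) (v j) x"
        obtain W where W: "\<And>x. norm (w x) \<le> W" using test_fun_bounded[OF w(1)] by blast
        have iw: "integrable lborel (\<lambda>x. (1 - w x) * (norm (?m x j))\<^sup>2)" if j: "j \<in> J" for j
        proof (rule Bochner_Integration.integrable_bound[OF mG(2)[OF k j]])
          note [measurable] = test_fun_measurable[OF w(1)] mG(1)[OF k j]
          show "(\<lambda>x. (1 - w x) * (norm (?m x j))\<^sup>2) \<in> borel_measurable lborel" by measurable
          show "AE x in lborel. norm ((1 - w x) * (norm (?m x j))\<^sup>2) \<le> norm ((norm (?m x j))\<^sup>2)"
            using w(2,3) by (intro always_eventually allI) (auto simp: abs_mult intro!: mult_left_le_one_le)
        qed
        have s1: "integrable lborel (\<lambda>x. \<Sum>j\<in>J. (norm (?m x j))\<^sup>2)"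
          by (intro Bochner_Integration.integrable_sum mG(2)[OF k])
        have s2: "integrable lborel (\<lambda>x. (1 - w x) * (\<Sum>j\<in>J. (norm (?m x j))\<^sup>2))"
          unfolding sum_distrib_left by (intro Bochner_Integration.integrable_sum iw)
        have "(LINT x|lborel. (1 - w x) * (\<Sum>j\<in>J. (norm (?m x j))\<^sup>2)) = (\<Sum>j\<in>J. LINT x|lborel. (1 - w x) * (norm (?m x j))\<^sup>2)"
          unfolding sum_distrib_left by (rule Bochner_Integration.integral_sum[OF iw])
        also have "\<dots> \<le> (\<Sum>j\<in>J. C2 / 4 ^ k * (LINT x|lborel. (norm (v j x))\<^sup>2))"
          by (intro sum_mono loc v wv k)
        also have "\<dots> = C2 / 4 ^ k * N" unfolding N_def by (simp add: sum_distrib_left)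
        finally have wN: "(LINT x|lborel. (1 - w x) * (\<Sum>j\<in>J. (norm (?m x j))\<^sup>2)) \<le> C2 / 4 ^ k * N" .
        have sn: "(LINT x|lborel. (\<Sum>j\<in>J. (norm (?m x j))\<^sup>2)) = n k"
          unfolding n_def by (rule Bochner_Integration.integral_sum[OF mG(2)[OF k]])
        have "c0 * (b k)\<^sup>2 * n k - D' * (b k)\<^sup>2 * (LINT x|lborel. (1 - w x) * (\<Sum>j\<in>J. (norm (?m x j))\<^sup>2)) =
            (LINT x|lborel. c0 * (b k)\<^sup>2 * (\<Sum>j\<in>J. (norm (?m x j))\<^sup>2) - D' * (b k)\<^sup>2 * ((1 - w x) * (\<Sum>j\<in>J. (norm (?m x j))\<^sup>2)))"
          using s1 s2 sn by simp
        also have "\<dots> \<le> (LINT x|lborel. M * 2 ^ k * ?q (\<lambda>t. ?g t x) (?m x) + ?q (\<lambda>t. P k t x) (?m x))"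
          by (rule integral_mono[OF Bochner_Integration.integrable_diff[OF integrable_mult_right[OF s1] integrable_mult_right[OF s2]]
                Bochner_Integration.integrable_add[OF integrable_mult_right[OF iq[OF k]] iP[OF k]] pointwise[OF k]])
        also have "\<dots> = M * (2 ^ k * (LINT x|lborel. ?q (\<lambda>t. ?g t x) (?m x))) + Ip k"
          unfolding Ip_def using iq[OF k] iP[OF k] by (simp add: mult.assoc)
        finally have "c0 * ((b k)\<^sup>2 * n k) \<le> M * (2 ^ k * (LINT x|lborel. ?q (\<lambda>t. ?g t x) (?m x))) + Ip k
            + D' * (b k)\<^sup>2 * (LINT x|lborel. (1 - w x) * (\<Sum>j\<in>J. (norm (?m x j))\<^sup>2))" by (simp add: mult.assoc)
        \<comment> \<open>The escape \<open>4\<^sup>-\<^sup>k\<close> beats the possible growth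
          \<open>2\<^sup>k\<close> of \<open>(b k)\<^sup>2\<close> and leaves a geometric
          series.\<close>
        also have "D' * (b k)\<^sup>2 * (LINT x|lborel. (1 - w x) * (\<Sum>j\<in>J. (norm (?m x j))\<^sup>2)) \<le> D' * 2 ^ k * (C2 / 4 ^ k * N)"
          using D' b[OF k] C2 N0 by (intro mult_mono wN integral_nonneg_AE always_eventually allI mult_nonneg_nonneg sum_nonneg)
            (auto simp: w(3))
        also have "D' * 2 ^ k * (C2 / 4 ^ k * N) = D' * C2 * N * (1 / 2) ^ k"
        proof -
          have "(4::real) ^ k = 2 ^ k * 2 ^ k" by (simp flip: power_mult_distrib)
          then show ?thesis by (simp add: power_divide)
        qed
        finally show ?thesis by simp
      qed
      have sumlower: "e * c0 * (\<Sum>k\<in>{1..K}. (b k)\<^sup>2 * n k) \<le> X + (\<Sum>k\<in>{1..K}. e * Ip k) + N / 2" for K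
      proof -
        have "c0 * (\<Sum>k\<in>{1..K}. (b k)\<^sup>2 * n k) \<le>
            (\<Sum>k\<in>{1..K}. M * (2 ^ k * (LINT x|lborel. ?q (\<lambda>t. ?g t x) (\<lambda>j. multiplier (\<Gamma> k) (v j) x))) + Ip k + D' * C2 * N * (1 / 2) ^ k)"
          unfolding sum_distrib_left by (intro sum_mono lower) auto
        also have "\<dots> = M * (\<Sum>k\<in>{1..K}. 2 ^ k * (LINT x|lborel. ?q (\<lambda>t. ?g t x) (\<lambda>j. multiplier (\<Gamma> k) (v j) x)))
            + (\<Sum>k\<in>{1..K}. Ip k) + D' * C2 * N * (\<Sum>k\<in>{1..K}. (1 / 2) ^ k)"
          by (simp only: sum.distrib sum_distrib_left)
        also have "\<dots> \<le> M * (C4 * (X + N)) + (\<Sum>k\<in>{1..K}. Ip k) + D' * C2 * N * 1"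
        proof (intro add_mono order_refl mult_left_mono M)
          have "C4 * ((LINT x|lborel. ?q (\<lambda>t. ?g t x) (\<lambda>j. multiplier ?l (v j) x)) + N) \<le> C4 * (X + N)"
            using XX C4 by (intro mult_left_mono) auto
          then show "(\<Sum>k\<in>{1..K}. 2 ^ k * (LINT x|lborel. ?q (\<lambda>t. ?g t x) (\<lambda>j. multiplier (\<Gamma> k) (v j) x))) \<le> C4 * (X + N)"
            using gard[where v=v and K=K, OF v] unfolding N_def by linarith
          have "(\<Sum>k\<in>{1..K}. (1 / 2 :: real) ^ k) = 1 - (1 / 2) ^ K" by (induction K) (auto simp: field_simps)
          then show "(\<Sum>k\<in>{1..K}. (1 / 2 :: real) ^ k) \<le> 1" by simp
          show "0 \<le> D' * C2 * N" using D' C2 N0 by simp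
        qed
        also have "\<dots> = M * C4 * X + (\<Sum>k\<in>{1..K}. Ip k) + E * N" unfolding E_def by (simp add: algebra_simps)
        finally have "e * (c0 * (\<Sum>k\<in>{1..K}. (b k)\<^sup>2 * n k)) \<le> e * (M * C4 * X + (\<Sum>k\<in>{1..K}. Ip k) + E * N)"
          using e(1) by (intro mult_left_mono) auto
        also have "\<dots> = (e * M * C4) * X + (\<Sum>k\<in>{1..K}. e * Ip k) + (e * E) * N"
          by (simp add: distrib_left sum_distrib_left mult.assoc)
        also have "\<dots> \<le> 1 * X + (\<Sum>k\<in>{1..K}. e * Ip k) + (1 / 2) * N"
          by (intro add_mono order_refl mult_right_mono eM eE X0 N0)
        finally show ?thesis by (simp add: mult.assoc)
      qed
      have summ: "summable (\<lambda>k. e * Ip (Suc k))"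
      proof -
        have Ib: "\<bar>Ip k\<bar> \<le> D * card T * (2 ^ k * n k)" if k: "1 \<le> k" for k
        proof -
          have i: "integrable lborel (\<lambda>x. D * (b k)\<^sup>2 * card T * (\<Sum>j\<in>J. (norm (multiplier (\<Gamma> k) (v j) x))\<^sup>2))"
            by (intro integrable_mult_right Bochner_Integration.integrable_sum mG(2)[OF k])
          have "\<bar>Ip k\<bar> \<le> (LINT x|lborel. \<bar>?q (\<lambda>t. P k t x) (\<lambda>j. multiplier (\<Gamma> k) (v j) x)\<bar>)"
            unfolding Ip_def by (rule integral_abs_bound)
          also have "\<dots> \<le> (LINT x|lborel. D * (b k)\<^sup>2 * card T * (\<Sum>j\<in>J. (norm (multiplier (\<Gamma> k) (v j) x))\<^sup>2))"
            by (rule integral_mono[OF integrable_abs[OF iP[OF k]] i qform_bound[OF fin P(2)[OF k]]])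
          also have "\<dots> = D * (b k)\<^sup>2 * card T * n k"
            unfolding n_def using mG(2)[OF k] by simp
          also have "\<dots> \<le> D * 2 ^ k * card T * n k"
            using b[OF k] D n0 by (intro mult_right_mono mult_left_mono) auto
          finally show ?thesis by (simp add: mult_ac)
        qed
        then have "e * \<bar>Ip (Suc k)\<bar> \<le> e * (D * card T * (2 ^ Suc k * n (Suc k)))" for k
          using e(1) by (intro mult_left_mono Ib) simp_all
        then have le: "norm (e * Ip (Suc k)) \<le> e * D * card T * (2 ^ Suc k * n (Suc k))" for k
          by (simp only: real_norm_def abs_mult abs_of_pos[OF e(1)] mult.assoc)
        have "summable (\<lambda>k. 2 ^ Suc k * n (Suc k))"
        proof (rule summableI_nonneg_bounded)
          show "0 \<le> 2 ^ Suc k * n (Suc k)" for k using n0 by simp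
          show "(\<Sum>k<K. 2 ^ Suc k * n (Suc k)) \<le>
            (\<Sum>j\<in>J. (LINT \<xi>|lborel. A * ((?l \<xi>)\<^sup>2 * (norm (fourier (v j) \<xi>))\<^sup>2)) / ?c)" for K
          proof -
            have "(\<Sum>k<K. 2 ^ Suc k * n (Suc k)) = (\<Sum>k\<in>{1..K}. 2 ^ k * n k)" by (simp add: sum.atLeast1_atMost_eq)
            also have "\<dots> = (\<Sum>j\<in>J. \<Sum>k\<in>{1..K}. 2 ^ k * (LINT x|lborel. (norm (multiplier (\<Gamma> k) (v j) x))\<^sup>2))"
              unfolding n_def sum_distrib_left by (rule sum.swap)
            also have "\<dots> \<le> (\<Sum>j\<in>J. (LINT \<xi>|lborel. A * ((?l \<xi>)\<^sup>2 * (norm (fourier (v j) \<xi>))\<^sup>2)) / ?c)"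
              by (intro sum_mono dyadic_pieces_summable_bound v)
            finally show ?thesis .
          qed
        qed
        then have "summable (\<lambda>k. e * D * card T * (2 ^ Suc k * n (Suc k)))" by (rule summable_mult)
        then show ?thesis by (rule summable_comparison_test'[where N=0]) (rule le)
      qed
      define S where "S = (\<Sum>k. e * Ip (Suc k))"
      have lim: "(\<lambda>K. \<Sum>k\<in>{1..K}. e * Ip k) \<longlonglongrightarrow> S"
        using summable_LIMSEQ[OF summ] unfolding S_def by (simp add: sum.atLeast1_atMost_eq)
      let ?R = "\<lambda>j \<xi>. (\<sigma> \<xi>)\<^sup>2 * (norm (fourier (v j) \<xi>))\<^sup>2"
      let ?ind = "\<lambda>K \<xi>. indicator {\<xi>. A * Lambda_symbol \<xi> \<le> 2 ^ K} \<xi> :: real"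
      have energy: "(\<Sum>j\<in>J. (LINT \<xi>|lborel. ?ind K \<xi> * ?R j \<xi>) / ?c) \<le> C6 * (N + (1 / (e * c0)) * (X + (\<Sum>k\<in>{1..K}. e * Ip k) + N / 2))" for K
      proof -
        have "(\<Sum>j\<in>J. (LINT \<xi>|lborel. ?ind K \<xi> * ?R j \<xi>) / ?c) \<le>
          (\<Sum>j\<in>J. C6 * ((LINT x|lborel. (norm (v j x))\<^sup>2) + (\<Sum>k\<in>{1..K}. (b k)\<^sup>2 * (LINT x|lborel. (norm (multiplier (\<Gamma> k) (v j) x))\<^sup>2))))"
          unfolding C6_def by (intro sum_mono symbol_energy_bound v \<sigma>(1,2)) (use \<sigma>(3) in auto)
        also have "\<dots> = C6 * (N + (\<Sum>j\<in>J. \<Sum>k\<in>{1..K}. (b k)\<^sup>2 * (LINT x|lborel. (norm (multiplier (\<Gamma> k) (v j) x))\<^sup>2)))"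
          unfolding N_def by (simp only: sum_distrib_left[symmetric] sum.distrib)
        also have "(\<Sum>j\<in>J. \<Sum>k\<in>{1..K}. (b k)\<^sup>2 * (LINT x|lborel. (norm (multiplier (\<Gamma> k) (v j) x))\<^sup>2)) = (\<Sum>k\<in>{1..K}. (b k)\<^sup>2 * n k)"
          unfolding n_def sum_distrib_left by (rule sum.swap)
        also have "\<dots> \<le> (1 / (e * c0)) * (X + (\<Sum>k\<in>{1..K}. e * Ip k) + N / 2)"
          using sumlower[of K] e(1) c0 by (simp add: field_simps)
        finally show ?thesis using C6 by (simp add: mult_left_mono)
      qed
      \<comment> \<open>Each fixed frequency satisfies the truncation condition from some
        \<open>K\<close> on, and the energy of a test function dominates.\<close>
      have limR: "(\<lambda>K. \<Sum>j\<in>J. (LINT \<xi>|lborel. ?ind K \<xi> * ?R j \<xi>) / ?c) \<longlonglongrightarrow> (\<Sum>j\<in>J. (LINT \<xi>|lborel. ?R j \<xi>) / ?c)"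
      proof (intro tendsto_sum tendsto_divide tendsto_const)
        fix j assume j: "j \<in> J"
        note [measurable] = poly_growth_measurable[OF \<sigma>(1)] rapid_measurable[OF rapid_fourier[OF v[OF j]]]
        show "(\<lambda>K. LINT \<xi>|lborel. ?ind K \<xi> * ?R j \<xi>) \<longlonglongrightarrow> (LINT \<xi>|lborel. ?R j \<xi>)"
        proof (rule integral_dominated_convergence)
          show "integrable lborel (?R j)" by (rule symbol_square_integrable[OF \<sigma>(1) v[OF j]])
          show "AE \<xi> in lborel. (\<lambda>K. ?ind K \<xi> * ?R j \<xi>) \<longlonglongrightarrow> ?R j \<xi>"
          proof (intro always_eventually allI)
            fix \<xi> :: "real^'m"
            obtain K0 where K0: "A * Lambda_symbol \<xi> < 2 ^ K0" using real_arch_pow[of 2 "A * Lambda_symbol \<xi>"] by auto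
            have "\<forall>\<^sub>F K in sequentially. ?R j \<xi> = ?ind K \<xi> * ?R j \<xi>"
            proof (rule eventually_sequentiallyI[of K0])
              fix K assume "K0 \<le> K"
              then have "(2::real) ^ K0 \<le> 2 ^ K" by (intro power_increasing) auto
              then have "A * Lambda_symbol \<xi> \<le> 2 ^ K" using K0 by linarith
              then show "?R j \<xi> = ?ind K \<xi> * ?R j \<xi>" by simp
            qed
            then show "(\<lambda>K. ?ind K \<xi> * ?R j \<xi>) \<longlonglongrightarrow> ?R j \<xi>" by (rule Lim_transform_eventually[OF tendsto_const])
          qed
          show "AE \<xi> in lborel. norm (?ind K \<xi> * ?R j \<xi>) \<le> ?R j \<xi>" for K
            by (intro always_eventually allI) (auto simp: indicator_def)
        qed measurable
      qed simp
      have "(\<lambda>K. C6 * (N + (1 / (e * c0)) * (X + (\<Sum>k\<in>{1..K}. e * Ip k) + N / 2))) \<longlonglongrightarrow> C6 * (N + (1 / (e * c0)) * (X + S + N / 2))"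
        by (intro tendsto_intros lim)
      then have total: "(\<Sum>j\<in>J. (LINT \<xi>|lborel. ?R j \<xi>) / ?c) \<le> C6 * (N + (1 / (e * c0)) * (X + S + N / 2))"
        by (rule LIMSEQ_le[OF limR]) (use energy in blast)
      have "(\<lambda>K. X + (\<Sum>k\<in>{1..K}. e * Ip k) + N / 2) \<longlonglongrightarrow> X + S + N / 2" by (intro tendsto_intros lim)
      moreover have "0 \<le> X + (\<Sum>k\<in>{1..K}. e * Ip k) + N / 2" for K
      proof -
        have "0 \<le> e * c0 * (\<Sum>k\<in>{1..K}. (b k)\<^sup>2 * n k)" using e(1) c0 n0 by (intro mult_nonneg_nonneg sum_nonneg) auto
        then show ?thesis using sumlower[of K] by linarith
      qed
      \<comment> \<open>The sum \<open>S\<close> may be negative, but the partial sums plus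
        \<open>X + N / 2\<close> dominate a nonnegative quantity. Hence
        \<open>N \<le> 2 * (X + S + N)\<close>, which is where the summand 2 in the final constant
        comes from.\<close>
      ultimately have Q0: "0 \<le> X + S + N / 2" by (intro LIMSEQ_le_const) auto
      have fin1: "N + (1 / (e * c0)) * (X + S + N / 2) \<le> (2 + 1 / (e * c0)) * (X + S + N)"
      proof -
        have "N \<le> 2 * (X + S + N)" using Q0 by simp
        moreover have "(1 / (e * c0)) * (X + S + N / 2) \<le> (1 / (e * c0)) * (X + S + N)"
          using N0 e(1) c0 by (intro mult_left_mono) auto
        ultimately show ?thesis unfolding distrib_right by linarith
      qed
      have "(\<Sum>j\<in>J. LINT x|lborel. (norm (multiplier \<sigma> (v j) x))\<^sup>2) \<le> (\<Sum>j\<in>J. (LINT \<xi>|lborel. ?R j \<xi>) / ?c)"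
        by (intro sum_mono multiplier_bessel(2) \<sigma>(1) v)
      also note total
      also have "C6 * (N + (1 / (e * c0)) * (X + S + N / 2)) \<le> C6 * (2 + 1 / (e * c0)) * (X + S + N)"
        unfolding mult.assoc using fin1 C6 by (intro mult_left_mono) auto
      finally show "summable (\<lambda>k. LINT x|lborel. ?q (\<lambda>t. complex_of_real e * P (Suc k) t x) (\<lambda>j. multiplier (\<Gamma> (Suc k)) (v j) x)) \<and>
        (\<Sum>j\<in>J. LINT x|lborel. (norm (multiplier \<sigma> (v j) x))\<^sup>2) \<le>
          C6 * (2 + 1 / (e * c0)) * ((LINT x|lborel. ?q (\<lambda>t. C t x) (\<lambda>j. multiplier ?l (v j) x))
            + (\<Sum>k. LINT x|lborel. ?q (\<lambda>t. complex_of_real e * P (Suc k) t x) (\<lambda>j. multiplier (\<Gamma> (Suc k)) (v j) x))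
            + (\<Sum>j\<in>J. LINT x|lborel. (norm (v j x))\<^sup>2))"
        unfolding Ie using summ unfolding S_def X_def N_def by blast
    qed
  qed
qed

end

section \<open>Quadratic forms of matrices on forms\<close>

definition index_sign :: "nat \<Rightarrow> nat set \<Rightarrow> real" where
  "index_sign i K = (-1) ^ card {k\<in>K. k < i}"

lemma index_sign_abs: "\<bar>index_sign i K\<bar> = 1"
  by (simp add: index_sign_def)

lemma index_sign_square: "index_sign i K * index_sign i K = 1"
  by (simp add: index_sign_def flip: power_add mult_2)

lemma index_sign_insert:
  assumes "finite K" "j \<notin> K"
  shows "index_sign i (insert j K) = (if j < i then - index_sign i K else index_sign i K)"
proof (cases "j < i")
  case True
  then have "{k \<in> insert j K. k < i} = insert j {k\<in>K. k < i}" by auto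
  then show ?thesis using True assms by (simp add: index_sign_def)
next
  case False
  then have "{k \<in> insert j K. k < i} = {k\<in>K. k < i}" by auto
  then show ?thesis using False by (simp add: index_sign_def)
qed

text \<open>Of two distinct indices exactly one lies below the other, so exactly one of the two
  signs changes when the other index is inserted.\<close>

lemma index_sign_swap:
  assumes "finite K" "i \<notin> K" "j \<notin> K" "i \<noteq> j"
  shows "index_sign i (insert j K) * index_sign j (insert i K) = - (index_sign i K * index_sign j K)"
  using assms by (cases "i < j") (auto simp: index_sign_insert)

lemma alt_coeff_eq:
  "alt_coeff v i K x = (if i \<in> K then 0 else complex_of_real (index_sign i K) * v (insert i K) x)"
  by (simp add: alt_coeff_def index_sign_def)

lemma finite_index_subsets: "finite {K. K \<subseteq> {..<r::nat} \<and> Q K}"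
  by (rule finite_subset[of _ "Pow {..<r}"]) auto

lemma finite_multi_indices: "finite (multi_indices r h)"
  unfolding multi_indices_def by (rule finite_index_subsets)

text \<open>Both quadratic forms of the theorem are superpositions of evaluations of the matrix on
  vectors whose entries are, up to sign, coefficients of the form. \<open>Q\<close> stands for either of them.\<close>

definition form_representation ::
  "nat \<Rightarrow> nat set set \<Rightarrow> ((nat \<Rightarrow> nat \<Rightarrow> real^'m \<Rightarrow> complex) \<Rightarrow> 'm::finite cform \<Rightarrow> real^'m \<Rightarrow> real) \<Rightarrow> bool" where
  "form_representation r J Q \<longleftrightarrow>
    (\<exists>(T :: (nat set \<times> nat \<times> nat) set) \<alpha> \<beta> \<kappa> \<iota> \<iota>'. finite T \<and> \<alpha> ` T \<subseteq> J \<and> \<beta> ` T \<subseteq> J \<and>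
       (\<forall>t\<in>T. \<bar>\<kappa> t\<bar> \<le> 1 \<and> \<iota> t < r \<and> \<iota>' t < r) \<and>
       (\<forall>A v x. Q A v x = qform T \<alpha> \<beta> (\<lambda>t. complex_of_real (\<kappa> t) * A (\<iota> t) (\<iota>' t) x) (\<lambda>j. v j x)) \<and>
       (\<forall>A v x t. 0 \<le> t \<longrightarrow> (\<forall>a. t * (\<Sum>i<r. (cmod (a i))\<^sup>2) \<le> Re (\<Sum>i<r. \<Sum>j<r. A i j x * a i * cnj (a j))) \<longrightarrow>
          t * (\<Sum>j\<in>J. (cmod (v j x))\<^sup>2) \<le> Q A v x))"

text \<open>Both sides run over a set with a marked index; inserting the mark and deleting it are
  inverse bijections. This is what counts how often a coefficient occurs.\<close>

lemma sum_pairs_insert: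
  fixes f :: "nat set \<Rightarrow> nat \<Rightarrow> 'a::comm_monoid_add"
  shows "(\<Sum>K\<in>{K. K \<subseteq> {..<r} \<and> Suc (card K) = h}. \<Sum>i\<in>{..<r} - K. f (insert i K) i) =
    (\<Sum>J\<in>multi_indices r h. \<Sum>i\<in>J. f J i)"
proof -
  have f1: "\<forall>K\<in>{K. K \<subseteq> {..<r} \<and> Suc (card K) = h}. finite ({..<r} - K)" by auto
  have f2: "\<forall>J\<in>multi_indices r h. finite J" by (auto simp: multi_indices_def intro: finite_subset)
  show ?thesis
    unfolding sum.Sigma[OF finite_index_subsets f1] sum.Sigma[OF finite_multi_indices f2]
    by (rule sum.reindex_bij_witness[where i="\<lambda>(J, i). (J - {i}, i)" and j="\<lambda>(K, i). (insert i K, i)"])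
       (auto simp: multi_indices_def insert_absorb card_insert_if finite_subset[OF _ finite_lessThan]
          card_Suc_Diff1[OF finite_subset[OF _ finite_lessThan]] simp del: card_Diff_singleton card_Diff_insert)
qed

lemma sum_pairs_remove:
  fixes f :: "nat set \<Rightarrow> nat \<Rightarrow> 'a::comm_monoid_add"
  shows "(\<Sum>L\<in>{L. L \<subseteq> {..<r} \<and> card L = Suc h}. \<Sum>i\<in>L. f (L - {i}) i) =
    (\<Sum>J\<in>multi_indices r h. \<Sum>i\<in>{..<r} - J. f J i)"
proof -
  have "(\<Sum>K\<in>{K. K \<subseteq> {..<r} \<and> Suc (card K) = Suc h}. \<Sum>i\<in>{..<r} - K. (\<lambda>L i. f (L - {i}) i) (insert i K) i) =
    (\<Sum>J\<in>multi_indices r (Suc h). \<Sum>i\<in>J. (\<lambda>L i. f (L - {i}) i) J i)"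
    by (rule sum_pairs_insert)
  moreover have "(\<Sum>K\<in>{K. K \<subseteq> {..<r} \<and> Suc (card K) = Suc h}. \<Sum>i\<in>{..<r} - K. (\<lambda>L i. f (L - {i}) i) (insert i K) i) =
     (\<Sum>J\<in>multi_indices r h. \<Sum>i\<in>{..<r} - J. f J i)"
    by (intro sum.cong) (auto simp: multi_indices_def)
  ultimately show ?thesis by (simp add: multi_indices_def)
qed

lemma matrix_form_slots:
  fixes v :: "'m::finite cform"
  shows "(\<Sum>i<r. \<Sum>j<r. A i j x * alt_coeff v i K x * cnj (alt_coeff v j K x)) =
    (\<Sum>i\<in>{..<r} - K. \<Sum>j\<in>{..<r} - K. complex_of_real (index_sign i K * index_sign j K) * A i j x * v (insert i K) x * cnj (v (insert j K) x))"
proof -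
  have "(\<Sum>i<r. \<Sum>j<r. A i j x * alt_coeff v i K x * cnj (alt_coeff v j K x)) =
      (\<Sum>i\<in>{..<r} - K. \<Sum>j<r. A i j x * alt_coeff v i K x * cnj (alt_coeff v j K x))"
    by (rule sum.mono_neutral_right) (auto simp: alt_coeff_eq)
  also have "\<dots> = (\<Sum>i\<in>{..<r} - K. \<Sum>j\<in>{..<r} - K. A i j x * alt_coeff v i K x * cnj (alt_coeff v j K x))"
    by (intro sum.cong refl sum.mono_neutral_right) (auto simp: alt_coeff_eq)
  also have "\<dots> = (\<Sum>i\<in>{..<r} - K. \<Sum>j\<in>{..<r} - K. complex_of_real (index_sign i K * index_sign j K) * A i j x * v (insert i K) x * cnj (v (insert j K) x))"
    by (intro sum.cong refl) (auto simp: alt_coeff_eq)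
  finally show ?thesis .
qed

text \<open>The terms are the triples \<open>(K, i, j)\<close> with both indices outside
  \<open>K\<close>. For the lower bound the matrix is evaluated on the vector of all
  \<open>v\<^sub>i\<^sub>K\<close> for each \<open>K\<close>. The squared lengths of these vectors
  count every \<open>v\<^sub>J\<close> exactly \<open>h\<close> times, once per index split off from
  \<open>J\<close>, and \<open>h \<ge> 1\<close>.\<close>

lemma matrix_form_representation:
  assumes "1 \<le> h"
  shows "form_representation r (multi_indices r h) (matrix_form r h :: _ \<Rightarrow> 'm::finite cform \<Rightarrow> _)"
proof -
  let ?S = "{K. K \<subseteq> {..<r} \<and> Suc (card K) = h}"
  define T where "T = (SIGMA K:?S. ({..<r} - K) \<times> ({..<r} - K))"
  have fT: "finite T" unfolding T_def by (intro finite_SigmaI finite_index_subsets) auto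
  have ins: "insert i K \<in> multi_indices r h" if "K \<in> ?S" "i \<in> {..<r} - K" for i K
    using that by (auto simp: multi_indices_def card_insert_if finite_subset[OF _ finite_lessThan])
  have rep: "matrix_form r h A v x = qform T (\<lambda>(K, i, j). insert i K) (\<lambda>(K, i, j). insert j K)
      (\<lambda>t. complex_of_real ((\<lambda>(K, i, j). index_sign i K * index_sign j K) t) * A ((\<lambda>(K, i, j). i) t) ((\<lambda>(K, i, j). j) t) x) (\<lambda>j. v j x)"
    for A and v :: "'m cform" and x
  proof -
    have f1: "\<forall>K\<in>?S. finite (({..<r} - K) \<times> ({..<r} - K))" by auto
    have "(\<Sum>K\<in>?S. \<Sum>i<r. \<Sum>j<r. A i j x * alt_coeff v i K x * cnj (alt_coeff v j K x)) =
       (\<Sum>K\<in>?S. \<Sum>(i, j)\<in>({..<r} - K) \<times> ({..<r} - K). complex_of_real (index_sign i K * index_sign j K) * A i j x * v (insert i K) x * cnj (v (insert j K) x))"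
      by (intro sum.cong refl) (subst matrix_form_slots, rule sum.cartesian_product)
    also have "\<dots> = (\<Sum>(K, i, j)\<in>T. complex_of_real (index_sign i K * index_sign j K) * A i j x * v (insert i K) x * cnj (v (insert j K) x))"
      unfolding T_def by (rule sum.Sigma[OF finite_index_subsets f1])
    finally show ?thesis
      unfolding matrix_form_def qform_def by (simp only: case_prod_unfold)
  qed
  have low: "t * (\<Sum>j\<in>multi_indices r h. (cmod (v j x))\<^sup>2) \<le> matrix_form r h A v x"
    if t: "0 \<le> t" and A: "\<And>a. t * (\<Sum>i<r. (cmod (a i))\<^sup>2) \<le> Re (\<Sum>i<r. \<Sum>j<r. A i j x * a i * cnj (a j))"
    for A and v :: "'m cform" and x t
  proof -
    have "(\<Sum>K\<in>?S. \<Sum>i<r. (cmod (alt_coeff v i K x))\<^sup>2) = (\<Sum>K\<in>?S. \<Sum>i\<in>{..<r} - K. (cmod (v (insert i K) x))\<^sup>2)"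
      by (intro sum.cong refl sum.mono_neutral_cong_right)
         (auto simp: alt_coeff_eq norm_mult index_sign_abs)
    also have "\<dots> = (\<Sum>J\<in>multi_indices r h. \<Sum>i\<in>J. (cmod (v J x))\<^sup>2)"
      by (rule sum_pairs_insert[where r=r and h=h and f="\<lambda>J i. (cmod (v J x))\<^sup>2"])
    also have "\<dots> = h * (\<Sum>J\<in>multi_indices r h. (cmod (v J x))\<^sup>2)"
      unfolding sum_distrib_left by (intro sum.cong) (auto simp: multi_indices_def)
    finally have eq: "(\<Sum>K\<in>?S. \<Sum>i<r. (cmod (alt_coeff v i K x))\<^sup>2) = h * (\<Sum>J\<in>multi_indices r h. (cmod (v J x))\<^sup>2)" .
    have "1 * (\<Sum>J\<in>multi_indices r h. (cmod (v J x))\<^sup>2) \<le> h * (\<Sum>J\<in>multi_indices r h. (cmod (v J x))\<^sup>2)"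
      using assms by (intro mult_right_mono sum_nonneg) auto
    then have "t * (\<Sum>J\<in>multi_indices r h. (cmod (v J x))\<^sup>2) \<le> t * (\<Sum>K\<in>?S. \<Sum>i<r. (cmod (alt_coeff v i K x))\<^sup>2)"
      unfolding eq using t by (intro mult_left_mono) auto
    also have "\<dots> \<le> (\<Sum>K\<in>?S. Re (\<Sum>i<r. \<Sum>j<r. A i j x * alt_coeff v i K x * cnj (alt_coeff v j K x)))"
      unfolding sum_distrib_left[of t _ ?S] by (intro sum_mono A)
    also have "\<dots> = matrix_form r h A v x" unfolding matrix_form_def by (rule Re_sum[symmetric])
    finally show ?thesis .
  qed
  show ?thesis
    unfolding form_representation_def
  proof (rule exI[of _ T], rule exI[of _ "\<lambda>(K, i, j). insert i K"], rule exI[of _ "\<lambda>(K, i, j). insert j K"],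
      rule exI[of _ "\<lambda>(K, i, j). index_sign i K * index_sign j K"], rule exI[of _ "\<lambda>(K, i, j). i"],
      rule exI[of _ "\<lambda>(K, i, j). j"], intro conjI allI impI)
    show "(\<lambda>(K, i, j). insert i K) ` T \<subseteq> multi_indices r h" "(\<lambda>(K, i, j). insert j K) ` T \<subseteq> multi_indices r h"
      unfolding T_def using ins by auto
    show "\<forall>t\<in>T. \<bar>(\<lambda>(K, i, j). index_sign i K * index_sign j K) t\<bar> \<le> 1 \<and> (\<lambda>(K, i, j). i) t < r \<and> (\<lambda>(K, i, j). j) t < r"
      unfolding T_def by (auto simp: abs_mult index_sign_abs)
  qed (use fT rep low in auto)
qed

text \<open>The coefficient at \<open>L\<close> of the exterior product of the conjugate of
  \<open>\<omega>\<^sub>i\<close> with \<open>v\<close>, just as \<open>alt_coeff\<close> is a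
  coefficient of a contraction of \<open>v\<close>. The trace form is built from the former as the
  matrix form is from the latter.\<close>

definition comp_coeff :: "'m::finite cform \<Rightarrow> nat \<Rightarrow> nat set \<Rightarrow> real^'m \<Rightarrow> complex" where
  "comp_coeff v i L x = (if i \<in> L then complex_of_real (index_sign i (L - {i})) * v (L - {i}) x else 0)"

lemma trace_form_slots:
  fixes v :: "'m::finite cform"
  assumes "L \<subseteq> {..<r}"
  shows "(\<Sum>i<r. \<Sum>j<r. A i j x * cnj (comp_coeff v i L x) * comp_coeff v j L x) =
    (\<Sum>i\<in>L. \<Sum>j\<in>L. complex_of_real (index_sign i (L - {i}) * index_sign j (L - {j})) * A i j x * v (L - {j}) x * cnj (v (L - {i}) x))"
proof -
  have "(\<Sum>i<r. \<Sum>j<r. A i j x * cnj (comp_coeff v i L x) * comp_coeff v j L x) =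
      (\<Sum>i\<in>L. \<Sum>j<r. A i j x * cnj (comp_coeff v i L x) * comp_coeff v j L x)"
    using assms by (intro sum.mono_neutral_right) (auto simp: comp_coeff_def)
  also have "\<dots> = (\<Sum>i\<in>L. \<Sum>j\<in>L. A i j x * cnj (comp_coeff v i L x) * comp_coeff v j L x)"
    using assms by (intro sum.cong refl sum.mono_neutral_right) (auto simp: comp_coeff_def)
  also have "\<dots> = (\<Sum>i\<in>L. \<Sum>j\<in>L. complex_of_real (index_sign i (L - {i}) * index_sign j (L - {j})) * A i j x * v (L - {j}) x * cnj (v (L - {i}) x))"
    by (intro sum.cong refl) (auto simp: comp_coeff_def)
  finally show ?thesis .
qed

lemma sum_split_diagonal:
  fixes f :: "nat \<Rightarrow> nat \<Rightarrow> 'a::comm_monoid_add"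
  assumes "finite X"
  shows "(\<Sum>i\<in>X. \<Sum>j\<in>X. f i j) = (\<Sum>i\<in>X. f i i) + (\<Sum>i\<in>X. \<Sum>j\<in>X - {i}. f i j)"
  unfolding sum.distrib[symmetric] using assms by (intro sum.cong refl) (simp add: sum.remove)

text \<open>Removing two distinct indices from \<open>L\<close>, instead of adding one to \<open>K\<close> in two ways, changes
  the sign of the off-diagonal terms; this turns \<open>-A(v,v)\<close> into a nonnegative sum for \<open>A \<ge> 0\<close>.\<close>

lemma off_diagonal_swap:
  fixes v :: "'m::finite cform"
  shows "(\<Sum>L\<in>{L. L \<subseteq> {..<r} \<and> card L = Suc h}. \<Sum>i\<in>L. \<Sum>j\<in>L - {i}.
      complex_of_real (index_sign i (L - {i}) * index_sign j (L - {j})) * A i j x * v (L - {j}) x * cnj (v (L - {i}) x)) =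
    - (\<Sum>K\<in>{K. K \<subseteq> {..<r} \<and> Suc (card K) = h}. \<Sum>i\<in>{..<r} - K. \<Sum>j\<in>{..<r} - K - {i}.
      complex_of_real (index_sign i K * index_sign j K) * A i j x * v (insert i K) x * cnj (v (insert j K) x))"
proof -
  let ?L = "{L. L \<subseteq> {..<r} \<and> card L = Suc h}" and ?K = "{K. K \<subseteq> {..<r} \<and> Suc (card K) = h}"
  have finL: "finite L" if "L \<subseteq> {..<r}" for L :: "nat set" using that finite_subset by blast
  have f1: "\<forall>L\<in>?L. finite (SIGMA i:L. L - {i})" by (intro ballI finite_SigmaI) (auto intro: finL)
  have f2: "\<forall>K\<in>?K. finite (SIGMA i:{..<r} - K. {..<r} - K - {i})" by (intro ballI finite_SigmaI) auto
  have e1: "(\<Sum>i\<in>L. \<Sum>j\<in>L - {i}. g i j) = (\<Sum>(i, j)\<in>(SIGMA i:L. L - {i}). g i j)" if "L \<in> ?L" for L and g :: "nat \<Rightarrow> nat \<Rightarrow> complex"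
    using that by (intro sum.Sigma) (auto intro: finL)
  have e2: "(\<Sum>i\<in>{..<r} - K. \<Sum>j\<in>{..<r} - K - {i}. g i j) = (\<Sum>(i, j)\<in>(SIGMA i:{..<r} - K. {..<r} - K - {i}). g i j)" for K and g :: "nat \<Rightarrow> nat \<Rightarrow> complex"
    by (intro sum.Sigma) auto
  have l: "(\<Sum>L\<in>?L. \<Sum>i\<in>L. \<Sum>j\<in>L - {i}. g L i j) = (\<Sum>L\<in>?L. \<Sum>(i, j)\<in>(SIGMA i:L. L - {i}). g L i j)"
    for g :: "nat set \<Rightarrow> nat \<Rightarrow> nat \<Rightarrow> complex"
    by (rule sum.cong[OF refl], rule e1)
  have n: "- (\<Sum>K\<in>?K. \<Sum>i\<in>{..<r} - K. \<Sum>j\<in>{..<r} - K - {i}. g K i j) = (\<Sum>K\<in>?K. \<Sum>i\<in>{..<r} - K. \<Sum>j\<in>{..<r} - K - {i}. - g K i j)"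
    for g :: "nat set \<Rightarrow> nat \<Rightarrow> nat \<Rightarrow> complex"
    by (simp only: sum_negf)
  show ?thesis
    unfolding n
    unfolding l e2
    unfolding sum.Sigma[OF finite_index_subsets f1] sum.Sigma[OF finite_index_subsets f2]
  proof (rule sum.reindex_bij_witness[where i="\<lambda>(K, i, j). (insert i (insert j K), i, j)" and j="\<lambda>(L, i, j). (L - {i, j}, i, j)"])
    fix p assume "p \<in> (SIGMA L:?L. SIGMA i:L. L - {i})"
    then obtain L i j where p: "p = (L, i, j)" "L \<subseteq> {..<r}" "card L = Suc h" "i \<in> L" "j \<in> L" "i \<noteq> j" by auto
    define K where "K = L - {i, j}"
    have K: "finite K" "i \<notin> K" "j \<notin> K" "L = insert i (insert j K)" "L - {i} = insert j K" "L - {j} = insert i K"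
      unfolding K_def using p finL by auto
    show "(\<lambda>(K, i, j). (insert i (insert j K), i, j)) ((\<lambda>(L, i, j). (L - {i, j}, i, j)) p) = p" using p by auto
    have "card (insert i (insert j K)) = Suc (Suc (card K))" using K(1,2,3) p(6) by simp
    then have "card L = Suc (Suc (card (L - {i, j})))" unfolding K(4)[symmetric] unfolding K_def .
    then show "(\<lambda>(L, i, j). (L - {i, j}, i, j)) p \<in> (SIGMA K:?K. SIGMA i:{..<r} - K. {..<r} - K - {i})"
      using p(2-6) unfolding p(1) by auto
    have sgn: "index_sign i (L - {i}) * index_sign j (L - {j}) = - (index_sign i (L - {i, j}) * index_sign j (L - {i, j}))"
      unfolding K(5,6) index_sign_swap[OF K(1,2,3) p(6)] unfolding K_def ..
    have ins: "insert i (L - {i, j}) = L - {j}" "insert j (L - {i, j}) = L - {i}" using p(4-6) by auto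
    show "(case (\<lambda>(L, i, j). (L - {i, j}, i, j)) p of (K, i, j) \<Rightarrow> - (complex_of_real (index_sign i K * index_sign j K) * A i j x * v (insert i K) x * cnj (v (insert j K) x))) =
       (case p of (L, i, j) \<Rightarrow> complex_of_real (index_sign i (L - {i}) * index_sign j (L - {j})) * A i j x * v (L - {j}) x * cnj (v (L - {i}) x))"
      by (simp only: p(1) prod.case ins sgn of_real_minus mult_minus_left)
  next
    fix p assume "p \<in> (SIGMA K:?K. SIGMA i:{..<r} - K. {..<r} - K - {i})"
    then obtain K i j where p: "p = (K, i, j)" "K \<subseteq> {..<r}" "Suc (card K) = h" "i < r" "j < r" "i \<notin> K" "j \<notin> K" "i \<noteq> j" by auto
    show "(\<lambda>(L, i, j). (L - {i, j}, i, j)) ((\<lambda>(K, i, j). (insert i (insert j K), i, j)) p) = p" using p by auto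
    show "(\<lambda>(K, i, j). (insert i (insert j K), i, j)) p \<in> (SIGMA L:?L. SIGMA i:L. L - {i})"
      using p finL[OF p(2)] by auto
  qed
qed

text \<open>On the diagonal, the trace counts every index for each \<open>J\<close> and the matrix
  form removes those in \<open>J\<close>, so the indices outside \<open>J\<close> remain, one for
  each \<open>L = insert i J\<close>. The off-diagonal terms match by the sign rule for two removed
  indices. The conjugation sits on the first slot, so the matrix acts on the conjugate
  vector.\<close>

lemma trace_minus_form_eq:
  fixes v :: "'m::finite cform"
  shows "trace_minus_form r h A v x =
    Re (\<Sum>L\<in>{L. L \<subseteq> {..<r} \<and> card L = Suc h}. \<Sum>i<r. \<Sum>j<r. A i j x * cnj (comp_coeff v i L x) * comp_coeff v j L x)"
proof -
  let ?L = "{L. L \<subseteq> {..<r} \<and> card L = Suc h}" and ?K = "{K. K \<subseteq> {..<r} \<and> Suc (card K) = h}"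
  let ?J = "multi_indices r h"
  define n where "n = (\<lambda>J. complex_of_real ((cmod (v J x))\<^sup>2))"
  have n: "v J x * cnj (v J x) = n J" for J unfolding n_def by (rule complex_norm_square[symmetric])
  have finL: "finite L" if "L \<subseteq> {..<r}" for L :: "nat set" using that finite_subset by blast
  have sq: "complex_of_real (index_sign i K * index_sign i K) * a * v J x * cnj (v J x) = a * n J" for i K a J
    unfolding index_sign_square by (simp add: mult.assoc n)
  have "(\<Sum>L\<in>?L. \<Sum>i<r. \<Sum>j<r. A i j x * cnj (comp_coeff v i L x) * comp_coeff v j L x) =
     (\<Sum>L\<in>?L. \<Sum>i\<in>L. \<Sum>j\<in>L. complex_of_real (index_sign i (L - {i}) * index_sign j (L - {j})) * A i j x * v (L - {j}) x * cnj (v (L - {i}) x))"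
    by (intro sum.cong refl trace_form_slots) auto
  also have "\<dots> = (\<Sum>L\<in>?L. (\<Sum>i\<in>L. A i i x * n (L - {i})) + (\<Sum>i\<in>L. \<Sum>j\<in>L - {i}. complex_of_real (index_sign i (L - {i}) * index_sign j (L - {j})) * A i j x * v (L - {j}) x * cnj (v (L - {i}) x)))"
    by (intro sum.cong refl, subst sum_split_diagonal) (auto intro: finL simp only: sq)
  also have "\<dots> = (\<Sum>J\<in>?J. \<Sum>i\<in>{..<r} - J. A i i x * n J)
     - (\<Sum>K\<in>?K. \<Sum>i\<in>{..<r} - K. \<Sum>j\<in>{..<r} - K - {i}. complex_of_real (index_sign i K * index_sign j K) * A i j x * v (insert i K) x * cnj (v (insert j K) x))"
    unfolding sum.distrib off_diagonal_swap sum_pairs_remove[where f="\<lambda>J i. A i i x * n J"] by simp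
  finally have rhs: "(\<Sum>L\<in>?L. \<Sum>i<r. \<Sum>j<r. A i j x * cnj (comp_coeff v i L x) * comp_coeff v j L x) = \<dots>" .
  have "(\<Sum>K\<in>?K. \<Sum>i<r. \<Sum>j<r. A i j x * alt_coeff v i K x * cnj (alt_coeff v j K x)) =
     (\<Sum>K\<in>?K. (\<Sum>i\<in>{..<r} - K. A i i x * n (insert i K)) + (\<Sum>i\<in>{..<r} - K. \<Sum>j\<in>{..<r} - K - {i}. complex_of_real (index_sign i K * index_sign j K) * A i j x * v (insert i K) x * cnj (v (insert j K) x)))"
    unfolding matrix_form_slots by (intro sum.cong refl, subst sum_split_diagonal) (auto simp only: sq finite_Diff finite_lessThan)
  also have "\<dots> = (\<Sum>J\<in>?J. \<Sum>i\<in>J. A i i x * n J) + (\<Sum>K\<in>?K. \<Sum>i\<in>{..<r} - K. \<Sum>j\<in>{..<r} - K - {i}. complex_of_real (index_sign i K * index_sign j K) * A i j x * v (insert i K) x * cnj (v (insert j K) x))"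
    unfolding sum.distrib sum_pairs_insert[where f="\<lambda>J i. A i i x * n J"] ..
  finally have mf: "(\<Sum>K\<in>?K. \<Sum>i<r. \<Sum>j<r. A i j x * alt_coeff v i K x * cnj (alt_coeff v j K x)) = \<dots>" .
  have "complex_of_real (\<Sum>J\<in>?J. (cmod (v J x))\<^sup>2) * (\<Sum>i<r. A i i x) = (\<Sum>J\<in>?J. \<Sum>i<r. A i i x * n J)"
    unfolding of_real_sum sum_product n_def by (intro sum.cong refl mult.commute)
  also have "\<dots> = (\<Sum>J\<in>?J. (\<Sum>i\<in>{..<r} - J. A i i x * n J) + (\<Sum>i\<in>J. A i i x * n J))"
    by (intro sum.cong refl sum.subset_diff) (auto simp: multi_indices_def)
  finally have tr: "complex_of_real (\<Sum>J\<in>?J. (cmod (v J x))\<^sup>2) * (\<Sum>i<r. A i i x) =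
     (\<Sum>J\<in>?J. \<Sum>i\<in>{..<r} - J. A i i x * n J) + (\<Sum>J\<in>?J. \<Sum>i\<in>J. A i i x * n J)" by (simp only: sum.distrib)
  have "trace_minus_form r h A v x = Re (complex_of_real (\<Sum>J\<in>?J. (cmod (v J x))\<^sup>2) * (\<Sum>i<r. A i i x)
      - (\<Sum>K\<in>?K. \<Sum>i<r. \<Sum>j<r. A i j x * alt_coeff v i K x * cnj (alt_coeff v j K x)))"
    unfolding trace_minus_form_def matrix_form_def by simp
  then show ?thesis unfolding rhs mf tr by simp
qed

text \<open>Here each \<open>v\<^sub>J\<close> occurs once for every index outside \<open>J\<close>,
  that is \<open>r - h\<close> times, so \<open>h < r\<close> plays the part of
  \<open>h \<ge> 1\<close> for the matrix form.\<close>

lemma trace_minus_form_representation: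
  assumes "h < r"
  shows "form_representation r (multi_indices r h) (trace_minus_form r h :: _ \<Rightarrow> 'm::finite cform \<Rightarrow> _)"
proof -
  let ?S = "{L. L \<subseteq> {..<r} \<and> card L = Suc h}"
  define T where "T = (SIGMA L:?S. L \<times> L)"
  have finL: "finite L" if "L \<in> ?S" for L using that finite_subset[of L "{..<r}"] by auto
  have fT: "finite T" unfolding T_def by (intro finite_SigmaI finite_index_subsets finite_cartesian_product finL)
  have rem: "L - {i} \<in> multi_indices r h" if "L \<in> ?S" "i \<in> L" for i L
    using that finL[OF that(1)] by (auto simp: multi_indices_def)
  have rep: "trace_minus_form r h A v x = qform T (\<lambda>(L, i, j). L - {j}) (\<lambda>(L, i, j). L - {i})
      (\<lambda>t. complex_of_real ((\<lambda>(L, i, j). index_sign i (L - {i}) * index_sign j (L - {j})) t) * A ((\<lambda>(L, i, j). i) t) ((\<lambda>(L, i, j). j) t) x) (\<lambda>j. v j x)"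
    for A and v :: "'m cform" and x
  proof -
    have f1: "\<forall>L\<in>?S. finite (L \<times> L)" using finL by auto
    have "(\<Sum>L\<in>?S. \<Sum>i<r. \<Sum>j<r. A i j x * cnj (comp_coeff v i L x) * comp_coeff v j L x) =
       (\<Sum>L\<in>?S. \<Sum>i\<in>L. \<Sum>j\<in>L. complex_of_real (index_sign i (L - {i}) * index_sign j (L - {j})) * A i j x * v (L - {j}) x * cnj (v (L - {i}) x))"
      by (intro sum.cong refl trace_form_slots) auto
    also have "\<dots> = (\<Sum>L\<in>?S. \<Sum>(i, j)\<in>L \<times> L. complex_of_real (index_sign i (L - {i}) * index_sign j (L - {j})) * A i j x * v (L - {j}) x * cnj (v (L - {i}) x))"
      by (simp only: sum.cartesian_product)
    also have "\<dots> = (\<Sum>(L, i, j)\<in>T. complex_of_real (index_sign i (L - {i}) * index_sign j (L - {j})) * A i j x * v (L - {j}) x * cnj (v (L - {i}) x))"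
      unfolding T_def by (rule sum.Sigma[OF finite_index_subsets f1])
    finally show ?thesis
      unfolding trace_minus_form_eq qform_def by (simp only: case_prod_unfold)
  qed
  have low: "t * (\<Sum>j\<in>multi_indices r h. (cmod (v j x))\<^sup>2) \<le> trace_minus_form r h A v x"
    if t: "0 \<le> t" and A: "\<And>a. t * (\<Sum>i<r. (cmod (a i))\<^sup>2) \<le> Re (\<Sum>i<r. \<Sum>j<r. A i j x * a i * cnj (a j))"
    for A and v :: "'m cform" and x t
  proof -
    have "(\<Sum>L\<in>?S. \<Sum>i<r. (cmod (comp_coeff v i L x))\<^sup>2) = (\<Sum>L\<in>?S. \<Sum>i\<in>L. (cmod (v (L - {i}) x))\<^sup>2)"
      by (intro sum.cong refl sum.mono_neutral_cong_right)
         (auto simp: comp_coeff_def norm_mult index_sign_abs)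
    also have "\<dots> = (\<Sum>J\<in>multi_indices r h. \<Sum>i\<in>{..<r} - J. (cmod (v J x))\<^sup>2)"
      by (rule sum_pairs_remove[where f="\<lambda>J i. (cmod (v J x))\<^sup>2"])
    also have "\<dots> = (r - h) * (\<Sum>J\<in>multi_indices r h. (cmod (v J x))\<^sup>2)"
      unfolding sum_distrib_left by (intro sum.cong) (auto simp: multi_indices_def card_Diff_subset finite_subset[OF _ finite_lessThan])
    finally have eq: "(\<Sum>L\<in>?S. \<Sum>i<r. (cmod (comp_coeff v i L x))\<^sup>2) = (r - h) * (\<Sum>J\<in>multi_indices r h. (cmod (v J x))\<^sup>2)" .
    have "1 * (\<Sum>J\<in>multi_indices r h. (cmod (v J x))\<^sup>2) \<le> (r - h) * (\<Sum>J\<in>multi_indices r h. (cmod (v J x))\<^sup>2)"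
      using assms by (intro mult_right_mono sum_nonneg) auto
    then have "t * (\<Sum>J\<in>multi_indices r h. (cmod (v J x))\<^sup>2) \<le> t * (\<Sum>L\<in>?S. \<Sum>i<r. (cmod (comp_coeff v i L x))\<^sup>2)"
      unfolding eq using t by (intro mult_left_mono) auto
    also have "\<dots> \<le> (\<Sum>L\<in>?S. Re (\<Sum>i<r. \<Sum>j<r. A i j x * cnj (comp_coeff v i L x) * comp_coeff v j L x))"
      unfolding sum_distrib_left[of t _ ?S]
    proof (rule sum_mono)
      \<comment> \<open>The hypothesis on the matrix is applied to the conjugated vector, which has
        the same length.\<close>
      fix L show "t * (\<Sum>i<r. (cmod (comp_coeff v i L x))\<^sup>2) \<le> Re (\<Sum>i<r. \<Sum>j<r. A i j x * cnj (comp_coeff v i L x) * comp_coeff v j L x)"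
        using A[of "\<lambda>i. cnj (comp_coeff v i L x)"] by simp
    qed
    also have "\<dots> = trace_minus_form r h A v x" unfolding trace_minus_form_eq by (rule Re_sum[symmetric])
    finally show ?thesis .
  qed
  show ?thesis
    unfolding form_representation_def
  proof (rule exI[of _ T], rule exI[of _ "\<lambda>(L, i, j). L - {j}"], rule exI[of _ "\<lambda>(L, i, j). L - {i}"],
      rule exI[of _ "\<lambda>(L, i, j). index_sign i (L - {i}) * index_sign j (L - {j})"], rule exI[of _ "\<lambda>(L, i, j). i"],
      rule exI[of _ "\<lambda>(L, i, j). j"], intro conjI allI impI)
    show "(\<lambda>(L, i, j). L - {j}) ` T \<subseteq> multi_indices r h" "(\<lambda>(L, i, j). L - {i}) ` T \<subseteq> multi_indices r h"
      unfolding T_def using rem by auto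
    show "\<forall>t\<in>T. \<bar>(\<lambda>(L, i, j). index_sign i (L - {i}) * index_sign j (L - {j})) t\<bar> \<le> 1 \<and> (\<lambda>(L, i, j). i) t < r \<and> (\<lambda>(L, i, j). j) t < r"
      unfolding T_def by (auto simp: abs_mult index_sign_abs)
  qed (use fT rep low in auto)
qed

section \<open>The gain of a type function\<close>

lemma admissible_type_facts:
  assumes F: "admissible_type F"
  shows "continuous_on {0<..} F" "strict_mono_on {0<..} F" "\<And>d. 0 < d \<Longrightarrow> 0 < F d"
    and "(F \<longlongrightarrow> 0) (at_right 0)"
    and "\<exists>\<delta>>0. \<delta> \<le> 1 \<and> mono_on {0<..<\<delta>} (\<lambda>d. F d / d\<^sup>2) \<and> (\<forall>d. 0 < d \<and> d < \<delta> \<longrightarrow> F d \<le> d\<^sup>2)"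
proof -
  show c: "continuous_on {0<..} F" and sm: "strict_mono_on {0<..} F"
    using F smooth_on_continuous_on unfolding admissible_type_def by auto
  obtain \<delta>0 where d0: "0 < \<delta>0" "mono_on {0<..<\<delta>0} (\<lambda>d. F d / d\<^sup>2)" using F unfolding admissible_type_def by blast
  have lim: "((\<lambda>d. F d / d\<^sup>2) \<longlongrightarrow> 0) (at_right 0)" using F unfolding admissible_type_def by blast
  \<comment> \<open>Nothing is assumed about the value of \<open>F\<close> at 0; that
    \<open>F\<close> tends to 0 there is recovered from the limit of the quotient, and positivity
    then follows from monotonicity.\<close>
  have "((\<lambda>d. F d / d\<^sup>2 * d\<^sup>2) \<longlongrightarrow> 0 * 0\<^sup>2) (at_right 0)"
    by (intro tendsto_intros lim)
  then have "((\<lambda>d. F d / d\<^sup>2 * d\<^sup>2) \<longlongrightarrow> 0) (at_right 0)" by simp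
  then show lF: "(F \<longlongrightarrow> 0) (at_right 0)"
    by (rule Lim_transform_eventually) (auto simp: eventually_at_right_field intro!: exI[of _ 1])
  have nn: "0 \<le> F d" if d: "0 < d" for d
  proof (rule tendsto_upperbound[OF lF])
    show "\<forall>\<^sub>F x in at_right 0. F x \<le> F d"
      using d strict_mono_onD[OF sm] by (auto simp: eventually_at_right_field intro!: exI[of _ d] less_imp_le)
  qed simp
  show "0 < F d" if "0 < d" for d
    using nn[of "d / 2"] strict_mono_onD[OF sm, of "d / 2" d] that by simp
  have "\<forall>\<^sub>F d in at_right 0. F d / d\<^sup>2 < 1" using order_tendstoD(2)[OF lim] by simp
  then obtain \<delta>1 where d1: "0 < \<delta>1" "\<And>d. 0 < d \<Longrightarrow> d < \<delta>1 \<Longrightarrow> F d / d\<^sup>2 < 1" by (auto simp: eventually_at_right_field)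
  show "\<exists>\<delta>>0. \<delta> \<le> 1 \<and> mono_on {0<..<\<delta>} (\<lambda>d. F d / d\<^sup>2) \<and> (\<forall>d. 0 < d \<and> d < \<delta> \<longrightarrow> F d \<le> d\<^sup>2)"
  proof (intro exI[of _ "min 1 (min \<delta>0 \<delta>1)"] conjI allI impI)
    show "mono_on {0<..<min 1 (min \<delta>0 \<delta>1)} (\<lambda>d. F d / d\<^sup>2)" by (rule mono_on_subset[OF d0(2)]) auto
    fix d assume "0 < d \<and> d < min 1 (min \<delta>0 \<delta>1)"
    then show "F d \<le> d\<^sup>2" using d1(2)[of d] by (simp add: field_simps)
  qed (use d0 d1 in auto)
qed

lemma type_inverse:
  assumes F: "admissible_type F" and y: "y \<in> F ` {0<..}"
  shows "0 < the_inv_into {0<..} F y" "F (the_inv_into {0<..} F y) = y"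
proof -
  have inj: "inj_on F {0<..}" by (rule strict_mono_on_imp_inj_on[OF admissible_type_facts(2)[OF F]])
  show "0 < the_inv_into {0<..} F y" using the_inv_into_into[OF inj y order_refl] by simp
  show "F (the_inv_into {0<..} F y) = y" by (rule f_the_inv_into_f[OF inj y])
qed

text \<open>\<open>F\<close> is continuous and tends to 0 at 0, so the range is an initial interval
  of the positive axis by the intermediate value theorem. Thus the inverse is defined at
  \<open>1 / t\<close> for all large \<open>t\<close>.\<close>

lemma type_range:
  assumes F: "admissible_type F" and y: "0 < y" "y \<le> F d" "0 < d"
  shows "y \<in> F ` {0<..}"
proof -
  have "\<forall>\<^sub>F x in at_right 0. F x < y" using order_tendstoD(2)[OF admissible_type_facts(4)[OF F] y(1)] .
  then obtain e where e: "0 < e" "\<And>x. 0 < x \<Longrightarrow> x < e \<Longrightarrow> F x < y" by (auto simp: eventually_at_right_field)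
  define x where "x = min (e / 2) d"
  have x: "0 < x" "x < e" "x \<le> d" unfolding x_def using e y by auto
  have "continuous_on {x..d} F"
    by (rule continuous_on_subset[OF admissible_type_facts(1)[OF F]]) (use x in auto)
  then have "\<exists>t\<ge>x. t \<le> d \<and> F t = y"
    using x e(2)[of x] y by (intro IVT') auto
  then show ?thesis using x(1) by force
qed

lemma type_inverse_mono:
  assumes F: "admissible_type F" and y: "y \<in> F ` {0<..}" "0 < d" "F d \<le> y"
  shows "d \<le> the_inv_into {0<..} F y"
proof (rule ccontr)
  assume "\<not> ?thesis"
  then have "F (the_inv_into {0<..} F y) < F d"
    using strict_mono_onD[OF admissible_type_facts(2)[OF F]] type_inverse(1)[OF F y(1)] y(2) by simp
  then show False using type_inverse(2)[OF F y(1)] y(3) by simp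
qed

text \<open>\<open>b k\<close> is the gain at \<open>2 ^ k\<close>, and \<open>a = 1 / b k\<close>
  solves \<open>F a = 2\<^sup>-\<^sup>k\<close>. Monotonicity of the quotient gives
  \<open>F d / d\<^sup>2 \<ge> F a / a\<^sup>2\<close> for \<open>d \<ge> a\<close>, which is the
  lower bound away from \<open>S\<close>; \<open>F d \<le> d\<^sup>2\<close> gives
  \<open>(b k)\<^sup>2 \<le> 2 ^ k\<close>; and the gain at comparable arguments changes at most by
  the factor \<open>A\<close>.\<close>

lemma type_gain_sequence:
  assumes F: "admissible_type F" and A: "1 \<le> A"
  shows "\<exists>(b :: nat \<Rightarrow> real) \<delta> C1 k0. 0 < \<delta> \<and> 0 < C1 \<and>
     (\<forall>k<k0. b k = 0) \<and> (\<forall>k\<ge>k0. 1 \<le> b k \<and> (\<forall>d. 1 / b k \<le> d \<and> d < \<delta> \<longrightarrow> (b k)\<^sup>2 / 2 ^ k \<le> F d / d\<^sup>2)) \<and>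
     (\<forall>k. (b k)\<^sup>2 \<le> 2 ^ k) \<and>
     (\<forall>k t. 1 \<le> t \<and> 2 ^ k \<le> A * t \<and> t \<le> A * 2 ^ k \<longrightarrow> (type_gain F t)\<^sup>2 \<le> C1 * (1 + (b k)\<^sup>2)) \<and>
     (\<forall>t\<ge>1. (type_gain F t)\<^sup>2 \<le> C1 * t)"
proof -
  let ?g = "the_inv_into {0<..} F"
  obtain \<delta> where d: "0 < \<delta>" "\<delta> \<le> 1" "mono_on {0<..<\<delta>} (\<lambda>d. F d / d\<^sup>2)" "\<And>d. 0 < d \<Longrightarrow> d < \<delta> \<Longrightarrow> F d \<le> d\<^sup>2"
    using admissible_type_facts(5)[OF F] by blast
  \<comment> \<open>Below \<open>F (\<delta> / 2)\<close> the inverse takes values in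
    \<open>(0, \<delta> / 2]\<close>, inside the interval where the quotient is monotone.\<close>
  define y0 where "y0 = F (\<delta> / 2)"
  have y0: "0 < y0" unfolding y0_def using admissible_type_facts(3)[OF F] d(1) by simp
  have R: "y \<in> F ` {0<..}" "0 < ?g y" "?g y \<le> \<delta> / 2" "F (?g y) = y" if y: "0 < y" "y \<le> y0" for y
  proof -
    show r: "y \<in> F ` {0<..}" by (rule type_range[OF F y(1), of "\<delta> / 2"]) (use y d(1) y0_def in auto)
    note i = type_inverse[OF F r]
    show "0 < ?g y" "F (?g y) = y" by (fact i)+
    show "?g y \<le> \<delta> / 2"
    proof (rule ccontr)
      assume "\<not> ?thesis"
      then have "F (\<delta> / 2) < F (?g y)" using strict_mono_onD[OF admissible_type_facts(2)[OF F]] d(1) i(1) by simp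
      then show False using i(2) y(2) y0_def by simp
    qed
  qed
  have gain: "1 \<le> type_gain F t" "(type_gain F t)\<^sup>2 \<le> t" "type_gain F t = 1 / ?g (1 / t)" if t: "1 / y0 \<le> t" for t
  proof -
    have t0: "0 < t" using t y0 by (meson divide_pos_pos less_le_trans zero_less_one)
    have y: "0 < 1 / t" "1 / t \<le> y0" using t t0 y0 by (auto simp: field_simps)
    note r = R[OF y]
    show e: "type_gain F t = 1 / ?g (1 / t)" by (simp add: type_gain_def inverse_eq_divide)
    show "1 \<le> type_gain F t" unfolding e using r(2,3) d(2) by (simp add: field_simps)
    have "1 / t \<le> (?g (1 / t))\<^sup>2" using d(4)[of "?g (1 / t)"] r d(1) by simp
    then show "(type_gain F t)\<^sup>2 \<le> t" unfolding e using t0 r(2) by (simp add: field_simps power_divide)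
  qed
  obtain k0 where k0: "1 / y0 < 2 ^ k0" using real_arch_pow[of 2 "1 / y0"] by auto
  have k0': "1 / y0 \<le> 2 ^ k" if "k0 \<le> k" for k
    using k0 power_increasing[OF that, of "2::real"] by linarith
  \<comment> \<open>For the levels below \<open>k0\<close> the value 0 makes the weight vanish and
    its inequality trivial. The low frequencies are covered by the summand 1 in
    \<open>1 + (b k)\<^sup>2\<close>.\<close>
  define b where "b = (\<lambda>k. if k0 \<le> k then type_gain F (2 ^ k) else 0)"
  \<comment> \<open>The threshold is such that \<open>t1 \<le> t \<le> A * 2 ^ k\<close> forces
    \<open>k0 \<le> k\<close>.\<close>
  define t1 where "t1 = A * 2 ^ k0"
  have t1: "1 / y0 \<le> t1" 
  proof -
    have "1 * 2 ^ k0 \<le> A * 2 ^ k0" by (intro mult_right_mono A) auto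
    then show ?thesis unfolding t1_def using k0 by linarith
  qed
  \<comment> \<open>The second entry is the value of \<open>type_gain\<close> where
    \<open>1 / t\<close> is not attained by \<open>F\<close>: the inverse is then a description of
    nothing, the same unspecified number for all such \<open>t\<close>.\<close>
  define B where "B = max (type_gain F t1) \<bar>inverse (THE x::real. False)\<bar>"
  have B1: "1 \<le> B" unfolding B_def using gain(1)[OF t1] by simp
  have small: "(type_gain F t)\<^sup>2 \<le> B\<^sup>2" if t: "1 \<le> t" "t \<le> t1" for t
  proof -
    have "\<bar>type_gain F t\<bar> \<le> B"
    proof (cases "inverse t \<in> F ` {0<..}")
      case True
      have y: "0 < 1 / t1" "1 / t1 \<le> y0" using t1 t y0 by (auto simp: field_simps)
      have "F (?g (1 / t1)) \<le> inverse t" unfolding R(4)[OF y] using t by (simp add: field_simps)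
      then have "?g (1 / t1) \<le> ?g (inverse t)" by (rule type_inverse_mono[OF F True R(2)[OF y]])
      then have "type_gain F t \<le> type_gain F t1"
        using R(2)[OF y] by (simp add: type_gain_def inverse_eq_divide frac_le)
      moreover have "0 < type_gain F t" using type_inverse(1)[OF F True] by (simp add: type_gain_def)
      ultimately show ?thesis unfolding B_def by simp
    next
      case False
      then have "(\<lambda>x. x \<in> {0<..} \<and> F x = inverse t) = (\<lambda>x. False)" by (intro ext) (metis imageI)
      then have "?g (inverse t) = (THE x. False)" unfolding the_inv_into_def by (rule arg_cong[where f=The])
      then show ?thesis by (simp add: type_gain_def B_def)
    qed
    then show ?thesis using power_mono[of "\<bar>type_gain F t\<bar>" B 2] by simp
  qed
  have large: "type_gain F t \<le> A * b k" if t: "t1 \<le> t" "2 ^ k \<le> A * t" "t \<le> A * 2 ^ k" for k t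
  proof -
    have t0: "0 < t" using t(1) t1 y0 by (meson divide_pos_pos less_le_trans zero_less_one order_trans)
    have "A * 2 ^ k0 \<le> A * 2 ^ k" using t(1,3) unfolding t1_def by linarith
    then have "(2::real) ^ k0 \<le> 2 ^ k" using A by simp
    then have k: "k0 \<le> k" by simp
    have y: "0 < 1 / (2::real) ^ k" "1 / 2 ^ k \<le> y0" using k0'[OF k] y0 by (auto simp: field_simps)
    have "1 / y0 \<le> t" using t(1) t1 by linarith
    then have y': "0 < 1 / t" "1 / t \<le> y0" using t0 y0 by (auto simp: field_simps)
    define a where "a = ?g (1 / 2 ^ k)"
    have a: "0 < a" "a \<le> \<delta> / 2" "F a = 1 / 2 ^ k" unfolding a_def using R[OF y] by auto
    have aA: "0 < a / A" "a / A \<le> a" using a(1) A by (auto simp: field_simps)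
    \<comment> \<open>Quadratic decay of \<open>F\<close> gives
      \<open>F (a / A) \<le> F a / A\<^sup>2\<close>, which is at most \<open>1 / t\<close>; hence
      the inverse at \<open>1 / t\<close> is at least \<open>a / A\<close> and the gain at most
      \<open>A * b k\<close>.\<close>
    have "F (a / A) / (a / A)\<^sup>2 \<le> F a / a\<^sup>2"
      by (rule mono_onD[OF d(3)]) (use aA a d(1) in auto)
    then have "F (a / A) \<le> F a / A\<^sup>2" using a(1) A by (simp add: field_simps)
    also have "\<dots> \<le> F a / A" using A a(3) by (intro divide_left_mono) (auto simp: power2_eq_square)
    also have "\<dots> \<le> 1 / t" unfolding a(3) using t(3) t0 A by (simp add: field_simps)
    finally have "a / A \<le> ?g (1 / t)" by (rule type_inverse_mono[OF F R(1)[OF y'] aA(1)])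
    then have "1 / ?g (1 / t) \<le> A * (1 / a)" using R(2)[OF y'] a(1) A by (simp add: field_simps)
    moreover have "type_gain F t = 1 / ?g (1 / t)" using t(1) t1 by (intro gain) linarith
    moreover have "b k = 1 / a" unfolding b_def a_def using k gain(3)[OF k0'[OF k]] by simp
    ultimately show ?thesis by simp
  qed
  show ?thesis
  proof (rule exI[of _ b], rule exI[of _ \<delta>], rule exI[of _ "A\<^sup>2 + B\<^sup>2"], rule exI[of _ k0], intro conjI allI impI)
    show "0 < \<delta>" by (fact d)
    show "0 < A\<^sup>2 + B\<^sup>2" using A by (simp add: add_pos_nonneg)
    show "k < k0 \<Longrightarrow> b k = 0" for k by (simp add: b_def)
    show "k0 \<le> k \<Longrightarrow> 1 \<le> b k" for k unfolding b_def using gain(1)[OF k0'] by simp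
    show "(b k)\<^sup>2 \<le> 2 ^ k" for k unfolding b_def using gain(2)[OF k0'[of k]] by simp
    show "(b k)\<^sup>2 / 2 ^ k \<le> F x / x\<^sup>2" if k: "k0 \<le> k" and x: "1 / b k \<le> x \<and> x < \<delta>" for k x
    proof -
      have y: "0 < 1 / (2::real) ^ k" "1 / 2 ^ k \<le> y0" using k0'[OF k] y0 by (auto simp: field_simps)
      define a where "a = ?g (1 / 2 ^ k)"
      have a: "0 < a" "a \<le> \<delta> / 2" "F a = 1 / 2 ^ k" unfolding a_def using R[OF y] by auto
      have bk: "b k = 1 / a" unfolding b_def a_def using k gain(3)[OF k0'[OF k]] by simp
      have "F a / a\<^sup>2 \<le> F x / x\<^sup>2"
        by (rule mono_onD[OF d(3)]) (use a x bk d(1) in auto)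
      then show ?thesis unfolding bk a(3) by (simp add: power_divide mult.commute)
    qed
    show "(type_gain F t)\<^sup>2 \<le> (A\<^sup>2 + B\<^sup>2) * (1 + (b k)\<^sup>2)" if t: "1 \<le> t \<and> 2 ^ k \<le> A * t \<and> t \<le> A * 2 ^ k" for k t
    proof (cases "t \<le> t1")
      case True
      have "(type_gain F t)\<^sup>2 \<le> B\<^sup>2 * 1" using small[OF _ True] t by simp
      also have "\<dots> \<le> (A\<^sup>2 + B\<^sup>2) * (1 + (b k)\<^sup>2)" by (intro mult_mono) auto
      finally show ?thesis .
    next
      case False
      then have "type_gain F t \<le> A * b k" using large t by simp
      moreover have "1 / y0 \<le> t" using False t1 by linarith
      then have "0 \<le> type_gain F t" using gain(1) by (meson order_trans zero_le_one)
      ultimately have "(type_gain F t)\<^sup>2 \<le> (A * b k)\<^sup>2" by (rule power_mono)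
      also have "\<dots> = A\<^sup>2 * (b k)\<^sup>2" by (simp add: power_mult_distrib)
      also have "\<dots> \<le> (A\<^sup>2 + B\<^sup>2) * (1 + (b k)\<^sup>2)" by (intro mult_mono) auto
      finally show ?thesis .
    qed
    show "(type_gain F t)\<^sup>2 \<le> (A\<^sup>2 + B\<^sup>2) * t" if t: "1 \<le> t" for t
    proof (cases "t \<le> t1")
      case True
      have "(type_gain F t)\<^sup>2 \<le> B\<^sup>2 * 1" using small[OF t True] by simp
      also have "\<dots> \<le> (A\<^sup>2 + B\<^sup>2) * t" using t by (intro mult_mono) auto
      finally show ?thesis .
    next
      case False
      then have "(type_gain F t)\<^sup>2 \<le> 1 * t" using gain(2)[of t] t1 by simp
      also have "\<dots> \<le> (A\<^sup>2 + B\<^sup>2) * t" using t one_le_power[OF A, of 2] by (intro mult_right_mono) (auto intro: add_increasing2)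
      finally show ?thesis .
    qed
  qed
qed

text \<open>Where \<open>1 / t\<close> is a value of \<open>F\<close> the gain is monotone,
  elsewhere it is constant. The range of \<open>F\<close> is Borel as a countable union of half-open
  intervals.\<close>

lemma type_gain_measurable:
  assumes F: "admissible_type F"
  shows "(\<lambda>\<xi>::real^'m::finite. type_gain F (Lambda_symbol \<xi>)) \<in> borel_measurable borel"
proof -
  let ?R = "F ` {0<..}"
  have "?R = (\<Union>n. {0<..F (real (Suc n))})"
  proof
    show "?R \<subseteq> (\<Union>n. {0<..F (real (Suc n))})"
    proof
      fix y assume "y \<in> ?R"
      then obtain d where d: "0 < d" "y = F d" by auto
      obtain n where "d < real (Suc n)" using reals_Archimedean2[of d] by (metis less_trans of_nat_less_iff lessI)
      then have "y \<le> F (real (Suc n))" using strict_mono_onD[OF admissible_type_facts(2)[OF F], of d "real (Suc n)"] d by simp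
      then show "y \<in> (\<Union>n. {0<..F (real (Suc n))})"
        by (intro UN_I[of n]) (use admissible_type_facts(3)[OF F d(1)] d(2) in simp_all)
    qed
    show "(\<Union>n. {0<..F (real (Suc n))}) \<subseteq> ?R"
    proof
      fix y assume "y \<in> (\<Union>n. {0<..F (real (Suc n))})"
      then obtain n where "0 < y" "y \<le> F (real (Suc n))" by auto
      then show "y \<in> ?R" by (intro type_range[OF F, of y "real (Suc n)"]) auto
    qed
  qed
  then have [measurable]: "?R \<in> sets borel" by simp
  define S where "S = {t. 0 < t \<and> inverse t \<in> ?R}"
  have S[measurable]: "S \<in> sets borel" unfolding S_def by measurable
  have mono: "mono_on S (type_gain F)"
  proof (rule mono_onI)
    fix s t assume st: "s \<in> S" "t \<in> S" "s \<le> t"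
    have "F (the_inv_into {0<..} F (inverse t)) \<le> inverse s"
      using type_inverse(2)[OF F, of "inverse t"] st unfolding S_def by (simp add: le_imp_inverse_le)
    then have "the_inv_into {0<..} F (inverse t) \<le> the_inv_into {0<..} F (inverse s)"
      using st type_inverse(1)[OF F, of "inverse t"] unfolding S_def by (intro type_inverse_mono[OF F]) auto
    then show "type_gain F s \<le> type_gain F t"
      unfolding type_gain_def using st type_inverse(1)[OF F, of "inverse t"] unfolding S_def by (intro le_imp_inverse_le) auto
  qed
  have m: "(\<lambda>t. if t \<in> S then type_gain F t else inverse (THE x::real. False)) \<in> borel_measurable borel"
    by (subst measurable_If_restrict_space_iff) (use borel_measurable_mono_on_fnc[OF mono] S in auto)
  have eq: "type_gain F (Lambda_symbol \<xi>) = (\<lambda>t. if t \<in> S then type_gain F t else inverse (THE x::real. False)) (Lambda_symbol \<xi>)"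
    for \<xi> :: "real^'m"
  proof (cases "Lambda_symbol \<xi> \<in> S")
    case False
    then have "inverse (Lambda_symbol \<xi>) \<notin> ?R" using Lambda_ge_1[of \<xi>] unfolding S_def by auto
    then have "(\<lambda>x. x \<in> {0<..} \<and> F x = inverse (Lambda_symbol \<xi>)) = (\<lambda>x. False)" by (intro ext) (metis imageI)
    then have "the_inv_into {0<..} F (inverse (Lambda_symbol \<xi>)) = (THE x. False)" unfolding the_inv_into_def by (rule arg_cong[where f=The])
    then show ?thesis using False by (simp add: type_gain_def)
  qed simp
  show ?thesis
    by (rule ssubst[OF ext[OF eq]]) (rule measurable_compose[OF Lambda_measurable m])
qed

section \<open>Levi forms of weights\<close>

lemma partial_cong_open:
  assumes "open V" "x \<in> V" "\<And>y. y \<in> V \<Longrightarrow> f y = g y"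
  shows "partial l f x = partial l g x"
  unfolding partial_def using frechet_derivative_cong_open[OF assms] by simp

lemma vf_apply_cong_open:
  assumes "open V" "x \<in> V" "\<And>y. y \<in> V \<Longrightarrow> f y = g y"
  shows "vf_apply X f x = vf_apply X g x"
  unfolding vf_apply_def using partial_cong_open[OF assms] by simp

lemma vf_apply_has_derivative:
  assumes "(f has_derivative D) (at x)"
  shows "vf_apply X f x = (\<Sum>l\<in>UNIV. X x $ l * D (axis l 1))"
  unfolding vf_apply_def partial_def frechet_derivative_at[OF assms, symmetric] ..

lemma vf_apply_sum:
  assumes "\<And>u. u \<in> I \<Longrightarrow> f u differentiable (at x)"
  shows "vf_apply X (\<lambda>y. \<Sum>u\<in>I. f u y) x = (\<Sum>u\<in>I. vf_apply X (f u) x)"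
proof -
  have "((\<lambda>y. \<Sum>u\<in>I. f u y) has_derivative (\<lambda>h. \<Sum>u\<in>I. frechet_derivative (f u) (at x) h)) (at x)"
    using assms by (intro has_derivative_sum) (simp add: frechet_derivative_works)
  from vf_apply_has_derivative[OF this, of X] show ?thesis
    unfolding vf_apply_def partial_def by (simp add: sum_distrib_left sum.swap[of _ _ I])
qed

lemma vf_apply_mult:
  assumes "f differentiable (at x)" "g differentiable (at x)"
  shows "vf_apply X (\<lambda>y. f y * g y) x = f x * vf_apply X g x + vf_apply X f x * g x"
proof -
  have "((\<lambda>y. f y * g y) has_derivative (\<lambda>h. f x * frechet_derivative g (at x) h + frechet_derivative f (at x) h * g x)) (at x)"
    using assms by (intro has_derivative_mult) (simp_all add: frechet_derivative_works)
  from vf_apply_has_derivative[OF this, of X] show ?thesis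
    unfolding vf_apply_def partial_def by (simp add: sum.distrib sum_distrib_left sum_distrib_right distrib_left mult_ac)
qed

lemma vf_apply_compose_real:
  fixes \<rho> :: "real^'m::finite \<Rightarrow> real"
  assumes "\<rho> differentiable (at x)" "(\<theta> has_real_derivative d) (at (\<rho> x))"
  shows "vf_apply X (\<lambda>y. complex_of_real (\<theta> (\<rho> y))) x = complex_of_real d * vf_apply X (\<lambda>y. complex_of_real (\<rho> y)) x"
proof -
  let ?D = "frechet_derivative \<rho> (at x)"
  have D: "(\<rho> has_derivative ?D) (at x)" using assms(1) by (simp add: frechet_derivative_works)
  have "((\<lambda>y. \<theta> (\<rho> y)) has_derivative (\<lambda>h. d * ?D h)) (at x)"
    using diff_chain_at[OF D assms(2)[unfolded has_field_derivative_def]] by (simp add: o_def)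
  from vf_apply_has_derivative[OF has_derivative_of_real[OF this], of X]
    vf_apply_has_derivative[OF has_derivative_of_real[OF D], of X]
  show ?thesis by (simp add: sum_distrib_left mult_ac)
qed

lemma vf_apply_cnj_real:
  fixes \<rho> :: "real^'m::finite \<Rightarrow> real"
  assumes "\<rho> differentiable (at x)"
  shows "vf_apply (vf_cnj X) (\<lambda>y. complex_of_real (\<rho> y)) x = cnj (vf_apply X (\<lambda>y. complex_of_real (\<rho> y)) x)"
proof -
  have D: "(\<rho> has_derivative frechet_derivative \<rho> (at x)) (at x)" using assms by (simp add: frechet_derivative_works)
  show ?thesis
    unfolding vf_apply_has_derivative[OF has_derivative_of_real[OF D]] by (simp add: vf_cnj_def)
qed

lemma smooth_on_vf_cnj:
  assumes "open V" "smooth_on V (X :: 'm::finite cfield)"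
  shows "smooth_on V (\<lambda>x. vf_cnj X x $ l)"
  unfolding vf_cnj_def by (simp add: smooth_on_cnj[OF assms(1) smooth_on_vec_nth[OF assms]])

lemma smooth_on_vf_apply:
  assumes "open V" "\<And>l. smooth_on V (\<lambda>x. X x $ l)" "smooth_on V f"
  shows "smooth_on V (vf_apply X f)"
  unfolding vf_apply_def[abs_def]
  by (intro smooth_on_sum[OF assms(1)] smooth_on_mult[OF assms(1)] assms(2) smooth_on_partial[OF assms(3)])

lemma smooth_on_bracket_form:
  fixes X Y \<eta> :: "'m::finite cfield"
  assumes "open V" "\<And>l. smooth_on V (\<lambda>x. X x $ l)" "\<And>l. smooth_on V (\<lambda>x. Y x $ l)" "\<And>l. smooth_on V (\<lambda>x. \<eta> x $ l)"
  shows "smooth_on V (form_apply \<eta> (lie_bracket X Y))"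
  unfolding form_apply_def[abs_def] lie_bracket_def
  by (simp, intro smooth_on_sum[OF assms(1)] smooth_on_mult[OF assms(1)] smooth_on_diff[OF assms(1)]
      smooth_on_vf_apply[OF assms(1)] assms)

locale frame_fields =
  fixes r :: nat and V :: "(real^'m::finite) set" and \<omega> L :: "nat \<Rightarrow> 'm cfield" and \<gamma> :: "'m cfield"
  assumes V: "open V" and sm_L: "\<And>j. j < r \<Longrightarrow> smooth_on V (L j)" and sm_\<omega>: "\<And>j. j < r \<Longrightarrow> smooth_on V (\<omega> j)"
    and sm_\<gamma>: "smooth_on V \<gamma>"
begin

lemma smooth_L: "j < r \<Longrightarrow> smooth_on V (\<lambda>x. L j x $ l)" and smooth_cnj_L: "j < r \<Longrightarrow> smooth_on V (\<lambda>x. vf_cnj (L j) x $ l)"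
  using smooth_on_vec_nth[OF V sm_L] smooth_on_vf_cnj[OF V sm_L] by auto

lemma smooth_levi: "i < r \<Longrightarrow> j < r \<Longrightarrow> smooth_on V (levi \<gamma> L i j)"
  unfolding levi_def[abs_def]
  by (intro smooth_on_bracket_form[OF V] smooth_L smooth_cnj_L smooth_on_vec_nth[OF V sm_\<gamma>])

lemma smooth_bracket_coeff: "h < r \<Longrightarrow> i < r \<Longrightarrow> j < r \<Longrightarrow> smooth_on V (bracket_coeff \<omega> L h i j)"
  unfolding bracket_coeff_def[abs_def]
  by (intro smooth_on_bracket_form[OF V] smooth_L smooth_cnj_L smooth_on_vec_nth[OF V sm_\<omega>])

lemma smooth_levi_weight:
  assumes "smooth_on V \<phi>" "i < r" "j < r"
  shows "smooth_on V (levi_weight r \<omega> L \<phi> i j)"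
proof -
  have u: "smooth_on V (\<lambda>y. complex_of_real (\<phi> y))" by (rule smooth_on_of_real[OF V assms(1)])
  have half: "smooth_on V (\<lambda>x. g x / 2)" if "smooth_on V g" for g :: "real^'m \<Rightarrow> complex"
    using smooth_on_mult[OF V that smooth_on_const[OF V, of "1 / 2"]] by simp
  show ?thesis
    unfolding levi_weight_def[abs_def] Let_def
    by (intro half smooth_on_add[OF V] smooth_on_sum[OF V] smooth_on_mult[OF V] smooth_on_cnj[OF V]
        smooth_on_vf_apply[OF V] smooth_bracket_coeff smooth_L smooth_cnj_L assms u) auto
qed

text \<open>The first-order terms of the Levi form of a weight are chosen so that it obeys the chain rule
  of a second-order operator without zeroth-order part.\<close>

lemma levi_weight_compose:
  assumes \<rho>: "smooth_on V \<rho>" and \<theta>: "smooth_on UNIV \<theta>" and ij: "i < r" "j < r" and x: "x \<in> V"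
  defines "d1 \<equiv> \<lambda>t::real. frechet_derivative \<theta> (at t) 1"
  defines "d2 \<equiv> \<lambda>t::real. frechet_derivative d1 (at t) 1"
  shows "levi_weight r \<omega> L (\<lambda>y. \<theta> (\<rho> y)) i j x = complex_of_real (d1 (\<rho> x)) * levi_weight r \<omega> L \<rho> i j x
    + complex_of_real (d2 (\<rho> x)) * (vf_apply (L i) (\<lambda>y. complex_of_real (\<rho> y)) x * cnj (vf_apply (L j) (\<lambda>y. complex_of_real (\<rho> y)) x))"
proof -
  let ?u = "\<lambda>y. complex_of_real (\<theta> (\<rho> y))" and ?v = "\<lambda>y. complex_of_real (\<rho> y)"
  have sd1: "smooth_on UNIV d1" unfolding d1_def by (rule smooth_on_frechet_derivative[OF \<theta>])
  have der: "(f has_real_derivative frechet_derivative f (at t) 1) (at t)" if "smooth_on UNIV f" for f :: "real \<Rightarrow> real" and t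
  proof -
    have D: "(f has_derivative frechet_derivative f (at t)) (at t)" using smooth_on_has_derivative[OF that] by simp
    then have "frechet_derivative f (at t) h = frechet_derivative f (at t) 1 * h" for h
      using linear_scale[OF has_derivative_linear[OF D], of h 1] by simp
    then have "frechet_derivative f (at t) = (*) (frechet_derivative f (at t) 1)" by (intro ext)
    with D show ?thesis unfolding has_field_derivative_def by simp
  qed
  have d\<rho>: "\<rho> differentiable (at y)" if "y \<in> V" for y using \<rho> that smooth_on_unfold by blast
  have ch: "vf_apply X ?u y = complex_of_real (d1 (\<rho> y)) * vf_apply X ?v y" if "y \<in> V" for X y
    using vf_apply_compose_real[OF d\<rho>[OF that] der[OF \<theta>]] unfolding d1_def .
  have ch1: "vf_apply X (\<lambda>y. complex_of_real (d1 (\<rho> y))) x = complex_of_real (d2 (\<rho> x)) * vf_apply X ?v x" for X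
    using vf_apply_compose_real[OF d\<rho>[OF x] der[OF sd1]] unfolding d2_def .
  have sv: "smooth_on V ?v" by (rule smooth_on_of_real[OF V \<rho>])
  have ssd: "smooth_on V (\<lambda>y. complex_of_real (d1 (\<rho> y)))"
    by (intro smooth_on_of_real[OF V] smooth_on_compose[OF V open_UNIV \<rho> sd1]) auto
  \<comment> \<open>Differentiating the outer factor \<open>d1\<close> once more is the only source
    of the term with two first derivatives of \<open>\<rho>\<close>.\<close>
  have second: "vf_apply X (vf_apply Y ?u) x = complex_of_real (d1 (\<rho> x)) * vf_apply X (vf_apply Y ?v) x
      + complex_of_real (d2 (\<rho> x)) * vf_apply X ?v x * vf_apply Y ?v x"
    if Y: "\<And>l. smooth_on V (\<lambda>x. Y x $ l)" for X Y
  proof -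
    have "vf_apply X (vf_apply Y ?u) x = vf_apply X (\<lambda>y. complex_of_real (d1 (\<rho> y)) * vf_apply Y ?v y) x"
      by (rule vf_apply_cong_open[OF V x]) (rule ch)
    also have "\<dots> = complex_of_real (d1 (\<rho> x)) * vf_apply X (vf_apply Y ?v) x
        + vf_apply X (\<lambda>y. complex_of_real (d1 (\<rho> y))) x * vf_apply Y ?v x"
      by (rule vf_apply_mult) (use ssd smooth_on_vf_apply[OF V Y sv] x smooth_on_unfold in blast)+
    finally show ?thesis unfolding ch1 .
  qed
  have cj: "vf_apply (vf_cnj X) ?v x = cnj (vf_apply X ?v x)" for X by (rule vf_apply_cnj_real[OF d\<rho>[OF x]])
  show ?thesis
    unfolding levi_weight_def Let_def second[OF smooth_cnj_L[OF ij(2)]] second[OF smooth_L[OF ij(1)]] ch[OF x] cj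
    by (simp add: sum_distrib_left algebra_simps add_divide_distrib)
qed

lemma levi_weight_sum:
  assumes I: "\<And>u. u \<in> I \<Longrightarrow> smooth_on V (f u)" and ij: "i < r" "j < r" and x: "x \<in> V"
  shows "levi_weight r \<omega> L (\<lambda>y. \<Sum>u\<in>I. f u y) i j x = (\<Sum>u\<in>I. levi_weight r \<omega> L (f u) i j x)"
proof -
  let ?u = "\<lambda>y. complex_of_real (\<Sum>u\<in>I. f u y)" and ?v = "\<lambda>u y. complex_of_real (f u y)"
  have sv: "smooth_on V (?v u)" if "u \<in> I" for u by (rule smooth_on_of_real[OF V I[OF that]])
  have first: "vf_apply X ?u y = (\<Sum>u\<in>I. vf_apply X (?v u) y)" if "y \<in> V" for X y
    unfolding of_real_sum by (rule vf_apply_sum) (use sv that smooth_on_unfold in blast)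
  have second: "vf_apply X (vf_apply Y ?u) x = (\<Sum>u\<in>I. vf_apply X (vf_apply Y (?v u)) x)"
    if Y: "\<And>l. smooth_on V (\<lambda>x. Y x $ l)" for X Y
  proof -
    have "vf_apply X (vf_apply Y ?u) x = vf_apply X (\<lambda>y. \<Sum>u\<in>I. vf_apply Y (?v u) y) x"
      by (rule vf_apply_cong_open[OF V x]) (rule first)
    also have "\<dots> = (\<Sum>u\<in>I. vf_apply X (vf_apply Y (?v u)) x)"
      by (rule vf_apply_sum) (use smooth_on_vf_apply[OF V Y sv] x smooth_on_unfold in blast)
    finally show ?thesis .
  qed
  show ?thesis
    unfolding levi_weight_def Let_def second[OF smooth_cnj_L[OF ij(2)]] second[OF smooth_L[OF ij(1)]] first[OF x]
    by (simp add: sum.distrib sum_distrib_left sum_divide_distrib[symmetric] sum.swap[of _ I])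
qed

end

lemma levi_weight_zero:
  fixes L :: "nat \<Rightarrow> 'm::finite cfield"
  shows "levi_weight r \<omega> L (\<lambda>y. 0) i j x = 0"
proof -
  have "vf_apply X (\<lambda>y. 0) = (\<lambda>y. 0)" for X :: "'m cfield"
    by (simp add: vf_apply_def[abs_def] partial_def)
  then show ?thesis by (simp add: levi_weight_def Let_def)
qed

text \<open>The chain rule with the linear outer function of slope \<open>e\<close>, whose second
  derivative vanishes.\<close>

lemma levi_weight_scale:
  fixes \<phi> :: "real^'m::finite \<Rightarrow> real"
  assumes "frame_fields r V \<omega> L \<gamma>" "smooth_on V \<phi>" "i < r" "j < r" "x \<in> V"
  shows "levi_weight r \<omega> L (\<lambda>y. e * \<phi> y) i j x = complex_of_real e * levi_weight r \<omega> L \<phi> i j x"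
proof -
  have s: "smooth_on UNIV (\<lambda>t::real. e * t)" by (intro smooth_on_mult smooth_on_const smooth_on_id) auto
  have d: "frechet_derivative (\<lambda>t::real. e * t) (at t) 1 = e" for t
  proof -
    have "((\<lambda>t::real. e * t) has_derivative (\<lambda>h. e * h)) (at t)" by (auto intro!: derivative_eq_intros)
    from frechet_derivative_at[OF this] show ?thesis by (metis mult.right_neutral)
  qed
  show ?thesis
    using frame_fields.levi_weight_compose[OF assms(1,2) s assms(3-5)] by (simp add: d)
qed

section \<open>Defining functions of a submanifold and the distance to it\<close>

lemma submanifold_equations:
  fixes S :: "'a::euclidean_space set"
  assumes S: "embedded_submanifold s S" and z: "z \<in> S"
  shows "\<exists>W H (h :: 'a \<Rightarrow> 'a \<Rightarrow> real). open W \<and> z \<in> W \<and> finite H \<and> (\<forall>u\<in>H. smooth_on W (h u) \<and> (\<forall>p\<in>S \<inter> W. h u p = 0)) \<and>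
     (\<forall>X. (\<forall>u\<in>H. frechet_derivative (h u) (at z) X = 0) \<longrightarrow> X \<in> tangent_space S z)"
proof -
  obtain W \<Phi> \<Psi> B and W' :: "'a set" where "open W \<and> z \<in> W \<and> open W' \<and> homeomorphism W W' \<Phi> \<Psi> \<and>
      smooth_on W \<Phi> \<and> smooth_on W' \<Psi> \<and> subspace B \<and> dim B = s \<and> \<Phi> ` (S \<inter> W) = B \<inter> W'"
    using bspec[OF S[unfolded embedded_submanifold_def] z] by blast
  then have W: "open W" "z \<in> W" "open W'" and hom: "homeomorphism W W' \<Phi> \<Psi>"
    and sm: "smooth_on W \<Phi>" "smooth_on W' \<Psi>" and B: "subspace B" and im: "\<Phi> ` (S \<inter> W) = B \<inter> W'"
    by simp_all
  \<comment> \<open>A basis of the orthogonal complement of the model subspace supplies the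
    equations: the components of the chart \<open>\<Phi>\<close> along \<open>H\<close> vanish on
    \<open>S\<close>, and a vector orthogonal to all of \<open>H\<close> lies in
    \<open>B\<close>.\<close>
  obtain H where H: "H \<subseteq> orthogonal_comp B" "independent H" "orthogonal_comp B \<subseteq> span H"
    using basis_exists[of "orthogonal_comp B"] by metis
  have fH: "finite H" using H(2) by (rule independent_imp_finite)
  have inB: "y \<in> B" if y: "\<And>u. u \<in> H \<Longrightarrow> y \<bullet> u = 0" for y
  proof -
    have "span H \<subseteq> {u. y \<bullet> u = 0}"
      by (rule span_minimal) (use y in \<open>auto simp: subspace_def inner_add_right\<close>)
    then have "y \<in> orthogonal_comp (orthogonal_comp B)"
      using H(3) unfolding orthogonal_comp_def[of "orthogonal_comp B"] orthogonal_def by (auto simp: inner_commute)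
    then show ?thesis using orthogonal_comp_self[OF B] by simp
  qed
  have \<Phi>z: "\<Phi> z \<in> B" "\<Phi> z \<in> W'" using im z W(2) by blast+
  have D\<Phi>: "(\<Phi> has_derivative frechet_derivative \<Phi> (at z)) (at z)" by (rule smooth_on_has_derivative[OF sm(1) W(2)])
  have D\<Psi>: "(\<Psi> has_derivative frechet_derivative \<Psi> (at (\<Phi> z))) (at (\<Phi> z))" by (rule smooth_on_has_derivative[OF sm(2) \<Phi>z(2)])
  have inv: "frechet_derivative \<Psi> (at (\<Phi> z)) (frechet_derivative \<Phi> (at z) X) = X" for X
  proof -
    have "((\<Psi> \<circ> \<Phi>) has_derivative (frechet_derivative \<Psi> (at (\<Phi> z)) \<circ> frechet_derivative \<Phi> (at z))) (at z)"
      by (rule diff_chain_at[OF D\<Phi> D\<Psi>])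
    then have "((\<lambda>x. x) has_derivative (frechet_derivative \<Psi> (at (\<Phi> z)) \<circ> frechet_derivative \<Phi> (at z))) (at z)"
      by (rule has_derivative_transform_within_open[OF _ W(1,2)]) (use hom in \<open>auto simp: homeomorphism_def\<close>)
    from has_derivative_unique[OF this has_derivative_ident] show ?thesis by (metis comp_apply)
  qed
  have Dh: "frechet_derivative (\<lambda>p. \<Phi> p \<bullet> u) (at z) X = frechet_derivative \<Phi> (at z) X \<bullet> u" for u X
    using frechet_derivative_at[OF has_derivative_inner_left[OF D\<Phi>, of u]] by metis
  show ?thesis
  proof (rule exI[of _ W], rule exI[of _ H], rule exI[of _ "\<lambda>u p. \<Phi> p \<bullet> u"], intro conjI ballI allI impI)
    fix u assume u: "u \<in> H"
    show "smooth_on W (\<lambda>p. \<Phi> p \<bullet> u)"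
      by (rule smooth_on_bounded_linear[OF W(1) bounded_linear_inner_left sm(1)])
    fix p assume "p \<in> S \<inter> W"
    then have "\<Phi> p \<in> B" using im by blast
    moreover have "u \<in> orthogonal_comp B" using H(1) u by blast
    ultimately show "\<Phi> p \<bullet> u = 0" unfolding orthogonal_comp_def orthogonal_def by simp
  next
    fix X assume X: "\<forall>u\<in>H. frechet_derivative (\<lambda>p. \<Phi> p \<bullet> u) (at z) X = 0"
    \<comment> \<open>In the chart, \<open>X\<close> becomes a vector \<open>Y\<close> of
      \<open>B\<close>. The straight line through \<open>\<Phi> z\<close> in the direction
      \<open>Y\<close> stays in \<open>B\<close>, and \<open>\<Psi>\<close> maps it to the curve in
      \<open>S\<close> with velocity \<open>X\<close> that the tangent space asks for.\<close>
    define Y where "Y = frechet_derivative \<Phi> (at z) X"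
    have Y: "Y \<in> B" unfolding Y_def by (rule inB) (use X Dh in simp)
    have inv_mem: "\<Psi> q \<in> S" if "q \<in> B" "q \<in> W'" for q
    proof -
      have "q \<in> \<Phi> ` (S \<inter> W)" using im that by blast
      then obtain p where "p \<in> S" "p \<in> W" "q = \<Phi> p" by blast
      then show ?thesis using hom by (simp add: homeomorphism_def)
    qed
    have lim: "((\<lambda>t::real. \<Phi> z + t *\<^sub>R Y) \<longlongrightarrow> \<Phi> z + 0 *\<^sub>R Y) (at 0)" by (intro tendsto_intros)
    have ev: "\<forall>\<^sub>F t in at (0::real). \<Phi> z + t *\<^sub>R Y \<in> W'"
      by (rule topological_tendstoD[OF lim W(3)]) (use \<Phi>z in simp)
    have "\<forall>\<^sub>F t in at (0::real). \<Psi> (\<Phi> z + t *\<^sub>R Y) \<in> S"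
      using ev by eventually_elim (intro inv_mem subspace_add[OF B \<Phi>z(1)] subspace_scale[OF B Y])
    moreover have "\<Psi> (\<Phi> z + 0 *\<^sub>R Y) = z" using hom W(2) by (simp add: homeomorphism_def)
    moreover have "((\<lambda>t. \<Psi> (\<Phi> z + t *\<^sub>R Y)) has_vector_derivative X) (at 0)"
    proof -
      have l: "((\<lambda>t::real. \<Phi> z + t *\<^sub>R Y) has_derivative (\<lambda>t. t *\<^sub>R Y)) (at 0)" by (auto intro!: derivative_eq_intros)
      have D': "(\<Psi> has_derivative frechet_derivative \<Psi> (at (\<Phi> z))) (at ((\<lambda>t::real. \<Phi> z + t *\<^sub>R Y) 0))" using D\<Psi> by simp
      have "frechet_derivative \<Psi> (at (\<Phi> z)) (t *\<^sub>R Y) = t *\<^sub>R X" for t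
        using linear_scale[OF has_derivative_linear[OF D\<Psi>], of t Y] inv[of X] unfolding Y_def by simp
      then show ?thesis
        using diff_chain_at[OF l D'] unfolding has_vector_derivative_def by (simp add: o_def)
    qed
    ultimately show "X \<in> tangent_space S z" unfolding tangent_space_def
      by (intro CollectI exI[of _ "\<lambda>t. \<Psi> (\<Phi> z + t *\<^sub>R Y)"] conjI)
  qed (use W fH in auto)
qed

text \<open>Near \<open>z\<close> the function is Lipschitz, so its value at \<open>p\<close> is
  bounded through points of \<open>S\<close> where it vanishes. The distance need not be attained,
  hence the nearly closest points and the passage to the limit.\<close>

lemma submanifold_function_le_infdist:
  fixes S :: "'a::euclidean_space set"
  assumes W: "open W" "z \<in> W" and z: "z \<in> S" and h: "smooth_on W h" "\<And>p. p \<in> S \<inter> W \<Longrightarrow> h p = (0::real)"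
  shows "\<exists>R>0. \<exists>C\<ge>0. \<forall>p. dist z p < R \<longrightarrow> \<bar>h p\<bar> \<le> C * infdist p S"
proof -
  obtain R where R: "R > 0" "cball z R \<subseteq> W" using W open_contains_cball by blast
  have "\<exists>B. \<forall>b\<in>Basis. \<forall>p\<in>cball z R. \<bar>frechet_derivative h (at p) b\<bar> \<le> B"
  proof -
    have "\<exists>B. \<forall>p\<in>cball z R. \<bar>frechet_derivative h (at p) b\<bar> \<le> B" for b
    proof -
      have "continuous_on (cball z R) (\<lambda>p. frechet_derivative h (at p) b)"
        by (rule continuous_on_subset[OF smooth_on_continuous_on[OF smooth_on_frechet_derivative[OF h(1)]] R(2)])
      then have "bounded ((\<lambda>p. frechet_derivative h (at p) b) ` cball z R)"
        by (intro compact_imp_bounded compact_continuous_image) auto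
      then show ?thesis unfolding bounded_iff by auto
    qed
    then obtain B where B: "\<And>b p. p \<in> cball z R \<Longrightarrow> \<bar>frechet_derivative h (at p) b\<bar> \<le> B b" by metis
    have "\<bar>frechet_derivative h (at p) b\<bar> \<le> (\<Sum>b\<in>Basis. \<bar>B b\<bar>)" if "b \<in> Basis" "p \<in> cball z R" for b p
      using B[OF that(2), of b] member_le_sum[of b Basis "\<lambda>b. \<bar>B b\<bar>"] that(1) by fastforce
    then show ?thesis by blast
  qed
  then obtain B where B: "\<And>b p. b \<in> Basis \<Longrightarrow> p \<in> cball z R \<Longrightarrow> \<bar>frechet_derivative h (at p) b\<bar> \<le> B" by blast
  define C where "C = \<bar>B\<bar> * DIM('a)"
  have C0: "0 \<le> C" unfolding C_def by simp
  have lip: "\<bar>h p - h q\<bar> \<le> C * dist p q" if "p \<in> cball z R" "q \<in> cball z R" for p q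
  proof -
    have "norm (h p - h q) \<le> \<bar>B\<bar> * DIM('a) * norm (p - q)"
    proof (rule lipschitz_of_directional[of "cball z R" h "\<lambda>p. frechet_derivative h (at p)"])
      show "(h has_derivative frechet_derivative h (at x)) (at x within cball z R)" if "x \<in> cball z R" for x
        by (rule has_derivative_at_withinI[OF smooth_on_has_derivative[OF h(1) subsetD[OF R(2) that]]])
      show "norm (frechet_derivative h (at x) b) \<le> \<bar>B\<bar>" if "x \<in> cball z R" "b \<in> Basis" for x b
        using order_trans[OF B[OF that(2,1)] abs_ge_self] by simp
    qed (rule convex_cball that)+
    then show ?thesis unfolding C_def by (simp add: dist_norm)
  qed
  show ?thesis
  proof (rule exI[of _ "R / 4"], rule conjI, use R in simp, rule exI[of _ C], intro conjI allI impI C0)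
    fix p assume p: "dist z p < R / 4"
    have inf: "infdist p S < R / 2" using infdist_le[OF z, of p] p R(1) by (simp add: dist_commute)
    show "\<bar>h p\<bar> \<le> C * infdist p S"
    proof (rule field_le_epsilon)
      fix e :: real assume e: "0 < e"
      \<comment> \<open>The first entry absorbs the Lipschitz constant. The second keeps the nearly
        closest point within \<open>R / 4 + R / 2 + R / 4 = R\<close> of \<open>z\<close>, where the
        Lipschitz bound holds.\<close>
      define e' where "e' = min (e / (C + 1)) (R / 4)"
      have e': "0 < e'" "C * e' \<le> e"
      proof -
        show "0 < e'" unfolding e'_def using e C0 R(1) by simp
        have "C * e' \<le> C * (e / (C + 1))" unfolding e'_def using C0 by (intro mult_left_mono) auto
        also have "\<dots> \<le> e" using C0 e by (simp add: field_simps)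
        finally show "C * e' \<le> e" .
      qed
      have "\<exists>q\<in>S. dist p q < infdist p S + e'"
      proof (rule ccontr)
        assume n: "\<not> ?thesis"
        have "infdist p S + e' \<le> Inf (dist p ` S)"
        proof (rule cINF_greatest)
          fix q assume "q \<in> S"
          then show "infdist p S + e' \<le> dist p q" using n by (meson not_less)
        qed (use z in blast)
        then have "infdist p S + e' \<le> infdist p S" using z unfolding infdist_def by (metis empty_iff)
        then show False using e' by simp
      qed
      then obtain q where q: "q \<in> S" "dist p q < infdist p S + e'" by blast
      have "dist z q \<le> dist z p + dist p q" by (rule dist_triangle)
      moreover have "e' \<le> R / 4" unfolding e'_def by (rule min.cobounded2)
      ultimately have "dist z q \<le> R" using p q(2) inf R(1) by linarith
      then have qR: "q \<in> cball z R" by (simp only: mem_cball)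
      have "h q = 0" using h(2) q(1) qR R(2) by blast
      then have "\<bar>h p\<bar> \<le> C * dist p q" using lip[OF _ qR, of p] p R(1) by (simp only: mem_cball diff_0_right)
      also have "\<dots> \<le> C * (infdist p S + e')" using q(2) C0 by (intro mult_left_mono) auto
      also have "\<dots> \<le> C * infdist p S + e" using e'(2) by (simp add: distrib_left)
      finally show "\<bar>h p\<bar> \<le> C * infdist p S + e" .
    qed
  qed
qed

lemma levi_weight_cong_open:
  assumes "open U" "x \<in> U" "\<And>y. y \<in> U \<Longrightarrow> f y = g y"
  shows "levi_weight r \<omega> L f i j x = levi_weight r \<omega> L g i j x"
proof -
  have 1: "vf_apply X (\<lambda>y. complex_of_real (f y)) y = vf_apply X (\<lambda>y. complex_of_real (g y)) y" if "y \<in> U" for X y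
    by (rule vf_apply_cong_open[OF assms(1) that]) (simp add: assms(3))
  have 2: "vf_apply Y (vf_apply X (\<lambda>y. complex_of_real (f y))) x = vf_apply Y (vf_apply X (\<lambda>y. complex_of_real (g y))) x" for X Y
    by (rule vf_apply_cong_open[OF assms(1,2) 1])
  show ?thesis unfolding levi_weight_def Let_def 1[OF assms(2)] 2 ..
qed

lemma bounded_on_compact_support:
  fixes f :: "'a::euclidean_space \<Rightarrow> complex"
  assumes "continuous_on V f" "compact K" "K \<subseteq> V" "\<And>x. x \<in> V \<Longrightarrow> x \<notin> K \<Longrightarrow> f x = 0"
  shows "\<exists>B\<ge>0. \<forall>x\<in>V. norm (f x) \<le> B"
proof -
  have "bounded (f ` K)"
    by (intro compact_imp_bounded compact_continuous_image continuous_on_subset[OF assms(1,3)] assms(2))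
  then obtain B where B: "\<And>x. x \<in> K \<Longrightarrow> norm (f x) \<le> B" unfolding bounded_iff by auto
  have "norm (f x) \<le> \<bar>B\<bar>" if "x \<in> V" for x
    using B[of x] assms(4)[OF that] by (cases "x \<in> K") auto
  then show ?thesis by (intro exI[of _ "\<bar>B\<bar>"]) auto
qed

text \<open>The right-hand side is continuous, homogeneous of degree two and positive on the unit
  sphere, because its zero set is the common kernel; its minimum on the compact sphere is the
  constant.\<close>

lemma linear_functionals_coercive:
  fixes k :: "'u \<Rightarrow> complex^'n \<Rightarrow> real"
  assumes H: "finite H" and lin: "\<And>u. u \<in> H \<Longrightarrow> linear (k u)"
    and ker: "\<And>X. (\<And>u. u \<in> H \<Longrightarrow> k u X = 0 \<and> k u (\<i> *s X) = 0) \<Longrightarrow> X = 0"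
  shows "\<exists>c>0. \<forall>X. c * (norm X)\<^sup>2 \<le> (\<Sum>u\<in>H. (k u X)\<^sup>2 + (k u (\<i> *s X))\<^sup>2)"
proof -
  define f where "f X = (\<Sum>u\<in>H. (k u X)\<^sup>2 + (k u (\<i> *s X))\<^sup>2)" for X
  have li: "linear (\<lambda>X::complex^'n. \<i> *s X)"
    by (rule linearI) (auto simp: vec_eq_iff algebra_simps)
  have c: "continuous_on UNIV f"
    unfolding f_def
  proof (intro continuous_intros)
    fix u assume u: "u \<in> H"
    show "continuous_on UNIV (k u)" by (rule linear_continuous_on[OF linear_conv_bounded_linear[THEN iffD1, OF lin[OF u]]])
    show "continuous_on UNIV (\<lambda>X. k u (\<i> *s X))"
      using linear_continuous_on[OF linear_conv_bounded_linear[THEN iffD1, OF linear_compose[OF li lin[OF u]]]] by (simp add: o_def)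
  qed
  have "sphere (0::complex^'n) 1 \<noteq> {}" by simp
  then obtain X0 where X0: "X0 \<in> sphere 0 1" "\<And>X. X \<in> sphere 0 1 \<Longrightarrow> f X0 \<le> f X"
    using continuous_attains_inf[OF compact_sphere _ continuous_on_subset[OF c subset_UNIV], of 0 1] by blast
  have f0: "0 \<le> f X" for X unfolding f_def by (intro sum_nonneg) auto
  have "f X0 \<noteq> 0"
  proof
    assume z: "f X0 = 0"
    have "X0 = 0"
    proof (rule ker)
      fix u assume u: "u \<in> H"
      have "(k u X0)\<^sup>2 + (k u (\<i> *s X0))\<^sup>2 = 0"
        using z u unfolding f_def by (subst (asm) sum_nonneg_eq_0_iff[OF H]) auto
      then show "k u X0 = 0 \<and> k u (\<i> *s X0) = 0" by (simp add: sum_power2_eq_zero_iff)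
    qed
    then show False using X0(1) by simp
  qed
  then have pos: "0 < f X0" using f0[of X0] by simp
  have "f X0 * (norm X)\<^sup>2 \<le> f X" for X
  proof (cases "X = 0")
    case False
    define Y where "Y = X /\<^sub>R norm X"
    have Y: "Y \<in> sphere 0 1" "X = norm X *\<^sub>R Y" unfolding Y_def using False by auto
    have iY: "\<i> *s (c *\<^sub>R Y) = c *\<^sub>R (\<i> *s Y)" for c :: real by (rule linear_scale[OF li])
    have "f X = f (norm X *\<^sub>R Y)" using Y(2) by simp
    also have "\<dots> = (norm X)\<^sup>2 * f Y"
      unfolding f_def iY sum_distrib_left
      by (intro sum.cong refl) (simp add: linear_scale[OF lin] power_mult_distrib distrib_left)
    finally show ?thesis using X0(2)[OF Y(1)] by (simp add: mult.commute[of "f Y"] mult.commute[of "f X0"] mult_left_mono)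
  next
    case True
    then show ?thesis using f0[of X] by simp
  qed
  then show ?thesis using pos unfolding f_def by blast
qed

section \<open>The saturation of the weights\<close>

definition saturation :: "real \<Rightarrow> real" where
  "saturation t = t * smooth_cutoff t"

definition saturation_d1 :: "real \<Rightarrow> real" where
  "saturation_d1 t = frechet_derivative saturation (at t) 1"

definition saturation_d2 :: "real \<Rightarrow> real" where
  "saturation_d2 t = frechet_derivative saturation_d1 (at t) 1"

text \<open>The identity below 1 and zero beyond 2. The second derivative is bounded together with a
  factor \<open>t\<close> because, in the chain rule for \<open>c * \<rho>\<close>, it multiplies
  \<open>c\<^sup>2\<close> times a gradient term of size \<open>\<rho>\<close>, that is
  \<open>c\<close> times \<open>c * \<rho>\<close>.\<close>

lemma saturation:
  shows "smooth_on UNIV saturation" "0 \<le> t \<Longrightarrow> \<bar>saturation t\<bar> \<le> 2"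
    and "t < 1 \<Longrightarrow> saturation_d1 t = 1" "t < 1 \<Longrightarrow> saturation_d2 t = 0"
    and "\<exists>E\<ge>0. \<forall>t\<ge>0. \<bar>saturation_d1 t\<bar> \<le> E \<and> \<bar>saturation_d2 t\<bar> * t \<le> E"
proof -
  show sm: "smooth_on UNIV saturation"
    unfolding saturation_def[abs_def] by (intro smooth_on_mult smooth_on_id smooth_cutoff) auto
  have sm1: "smooth_on UNIV saturation_d1" unfolding saturation_d1_def by (rule smooth_on_frechet_derivative[OF sm])
  have sm2: "smooth_on UNIV saturation_d2" unfolding saturation_d2_def by (rule smooth_on_frechet_derivative[OF sm1])
  show "\<bar>saturation t\<bar> \<le> 2" if "0 \<le> t"
  proof (cases "t \<le> 2")
    case True
    have "t * smooth_cutoff t \<le> 2 * 1" using True that smooth_cutoff(2,3) by (intro mult_mono) auto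
    then show ?thesis using that smooth_cutoff(2)[of t] by (simp add: saturation_def abs_mult)
  qed (simp add: saturation_def smooth_cutoff)
  have d1: "saturation_d1 t = 1" if "t < 1" for t
  proof -
    have "frechet_derivative saturation (at t) = frechet_derivative (\<lambda>t. t) (at t)"
      by (rule frechet_derivative_cong_open[of "{..<1}"]) (use that in \<open>auto simp: saturation_def smooth_cutoff\<close>)
    then show ?thesis unfolding saturation_d1_def by simp
  qed
  then show "t < 1 \<Longrightarrow> saturation_d1 t = 1" .
  have const: "frechet_derivative f (at t) 1 = 0" if "open U" "t \<in> U" "\<And>s. s \<in> U \<Longrightarrow> f s = c" for f :: "real \<Rightarrow> real" and c t U
  proof -
    have "frechet_derivative f (at t) = frechet_derivative (\<lambda>t. c) (at t)" by (rule frechet_derivative_cong_open[OF that])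
    then show ?thesis by simp
  qed
  show "t < 1 \<Longrightarrow> saturation_d2 t = 0" unfolding saturation_d2_def by (rule const[of "{..<1}" _ _ 1]) (auto simp: d1)
  have z1: "saturation_d1 t = 0" if "2 < t" for t
    unfolding saturation_d1_def by (rule const[of "{2<..}" _ _ 0]) (use that in \<open>auto simp: saturation_def smooth_cutoff\<close>)
  have z2: "saturation_d2 t = 0" if "2 < t" for t
    unfolding saturation_d2_def by (rule const[of "{2<..}" _ _ 0]) (use that in \<open>auto simp: z1\<close>)
  have bd: "\<exists>B. \<forall>t\<in>{0..2}. \<bar>f t\<bar> \<le> B" if "smooth_on UNIV f" for f :: "real \<Rightarrow> real"
  proof -
    have "bounded (f ` {0..2})"
      by (intro compact_imp_bounded compact_continuous_image continuous_on_subset[OF smooth_on_continuous_on[OF that]]) auto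
    then show ?thesis unfolding bounded_iff by auto
  qed
  obtain B1 B2 where B: "\<And>t. t \<in> {0..2} \<Longrightarrow> \<bar>saturation_d1 t\<bar> \<le> B1" "\<And>t. t \<in> {0..2} \<Longrightarrow> \<bar>saturation_d2 t\<bar> \<le> B2"
    using bd[OF sm1] bd[OF sm2] by blast
  have B0: "0 \<le> B1" "0 \<le> B2" using order_trans[OF abs_ge_zero B(1)[of 0]] order_trans[OF abs_ge_zero B(2)[of 0]] by auto
  show "\<exists>E\<ge>0. \<forall>t\<ge>0. \<bar>saturation_d1 t\<bar> \<le> E \<and> \<bar>saturation_d2 t\<bar> * t \<le> E"
  proof (intro exI[of _ "B1 + 2 * B2"] conjI allI impI)
    fix t :: real assume t: "0 \<le> t"
    show "\<bar>saturation_d1 t\<bar> \<le> B1 + 2 * B2" using B(1)[of t] B0 t z1[of t] by (cases "t \<le> 2") auto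
    show "\<bar>saturation_d2 t\<bar> * t \<le> B1 + 2 * B2"
    proof (cases "t \<le> 2")
      case True
      have "\<bar>saturation_d2 t\<bar> * t \<le> B2 * 2" using B(2)[of t] B0 t True by (intro mult_mono) auto
      then show ?thesis using B0 by simp
    qed (use z2 B0 in auto)
  qed (use B0 in auto)
qed

section \<open>Hermitian sums, CR frames and the induced volume\<close>

lemma hermitian_sum_bound:
  fixes r :: nat
  assumes "\<And>i j. i < r \<Longrightarrow> j < r \<Longrightarrow> cmod (A i j) \<le> (D::real)" "0 \<le> D"
  shows "\<bar>Re (\<Sum>i<r. \<Sum>j<r. A i j * a i * cnj (a j))\<bar> \<le> D * r * (\<Sum>i<r. (cmod (a i))\<^sup>2)"
proof -
  have "\<bar>Re (\<Sum>i<r. \<Sum>j<r. A i j * a i * cnj (a j))\<bar> \<le> (\<Sum>i<r. \<Sum>j<r. cmod (A i j * a i * cnj (a j)))"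
    by (rule order_trans[OF abs_Re_le_cmod order_trans[OF norm_sum sum_mono[OF norm_sum]]])
  also have "\<dots> \<le> (\<Sum>i<r. \<Sum>j<r. D * (((cmod (a i))\<^sup>2 + (cmod (a j))\<^sup>2) / 2))"
  proof (intro sum_mono)
    fix i j assume ij: "i \<in> {..<r}" "j \<in> {..<r}"
    have "cmod (a i) * cmod (a j) \<le> ((cmod (a i))\<^sup>2 + (cmod (a j))\<^sup>2) / 2"
      using zero_le_power2[of "cmod (a i) - cmod (a j)"] by (simp add: power2_diff)
    then have "cmod (A i j) * (cmod (a i) * cmod (a j)) \<le> D * (((cmod (a i))\<^sup>2 + (cmod (a j))\<^sup>2) / 2)"
      using assms ij by (intro mult_mono) auto
    then show "cmod (A i j * a i * cnj (a j)) \<le> D * (((cmod (a i))\<^sup>2 + (cmod (a j))\<^sup>2) / 2)"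
      by (simp add: norm_mult mult.assoc)
  qed
  also have "\<dots> = D * ((\<Sum>i<r. \<Sum>j<r. (cmod (a i))\<^sup>2 + (cmod (a j))\<^sup>2) / 2)"
    by (simp only: sum_distrib_left[symmetric] sum_divide_distrib[symmetric])
  also have "(\<Sum>i<r. \<Sum>j<r. (cmod (a i))\<^sup>2 + (cmod (a j))\<^sup>2) = 2 * (r * (\<Sum>i<r. (cmod (a i))\<^sup>2))"
    by (simp add: sum.distrib sum_distrib_left)
  finally show ?thesis by simp
qed

text \<open>\<open>X a\<close> and \<open>Y a\<close> are the push-forwards of the real and
  imaginary parts of the vector with coefficients \<open>a\<close>. The vanishing of its (0,1)
  components says \<open>X a = \<i> *s Y a\<close>, so its (1,0) components are
  \<open>X a + \<i> *s Y a\<close>, twice \<open>X a\<close>. Orthonormality of the frame then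
  produces the factor 4.\<close>

lemma frame_vector_parts:
  fixes \<psi> :: "real^'m::finite \<Rightarrow> complex^'n"
  assumes frame: "cr_frame r V \<psi> \<omega> \<gamma> L T" and x: "x \<in> V"
  defines "wl \<equiv> \<lambda>a l. \<Sum>i<r. a i * L i x $ l"
  defines "X \<equiv> \<lambda>a. \<Sum>l\<in>UNIV. Re (wl a l) *\<^sub>R partial l \<psi> x" and "Y \<equiv> \<lambda>a. \<Sum>l\<in>UNIV. Im (wl a l) *\<^sub>R partial l \<psi> x"
  shows "Y a = - (\<i> *s X a)" and "4 * (norm (X a))\<^sup>2 = (\<Sum>i<r. (cmod (a i))\<^sup>2)"
proof -
  let ?t = "\<lambda>l q. partial l \<psi> x $ q"
  note fr = bspec[OF conjunct2[OF conjunct2[OF conjunct2[OF frame[unfolded cr_frame_def]]]] x]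
  have bar: "(\<Sum>l\<in>UNIV. L i x $ l * cnj (?t l q)) = 0" if "i < r" for i q
    using conjunct1[OF fr, rule_format, OF that, of q] unfolding dzbar_apply_def .
  have orth: "(\<Sum>q\<in>UNIV. dz_apply \<psi> (L i) q x * cnj (dz_apply \<psi> (L j) q x)) = (if i = j then 1 else 0)" if "i < r" "j < r" for i j
    by (rule conjunct1[OF conjunct2[OF fr], rule_format, OF that])
  have Xq: "X a $ q = (\<Sum>l\<in>UNIV. complex_of_real (Re (wl a l)) * ?t l q)" for q
    unfolding X_def by (simp add: scaleR_conv_of_real[symmetric])
  have Yq: "Y a $ q = (\<Sum>l\<in>UNIV. complex_of_real (Im (wl a l)) * ?t l q)" for q
    unfolding Y_def by (simp add: scaleR_conv_of_real[symmetric])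
  have "(\<Sum>l\<in>UNIV. wl a l * cnj (?t l q)) = (\<Sum>i<r. a i * (\<Sum>l\<in>UNIV. L i x $ l * cnj (?t l q)))" for q
    unfolding wl_def sum_distrib_right sum_distrib_left by (subst sum.swap) (simp add: mult.assoc)
  then have "(\<Sum>l\<in>UNIV. wl a l * cnj (?t l q)) = 0" for q using bar by simp
  then have "cnj (\<Sum>l\<in>UNIV. wl a l * cnj (?t l q)) = 0" for q by simp
  then have c0: "(\<Sum>l\<in>UNIV. cnj (wl a l) * ?t l q) = 0" for q by (simp add: cnj_sum)
  have "(\<Sum>l\<in>UNIV. cnj (wl a l) * ?t l q) = X a $ q - \<i> * Y a $ q" for q
  proof -
    have "cnj (wl a l) * ?t l q = complex_of_real (Re (wl a l)) * ?t l q - \<i> * (complex_of_real (Im (wl a l)) * ?t l q)" for l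
      by (simp add: complex_eq_iff algebra_simps)
    then show ?thesis unfolding Xq Yq by (simp add: sum_subtractf sum_distrib_left)
  qed
  then have XY: "X a $ q = \<i> * Y a $ q" for q using c0 by simp
  show "Y a = - (\<i> *s X a)" by (simp add: vec_eq_iff XY)
  have "(\<Sum>i<r. a i * dz_apply \<psi> (L i) q x) = 2 * X a $ q" for q
  proof -
    have "(\<Sum>i<r. a i * dz_apply \<psi> (L i) q x) = (\<Sum>l\<in>UNIV. wl a l * ?t l q)"
      unfolding dz_apply_def wl_def sum_distrib_right sum_distrib_left by (subst sum.swap) (simp add: mult.assoc)
    also have "\<dots> = X a $ q + \<i> * Y a $ q"
    proof -
      have "wl a l * ?t l q = complex_of_real (Re (wl a l)) * ?t l q + \<i> * (complex_of_real (Im (wl a l)) * ?t l q)" for l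
        by (simp add: complex_eq_iff algebra_simps)
      then show ?thesis unfolding Xq Yq by (simp add: sum.distrib sum_distrib_left)
    qed
    finally show ?thesis by (simp add: XY)
  qed
  note p = this
  have "complex_of_real (4 * (norm (X a))\<^sup>2) = (\<Sum>q\<in>UNIV. (2 * X a $ q) * cnj (2 * X a $ q))"
  proof -
    have "(norm (X a))\<^sup>2 = (\<Sum>q\<in>UNIV. (cmod (X a $ q))\<^sup>2)"
      by (simp add: norm_vec_def L2_set_def sum_nonneg)
    then have "complex_of_real (4 * (norm (X a))\<^sup>2) = (\<Sum>q\<in>UNIV. complex_of_real ((cmod (2 * X a $ q))\<^sup>2))"
      by (simp add: norm_mult power_mult_distrib sum_distrib_left)
    then show ?thesis by (simp only: complex_norm_square)
  qed
  also have "\<dots> = (\<Sum>q\<in>UNIV. \<Sum>i<r. \<Sum>j<r. (a i * cnj (a j)) * (dz_apply \<psi> (L i) q x * cnj (dz_apply \<psi> (L j) q x)))"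
    unfolding p[symmetric] cnj_sum sum_product by (simp add: mult_ac)
  also have "\<dots> = (\<Sum>i<r. \<Sum>j<r. (a i * cnj (a j)) * (\<Sum>q\<in>UNIV. dz_apply \<psi> (L i) q x * cnj (dz_apply \<psi> (L j) q x)))"
    unfolding sum_distrib_left by (subst sum.swap, rule sum.cong[OF refl], rule sum.swap)
  also have "\<dots> = (\<Sum>i<r. \<Sum>j<r. if j = i then a i * cnj (a j) else 0)"
    by (intro sum.cong refl) (auto simp: orth)
  also have "\<dots> = (\<Sum>i<r. a i * cnj (a i))" by (simp add: sum.delta)
  also have "\<dots> = complex_of_real (\<Sum>i<r. (cmod (a i))\<^sup>2)" by (simp only: of_real_sum complex_norm_square)
  finally show "4 * (norm (X a))\<^sup>2 = (\<Sum>i<r. (cmod (a i))\<^sup>2)" by (simp only: of_real_eq_iff)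
qed

text \<open>The segment from the identity matrix to the Gram matrix consists of positive definite,
  hence invertible, matrices; the determinant starts at 1 and cannot change sign along it.\<close>

lemma gram_det_pos:
  fixes \<psi> :: "real^'m::finite \<Rightarrow> complex^'n"
  assumes \<psi>: "smooth_parametrization M V \<psi>" and x: "x \<in> V"
  shows "0 < det ((\<chi> l p. partial l \<psi> x \<bullet> partial p \<psi> x) :: real^'m^'m)"
proof -
  let ?G = "(\<chi> l p. partial l \<psi> x \<bullet> partial p \<psi> x) :: real^'m^'m"
  let ?D = "frechet_derivative \<psi> (at x)"
  have sm: "smooth_on V \<psi>" and inj: "inj ?D" using \<psi> x unfolding smooth_parametrization_def by simp_all
  have D: "(\<psi> has_derivative ?D) (at x)" by (rule smooth_on_has_derivative[OF sm x])
  have lin: "linear ?D" by (rule has_derivative_linear[OF D])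
  have Dy: "?D y = (\<Sum>l\<in>UNIV. y $ l *\<^sub>R partial l \<psi> x)" for y
  proof -
    have "?D y = ?D (\<Sum>l\<in>UNIV. y $ l *\<^sub>R axis l 1)" by (simp add: basis_expansion scalar_mult_eq_scaleR[symmetric])
    then show ?thesis unfolding partial_def by (simp add: linear_sum[OF lin] linear_scale[OF lin])
  qed
  define M where "M t = (1 - t) *\<^sub>R mat 1 + t *\<^sub>R ?G" for t
  have q: "y \<bullet> (M t *v y) = (1 - t) * (y \<bullet> y) + t * (?D y \<bullet> ?D y)" for t y
  proof -
    have "y \<bullet> (?G *v y) = ?D y \<bullet> ?D y"
    proof -
      have "y \<bullet> (?G *v y) = (\<Sum>l\<in>UNIV. \<Sum>p\<in>UNIV. y $ l * (y $ p * (partial l \<psi> x \<bullet> partial p \<psi> x)))"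
        by (simp add: inner_vec_def[of y] matrix_vector_mult_def sum_distrib_left mult_ac)
      then show ?thesis
        unfolding Dy by (simp add: inner_sum_left inner_sum_right sum_distrib_left mult_ac inner_commute)
    qed
    then show ?thesis unfolding M_def
      by (simp add: matrix_vector_mult_add_rdistrib scaleR_matrix_vector_assoc[symmetric] inner_add_right)
  qed
  have nz: "det (M t) \<noteq> 0" if t: "0 \<le> t" "t \<le> 1" for t
  proof -
    have "y = 0" if y: "M t *v y = 0" for y
    proof (rule ccontr)
      assume "y \<noteq> 0"
      then have "?D y \<noteq> 0" using inj linear_injective_0[OF lin] by blast
      then have "0 < y \<bullet> y" "0 < ?D y \<bullet> ?D y" using \<open>y \<noteq> 0\<close> by auto
      then have "0 < (1 - t) * (y \<bullet> y) + t * (?D y \<bullet> ?D y)"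
        using t by (cases "t = 0") (auto intro: add_nonneg_pos)
      then show False using q[of y t] y by simp
    qed
    then have "\<exists>B. B ** M t = mat 1" using matrix_left_invertible_ker by blast
    then show ?thesis using invertible_left_inverse invertible_det_nz by blast
  qed
  have c: "continuous_on {0..1} (\<lambda>t. det (M t))"
    unfolding det_def M_def by (simp, intro continuous_intros)
  have "det (M 0) = 1" unfolding M_def by simp
  moreover have "M 1 = ?G" unfolding M_def by simp
  moreover have "0 < det (M 1)"
  proof (rule ccontr)
    assume "\<not> ?thesis"
    then have "\<exists>t\<ge>0. t \<le> 1 \<and> det (M t) = 0"
      using \<open>det (M 0) = 1\<close> c by (intro IVT2') auto
    then show False using nz by blast
  qed
  ultimately show ?thesis by simp
qed

lemma volume_density_pos: "smooth_parametrization M V \<psi> \<Longrightarrow> x \<in> V \<Longrightarrow> 0 < volume_density \<psi> x"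
  unfolding volume_density_def using gram_det_pos by simp

lemma smooth_volume_density:
  fixes \<psi> :: "real^'m::finite \<Rightarrow> complex^'n"
  assumes \<psi>: "smooth_parametrization M V \<psi>"
  shows "smooth_on V (volume_density \<psi>)"
proof -
  have V: "open V" and s: "smooth_on V \<psi>" using \<psi> unfolding smooth_parametrization_def by auto
  have sg: "smooth_on V (\<lambda>x. partial l \<psi> x \<bullet> partial p \<psi> x)" for l p
    by (rule smooth_on_bilinear[OF V bounded_bilinear_inner smooth_on_partial[OF s] smooth_on_partial[OF s]])
  have "smooth_on V (\<lambda>x. det ((\<chi> l p. partial l \<psi> x \<bullet> partial p \<psi> x) :: real^'m^'m))"
    unfolding det_def
    by (simp, intro smooth_on_sum[OF V] smooth_on_mult[OF V] smooth_on_const[OF V] smooth_on_prod[OF V] sg)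
  then show ?thesis
    unfolding volume_density_def[abs_def] by (rule smooth_on_sqrt[OF V _ gram_det_pos[OF \<psi>]])
qed

lemma vf_apply_compose_map:
  fixes \<psi> :: "real^'m::finite \<Rightarrow> complex^'n" and k :: "complex^'n \<Rightarrow> real"
  assumes D: "(g has_derivative (\<lambda>y. k (\<psi>' y))) (at x)" and \<psi>': "\<psi>' = frechet_derivative \<psi> (at x)"
    and lin: "linear k"
  shows "(\<Sum>i<r. a i * vf_apply (L i) (\<lambda>y. complex_of_real (g y)) x)
    = complex_of_real (k (\<Sum>l\<in>UNIV. Re (\<Sum>i<r. a i * L i x $ l) *\<^sub>R partial l \<psi> x))
      + \<i> * complex_of_real (k (\<Sum>l\<in>UNIV. Im (\<Sum>i<r. a i * L i x $ l) *\<^sub>R partial l \<psi> x))"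
proof -
  let ?w = "\<lambda>l. \<Sum>i<r. a i * L i x $ l"
  have v: "vf_apply (L i) (\<lambda>y. complex_of_real (g y)) x = (\<Sum>l\<in>UNIV. L i x $ l * complex_of_real (k (partial l \<psi> x)))" for i
    using vf_apply_has_derivative[OF has_derivative_of_real[OF D], of "L i"] by (simp add: \<psi>' partial_def)
  have "(\<Sum>i<r. a i * vf_apply (L i) (\<lambda>y. complex_of_real (g y)) x) = (\<Sum>l\<in>UNIV. ?w l * complex_of_real (k (partial l \<psi> x)))"
    unfolding v sum_distrib_left sum_distrib_right by (subst sum.swap) (simp add: mult.assoc)
  also have "\<dots> = (\<Sum>l\<in>UNIV. complex_of_real (Re (?w l) * k (partial l \<psi> x)) + \<i> * complex_of_real (Im (?w l) * k (partial l \<psi> x)))"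
  proof (rule sum.cong[OF refl])
    fix l
    show "?w l * complex_of_real (k (partial l \<psi> x)) = complex_of_real (Re (?w l) * k (partial l \<psi> x)) + \<i> * complex_of_real (Im (?w l) * k (partial l \<psi> x))"
      by (subst complex_eq[of "?w l"]) (simp add: algebra_simps)
  qed
  finally show ?thesis
    by (simp only: linear_sum[OF lin] linear_scale[OF lin] sum.distrib sum_distrib_left of_real_sum real_scaleR_def)
qed

text \<open>If all differentials of the equations of \<open>S\<close> kill both \<open>X\<close> and
  \<open>\<i> *s X\<close>, then \<open>X\<close> is a complex tangent vector of \<open>S\<close>
  and vanishes as the CR dimension is 0. Compactness makes this quantitative, and the frame carries
  it over to the (1,0) derivatives of the pulled back equations at \<open>x0\<close>. A bump makes
  these functions global in the coordinates.\<close>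

lemma totally_real_defining_functions:
  fixes \<psi> :: "real^'m::finite \<Rightarrow> complex^'n"
  assumes param: "smooth_parametrization M V \<psi>" and frame: "cr_frame r V \<psi> \<omega> \<gamma> L T"
    and S: "embedded_submanifold s S" and cr: "has_cr_dim S 0" and z: "z \<in> S" "\<psi> x0 = z"
    and A: "open A" "x0 \<in> A" "A \<subseteq> V" and \<delta>: "0 < \<delta>"
  shows "\<exists>(H :: (complex^'n) set) (g :: complex^'n \<Rightarrow> real^'m \<Rightarrow> real) R C c. 0 < R \<and> cball x0 R \<subseteq> A \<and> 0 \<le> C \<and> 0 < c \<and> finite H \<and>
     (\<forall>u\<in>H. smooth_on UNIV (g u) \<and> (\<forall>x. x \<notin> cball x0 R \<longrightarrow> g u x = 0) \<and> g u x0 = 0) \<and>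
     (\<forall>x\<in>cball x0 (R / 2). infdist (\<psi> x) S < \<delta> \<and> (\<Sum>u\<in>H. (g u x)\<^sup>2) \<le> C * (infdist (\<psi> x) S)\<^sup>2) \<and>
     (\<forall>a. c * (\<Sum>i<r. (cmod (a i))\<^sup>2) \<le> (\<Sum>u\<in>H. (cmod (\<Sum>i<r. a i * vf_apply (L i) (\<lambda>y. complex_of_real (g u y)) x0))\<^sup>2))"
proof -
  have V: "open V" and s\<psi>: "smooth_on V \<psi>" using param unfolding smooth_parametrization_def by simp_all
  have x0V: "x0 \<in> V" using A by blast
  obtain W H and h :: "complex^'n \<Rightarrow> complex^'n \<Rightarrow> real" where W: "open W" "z \<in> W" "finite H"
    and h: "\<forall>u\<in>H. smooth_on W (h u) \<and> (\<forall>p\<in>S \<inter> W. h u p = 0)"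
    and tan: "\<forall>X. (\<forall>u\<in>H. frechet_derivative (h u) (at z) X = 0) \<longrightarrow> X \<in> tangent_space S z"
    using submanifold_equations[OF S z(1)] by (elim exE conjE) simp
  have hsm: "smooth_on W (h u)" and h0: "\<And>p. p \<in> S \<inter> W \<Longrightarrow> h u p = 0" if "u \<in> H" for u using h that by simp_all
  have "\<forall>u\<in>H. \<exists>RC. 0 < fst RC \<and> 0 \<le> snd RC \<and> (\<forall>p. dist z p < fst RC \<longrightarrow> \<bar>h u p\<bar> \<le> snd RC * infdist p S)"
  proof
    fix u assume u: "u \<in> H"
    have "\<exists>R>0. \<exists>C\<ge>0. \<forall>p. dist z p < R \<longrightarrow> \<bar>h u p\<bar> \<le> C * infdist p S"
      by (rule submanifold_function_le_infdist[OF W(1,2) z(1) hsm[OF u]]) (rule h0[OF u])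
    then obtain R C where "0 < R" "0 \<le> C" "\<forall>p. dist z p < R \<longrightarrow> \<bar>h u p\<bar> \<le> C * infdist p S"
      by (elim exE conjE)
    then show "\<exists>RC. 0 < fst RC \<and> 0 \<le> snd RC \<and> (\<forall>p. dist z p < fst RC \<longrightarrow> \<bar>h u p\<bar> \<le> snd RC * infdist p S)"
      by (intro exI[of _ "(R, C)"]) simp
  qed
  from bchoice[OF this] obtain RC where RC: "\<forall>u\<in>H. 0 < fst (RC u) \<and> 0 \<le> snd (RC u) \<and> (\<forall>p. dist z p < fst (RC u) \<longrightarrow> \<bar>h u p\<bar> \<le> snd (RC u) * infdist p S)"
    by (elim exE)
  \<comment> \<open>Including \<open>\<delta>\<close> keeps the distance to \<open>S\<close> in the
    interval where the quotient \<open>F d / d\<^sup>2\<close> is under control.\<close>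
  define R1 where "R1 = Min (insert \<delta> ((\<lambda>u. fst (RC u)) ` H))"
  have R1: "0 < R1" "R1 \<le> \<delta>" "\<And>u. u \<in> H \<Longrightarrow> R1 \<le> fst (RC u)"
    unfolding R1_def using W(3) RC \<delta> by (auto simp: Min_gr_iff)
  define C where "C = (\<Sum>u\<in>H. (snd (RC u))\<^sup>2)"
  have hC: "(\<Sum>u\<in>H. (h u p)\<^sup>2) \<le> C * (infdist p S)\<^sup>2" if "dist z p < R1" for p
    unfolding C_def sum_distrib_right power_mult_distrib[symmetric]
  proof (rule sum_mono)
    fix u assume u: "u \<in> H"
    then have "\<bar>h u p\<bar> \<le> snd (RC u) * infdist p S" using RC R1(3)[OF u] that by auto
    then show "(h u p)\<^sup>2 \<le> (snd (RC u) * infdist p S)\<^sup>2" using power_mono[of "\<bar>h u p\<bar>" _ 2] by simp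
  qed
  define G where "G = A \<inter> \<psi> -` (W \<inter> ball z R1)"
  have oG: "open G" unfolding G_def
    by (rule continuous_open_preimage[OF continuous_on_subset[OF smooth_on_continuous_on[OF s\<psi>] A(3)] A(1)]) (use W in auto)
  have "x0 \<in> G" unfolding G_def using A z W R1 by simp
  then obtain R where R: "0 < R" "cball x0 R \<subseteq> G" using oG open_contains_cball by blast
  have GA: "G \<subseteq> A" "\<psi> ` G \<subseteq> W" "\<And>x. x \<in> G \<Longrightarrow> dist z (\<psi> x) < R1" unfolding G_def by auto
  have GV: "G \<subseteq> V" using GA(1) A(3) by (rule subset_trans)
  obtain \<eta> :: "real^'m \<Rightarrow> real" where \<eta>: "smooth_on UNIV \<eta>" "\<And>x. dist x0 x \<le> R / 2 \<Longrightarrow> \<eta> x = 1" "\<And>x. R \<le> dist x0 x \<Longrightarrow> \<eta> x = 0"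
    using smooth_bump[OF R(1)] by metis
  define g where "g u x = (if x \<in> G then \<eta> x * h u (\<psi> x) else 0)" for u x
  have gh: "g u x = h u (\<psi> x)" if "dist x0 x \<le> R / 2" for u x
  proof -
    have "x \<in> cball x0 R" using that R(1) by simp
    then show ?thesis using R(2) \<eta>(2)[OF that] by (auto simp: g_def)
  qed
  have g0: "g u x = 0" if "x \<notin> cball x0 R" for u x using \<eta>(3)[of x] that by (simp add: g_def)
  have shG: "smooth_on G (\<lambda>x. h u (\<psi> x))" if "u \<in> H" for u
    by (rule smooth_on_compose[OF oG W(1) smooth_on_subset[OF s\<psi> GV] hsm[OF that] GA(2)])
  have sg: "smooth_on UNIV (g u)" if u: "u \<in> H" for u
  proof (rule smooth_on_extend_zero[OF oG _ closed_cball R(2) g0])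
    show "smooth_on G (g u)"
      by (rule smooth_on_cong[OF oG _ smooth_on_mult[OF oG smooth_on_subset[OF \<eta>(1) subset_UNIV] shG[OF u]]]) (simp add: g_def)
  qed
  define k where "k u = frechet_derivative (h u) (at z)" for u
  have Dh: "(h u has_derivative k u) (at (\<psi> x0))" if "u \<in> H" for u
    unfolding k_def z(2) by (rule smooth_on_has_derivative[OF hsm[OF that] W(2)])
  have lk: "linear (k u)" if "u \<in> H" for u by (rule has_derivative_linear[OF Dh[OF that]])
  have D\<psi>: "(\<psi> has_derivative frechet_derivative \<psi> (at x0)) (at x0)" by (rule smooth_on_has_derivative[OF s\<psi> x0V])
  have Dg: "(g u has_derivative (\<lambda>y. k u (frechet_derivative \<psi> (at x0) y))) (at x0)" if "u \<in> H" for u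
  proof -
    have "((\<lambda>x. h u (\<psi> x)) has_derivative (\<lambda>y. k u (frechet_derivative \<psi> (at x0) y))) (at x0)"
      using diff_chain_at[OF D\<psi> Dh[OF that]] by (simp add: o_def)
    then show ?thesis
      by (rule has_derivative_transform_within_open[of _ _ _ _ "ball x0 (R / 2)"]) (use R(1) gh in auto)
  qed
  \<comment> \<open>Membership of \<open>X\<close> in the image of the tangent space under
    multiplication by \<open>\<i>\<close> requires that \<open>- (\<i> *s X)\<close> be tangent,
    which the hypothesis on \<open>\<i> *s X\<close> gives by linearity.\<close>
  have ker: "X = 0" if X: "\<And>u. u \<in> H \<Longrightarrow> k u X = 0 \<and> k u (\<i> *s X) = 0" for X
  proof -
    have "X \<in> tangent_space S z" using tan X unfolding k_def by simp
    moreover have "- (\<i> *s X) \<in> tangent_space S z"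
      using tan X linear_neg[OF lk, of _ "\<i> *s X"] unfolding k_def by simp
    moreover have "X = \<i> *s (- (\<i> *s X))" by (simp add: vec_eq_iff)
    ultimately have "X \<in> complex_tangent_space S z"
      unfolding complex_tangent_space_def by (intro IntI image_eqI)
    moreover have "dim (complex_tangent_space S z) = 0" using cr z(1) unfolding has_cr_dim_def by simp
    ultimately show ?thesis using dim_eq_0[of "complex_tangent_space S z"] by (simp add: subset_iff)
  qed
  have "\<exists>c>0. \<forall>X. c * (norm X)\<^sup>2 \<le> (\<Sum>u\<in>H. (k u X)\<^sup>2 + (k u (\<i> *s X))\<^sup>2)"
    by (rule linear_functionals_coercive[OF W(3)]) (fact lk, rule ker)
  then obtain c where c: "0 < c" "\<forall>X. c * (norm X)\<^sup>2 \<le> (\<Sum>u\<in>H. (k u X)\<^sup>2 + (k u (\<i> *s X))\<^sup>2)"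
    by (elim exE conjE)
  \<comment> \<open>The quotient by 4 reflects that the squared length of \<open>a\<close> is four
    times that of the real vector \<open>?X\<close>.\<close>
  have coer: "c / 4 * (\<Sum>i<r. (cmod (a i))\<^sup>2) \<le> (\<Sum>u\<in>H. (cmod (\<Sum>i<r. a i * vf_apply (L i) (\<lambda>y. complex_of_real (g u y)) x0))\<^sup>2)" for a
  proof -
    let ?X = "\<Sum>l\<in>UNIV. Re (\<Sum>i<r. a i * L i x0 $ l) *\<^sub>R partial l \<psi> x0"
    let ?Y = "\<Sum>l\<in>UNIV. Im (\<Sum>i<r. a i * L i x0 $ l) *\<^sub>R partial l \<psi> x0"
    have Y: "?Y = - (\<i> *s ?X)" and N: "4 * (norm ?X)\<^sup>2 = (\<Sum>i<r. (cmod (a i))\<^sup>2)"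
      using frame_vector_parts[OF frame x0V, of a] by simp_all
    have "(cmod (\<Sum>i<r. a i * vf_apply (L i) (\<lambda>y. complex_of_real (g u y)) x0))\<^sup>2 = (k u ?X)\<^sup>2 + (k u (\<i> *s ?X))\<^sup>2" if "u \<in> H" for u
      unfolding vf_apply_compose_map[OF Dg[OF that] refl lk[OF that]] Y linear_neg[OF lk[OF that]]
      by (simp add: cmod_power2)
    then have "(\<Sum>u\<in>H. (cmod (\<Sum>i<r. a i * vf_apply (L i) (\<lambda>y. complex_of_real (g u y)) x0))\<^sup>2) = (\<Sum>u\<in>H. (k u ?X)\<^sup>2 + (k u (\<i> *s ?X))\<^sup>2)"
      by (rule sum.cong[OF refl])
    then show ?thesis using c(2)[rule_format, of ?X] unfolding N[symmetric] by simp
  qed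
  show ?thesis
  proof (rule exI[of _ H], rule exI[of _ g], rule exI[of _ R], rule exI[of _ C], rule exI[of _ "c / 4"], intro conjI ballI allI impI coer)
    show "cball x0 R \<subseteq> A" using R(2) GA(1) by (rule subset_trans)
    show "0 \<le> C" unfolding C_def by (rule sum_nonneg) simp
    show "g u x0 = 0" if "u \<in> H" for u using gh[of x0 u] h0[OF that, of z] R(1) z W by simp
    fix x assume x: "x \<in> cball x0 (R / 2)"
    then have "x \<in> G" using R by auto
    then have d: "dist z (\<psi> x) < R1" by (rule GA(3))
    show "infdist (\<psi> x) S < \<delta>" using infdist_le[OF z(1), of "\<psi> x"] d R1(2) by (simp add: dist_commute)
    show "(\<Sum>u\<in>H. (g u x)\<^sup>2) \<le> C * (infdist (\<psi> x) S)\<^sup>2" using hC[OF d] gh[of x] x by simp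
  qed (use R c W sg g0 in simp_all)
qed

section \<open>Weights adapted to a totally real submanifold\<close>

lemma uniform_bound_finite_family:
  fixes f :: "'i \<Rightarrow> 'a \<Rightarrow> 'b::real_normed_vector"
  assumes "finite I" "\<And>p. p \<in> I \<Longrightarrow> \<exists>B\<ge>0. \<forall>x\<in>X. norm (f p x) \<le> (B::real)"
  shows "\<exists>B\<ge>0. \<forall>p\<in>I. \<forall>x\<in>X. norm (f p x) \<le> B"
proof -
  have "\<forall>p\<in>I. \<exists>B. 0 \<le> B \<and> (\<forall>x\<in>X. norm (f p x) \<le> B)" using assms(2) by simp
  from bchoice[OF this] obtain B where B: "\<forall>p\<in>I. 0 \<le> B p \<and> (\<forall>x\<in>X. norm (f p x) \<le> B p)" by (elim exE)
  have "norm (f p x) \<le> sum B I" if "p \<in> I" "x \<in> X" for p x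
  proof -
    have "B p \<le> sum B I" by (rule member_le_sum) (use B that assms(1) in auto)
    then show ?thesis using B that by force
  qed
  moreover have "0 \<le> sum B I" by (rule sum_nonneg) (use B in simp)
  ultimately show ?thesis by (intro exI[of _ "sum B I"]) simp
qed

lemma levi_weight_perturbation:
  fixes L :: "nat \<Rightarrow> 'm::finite cfield"
  assumes ff: "frame_fields r V \<omega> L \<gamma>" and \<rho>: "smooth_on V \<rho>" and ij: "i < r" "j < r" and x: "x \<in> V"
  shows "levi_weight r \<omega> L (\<lambda>y. saturation (c * \<rho> y)) i j x
    = complex_of_real (saturation_d1 (c * \<rho> x) * c) * levi_weight r \<omega> L \<rho> i j x
    + complex_of_real (saturation_d2 (c * \<rho> x) * c\<^sup>2)
      * (vf_apply (L i) (\<lambda>y. complex_of_real (\<rho> y)) x * cnj (vf_apply (L j) (\<lambda>y. complex_of_real (\<rho> y)) x))"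
proof -
  have V: "open V" using ff by (rule frame_fields.V)
  have sc: "smooth_on V (\<lambda>y. c * \<rho> y)" by (intro smooth_on_mult[OF V] smooth_on_const[OF V] \<rho>)
  have d: "\<rho> differentiable (at x)" using \<rho> x smooth_on_unfold by blast
  have v: "vf_apply X (\<lambda>y. complex_of_real (c * \<rho> y)) x = complex_of_real c * vf_apply X (\<lambda>y. complex_of_real (\<rho> y)) x" for X
    by (rule vf_apply_compose_real[OF d]) (auto intro!: derivative_eq_intros)
  have "levi_weight r \<omega> L (\<lambda>y. saturation (c * \<rho> y)) i j x
    = complex_of_real (saturation_d1 (c * \<rho> x)) * levi_weight r \<omega> L (\<lambda>y. c * \<rho> y) i j x
    + complex_of_real (saturation_d2 (c * \<rho> x))
      * (vf_apply (L i) (\<lambda>y. complex_of_real (c * \<rho> y)) x * cnj (vf_apply (L j) (\<lambda>y. complex_of_real (c * \<rho> y)) x))"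
    unfolding saturation_d2_def saturation_d1_def[abs_def]
    by (rule frame_fields.levi_weight_compose[OF ff sc saturation(1) ij x])
  then show ?thesis
    unfolding levi_weight_scale[OF ff \<rho> ij x] v by (simp add: power2_eq_square mult_ac)
qed

text \<open>At a zero of \<open>f\<close> the first derivative of the square vanishes, so the Levi
  form of \<open>f\<close> itself drops out and only the positive gradient term remains.\<close>

lemma levi_weight_square_at_zero:
  fixes L :: "nat \<Rightarrow> 'm::finite cfield"
  assumes ff: "frame_fields r V \<omega> L \<gamma>" and f: "smooth_on V f" and ij: "i < r" "j < r" and x: "x \<in> V" "f x = 0"
  shows "levi_weight r \<omega> L (\<lambda>y. (f y)\<^sup>2) i j x
    = 2 * (vf_apply (L i) (\<lambda>y. complex_of_real (f y)) x * cnj (vf_apply (L j) (\<lambda>y. complex_of_real (f y)) x))"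
proof -
  have s: "smooth_on UNIV (\<lambda>t::real. t\<^sup>2)" by (intro smooth_on_power smooth_on_id) auto
  have d1: "(\<lambda>t. frechet_derivative (\<lambda>t::real. t\<^sup>2) (at t) 1) = (\<lambda>t. 2 * t)"
  proof
    fix t :: real
    have "((\<lambda>t::real. t\<^sup>2) has_derivative (\<lambda>h. 2 * t * h)) (at t)" by (auto intro!: derivative_eq_intros simp: field_simps)
    from frechet_derivative_at[OF this] show "frechet_derivative (\<lambda>t::real. t\<^sup>2) (at t) 1 = 2 * t" by (metis mult.right_neutral)
  qed
  have d2: "frechet_derivative (\<lambda>t::real. 2 * t) (at t) 1 = 2" for t
  proof -
    have "((\<lambda>t::real. 2 * t) has_derivative (\<lambda>h. 2 * h)) (at t)" by (auto intro!: derivative_eq_intros)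
    from frechet_derivative_at[OF this] show ?thesis by (metis mult.right_neutral)
  qed
  show ?thesis
    using frame_fields.levi_weight_compose[OF ff f s ij x(1)] fun_cong[OF d1, of 0] unfolding d1 d2 x(2) by simp
qed

text \<open>The weights are \<open>saturation (b\<^sub>k\<^sup>2 \<rho> / B)\<close> with \<open>\<rho>\<close> comparable to the squared distance to \<open>S\<close>: within
  distance \<open>1 / b\<^sub>k\<close> of \<open>S\<close> their Levi form is at least \<open>b\<^sub>k\<^sup>2\<close>, and further away the type condition
  makes \<open>2\<^sup>k (c\<^sub>i\<^sub>j)\<close> large enough to absorb it.\<close>

lemma weights_near_totally_real:
  fixes g :: "'u \<Rightarrow> real^'m::finite \<Rightarrow> real" and d :: "real^'m \<Rightarrow> real" and b :: "nat \<Rightarrow> real"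
  assumes ff: "frame_fields r V \<omega> L \<gamma>" and R: "0 < R" "cball x0 R \<subseteq> V" and C: "0 \<le> C" and c: "0 < c" and H: "finite H"
    and g: "\<And>u. u \<in> H \<Longrightarrow> smooth_on UNIV (g u)" "\<And>u x. u \<in> H \<Longrightarrow> x \<notin> cball x0 R \<Longrightarrow> g u x = 0" "\<And>u. u \<in> H \<Longrightarrow> g u x0 = 0"
    and gd: "\<And>x. x \<in> cball x0 (R / 2) \<Longrightarrow> (\<Sum>u\<in>H. (g u x)\<^sup>2) \<le> C * (d x)\<^sup>2"
    and coer: "\<And>a. c * (\<Sum>i<r. (cmod (a i))\<^sup>2) \<le> (\<Sum>u\<in>H. (cmod (\<Sum>i<r. a i * vf_apply (L i) (\<lambda>y. complex_of_real (g u y)) x0))\<^sup>2)"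
    and d: "\<And>x. 0 \<le> d x" "\<And>x. x \<in> cball x0 (R / 2) \<Longrightarrow> d x < \<delta>"
    and b: "\<And>k. b k = 0 \<or> 1 \<le> b k" "\<And>k d. b k \<noteq> 0 \<Longrightarrow> 1 / b k \<le> d \<Longrightarrow> d < \<delta> \<Longrightarrow> (b k)\<^sup>2 / 2 ^ k \<le> q d"
    and levi: "\<And>x a. x \<in> cball x0 (R / 2) \<Longrightarrow> 0 \<le> Re (\<Sum>i<r. \<Sum>j<r. levi \<gamma> L i j x * a i * cnj (a j))"
      "\<And>x a. x \<in> cball x0 (R / 2) \<Longrightarrow> cF * q (d x) * (\<Sum>i<r. (cmod (a i))\<^sup>2) \<le> Re (\<Sum>i<r. \<Sum>j<r. levi \<gamma> L i j x * a i * cnj (a j))"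
    and cF: "0 < cF"
  shows "\<exists>\<phi> R' D M c0. 0 < R' \<and> R' \<le> R \<and> 0 \<le> D \<and> 0 \<le> M \<and> 0 < c0 \<and>
     (\<forall>k::nat. smooth_on UNIV (\<phi> k) \<and> (\<forall>x. \<bar>\<phi> k x\<bar> \<le> 2)) \<and>
     (\<forall>k. \<forall>x\<in>V. \<forall>i<r. \<forall>j<r. cmod (levi_weight r \<omega> L (\<phi> k) i j x) \<le> D * (b k)\<^sup>2) \<and>
     (\<forall>k a. \<forall>x\<in>cball x0 R'. c0 * (b k)\<^sup>2 * (\<Sum>i<r. (cmod (a i))\<^sup>2) \<le>
        Re (\<Sum>i<r. \<Sum>j<r. (complex_of_real (M * 2 ^ k) * levi \<gamma> L i j x + levi_weight r \<omega> L (\<phi> k) i j x) * a i * cnj (a j)))"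
proof -
  interpret frame_fields r V \<omega> L \<gamma> by (rule ff)
  define \<rho> where "\<rho> x = (\<Sum>u\<in>H. (g u x)\<^sup>2)" for x
  have sgV: "smooth_on V (g u)" if "u \<in> H" for u by (rule smooth_on_subset[OF g(1)[OF that] subset_UNIV])
  have sg2: "smooth_on V (\<lambda>x. (g u x)\<^sup>2)" if "u \<in> H" for u by (rule smooth_on_power[OF V sgV[OF that]])
  have s\<rho>U: "smooth_on UNIV \<rho>" unfolding \<rho>_def by (intro smooth_on_sum smooth_on_power g) auto
  have s\<rho>: "smooth_on V \<rho>" by (rule smooth_on_subset[OF s\<rho>U subset_UNIV])
  have \<rho>0: "0 \<le> \<rho> x" for x unfolding \<rho>_def by (rule sum_nonneg) simp
  have oc: "open (- cball x0 R)" by (intro open_Compl closed_cball)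
  have x0V: "x0 \<in> V" using R by auto
  define vg where "vg u i x = vf_apply (L i) (\<lambda>y. complex_of_real (g u y)) x" for u i x
  define LW where "LW i j x = levi_weight r \<omega> L \<rho> i j x" for i j x
  have cLW: "continuous_on V (LW i j)" if "i < r" "j < r" for i j
    unfolding LW_def by (rule smooth_on_continuous_on[OF smooth_levi_weight[OF s\<rho> that]])
  have "\<exists>B\<ge>0. \<forall>p\<in>{..<r} \<times> {..<r}. \<forall>x\<in>V. norm ((case p of (i, j) \<Rightarrow> LW i j) x) \<le> B"
  proof (rule uniform_bound_finite_family)
    fix p assume "p \<in> {..<r} \<times> {..<r}"
    then obtain i j where p: "p = (i, j)" and ij: "i \<in> {..<r}" "j \<in> {..<r}" by (elim SigmaE)
    have "\<exists>B\<ge>0. \<forall>x\<in>V. norm (LW i j x) \<le> B"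
    proof (rule bounded_on_compact_support[OF cLW compact_cball R(2)])
      fix x assume x: "x \<notin> cball x0 R"
      have "levi_weight r \<omega> L \<rho> i j x = levi_weight r \<omega> L (\<lambda>y. 0) i j x"
        by (rule levi_weight_cong_open[OF oc]) (use x g(2) in \<open>auto simp: \<rho>_def\<close>)
      then show "LW i j x = 0" unfolding LW_def levi_weight_zero .
    qed (use ij in auto)
    then show "\<exists>B\<ge>0. \<forall>x\<in>V. norm ((case p of (i, j) \<Rightarrow> LW i j) x) \<le> B" unfolding p by simp
  qed simp
  then obtain Bl where Bl0: "0 \<le> Bl" "\<forall>p\<in>{..<r} \<times> {..<r}. \<forall>x\<in>V. norm ((case p of (i, j) \<Rightarrow> LW i j) x) \<le> Bl" by (elim exE conjE)
  have Bl: "cmod (LW i j x) \<le> Bl" if "i < r" "j < r" "x \<in> V" for i j x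
    using bspec[OF Bl0(2), of "(i, j)"] that by simp
  have "\<exists>B\<ge>0. \<forall>p\<in>H \<times> {..<r}. \<forall>x\<in>V. norm ((case p of (u, i) \<Rightarrow> vg u i) x) \<le> B"
  proof (rule uniform_bound_finite_family)
    fix p assume "p \<in> H \<times> {..<r}"
    then obtain u i where p: "p = (u, i)" and u: "u \<in> H" and i: "i \<in> {..<r}" by (elim SigmaE)
    have "\<exists>B\<ge>0. \<forall>x\<in>V. norm (vg u i x) \<le> B"
    proof (rule bounded_on_compact_support[OF _ compact_cball R(2)])
      show "continuous_on V (vg u i)" unfolding vg_def
        by (rule smooth_on_continuous_on[OF smooth_on_vf_apply[OF V smooth_L smooth_on_of_real[OF V sgV[OF u]]]]) (use i in simp)
      fix x assume x: "x \<notin> cball x0 R"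
      have "vf_apply (L i) (\<lambda>y. complex_of_real (g u y)) x = vf_apply (L i) (\<lambda>y. 0) x"
        by (rule vf_apply_cong_open[OF oc]) (use x g(2)[OF u] in auto)
      then show "vg u i x = 0" unfolding vg_def by (simp add: vf_apply_def partial_def)
    qed
    then show "\<exists>B\<ge>0. \<forall>x\<in>V. norm ((case p of (u, i) \<Rightarrow> vg u i) x) \<le> B" unfolding p by simp
  qed (simp add: H)
  then obtain Bm where Bm0: "0 \<le> Bm" "\<forall>p\<in>H \<times> {..<r}. \<forall>x\<in>V. norm ((case p of (u, i) \<Rightarrow> vg u i) x) \<le> Bm" by (elim exE conjE)
  have Bm: "cmod (vg u i x) \<le> Bm" if "u \<in> H" "i < r" "x \<in> V" for u i x
    using bspec[OF Bm0(2), of "(u, i)"] that by simp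
  have dg: "g u differentiable (at x)" if "u \<in> H" for u x using g(1)[OF that] smooth_on_unfold by blast
  have v\<rho>: "vf_apply (L i) (\<lambda>y. complex_of_real (\<rho> y)) x = (\<Sum>u\<in>H. complex_of_real (2 * g u x) * vg u i x)" for i x
  proof -
    have sq: "vf_apply (L i) (\<lambda>y. complex_of_real ((g u y)\<^sup>2)) x = complex_of_real (2 * g u x) * vg u i x" if "u \<in> H" for u
      unfolding vg_def by (rule vf_apply_compose_real[OF dg[OF that]]) (auto intro!: derivative_eq_intros)
    have "vf_apply (L i) (\<lambda>y. complex_of_real (\<rho> y)) x = vf_apply (L i) (\<lambda>y. \<Sum>u\<in>H. complex_of_real ((g u y)\<^sup>2)) x"
      unfolding \<rho>_def of_real_sum ..
    also have "\<dots> = (\<Sum>u\<in>H. vf_apply (L i) (\<lambda>y. complex_of_real ((g u y)\<^sup>2)) x)"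
    proof (rule vf_apply_sum)
      fix u assume "u \<in> H"
      have "smooth_on UNIV (\<lambda>y. complex_of_real ((g u y)\<^sup>2))" by (intro smooth_on_of_real smooth_on_power g \<open>u \<in> H\<close>) auto
      then show "(\<lambda>y. complex_of_real ((g u y)\<^sup>2)) differentiable (at x)" using smooth_on_unfold by blast
    qed
    also have "\<dots> = (\<Sum>u\<in>H. complex_of_real (2 * g u x) * vg u i x)" by (rule sum.cong[OF refl sq])
    finally show ?thesis .
  qed
  \<comment> \<open>The gradient of a sum of squares is at most a constant times
    \<open>sqrt (\<rho> x)\<close>; \<open>N\<close> is the square of that constant.\<close>
  define N where "N = (2 * Bm * card H)\<^sup>2"
  have v\<rho>_bd: "cmod (vf_apply (L i) (\<lambda>y. complex_of_real (\<rho> y)) x) \<le> 2 * Bm * card H * sqrt (\<rho> x)" if "i < r" "x \<in> V" for i x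
  proof -
    have "cmod (vf_apply (L i) (\<lambda>y. complex_of_real (\<rho> y)) x) \<le> (\<Sum>u\<in>H. 2 * Bm * sqrt (\<rho> x))"
      unfolding v\<rho>
    proof (rule sum_norm_le)
      fix u assume u: "u \<in> H"
      have "(g u x)\<^sup>2 \<le> \<rho> x" unfolding \<rho>_def by (rule member_le_sum) (use u H in auto)
      then have "\<bar>g u x\<bar> \<le> sqrt (\<rho> x)" by (rule real_le_rsqrt[of "\<bar>g u x\<bar>", simplified])
      then have "\<bar>g u x\<bar> * cmod (vg u i x) \<le> sqrt (\<rho> x) * Bm" using Bm[OF u that] by (intro mult_mono) (auto simp: \<rho>0)
      then show "norm (complex_of_real (2 * g u x) * vg u i x) \<le> 2 * Bm * sqrt (\<rho> x)" by (simp add: norm_mult mult_ac)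
    qed
    then show ?thesis by (simp add: mult_ac)
  qed
  have prod_bd: "cmod (vf_apply (L i) (\<lambda>y. complex_of_real (\<rho> y)) x * cnj (vf_apply (L j) (\<lambda>y. complex_of_real (\<rho> y)) x)) \<le> N * \<rho> x"
    if "i < r" "j < r" "x \<in> V" for i j x
  proof -
    have "cmod (vf_apply (L i) (\<lambda>y. complex_of_real (\<rho> y)) x) * cmod (vf_apply (L j) (\<lambda>y. complex_of_real (\<rho> y)) x)
      \<le> (2 * Bm * card H * sqrt (\<rho> x)) * (2 * Bm * card H * sqrt (\<rho> x))"
      by (rule mult_mono[OF v\<rho>_bd[OF that(1,3)] v\<rho>_bd[OF that(2,3)]]) (use Bm0(1) \<rho>0 in auto)
    also have "\<dots> = N * (sqrt (\<rho> x) * sqrt (\<rho> x))" unfolding N_def by (simp add: power2_eq_square mult_ac)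
    finally show ?thesis using \<rho>0[of x] by (simp add: norm_mult)
  qed
  obtain E where E: "0 \<le> E" "\<forall>t\<ge>0. \<bar>saturation_d1 t\<bar> \<le> E \<and> \<bar>saturation_d2 t\<bar> * t \<le> E"
    using saturation(5) by (elim exE conjE)
  define D where "D = E * (Bl + N)"
  have N0: "0 \<le> N" unfolding N_def by simp
  have D0: "0 \<le> D" unfolding D_def using E(1) Bl0(1) N0 by simp
  \<comment> \<open>Dividing by a positive number that bounds \<open>\<rho>\<close> against the
    squared distance makes \<open>e k * \<rho> x \<ge> 1\<close> imply
    \<open>b k * d x \<ge> 1\<close>: leaving the linear range of the saturation means being at
    distance at least \<open>1 / b k\<close> from \<open>S\<close>.\<close>
  define B where "B = C + 1"
  have B: "1 \<le> B" "0 < B" unfolding B_def using C by auto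
  define e where "e k = (b k)\<^sup>2 / B" for k
  have e: "0 \<le> e k" "e k \<le> (b k)\<^sup>2" for k
    unfolding e_def using B mult_left_mono[of 1 B "(b k)\<^sup>2"] by (auto simp: field_simps)
  define \<phi> where "\<phi> k x = saturation (e k * \<rho> x)" for k x
  have lw\<phi>: "levi_weight r \<omega> L (\<phi> k) i j x = complex_of_real (saturation_d1 (e k * \<rho> x) * e k) * LW i j x
    + complex_of_real (saturation_d2 (e k * \<rho> x) * (e k)\<^sup>2)
      * (vf_apply (L i) (\<lambda>y. complex_of_real (\<rho> y)) x * cnj (vf_apply (L j) (\<lambda>y. complex_of_real (\<rho> y)) x))"
    if "i < r" "j < r" "x \<in> V" for i j x k
    unfolding \<phi>_def LW_def by (rule levi_weight_perturbation[OF ff s\<rho> that])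
  have lw_bd: "cmod (levi_weight r \<omega> L (\<phi> k) i j x) \<le> D * (b k)\<^sup>2" if ij: "i < r" "j < r" and x: "x \<in> V" for i j x k
  proof -
    let ?P = "vf_apply (L i) (\<lambda>y. complex_of_real (\<rho> y)) x * cnj (vf_apply (L j) (\<lambda>y. complex_of_real (\<rho> y)) x)"
    let ?t = "e k * \<rho> x"
    have t: "0 \<le> ?t" using e(1) \<rho>0 by simp
    have p1: "cmod (complex_of_real (saturation_d1 ?t * e k) * LW i j x) \<le> (E * e k) * Bl"
      unfolding norm_mult norm_of_real abs_mult
      by (intro mult_mono Bl[OF ij x]) (use E t e(1) in auto)
    have p2: "cmod (complex_of_real (saturation_d2 ?t * (e k)\<^sup>2) * ?P) \<le> (E * e k) * N"
    proof -
      have "cmod (complex_of_real (saturation_d2 ?t * (e k)\<^sup>2) * ?P) \<le> \<bar>saturation_d2 ?t * (e k)\<^sup>2\<bar> * (N * \<rho> x)"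
        unfolding norm_mult[of "complex_of_real (saturation_d2 ?t * (e k)\<^sup>2)"] norm_of_real
        by (intro mult_left_mono prod_bd[OF ij x]) simp
      also have "\<dots> = (\<bar>saturation_d2 ?t\<bar> * ?t) * (e k * N)" by (simp add: abs_mult power2_eq_square mult_ac)
      also have "\<dots> \<le> E * (e k * N)" using E(2) t e(1) N0 by (intro mult_right_mono) auto
      finally show ?thesis by (simp add: mult_ac)
    qed
    have "cmod (levi_weight r \<omega> L (\<phi> k) i j x) \<le> (E * e k) * Bl + (E * e k) * N"
      unfolding lw\<phi>[OF ij x] by (rule order_trans[OF norm_triangle_ineq add_mono[OF p1 p2]])
    also have "\<dots> = D * e k" unfolding D_def by (simp add: algebra_simps)
    also have "\<dots> \<le> D * (b k)\<^sup>2" using D0 e(2) by (rule mult_left_mono[rotated])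
    finally show ?thesis .
  qed
  have LW0: "Re (\<Sum>i<r. \<Sum>j<r. LW i j x0 * a i * cnj (a j)) \<ge> 2 * c * (\<Sum>i<r. (cmod (a i))\<^sup>2)" for a
  proof -
    have l: "LW i j x0 = (\<Sum>u\<in>H. 2 * (vg u i x0 * cnj (vg u j x0)))" if "i < r" "j < r" for i j
    proof -
      have "LW i j x0 = (\<Sum>u\<in>H. levi_weight r \<omega> L (\<lambda>y. (g u y)\<^sup>2) i j x0)"
        unfolding LW_def \<rho>_def by (rule levi_weight_sum[OF _ that x0V]) (rule sg2)
      also have "\<dots> = (\<Sum>u\<in>H. 2 * (vg u i x0 * cnj (vg u j x0)))"
        unfolding vg_def by (rule sum.cong[OF refl]) (rule levi_weight_square_at_zero[OF ff sgV that x0V g(3)])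
      finally show ?thesis .
    qed
    have "(\<Sum>i<r. \<Sum>j<r. LW i j x0 * a i * cnj (a j)) = (\<Sum>i<r. \<Sum>j<r. \<Sum>u\<in>H. 2 * ((a i * vg u i x0) * cnj (a j * vg u j x0)))"
      by (intro sum.cong refl) (simp add: l sum_distrib_left sum_distrib_right mult_ac)
    also have "\<dots> = (\<Sum>i<r. \<Sum>u\<in>H. \<Sum>j<r. 2 * ((a i * vg u i x0) * cnj (a j * vg u j x0)))"
      by (rule sum.cong[OF refl], rule sum.swap)
    also have "\<dots> = (\<Sum>u\<in>H. \<Sum>i<r. \<Sum>j<r. 2 * ((a i * vg u i x0) * cnj (a j * vg u j x0)))"
      by (rule sum.swap)
    also have "\<dots> = (\<Sum>u\<in>H. 2 * ((\<Sum>i<r. a i * vg u i x0) * cnj (\<Sum>i<r. a i * vg u i x0)))"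
      unfolding cnj_sum sum_product unfolding sum_distrib_left ..
    also have "\<dots> = complex_of_real (\<Sum>u\<in>H. 2 * (cmod (\<Sum>i<r. a i * vg u i x0))\<^sup>2)"
      unfolding complex_norm_square[symmetric] by simp
    finally have "Re (\<Sum>i<r. \<Sum>j<r. LW i j x0 * a i * cnj (a j)) = 2 * (\<Sum>u\<in>H. (cmod (\<Sum>i<r. a i * vg u i x0))\<^sup>2)"
      by (simp add: sum_distrib_left)
    then show ?thesis using coer[of a] unfolding vg_def by simp
  qed
  \<comment> \<open>At \<open>x0\<close> the Levi form of \<open>\<rho>\<close> is at least
    \<open>2 * c\<close>. Entries that move by at most \<open>c / (real r + 1)\<close> change the
    form by at most \<open>c\<close>, so \<open>c\<close> survives on a smaller ball.\<close>
  have "\<exists>R'>0. R' \<le> R / 2 \<and> (\<forall>x\<in>cball x0 R'. \<forall>i<r. \<forall>j<r. cmod (LW i j x - LW i j x0) \<le> c / (real r + 1))"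
  proof -
    have "\<forall>\<^sub>F x in nhds x0. \<forall>p\<in>{..<r} \<times> {..<r}. cmod (LW (fst p) (snd p) x - LW (fst p) (snd p) x0) \<le> c / (real r + 1)"
    proof (rule eventually_ball_finite, simp, rule ballI)
      fix p assume p: "p \<in> {..<r} \<times> {..<r}"
      have "isCont (LW (fst p) (snd p)) x0"
        using cLW[of "fst p" "snd p"] p x0V by (auto simp: continuous_on_eq_continuous_at[OF V])
      then have "(LW (fst p) (snd p) \<longlongrightarrow> LW (fst p) (snd p) x0) (nhds x0)" by (simp add: isCont_def tendsto_at_iff_tendsto_nhds)
      then have "\<forall>\<^sub>F x in nhds x0. dist (LW (fst p) (snd p) x) (LW (fst p) (snd p) x0) < c / (real r + 1)"
        by (rule tendstoD) (use c in simp)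
      then show "\<forall>\<^sub>F x in nhds x0. cmod (LW (fst p) (snd p) x - LW (fst p) (snd p) x0) \<le> c / (real r + 1)"
        by eventually_elim (simp add: dist_norm)
    qed
    then obtain e where e: "0 < e" "\<And>x. dist x x0 < e \<Longrightarrow> \<forall>p\<in>{..<r} \<times> {..<r}. cmod (LW (fst p) (snd p) x - LW (fst p) (snd p) x0) \<le> c / (real r + 1)"
      unfolding eventually_nhds_metric by (elim exE conjE) simp
    show ?thesis
    proof (rule exI[of _ "min (e / 2) (R / 2)"], intro conjI ballI allI impI)
      fix x i j assume "x \<in> cball x0 (min (e / 2) (R / 2))" and ij: "i < r" "j < r"
      then have "dist x x0 < e" using e(1) by (simp add: dist_commute)
      from e(2)[OF this] ij show "cmod (LW i j x - LW i j x0) \<le> c / (real r + 1)" by simp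
    qed (use e R in simp_all)
  qed
  then obtain R' where R': "0 < R'" "R' \<le> R / 2"
    and LWc: "\<forall>x\<in>cball x0 R'. \<forall>i<r. \<forall>j<r. cmod (LW i j x - LW i j x0) \<le> c / (real r + 1)" by (elim exE conjE)
  have LW_low: "c * (\<Sum>i<r. (cmod (a i))\<^sup>2) \<le> Re (\<Sum>i<r. \<Sum>j<r. LW i j x * a i * cnj (a j))" if x: "x \<in> cball x0 R'" for x a
  proof -
    let ?N = "\<Sum>i<r. (cmod (a i))\<^sup>2"
    have "\<bar>Re (\<Sum>i<r. \<Sum>j<r. (LW i j x - LW i j x0) * a i * cnj (a j))\<bar> \<le> c / (real r + 1) * r * ?N"
      by (rule hermitian_sum_bound) (use LWc x c in auto)
    moreover have "c / (real r + 1) * r * ?N \<le> c * ?N"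
    proof (rule mult_right_mono)
      show "c / (real r + 1) * r \<le> c" using c by (simp add: field_simps)
    qed (simp add: sum_nonneg)
    moreover have "(\<Sum>i<r. \<Sum>j<r. (LW i j x - LW i j x0) * a i * cnj (a j))
      = (\<Sum>i<r. \<Sum>j<r. LW i j x * a i * cnj (a j)) - (\<Sum>i<r. \<Sum>j<r. LW i j x0 * a i * cnj (a j))"
      by (simp add: sum_subtractf left_diff_distrib)
    ultimately show ?thesis using LW0[of a] by simp
  qed
  define c0 where "c0 = c / B"
  \<comment> \<open>In the far region \<open>M * cF\<close> pays for the worst value
    \<open>D * r\<close> of the weight's Levi form and still leaves \<open>c0\<close>.\<close>
  define M where "M = (D * r + c0) / cF"
  have c0: "0 < c0" unfolding c0_def using c B by simp
  have M0: "0 \<le> M" unfolding M_def using D0 c0 cF by simp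
  have low: "c0 * (b k)\<^sup>2 * (\<Sum>i<r. (cmod (a i))\<^sup>2) \<le>
        Re (\<Sum>i<r. \<Sum>j<r. (complex_of_real (M * 2 ^ k) * levi \<gamma> L i j x + levi_weight r \<omega> L (\<phi> k) i j x) * a i * cnj (a j))"
    if x: "x \<in> cball x0 R'" for k a x
  proof -
    let ?N = "\<Sum>i<r. (cmod (a i))\<^sup>2"
    let ?Q = "Re (\<Sum>i<r. \<Sum>j<r. levi \<gamma> L i j x * a i * cnj (a j))"
    let ?W = "Re (\<Sum>i<r. \<Sum>j<r. levi_weight r \<omega> L (\<phi> k) i j x * a i * cnj (a j))"
    have xR: "x \<in> cball x0 (R / 2)" and xV: "x \<in> V" using x R' R by auto
    have N: "0 \<le> ?N" by (simp add: sum_nonneg)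
    have "(\<Sum>i<r. \<Sum>j<r. (complex_of_real (M * 2 ^ k) * levi \<gamma> L i j x + levi_weight r \<omega> L (\<phi> k) i j x) * a i * cnj (a j))
      = complex_of_real (M * 2 ^ k) * (\<Sum>i<r. \<Sum>j<r. levi \<gamma> L i j x * a i * cnj (a j)) + (\<Sum>i<r. \<Sum>j<r. levi_weight r \<omega> L (\<phi> k) i j x * a i * cnj (a j))"
      by (simp only: distrib_right sum.distrib sum_distrib_left mult.assoc)
    then have split: "Re (\<Sum>i<r. \<Sum>j<r. (complex_of_real (M * 2 ^ k) * levi \<gamma> L i j x + levi_weight r \<omega> L (\<phi> k) i j x) * a i * cnj (a j)) = M * 2 ^ k * ?Q + ?W"
      by (simp only: plus_complex.sel Re_complex_of_real Im_complex_of_real times_complex.sel)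
    have Q0: "0 \<le> ?Q" by (rule levi(1)[OF xR])
    have "c0 * (b k)\<^sup>2 * ?N \<le> M * 2 ^ k * ?Q + ?W"
    \<comment> \<open>In the linear range the Levi form of the weight is exactly \<open>e k\<close>
      times that of \<open>\<rho>\<close>, and the Levi form of the manifold is only needed to be
      nonnegative. Otherwise the roles are exchanged.\<close>
    proof (cases "e k * \<rho> x < 1")
      case True
      have "(\<Sum>i<r. \<Sum>j<r. levi_weight r \<omega> L (\<phi> k) i j x * a i * cnj (a j)) = complex_of_real (e k) * (\<Sum>i<r. \<Sum>j<r. LW i j x * a i * cnj (a j))"
        unfolding sum_distrib_left by (intro sum.cong refl) (simp add: lw\<phi> xV saturation(3,4)[OF True])
      then have "?W = e k * Re (\<Sum>i<r. \<Sum>j<r. LW i j x * a i * cnj (a j))" by simp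
      moreover have "e k * (c * ?N) \<le> e k * Re (\<Sum>i<r. \<Sum>j<r. LW i j x * a i * cnj (a j))"
        using LW_low[OF x] e(1) by (rule mult_left_mono)
      moreover have "0 \<le> M * 2 ^ k * ?Q" using M0 Q0 by simp
      moreover have "e k * (c * ?N) = c0 * (b k)\<^sup>2 * ?N" unfolding e_def c0_def by simp
      ultimately show ?thesis by linarith
    next
      case False
      have ek: "e k \<noteq> 0" using False by auto
      then have bk: "b k \<noteq> 0" "1 \<le> b k" using b(1)[of k] unfolding e_def by auto
      have "\<rho> x \<le> C * (d x)\<^sup>2" using gd[OF xR] unfolding \<rho>_def .
      also have "\<dots> \<le> B * (d x)\<^sup>2" unfolding B_def by (simp add: distrib_right)
      finally have "e k * \<rho> x \<le> e k * (B * (d x)\<^sup>2)" using e(1) by (rule mult_left_mono)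
      also have "\<dots> = (b k * d x)\<^sup>2" unfolding e_def using B by (simp add: power_mult_distrib)
      finally have "1 \<le> (b k * d x)\<^sup>2" using False by simp
      then have "1 \<le> b k * d x" using power2_le_imp_le[of 1 "b k * d x"] bk d(1)[of x] by simp
      then have "1 / b k \<le> d x" using bk by (simp add: field_simps)
      \<comment> \<open>Here \<open>d x\<close> is positive, so the conventional value of the type
        quotient on \<open>S\<close> does not enter.\<close>
      then have qd: "(b k)\<^sup>2 / 2 ^ k \<le> q (d x)" by (rule b(2)[OF bk(1) _ d(2)[OF xR]])
      have "cF * ((b k)\<^sup>2 / 2 ^ k) * ?N \<le> cF * q (d x) * ?N"
        using qd cF N by (intro mult_right_mono mult_left_mono) auto
      then have "cF * ((b k)\<^sup>2 / 2 ^ k) * ?N \<le> ?Q" using levi(2)[OF xR, of a] by linarith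
      then have "M * 2 ^ k * (cF * ((b k)\<^sup>2 / 2 ^ k) * ?N) \<le> M * 2 ^ k * ?Q" using M0 by (intro mult_left_mono) auto
      moreover have "M * 2 ^ k * (cF * ((b k)\<^sup>2 / 2 ^ k) * ?N) = (M * cF) * ((b k)\<^sup>2 * ?N)" by simp
      moreover have "M * cF = D * r + c0" unfolding M_def using cF by simp
      moreover have "\<bar>?W\<bar> \<le> D * (b k)\<^sup>2 * r * ?N"
        by (rule hermitian_sum_bound) (use lw_bd xV D0 in auto)
      ultimately show ?thesis by (simp add: distrib_right mult_ac abs_le_iff)
    qed
    then show ?thesis unfolding split .
  qed
  show ?thesis
  proof (rule exI[of _ \<phi>], rule exI[of _ R'], rule exI[of _ D], rule exI[of _ M], rule exI[of _ c0], intro conjI allI ballI impI)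
    show "smooth_on UNIV (\<phi> k)" for k unfolding \<phi>_def
      by (rule smooth_on_compose[OF open_UNIV open_UNIV _ saturation(1)]) (intro smooth_on_mult smooth_on_const s\<rho>U, auto)
    show "\<bar>\<phi> k x\<bar> \<le> 2" for k x unfolding \<phi>_def by (rule saturation(2)) (use e(1) \<rho>0 in simp)
  qed (use R' R D0 M0 c0 lw_bd low in simp_all)
qed

text \<open>Passage from matrices on forms to the abstract estimate: signs and volume density are
  absorbed into the coefficients, which are extended by 0 outside \<open>\<Omega>\<close>.
  \<open>pe e\<close> stands for the Levi matrix of the weight scaled by \<open>e\<close>; that it
  equals \<open>e\<close> times \<open>p\<close> is assumed on \<open>\<Omega>\<close> only.\<close>

lemma (in dyadic_symbols) weighted_form_estimate:
  fixes c :: "nat \<Rightarrow> nat \<Rightarrow> real^'m \<Rightarrow> complex" and p :: "nat \<Rightarrow> nat \<Rightarrow> nat \<Rightarrow> real^'m \<Rightarrow> complex"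
    and pe :: "real \<Rightarrow> nat \<Rightarrow> nat \<Rightarrow> nat \<Rightarrow> real^'m \<Rightarrow> complex" and dens \<rho> w \<sigma> :: "real^'m \<Rightarrow> real" and b :: "nat \<Rightarrow> real"
    and Q :: "(nat \<Rightarrow> nat \<Rightarrow> real^'m \<Rightarrow> complex) \<Rightarrow> 'm cform \<Rightarrow> real^'m \<Rightarrow> real"
  assumes Q: "form_representation r J Q" and J: "finite J" and \<Omega>: "open \<Omega>"
    and c: "\<And>i j. i < r \<Longrightarrow> j < r \<Longrightarrow> smooth_on \<Omega> (c i j)" "\<And>i j x. i < r \<Longrightarrow> j < r \<Longrightarrow> x \<in> \<Omega> \<Longrightarrow> cmod (c i j x) \<le> D1"
      "\<And>x a. x \<in> \<Omega> \<Longrightarrow> 0 \<le> Re (\<Sum>i<r. \<Sum>j<r. c i j x * a i * cnj (a j))"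
    and p: "\<And>k i j. i < r \<Longrightarrow> j < r \<Longrightarrow> continuous_on \<Omega> (p k i j)"
      "\<And>k i j x. i < r \<Longrightarrow> j < r \<Longrightarrow> x \<in> \<Omega> \<Longrightarrow> cmod (p k i j x) \<le> D1 * (b k)\<^sup>2"
    and pe: "\<And>e k i j x. i < r \<Longrightarrow> j < r \<Longrightarrow> x \<in> \<Omega> \<Longrightarrow> pe e k i j x = complex_of_real e * p k i j x"
    and dens: "smooth_on \<Omega> dens" "\<And>x. x \<in> \<Omega> \<Longrightarrow> 0 \<le> dens x" "\<And>x. x \<in> \<Omega> \<Longrightarrow> dens x \<le> D2"
    and D: "0 \<le> D1" "0 \<le> D2" and b: "\<And>k. (b k)\<^sup>2 \<le> 2 ^ k"
    and B: "B \<subseteq> \<Omega>" "\<And>x. x \<in> B \<Longrightarrow> d0 \<le> dens x" "0 < d0"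
      "\<And>k x a. x \<in> B \<Longrightarrow> c0 * (b k)\<^sup>2 * (\<Sum>i<r. (cmod (a i))\<^sup>2) \<le>
         Re (\<Sum>i<r. \<Sum>j<r. (complex_of_real (M * 2 ^ k) * c i j x + p k i j x) * a i * cnj (a j))"
    and c0: "0 < c0" and M: "0 \<le> M"
    and \<rho>: "smooth_on UNIV \<rho>" "\<And>x. 0 \<le> \<rho> x" "\<And>x. \<rho> x \<le> 1" "\<And>x. x \<in> B \<Longrightarrow> \<rho> x = 1"
      and K: "compact K" "K \<subseteq> \<Omega>" "\<And>x. x \<notin> K \<Longrightarrow> \<rho> x = 0"
    and w: "test_fun w" "\<And>x. 0 \<le> w x" "\<And>x. w x \<le> 1" "\<And>x. x \<notin> B \<Longrightarrow> w x = 0"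
    and \<sigma>: "poly_growth \<sigma>" "\<And>k \<xi>. 1 \<le> k \<Longrightarrow> \<Gamma> k \<xi> \<noteq> 0 \<Longrightarrow> (\<sigma> \<xi>)\<^sup>2 \<le> C1 * (1 + (b k)\<^sup>2)" "0 < C1"
  defines "I \<equiv> \<lambda>e v k. LINT x:\<Omega>|lborel. Q (pe e k) (multiplier_form (\<Gamma> k) v) x * dens x"
  shows "\<exists>e0>0. \<forall>e. 0 < e \<longrightarrow> e \<le> e0 \<longrightarrow> (\<exists>C'>0. \<forall>v. (\<forall>j\<in>J. test_fun (v j) \<and> (\<forall>x. complex_of_real (w x) * v j x = v j x)) \<longrightarrow>
    summable (\<lambda>k. I e v (Suc k)) \<and>
    (\<Sum>j\<in>J. LINT x|lborel. (cmod (multiplier_form \<sigma> v j x))\<^sup>2) \<le>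
      C' * ((LINT x:\<Omega>|lborel. Q c (multiplier_form (\<lambda>\<xi>. Lambda_symbol \<xi> powr (1/2)) v) x * dens x)
        + (\<Sum>k. I e v (Suc k)) + (\<Sum>j\<in>J. LINT x|lborel. (cmod (v j x))\<^sup>2)))"
proof -
  obtain T \<alpha> \<beta> \<kappa> \<iota> \<iota>' where Ta: "finite (T :: (nat set \<times> nat \<times> nat) set)" "\<alpha> ` T \<subseteq> J" "\<beta> ` T \<subseteq> J"
    and \<kappa>: "\<forall>t\<in>T. \<bar>\<kappa> t\<bar> \<le> 1 \<and> \<iota> t < r \<and> \<iota>' t < r"
    and rep: "\<forall>A v x. Q A v x = qform T \<alpha> \<beta> (\<lambda>t. complex_of_real (\<kappa> t) * A (\<iota> t) (\<iota>' t) x) (\<lambda>j. v j x)"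
    and low: "\<forall>A v x t. 0 \<le> t \<longrightarrow> (\<forall>a. t * (\<Sum>i<r. (cmod (a i))\<^sup>2) \<le> Re (\<Sum>i<r. \<Sum>j<r. A i j x * a i * cnj (a j))) \<longrightarrow>
          t * (\<Sum>j\<in>J. (cmod (v j x))\<^sup>2) \<le> Q A v x"
    using Q unfolding form_representation_def by (elim exE conjE)
  have \<iota>: "\<iota> t < r" "\<iota>' t < r" "\<bar>\<kappa> t\<bar> \<le> 1" if "t \<in> T" for t using \<kappa> that by simp_all
  define C where "C t x = (if x \<in> \<Omega> then complex_of_real (dens x) * (complex_of_real (\<kappa> t) * c (\<iota> t) (\<iota>' t) x) else 0)" for t x
  define P where "P k t x = (if x \<in> \<Omega> then complex_of_real (dens x) * (complex_of_real (\<kappa> t) * p k (\<iota> t) (\<iota>' t) x) else 0)" for k t x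
  have q0: "qform T \<alpha> \<beta> (\<lambda>t. 0) y = 0" for y by (simp add: qform_def)
  have qC: "qform T \<alpha> \<beta> (\<lambda>t. C t x) (\<lambda>j. v j x) = indicator \<Omega> x * (Q c v x * dens x)" for v x
    by (cases "x \<in> \<Omega>") (simp_all add: C_def qform_scale rep q0 mult.commute)
  have qP: "qform T \<alpha> \<beta> (\<lambda>t. P k t x) (\<lambda>j. v j x) = indicator \<Omega> x * (Q (p k) v x * dens x)" for k v x
    by (cases "x \<in> \<Omega>") (simp_all add: P_def qform_scale rep q0 mult.commute)
  have Qpe: "Q (pe e k) v x = e * Q (p k) v x" if "x \<in> \<Omega>" for e k v x
  proof -
    have "Q (pe e k) v x = qform T \<alpha> \<beta> (\<lambda>t. complex_of_real e * (complex_of_real (\<kappa> t) * p k (\<iota> t) (\<iota>' t) x)) (\<lambda>j. v j x)"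
      unfolding rep[rule_format] qform_def by (intro arg_cong[where f=Re] sum.cong refl) (simp add: pe \<iota> that)
    then show ?thesis unfolding qform_scale rep[rule_format] .
  qed
  have Qlin: "Q (\<lambda>i j x. complex_of_real m * c i j x + p k i j x) v x = m * Q c v x + Q (p k) v x" for m k v x
  proof -
    have "(\<Sum>t\<in>T. complex_of_real (\<kappa> t) * (complex_of_real m * c (\<iota> t) (\<iota>' t) x + p k (\<iota> t) (\<iota>' t) x) * v (\<alpha> t) x * cnj (v (\<beta> t) x))
      = complex_of_real m * (\<Sum>t\<in>T. complex_of_real (\<kappa> t) * c (\<iota> t) (\<iota>' t) x * v (\<alpha> t) x * cnj (v (\<beta> t) x))
        + (\<Sum>t\<in>T. complex_of_real (\<kappa> t) * p k (\<iota> t) (\<iota>' t) x * v (\<alpha> t) x * cnj (v (\<beta> t) x))"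
      unfolding sum_distrib_left sum.distrib[symmetric] by (intro sum.cong refl) (simp add: algebra_simps)
    then show ?thesis unfolding rep[rule_format] qform_def by simp
  qed
  have meas: "(\<lambda>x. if x \<in> \<Omega> then f x else 0) \<in> borel_measurable borel" if "continuous_on \<Omega> f" for f :: "real^'m \<Rightarrow> complex"
  proof -
    have "(\<lambda>x. indicator \<Omega> x *\<^sub>R f x) \<in> borel_measurable borel"
      by (rule borel_measurable_continuous_on_indicator[OF _ that]) (use \<Omega> in simp)
    moreover have "(\<lambda>x. indicator \<Omega> x *\<^sub>R f x) = (\<lambda>x. if x \<in> \<Omega> then f x else 0)" by (auto simp: indicator_def)
    ultimately show ?thesis by simp
  qed
  have cdens: "continuous_on \<Omega> (\<lambda>x. complex_of_real (dens x))"
    by (intro continuous_intros smooth_on_continuous_on[OF dens(1)])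
  have bd: "cmod (complex_of_real (dens x) * (complex_of_real (\<kappa> t) * y)) \<le> D2 * E" if "t \<in> T" "x \<in> \<Omega>" "cmod y \<le> E" for t x y E
  proof -
    have "\<bar>dens x\<bar> * (\<bar>\<kappa> t\<bar> * cmod y) \<le> D2 * (1 * E)"
      by (intro mult_mono) (use that \<iota> dens D in auto)
    then show ?thesis by (simp add: norm_mult)
  qed
  have smC: "smooth_on \<Omega> (\<lambda>x. complex_of_real (\<rho> x) * C t x)" if "t \<in> T" for t
  proof (rule smooth_on_cong[OF \<Omega>])
    show "smooth_on \<Omega> (\<lambda>x. complex_of_real (\<rho> x) * (complex_of_real (dens x) * (complex_of_real (\<kappa> t) * c (\<iota> t) (\<iota>' t) x)))"
      by (intro smooth_on_mult[OF \<Omega>] smooth_on_of_real[OF \<Omega>] smooth_on_const[OF \<Omega>] dens(1) c(1) \<iota> that smooth_on_subset[OF \<rho>(1)] subset_UNIV)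
  qed (simp add: C_def)
  have "\<exists>e0>0. \<forall>e. 0 < e \<longrightarrow> e \<le> e0 \<longrightarrow> (\<exists>C'>0. \<forall>v. (\<forall>j\<in>J. test_fun (v j) \<and> (\<forall>x. complex_of_real (w x) * v j x = v j x)) \<longrightarrow>
    summable (\<lambda>k. LINT x|lborel. qform T \<alpha> \<beta> (\<lambda>t. complex_of_real e * P (Suc k) t x) (\<lambda>j. multiplier (\<Gamma> (Suc k)) (v j) x)) \<and>
    (\<Sum>j\<in>J. LINT x|lborel. (norm (multiplier \<sigma> (v j) x))\<^sup>2) \<le>
      C' * ((LINT x|lborel. qform T \<alpha> \<beta> (\<lambda>t. C t x) (\<lambda>j. multiplier (\<lambda>\<xi>. Lambda_symbol \<xi> powr (1/2)) (v j) x))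
        + (\<Sum>k. LINT x|lborel. qform T \<alpha> \<beta> (\<lambda>t. complex_of_real e * P (Suc k) t x) (\<lambda>j. multiplier (\<Gamma> (Suc k)) (v j) x))
        + (\<Sum>j\<in>J. LINT x|lborel. (norm (v j x))\<^sup>2)))"
  proof (rule weighted_estimate[where D="D2 * D1" and B=B and M=M and ?c0.0="c0 * d0" and b=b and \<rho>=\<rho> and ?C1.0=C1])
    show "C t \<in> borel_measurable borel" if "t \<in> T" for t
      unfolding C_def[abs_def]
      by (rule meas) (intro continuous_on_mult cdens continuous_on_const smooth_on_continuous_on[OF c(1)] \<iota> that)
    show "P k t \<in> borel_measurable borel" if "t \<in> T" for k t
      unfolding P_def[abs_def]
      by (rule meas) (intro continuous_on_mult cdens continuous_on_const p(1) \<iota> that)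
    show "norm (C t x) \<le> D2 * D1" if "t \<in> T" for t x
      using bd[OF that _ c(2)[OF \<iota>(1,2)[OF that]], of x x] D by (simp add: C_def)
    show "norm (P k t x) \<le> D2 * D1 * (b k)\<^sup>2" if "t \<in> T" for k t x
      using bd[OF that _ p(2)[OF \<iota>(1,2)[OF that]], of x x k] D by (simp add: P_def mult.assoc)
    show "0 \<le> qform T \<alpha> \<beta> (\<lambda>t. C t x) y" for x and y :: "nat set \<Rightarrow> complex"
    proof -
      have "0 \<le> Q c (\<lambda>j _. y j) x" if "x \<in> \<Omega>"
        using low[rule_format, of 0 c x "\<lambda>j _. y j"] c(3)[OF that] by simp
      then show ?thesis unfolding qC[of x "\<lambda>j _. y j"] using dens(2) by (cases "x \<in> \<Omega>") simp_all
    qed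
    \<comment> \<open>The lower bound for matrices passes to forms with the same constant through
      the representation; multiplication by the density costs its minimum \<open>d0\<close> on
      \<open>B\<close>.\<close>
    fix k x and y :: "nat set \<Rightarrow> complex" assume x: "x \<in> B"
    then have x\<Omega>: "x \<in> \<Omega>" using B(1) by blast
    let ?N = "\<Sum>j\<in>J. (norm (y j))\<^sup>2"
    let ?A = "\<lambda>i j x. complex_of_real (M * 2 ^ k) * c i j x + p k i j x"
    have l: "c0 * (b k)\<^sup>2 * ?N \<le> Q ?A (\<lambda>j _. y j) x"
      using low[rule_format, of "c0 * (b k)\<^sup>2" ?A x "\<lambda>j _. y j"] B(4)[OF x, of k] c0 by simp
    have "c0 * d0 * (b k)\<^sup>2 * ?N = d0 * (c0 * (b k)\<^sup>2 * ?N)" by simp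
    also have "\<dots> \<le> dens x * Q ?A (\<lambda>j _. y j) x"
      by (rule mult_mono[OF B(2)[OF x] l]) (use dens(2)[OF x\<Omega>] c0 in \<open>auto intro!: mult_nonneg_nonneg sum_nonneg\<close>)
    also have "\<dots> = M * 2 ^ k * qform T \<alpha> \<beta> (\<lambda>t. C t x) y + qform T \<alpha> \<beta> (\<lambda>t. P k t x) y"
      unfolding qC[of x "\<lambda>j _. y j"] qP[of k x "\<lambda>j _. y j"] Qlin using x\<Omega> by (simp add: algebra_simps)
    finally show "c0 * d0 * (b k)\<^sup>2 * ?N \<le> M * 2 ^ k * qform T \<alpha> \<beta> (\<lambda>t. C t x) y + qform T \<alpha> \<beta> (\<lambda>t. P k t x) y" .
  next
    fix t assume t: "t \<in> T"
    have z: "complex_of_real (\<rho> x) * C t x = 0" if "x \<notin> K" for x using K(3)[OF that] by simp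
    have "smooth_on UNIV (\<lambda>x. complex_of_real (\<rho> x) * C t x)"
      by (rule smooth_on_extend_zero[OF \<Omega> smC[OF t] compact_imp_closed[OF K(1)] K(2) z])
    then show "test_fun (\<lambda>x. complex_of_real (\<rho> x) * C t x)"
      unfolding test_fun_def by (intro conjI exI[of _ K] allI impI K(1) z)
  qed (use Ta J D b B c0 M \<rho> w \<sigma> in simp_all)
  moreover have "(LINT x|lborel. qform T \<alpha> \<beta> (\<lambda>t. complex_of_real e * P k t x) (\<lambda>j. multiplier (\<Gamma> k) (v j) x)) = I e v k" for e k v
    unfolding I_def set_lebesgue_integral_def qform_scale qP[of k _ "multiplier_form (\<Gamma> k) v", unfolded multiplier_form_def] multiplier_form_def
    by (rule Bochner_Integration.integral_cong[OF refl]) (auto simp: indicator_def Qpe)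
  moreover have "(LINT x|lborel. qform T \<alpha> \<beta> (\<lambda>t. C t x) (\<lambda>j. multiplier s (v j) x)) = (LINT x:\<Omega>|lborel. Q c (multiplier_form s v) x * dens x)" for s v
    unfolding set_lebesgue_integral_def qC[of _ "multiplier_form s v", unfolded multiplier_form_def] multiplier_form_def
    by simp
  ultimately show ?thesis unfolding multiplier_form_def by simp
qed

section \<open>The estimate\<close>

text \<open>The final weights may depend neither on the degree nor on which estimate is considered.
  Each estimate tolerates every smaller \<open>e\<close> and every larger constant, so a minimum and
  a maximum over the finitely many cases serve all of them.\<close>

lemma common_small_parameter:
  fixes P :: "'i \<Rightarrow> real \<Rightarrow> real \<Rightarrow> bool"
  assumes "finite I" and P: "\<And>i. i \<in> I \<Longrightarrow> \<exists>e0>0. \<forall>e. 0 < e \<longrightarrow> e \<le> e0 \<longrightarrow> (\<exists>C>0. P i e C)"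
    and mono: "\<And>i e C C'. P i e C \<Longrightarrow> 0 < C \<Longrightarrow> C \<le> C' \<Longrightarrow> P i e C'"
  shows "\<exists>e>0. \<exists>C>0. \<forall>i\<in>I. P i e C"
proof -
  have "\<exists>e0>0. \<forall>e. 0 < e \<longrightarrow> e \<le> e0 \<longrightarrow> (\<exists>C>0. \<forall>i\<in>I. P i e C)"
    using assms(1) P
  proof (induction I rule: finite_induct)
    case empty
    show ?case by (intro exI[of _ 1]) auto
  next
    case (insert i I)
    have "\<exists>e0>0. \<forall>e. 0 < e \<longrightarrow> e \<le> e0 \<longrightarrow> (\<exists>C>0. \<forall>i\<in>I. P i e C)"
      by (rule insert.IH) (rule insert.prems[OF insertI2])
    then obtain e1 where e1: "0 < e1" "\<forall>e. 0 < e \<longrightarrow> e \<le> e1 \<longrightarrow> (\<exists>C>0. \<forall>i\<in>I. P i e C)"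
      by (elim exE conjE)
    obtain e2 where e2: "0 < e2" "\<forall>e. 0 < e \<longrightarrow> e \<le> e2 \<longrightarrow> (\<exists>C>0. P i e C)"
      using insert.prems[OF insertI1] by (elim exE conjE)
    show ?case
    proof (rule exI[of _ "min e1 e2"], intro conjI allI impI)
      fix e assume e: "0 < e" "e \<le> min e1 e2"
      have "\<exists>C>0. \<forall>i\<in>I. P i e C" by (rule e1(2)[rule_format, OF e(1)]) (use e(2) in simp)
      then obtain C1 where C1: "0 < C1" "\<forall>i\<in>I. P i e C1" by (elim exE conjE)
      have "\<exists>C>0. P i e C" by (rule e2(2)[rule_format, OF e(1)]) (use e(2) in simp)
      then obtain C2 where C2: "0 < C2" "P i e C2" by (elim exE conjE)
      have "P j e (max C1 C2)" if "j \<in> insert i I" for j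
      proof (cases "j = i")
        case True
        then show ?thesis using mono[OF C2(2,1)] by simp
      next
        case False
        then have "P j e C1" using that C1(2) by simp
        then show ?thesis by (rule mono[OF _ C1(1)]) simp
      qed
      then show "\<exists>C>0. \<forall>i\<in>insert i I. P i e C" using C1(1) by (intro exI[of _ "max C1 C2"]) simp
    qed (use e1 e2 in simp)
  qed
  then obtain e0 where "0 < e0" "\<forall>e. 0 < e \<longrightarrow> e \<le> e0 \<longrightarrow> (\<exists>C>0. \<forall>i\<in>I. P i e C)" by (elim exE conjE)
  then show ?thesis by (intro exI[of _ e0]) simp
qed

lemma hermitian_sum_diff_scalar:
  fixes r :: nat
  shows "Re (\<Sum>i<r. \<Sum>j<r. (A i j - (if i = j then complex_of_real t else 0)) * a i * cnj (a j))
    = Re (\<Sum>i<r. \<Sum>j<r. A i j * a i * cnj (a j)) - t * (\<Sum>i<r. (cmod (a i))\<^sup>2)"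
proof -
  have "(\<Sum>j<r. (if i = j then complex_of_real t else 0) * a i * cnj (a j)) = complex_of_real (t * (cmod (a i))\<^sup>2)" if "i < r" for i
  proof -
    have "(\<Sum>j<r. (if i = j then complex_of_real t else 0) * a i * cnj (a j)) = (\<Sum>j<r. if i = j then complex_of_real t * (a i * cnj (a i)) else 0)"
      by (intro sum.cong refl) simp
    also have "\<dots> = complex_of_real t * (a i * cnj (a i))" using that by simp
    also have "\<dots> = complex_of_real (t * (cmod (a i))\<^sup>2)" unfolding of_real_mult complex_norm_square ..
    finally show ?thesis .
  qed
  then have "(\<Sum>i<r. \<Sum>j<r. (A i j - (if i = j then complex_of_real t else 0)) * a i * cnj (a j))
    = (\<Sum>i<r. \<Sum>j<r. A i j * a i * cnj (a j)) - (\<Sum>i<r. complex_of_real (t * (cmod (a i))\<^sup>2))"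
    by (simp add: left_diff_distrib sum_subtractf)
  then show ?thesis by (simp add: sum_distrib_left flip: of_real_sum of_real_mult of_real_power)
qed

lemma type_gain_poly_growth:
  assumes F: "admissible_type F" and C: "0 < C" "\<And>t. 1 \<le> t \<Longrightarrow> (type_gain F t)\<^sup>2 \<le> C * t"
  shows "poly_growth (\<lambda>\<xi>::real^'m::finite. type_gain F (Lambda_symbol \<xi>))"
proof (rule poly_growthI[OF type_gain_measurable[OF F]])
  fix \<xi> :: "real^'m"
  let ?t = "Lambda_symbol \<xi>"
  have t: "1 \<le> ?t" by (rule Lambda_ge_1)
  have "(type_gain F ?t)\<^sup>2 \<le> C * ?t" by (rule C(2)[OF t])
  also have "\<dots> \<le> (1 + C)\<^sup>2 * ?t\<^sup>2"
    using C(1) t by (intro mult_mono) (auto simp: power2_eq_square algebra_simps)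
  finally have "(type_gain F ?t)\<^sup>2 \<le> ((1 + C) * ?t)\<^sup>2" by (simp add: power_mult_distrib)
  then show "\<bar>type_gain F ?t\<bar> \<le> (1 + C) * ?t"
    using C(1) t by (simp add: abs_le_square_iff[symmetric])
qed

lemma smooth_bounded_on_compact:
  fixes f :: "'a::euclidean_space \<Rightarrow> 'b::real_normed_vector"
  assumes "smooth_on V f" "compact K" "K \<subseteq> V"
  shows "\<exists>B\<ge>0. \<forall>x\<in>K. norm (f x) \<le> B"
proof -
  have "bounded (f ` K)"
    by (intro compact_imp_bounded compact_continuous_image continuous_on_subset[OF smooth_on_continuous_on[OF assms(1)] assms(3)] assms(2))
  then obtain B where B: "0 < B" "\<forall>y\<in>f ` K. norm y \<le> B" unfolding bounded_pos by (elim exE conjE)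
  then show ?thesis by (intro exI[of _ B]) simp
qed

theorem theorem1p1:
  fixes M S U :: "(complex^'n) set" and z :: "complex^'n"
    and V :: "(real^'m) set" and \<psi> :: "real^'m \<Rightarrow> complex^'n"
    and \<omega> L :: "nat \<Rightarrow> real^'m \<Rightarrow> complex^'m" and \<gamma> T :: "real^'m \<Rightarrow> complex^'m"
    and \<Gamma> :: "nat \<Rightarrow> real^'m \<Rightarrow> real"
    and F :: "real \<Rightarrow> real" and r s :: nat
  assumes dims: "CARD('n) = r + 1" "CARD('m) = 2 * r + 1"
    and hypersurface: "embedded_submanifold (2 * r + 1) M"
    and param: "smooth_parametrization M V \<psi>"
    and frame: "cr_frame r V \<psi> \<omega> \<gamma> L T"
    and pseudoconvex: "pseudoconvex_on r V \<gamma> L"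
    and S: "embedded_submanifold s S" "S \<subseteq> M" "has_cr_dim S 0" "z \<in> S"
    and U: "open U" "z \<in> U" "\<exists>K. compact K \<and> M \<inter> U \<subseteq> K \<and> K \<subseteq> \<psi> ` V"
    and F: "admissible_type F"
    and type_F: "has_type_along r F S {x \<in> V. \<psi> x \<in> U} \<psi> \<gamma> L"
    and dyadic: "dyadic_partition \<Gamma>"
  shows "\<exists>U' (\<phi> :: nat \<Rightarrow> real^'m \<Rightarrow> real) C.
     open U' \<and> z \<in> U' \<and> U' \<subseteq> U \<and> C > 0 \<and>
     (\<forall>k\<ge>1. smooth_on V (\<phi> k)) \<and>
     (\<exists>B. \<forall>k\<ge>1. \<forall>x\<in>V. \<bar>\<phi> k x\<bar> \<le> B) \<and>
     (\<forall>h v. 1 \<le> h \<and> h \<le> r \<and> test_form r h {x \<in> V. \<psi> x \<in> U'} v \<longrightarrow>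
        (let I = (\<lambda>k. integral_dV \<psi> {x \<in> V. \<psi> x \<in> U}
                   (matrix_form r h (levi_weight r \<omega> L (\<phi> k)) (multiplier_form (\<Gamma> k) v)))
         in summable (\<lambda>k. I (Suc k)) \<and>
            form_norm_sq r h (multiplier_form (\<lambda>\<xi>. type_gain F (Lambda_symbol \<xi>)) v)
            \<le> C * (integral_dV \<psi> {x \<in> V. \<psi> x \<in> U}
                     (matrix_form r h (levi \<gamma> L)
                       (multiplier_form (\<lambda>\<xi>. Lambda_symbol \<xi> powr (1/2)) v))
                   + (\<Sum>k. I (Suc k)) + form_norm_sq r h v))) \<and>
     (\<forall>h v. h < r \<and> test_form r h {x \<in> V. \<psi> x \<in> U'} v \<longrightarrow>
        (let I = (\<lambda>k. integral_dV \<psi> {x \<in> V. \<psi> x \<in> U}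
                   (trace_minus_form r h (levi_weight r \<omega> L (\<phi> k)) (multiplier_form (\<Gamma> k) v)))
         in summable (\<lambda>k. I (Suc k)) \<and>
            form_norm_sq r h (multiplier_form (\<lambda>\<xi>. type_gain F (Lambda_symbol \<xi>)) v)
            \<le> C * (integral_dV \<psi> {x \<in> V. \<psi> x \<in> U}
                     (trace_minus_form r h (levi \<gamma> L)
                       (multiplier_form (\<lambda>\<xi>. Lambda_symbol \<xi> powr (1/2)) v))
                   + (\<Sum>k. I (Suc k)) + form_norm_sq r h v)))"
proof -
  obtain A Lc where ds: "dyadic_symbols \<Gamma> A Lc" using dyadic_partition_symbols[OF dyadic] by (elim exE)
  obtain b :: "nat \<Rightarrow> real" and \<delta> C1 k0 where \<delta>: "0 < \<delta>" and C1: "0 < C1" and b0: "\<forall>k<k0. b k = 0"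
    and b1: "\<forall>k\<ge>k0. 1 \<le> b k \<and> (\<forall>d. 1 / b k \<le> d \<and> d < \<delta> \<longrightarrow> (b k)\<^sup>2 / 2 ^ k \<le> F d / d\<^sup>2)"
    and b2: "\<forall>k. (b k)\<^sup>2 \<le> 2 ^ k"
    and tg: "\<forall>k t. 1 \<le> t \<and> 2 ^ k \<le> A * t \<and> t \<le> A * 2 ^ k \<longrightarrow> (type_gain F t)\<^sup>2 \<le> C1 * (1 + (b k)\<^sup>2)"
    and tg1: "\<forall>t\<ge>1. (type_gain F t)\<^sup>2 \<le> C1 * t"
    using type_gain_sequence[OF F dyadic_symbols.A[OF ds]] by (elim exE conjE)
  have bk: "k0 \<le> k" if "b k \<noteq> 0" for k using that b0 by (meson not_le)
  have V: "open V" and s\<psi>: "smooth_on V \<psi>" and rel: "openin (top_of_set M) (\<psi> ` V)"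
    using param unfolding smooth_parametrization_def by simp_all
  obtain \<kappa> where hom: "homeomorphism V (\<psi> ` V) \<psi> \<kappa>" using param unfolding smooth_parametrization_def by (elim conjE exE)
  have inv: "\<kappa> (\<psi> x) = x" if "x \<in> V" for x using hom that by (simp add: homeomorphism_def)
  obtain K where K: "compact K" "M \<inter> U \<subseteq> K" "K \<subseteq> \<psi> ` V" using U(3) by (elim exE conjE)
  have zK: "z \<in> K" using S(2,4) U(2) K(2) by blast
  then obtain x0 where x0: "x0 \<in> V" "\<psi> x0 = z" using K(3) by blast
  define \<Omega> where "\<Omega> = {x \<in> V. \<psi> x \<in> U}"
  have \<Omega>V: "\<Omega> \<subseteq> V" unfolding \<Omega>_def by simp
  have o\<Omega>: "open \<Omega>"
  proof -
    have "\<Omega> = V \<inter> \<psi> -` U" unfolding \<Omega>_def by auto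
    then show ?thesis using continuous_open_preimage[OF smooth_on_continuous_on[OF s\<psi>] V U(1)] by simp
  qed
  have x0\<Omega>: "x0 \<in> \<Omega>" unfolding \<Omega>_def using x0 U(2) by simp
  \<comment> \<open>In coordinates the compact set of the hypothesis contains all of
    \<open>\<Omega>\<close>, which bounds the Levi matrix and the density up to the boundary. This
    matters because the multipliers spread \<open>v\<close> over the whole of
    \<open>\<Omega>\<close>.\<close>
  define KV where "KV = \<kappa> ` K"
  have KV: "compact KV" "KV \<subseteq> V" "\<Omega> \<subseteq> KV"
  proof -
    show "compact KV" unfolding KV_def
      by (rule compact_continuous_image[OF continuous_on_subset[OF homeomorphism_cont2[OF hom] K(3)] K(1)])
    show "KV \<subseteq> V" unfolding KV_def using K(3) homeomorphism_image2[OF hom] by blast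
    show "\<Omega> \<subseteq> KV"
    proof
      fix x assume x: "x \<in> \<Omega>"
      then have "\<psi> x \<in> M \<inter> U" using openin_imp_subset[OF rel] unfolding \<Omega>_def by blast
      then have "\<psi> x \<in> K" using K(2) by blast
      then show "x \<in> KV" unfolding KV_def using inv[of x] x \<Omega>V by (intro image_eqI[of _ _ "\<psi> x"]) auto
    qed
  qed
  have ff: "frame_fields r V \<omega> L \<gamma>"
    by (rule frame_fields.intro[OF V])
      (use conjunct1[OF frame[unfolded cr_frame_def]] conjunct1[OF conjunct2[OF frame[unfolded cr_frame_def]]] in simp_all)
  obtain cF where cF: "0 < cF" and ty: "\<forall>x\<in>\<Omega>. psd_matrix r (\<lambda>i j. levi \<gamma> L i j x
        - (if i = j then complex_of_real (cF * (F (infdist (\<psi> x) S) / (infdist (\<psi> x) S)\<^sup>2)) else 0))"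
    using type_F unfolding has_type_along_def \<Omega>_def[symmetric] by (elim exE conjE)
  have lev0: "0 \<le> Re (\<Sum>i<r. \<Sum>j<r. levi \<gamma> L i j x * a i * cnj (a j))" if "x \<in> V" for x a
    by (rule conjunct2[OF bspec[OF pseudoconvex[unfolded pseudoconvex_on_def psd_matrix_def] that], rule_format])
  have lev1: "cF * (F (infdist (\<psi> x) S) / (infdist (\<psi> x) S)\<^sup>2) * (\<Sum>i<r. (cmod (a i))\<^sup>2) \<le> Re (\<Sum>i<r. \<Sum>j<r. levi \<gamma> L i j x * a i * cnj (a j))"
    if "x \<in> \<Omega>" for x a
  proof -
    have "0 \<le> Re (\<Sum>i<r. \<Sum>j<r. (levi \<gamma> L i j x - (if i = j then complex_of_real (cF * (F (infdist (\<psi> x) S) / (infdist (\<psi> x) S)\<^sup>2)) else 0)) * a i * cnj (a j))"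
      by (rule conjunct2[OF bspec[OF ty[unfolded psd_matrix_def] that], rule_format])
    then show ?thesis unfolding hermitian_sum_diff_scalar by simp
  qed
  obtain H :: "(complex^'n) set" and g :: "complex^'n \<Rightarrow> real^'m \<Rightarrow> real" and R C c where R: "0 < R" "cball x0 R \<subseteq> \<Omega>"
    and C: "0 \<le> C" and c: "0 < c" and H: "finite H"
    and g: "\<forall>u\<in>H. smooth_on UNIV (g u) \<and> (\<forall>x. x \<notin> cball x0 R \<longrightarrow> g u x = 0) \<and> g u x0 = 0"
    and gd: "\<forall>x\<in>cball x0 (R / 2). infdist (\<psi> x) S < \<delta> \<and> (\<Sum>u\<in>H. (g u x)\<^sup>2) \<le> C * (infdist (\<psi> x) S)\<^sup>2"
    and coer: "\<forall>a. c * (\<Sum>i<r. (cmod (a i))\<^sup>2) \<le> (\<Sum>u\<in>H. (cmod (\<Sum>i<r. a i * vf_apply (L i) (\<lambda>y. complex_of_real (g u y)) x0))\<^sup>2)"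
    using totally_real_defining_functions[OF param frame S(1,3,4) x0(2) o\<Omega> x0\<Omega> \<Omega>V \<delta>] by (elim exE conjE)
  have R2: "cball x0 (R / 2) \<subseteq> \<Omega>" using subset_cball[of "R / 2" R x0] R by simp
  have "\<exists>\<phi> R' D M c0. 0 < R' \<and> R' \<le> R \<and> 0 \<le> D \<and> 0 \<le> M \<and> 0 < c0 \<and>
     (\<forall>k::nat. smooth_on UNIV (\<phi> k) \<and> (\<forall>x. \<bar>\<phi> k x\<bar> \<le> 2)) \<and>
     (\<forall>k. \<forall>x\<in>V. \<forall>i<r. \<forall>j<r. cmod (levi_weight r \<omega> L (\<phi> k) i j x) \<le> D * (b k)\<^sup>2) \<and>
     (\<forall>k a. \<forall>x\<in>cball x0 R'. c0 * (b k)\<^sup>2 * (\<Sum>i<r. (cmod (a i))\<^sup>2) \<le>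
        Re (\<Sum>i<r. \<Sum>j<r. (complex_of_real (M * 2 ^ k) * levi \<gamma> L i j x + levi_weight r \<omega> L (\<phi> k) i j x) * a i * cnj (a j)))"
  proof (rule weights_near_totally_real[where g=g and H=H and R=R and C=C and c=c and d="\<lambda>x. infdist (\<psi> x) S" and \<delta>=\<delta>
        and q="\<lambda>d. F d / d\<^sup>2" and cF=cF, OF ff R(1) subset_trans[OF R(2) \<Omega>V] C c H])
    show "b k = 0 \<or> 1 \<le> b k" for k using bk[of k] b1 by blast
    show "(b k)\<^sup>2 / 2 ^ k \<le> F d / d\<^sup>2" if "b k \<noteq> 0" "1 / b k \<le> d" "d < \<delta>" for k d
      using b1[rule_format, OF bk[OF that(1)]] that by simp
    show "0 \<le> Re (\<Sum>i<r. \<Sum>j<r. levi \<gamma> L i j x * a i * cnj (a j))" if "x \<in> cball x0 (R / 2)" for x a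
      by (rule lev0) (use that R2 \<Omega>V in blast)
    show "cF * (F (infdist (\<psi> x) S) / (infdist (\<psi> x) S)\<^sup>2) * (\<Sum>i<r. (cmod (a i))\<^sup>2) \<le> Re (\<Sum>i<r. \<Sum>j<r. levi \<gamma> L i j x * a i * cnj (a j))"
      if "x \<in> cball x0 (R / 2)" for x a
      by (rule lev1) (use that R2 in blast)
    show "g u x = 0" if "u \<in> H" "x \<notin> cball x0 R" for u x
      using bspec[OF g that(1)] that(2) by (elim conjE allE[of _ x]) (rule mp)
  qed (simp_all only: g gd coer infdist_nonneg cF)
  then obtain \<phi> :: "nat \<Rightarrow> real^'m \<Rightarrow> real" and R' D Mc c0 where R': "0 < R'" "R' \<le> R" and D: "0 \<le> D" and Mc: "0 \<le> Mc" and c0: "0 < c0"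
    and \<phi>: "\<forall>k::nat. smooth_on UNIV (\<phi> k) \<and> (\<forall>x. \<bar>\<phi> k x\<bar> \<le> 2)"
    and lw: "\<forall>k. \<forall>x\<in>V. \<forall>i<r. \<forall>j<r. cmod (levi_weight r \<omega> L (\<phi> k) i j x) \<le> D * (b k)\<^sup>2"
    and low: "\<forall>k a. \<forall>x\<in>cball x0 R'. c0 * (b k)\<^sup>2 * (\<Sum>i<r. (cmod (a i))\<^sup>2) \<le>
        Re (\<Sum>i<r. \<Sum>j<r. (complex_of_real (Mc * 2 ^ k) * levi \<gamma> L i j x + levi_weight r \<omega> L (\<phi> k) i j x) * a i * cnj (a j))"
    by (elim exE conjE)
  have \<phi>V: "smooth_on V (\<phi> k)" for k by (rule smooth_on_subset[OF conjunct1[OF spec[OF \<phi>]] subset_UNIV])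
  have ballR': "cball x0 R' \<subseteq> \<Omega>" using subset_cball[OF R'(2), of x0] R(2) by (rule subset_trans)
  \<comment> \<open>Three nested balls: \<open>\<rho>\<close> lives on radius \<open>R'\<close>,
    where the pointwise inequality holds; it equals 1 on \<open>B\<close>, of radius
    \<open>R' / 2\<close>, which supports \<open>w\<close>; and \<open>w\<close> equals 1 on radius
    \<open>R' / 4\<close>, where the forms will be supported.\<close>
  define B where "B = cball x0 (R' / 2)"
  have BR': "B \<subseteq> cball x0 R'" unfolding B_def by (rule subset_cball) (use R' in simp)
  have B\<Omega>: "B \<subseteq> \<Omega>" by (rule subset_trans[OF BR' ballR'])
  obtain \<rho> :: "real^'m \<Rightarrow> real" where \<rho>: "smooth_on UNIV \<rho>" "\<And>x. 0 \<le> \<rho> x" "\<And>x. \<rho> x \<le> 1"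
    "\<And>x. dist x0 x \<le> R' / 2 \<Longrightarrow> \<rho> x = 1" "\<And>x. R' \<le> dist x0 x \<Longrightarrow> \<rho> x = 0"
    using smooth_bump[OF R'(1)] by metis
  have R'2: "0 < R' / 2" using R'(1) by simp
  obtain w :: "real^'m \<Rightarrow> real" where w: "smooth_on UNIV w" "\<And>x. 0 \<le> w x" "\<And>x. w x \<le> 1"
    "\<And>x. dist x0 x \<le> R' / 2 / 2 \<Longrightarrow> w x = 1" "\<And>x. R' / 2 \<le> dist x0 x \<Longrightarrow> w x = 0"
    using smooth_bump[OF R'2] by metis
  have w0: "w x = 0" if "x \<notin> B" for x using w(5)[of x] that unfolding B_def by simp
  have tw: "test_fun w" unfolding test_fun_def
    by (intro conjI exI[of _ B] allI impI w(1) w0) (simp add: B_def)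
  have "\<exists>E\<ge>0. \<forall>p\<in>{..<r} \<times> {..<r}. \<forall>x\<in>KV. norm (levi \<gamma> L (fst p) (snd p) x) \<le> E"
  proof (rule uniform_bound_finite_family)
    fix p assume "p \<in> {..<r} \<times> {..<r}"
    then have p: "fst p < r" "snd p < r" by auto
    show "\<exists>B\<ge>0. \<forall>x\<in>KV. norm (levi \<gamma> L (fst p) (snd p) x) \<le> B"
      by (rule smooth_bounded_on_compact[OF frame_fields.smooth_levi[OF ff p] KV(1,2)])
  qed simp
  then obtain E where E: "0 \<le> E" "\<forall>p\<in>{..<r} \<times> {..<r}. \<forall>x\<in>KV. norm (levi \<gamma> L (fst p) (snd p) x) \<le> E" by (elim exE conjE)
  have lev_bd: "cmod (levi \<gamma> L i j x) \<le> E" if "i < r" "j < r" "x \<in> \<Omega>" for i j x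
    using bspec[OF bspec[OF E(2), of "(i, j)"] subsetD[OF KV(3) that(3)]] that by simp
  let ?dens = "volume_density \<psi>"
  have sdens: "smooth_on V ?dens" by (rule smooth_volume_density[OF param])
  have dpos: "0 < ?dens x" if "x \<in> V" for x by (rule volume_density_pos[OF param that])
  obtain D2 where D2: "0 \<le> D2" "\<forall>x\<in>KV. norm (?dens x) \<le> D2"
    using smooth_bounded_on_compact[OF sdens KV(1,2)] by (elim exE conjE)
  have dens_bd: "?dens x \<le> D2" if "x \<in> \<Omega>" for x
    using bspec[OF D2(2) subsetD[OF KV(3) that]] by simp
  have "\<exists>y\<in>B. \<forall>x\<in>B. ?dens y \<le> ?dens x"
    by (rule continuous_attains_inf[OF _ _ continuous_on_subset[OF smooth_on_continuous_on[OF sdens] subset_trans[OF B\<Omega> \<Omega>V]]])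
      (use R' in \<open>simp_all add: B_def\<close>)
  then obtain y where y: "y \<in> B" "\<forall>x\<in>B. ?dens y \<le> ?dens x" by (elim bexE)
  have dy: "0 < ?dens y" using y(1) B\<Omega> \<Omega>V dpos by blast
  let ?\<sigma> = "\<lambda>\<xi>::real^'m. type_gain F (Lambda_symbol \<xi>)" and ?l = "\<lambda>\<xi>::real^'m. Lambda_symbol \<xi> powr (1/2)"
  have pg: "poly_growth ?\<sigma>" by (rule type_gain_poly_growth[OF F C1]) (use tg1 in simp)
  have \<sigma>2: "(?\<sigma> \<xi>)\<^sup>2 \<le> C1 * (1 + (b k)\<^sup>2)" if "1 \<le> k" "\<Gamma> k \<xi> \<noteq> 0" for k \<xi>
    by (rule tg[rule_format]) (intro conjI Lambda_ge_1 dyadic_symbols.supp[OF ds that])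
  define adm where "adm h v \<longleftrightarrow> (\<forall>j\<in>multi_indices r h. test_fun (v j) \<and> (\<forall>x. complex_of_real (w x) * v j x = v j x))" for h and v :: "'m cform"
  define I where "I Q e v k = (LINT x:\<Omega>|lborel. Q (levi_weight r \<omega> L (\<lambda>y. e * \<phi> k y)) (multiplier_form (\<Gamma> k) v) x * ?dens x)"
    for Q :: "(nat \<Rightarrow> nat \<Rightarrow> real^'m \<Rightarrow> complex) \<Rightarrow> 'm cform \<Rightarrow> real^'m \<Rightarrow> real" and e v k
  define X where "X Q h e v = (LINT x:\<Omega>|lborel. Q (levi \<gamma> L) (multiplier_form ?l v) x * ?dens x) + (\<Sum>k. I Q e v (Suc k))
      + (\<Sum>j\<in>multi_indices r h. LINT x|lborel. (cmod (v j x))\<^sup>2)"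
    for Q :: "(nat \<Rightarrow> nat \<Rightarrow> real^'m \<Rightarrow> complex) \<Rightarrow> 'm cform \<Rightarrow> real^'m \<Rightarrow> real" and h e v
  define P where "P Q h e C' \<longleftrightarrow> (\<forall>v. adm h v \<longrightarrow> summable (\<lambda>k. I Q e v (Suc k)) \<and>
      (\<Sum>j\<in>multi_indices r h. LINT x|lborel. (cmod (multiplier_form ?\<sigma> v j x))\<^sup>2) \<le> C' * X Q h e v)"
    for Q :: "(nat \<Rightarrow> nat \<Rightarrow> real^'m \<Rightarrow> complex) \<Rightarrow> 'm cform \<Rightarrow> real^'m \<Rightarrow> real" and h and e C' :: real
  have est: "\<exists>e0>0. \<forall>e. 0 < e \<longrightarrow> e \<le> e0 \<longrightarrow> (\<exists>C'>0. P Q h e C')" if Q: "form_representation r (multi_indices r h) Q" for Q h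
    unfolding P_def X_def I_def adm_def
  proof (rule dyadic_symbols.weighted_form_estimate[OF ds Q finite_multi_indices o\<Omega>, where p="\<lambda>k. levi_weight r \<omega> L (\<phi> k)"
        and ?D1.0="E + D" and ?D2.0=D2 and b=b and B=B and ?d0.0="?dens y" and ?c0.0=c0 and M=Mc and \<rho>=\<rho> and K="cball x0 R'" and ?C1.0=C1])
    show "smooth_on \<Omega> (levi \<gamma> L i j)" if "i < r" "j < r" for i j
      by (rule smooth_on_subset[OF frame_fields.smooth_levi[OF ff that] \<Omega>V])
    show "cmod (levi \<gamma> L i j x) \<le> E + D" if "i < r" "j < r" "x \<in> \<Omega>" for i j x
      using lev_bd[OF that] D by simp
    show "0 \<le> Re (\<Sum>i<r. \<Sum>j<r. levi \<gamma> L i j x * a i * cnj (a j))" if "x \<in> \<Omega>" for x a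
      by (rule lev0[OF subsetD[OF \<Omega>V that]])
    show "continuous_on \<Omega> (levi_weight r \<omega> L (\<phi> k) i j)" if "i < r" "j < r" for k i j
      by (rule continuous_on_subset[OF smooth_on_continuous_on[OF frame_fields.smooth_levi_weight[OF ff \<phi>V that]] \<Omega>V])
    show "cmod (levi_weight r \<omega> L (\<phi> k) i j x) \<le> (E + D) * (b k)\<^sup>2" if "i < r" "j < r" "x \<in> \<Omega>" for k i j x
    proof -
      have "cmod (levi_weight r \<omega> L (\<phi> k) i j x) \<le> D * (b k)\<^sup>2" using lw subsetD[OF \<Omega>V that(3)] that by simp
      also have "\<dots> \<le> (E + D) * (b k)\<^sup>2" using E(1) by (intro mult_right_mono) simp_all
      finally show ?thesis .
    qed
    show "levi_weight r \<omega> L (\<lambda>y. e * \<phi> k y) i j x = complex_of_real e * levi_weight r \<omega> L (\<phi> k) i j x"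
      if "i < r" "j < r" "x \<in> \<Omega>" for e k i j x
      by (rule levi_weight_scale[OF ff \<phi>V that(1,2) subsetD[OF \<Omega>V that(3)]])
    show "smooth_on \<Omega> ?dens" by (rule smooth_on_subset[OF sdens \<Omega>V])
    show "0 \<le> ?dens x" if "x \<in> \<Omega>" for x by (rule less_imp_le[OF dpos[OF subsetD[OF \<Omega>V that]]])
    show "c0 * (b k)\<^sup>2 * (\<Sum>i<r. (cmod (a i))\<^sup>2) \<le>
         Re (\<Sum>i<r. \<Sum>j<r. (complex_of_real (Mc * 2 ^ k) * levi \<gamma> L i j x + levi_weight r \<omega> L (\<phi> k) i j x) * a i * cnj (a j))"
      if "x \<in> B" for k x a by (rule low[rule_format, OF subsetD[OF BR' that]])
    show "\<rho> x = 1" if "x \<in> B" for x by (rule \<rho>(4)) (use that in \<open>simp add: B_def\<close>)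
    show "\<rho> x = 0" if "x \<notin> cball x0 R'" for x by (rule \<rho>(5)) (use that in simp)
    show "0 \<le> E + D" using E(1) D by simp
    show "?dens y \<le> ?dens x" if "x \<in> B" for x by (rule bspec[OF y(2) that])
    show "(b k)\<^sup>2 \<le> 2 ^ k" for k by (rule b2[rule_format])
  qed (fact dens_bd D2(1) B\<Omega> dy c0 Mc \<rho>(1) \<rho>(2) \<rho>(3) compact_cball ballR' tw w(2) w(3) w0 pg \<sigma>2 C1)+
  \<comment> \<open>A Boolean tag puts the degrees of both estimates into one finite index set, over
    which the small parameter is chosen.\<close>
  define Qf where "Qf = (\<lambda>(s, h). if s then matrix_form r h else (trace_minus_form r h :: _ \<Rightarrow> 'm cform \<Rightarrow> _))"
  have "\<exists>e>0. \<exists>C'>0. \<forall>i\<in>{True} \<times> {1..r} \<union> {False} \<times> {..<r}. P (Qf i) (snd i) e C'"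
  proof (rule common_small_parameter)
    fix i assume "i \<in> {True} \<times> {1..r} \<union> {False} \<times> {..<r}"
    then have "form_representation r (multi_indices r (snd i)) (Qf i)"
      unfolding Qf_def using matrix_form_representation trace_minus_form_representation by (auto split: prod.split)
    then show "\<exists>e0>0. \<forall>e. 0 < e \<longrightarrow> e \<le> e0 \<longrightarrow> (\<exists>C'>0. P (Qf i) (snd i) e C')" by (rule est)
  next
    fix i e and C C' :: real assume p: "P (Qf i) (snd i) e C" and CC: "0 < C" "C \<le> C'"
    show "P (Qf i) (snd i) e C'" unfolding P_def
    proof (intro allI impI)
      fix v assume "adm (snd i) v"
      then have s: "summable (\<lambda>k. I (Qf i) e v (Suc k))"
        and le: "(\<Sum>j\<in>multi_indices r (snd i). LINT x|lborel. (cmod (multiplier_form ?\<sigma> v j x))\<^sup>2) \<le> C * X (Qf i) (snd i) e v"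
        using p unfolding P_def by simp_all
      \<comment> \<open>The bracket contains a sum without sign. Its nonnegativity is read off from
        the estimate itself, and only then may the constant be enlarged.\<close>
      have "0 \<le> (\<Sum>j\<in>multi_indices r (snd i). LINT x|lborel. (cmod (multiplier_form ?\<sigma> v j x))\<^sup>2)"
        by (intro sum_nonneg Bochner_Integration.integral_nonneg) simp
      then have "0 \<le> C * X (Qf i) (snd i) e v" using le by (rule order_trans)
      then have "0 \<le> X (Qf i) (snd i) e v" using CC(1) by (simp add: zero_le_mult_iff)
      then have "C * X (Qf i) (snd i) e v \<le> C' * X (Qf i) (snd i) e v" by (rule mult_right_mono[OF CC(2)])
      with s le show "summable (\<lambda>k. I (Qf i) e v (Suc k)) \<and>
        (\<Sum>j\<in>multi_indices r (snd i). LINT x|lborel. (cmod (multiplier_form ?\<sigma> v j x))\<^sup>2) \<le> C' * X (Qf i) (snd i) e v" by linarith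
    qed
  qed simp
  then obtain e C' where e: "0 < e" and C': "0 < C'" and all: "\<forall>i\<in>{True} \<times> {1..r} \<union> {False} \<times> {..<r}. P (Qf i) (snd i) e C'"
    by (elim exE conjE)
  define N where "N = ball x0 (R' / 4)"
  have NV: "N \<subseteq> V"
  proof -
    have "N \<subseteq> cball x0 R'" unfolding N_def using R'(1) by auto
    then show ?thesis using ballR' \<Omega>V by blast
  qed
  \<comment> \<open>A neighborhood in the ambient space is needed. The parametrization is a
    homeomorphism onto a relatively open piece of \<open>M\<close>, so the image of the small ball
    is the trace on \<open>M\<close> of an open set \<open>W\<close>.\<close>
  have "openin (top_of_set V) N" unfolding N_def by (rule open_openin_trans[OF V open_ball NV[unfolded N_def]])
  then have "openin (top_of_set (\<psi> ` V)) (\<psi> ` N)" by (rule homeomorphism_imp_open_map[OF hom])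
  then have "openin (top_of_set M) (\<psi> ` N)" using rel by (rule openin_trans)
  then obtain W where W: "open W" "\<psi> ` N = M \<inter> W" unfolding openin_open by (elim exE conjE)
  have adm: "adm h v" if v: "test_form r h {x \<in> V. \<psi> x \<in> U \<inter> W} v" for h v
    unfolding adm_def
  proof (intro ballI conjI allI)
    fix j assume j: "j \<in> multi_indices r h"
    obtain Kv where Kv: "smooth_on UNIV (v j)" "compact Kv" "Kv \<subseteq> {x \<in> V. \<psi> x \<in> U \<inter> W}" "\<forall>x. x \<notin> Kv \<longrightarrow> v j x = 0"
      using bspec[OF v[unfolded test_form_def] j] by (elim exE conjE)
    show "test_fun (v j)" unfolding test_fun_def by (intro conjI exI[of _ Kv] Kv)
    fix x
    show "complex_of_real (w x) * v j x = v j x"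
    proof (cases "x \<in> Kv")
      case True
      then have x: "x \<in> V" "\<psi> x \<in> W" using Kv(3) by auto
      \<comment> \<open>Injectivity of the parametrization leads from the image back to the ball: a
        point of \<open>V\<close> mapped into \<open>W\<close> lies in \<open>N\<close>, where
        \<open>w\<close> equals 1.\<close>
      have "\<psi> x \<in> \<psi> ` N"
        unfolding W(2) by (rule IntI[OF subsetD[OF openin_imp_subset[OF rel] imageI[OF x(1)]] x(2)])
      then obtain y where y: "\<psi> x = \<psi> y" "y \<in> N" by (elim imageE)
      have "\<kappa> (\<psi> x) = \<kappa> (\<psi> y)" by (rule arg_cong[OF y(1)])
      then have "x = y" unfolding inv[OF x(1)] inv[OF subsetD[OF NV y(2)]] .
      then have "dist x0 x \<le> R' / 2 / 2" using y(2) unfolding N_def by simp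
      then have "w x = 1" by (rule w(4))
      then show ?thesis by simp
    qed (use Kv(4) in simp)
  qed
  show ?thesis
    unfolding integral_dV_def form_norm_sq_def Let_def \<Omega>_def[symmetric]
  proof (rule exI[of _ "U \<inter> W"], rule exI[of _ "\<lambda>k y. e * \<phi> k y"], rule exI[of _ C'],
      (intro conjI[OF _ conjI]; (rule conjI)?; (intro allI impI)?))
    have "z \<in> \<psi> ` N" using x0(2) R'(1) unfolding N_def by auto
    then show "z \<in> U \<inter> W" unfolding W(2) using U(2) by simp
    show "open (U \<inter> W)" using U(1) W(1) by (rule open_Int)
    show "smooth_on V (\<lambda>y. e * \<phi> k y)" for k by (intro smooth_on_mult[OF V] smooth_on_const[OF V] \<phi>V)
    show "\<exists>B. \<forall>k\<ge>1. \<forall>x\<in>V. \<bar>e * \<phi> k x\<bar> \<le> B"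
    proof (rule exI[of _ "e * 2"], intro allI impI ballI)
      fix k x
      have "e * \<bar>\<phi> k x\<bar> \<le> e * 2" by (rule mult_left_mono[OF spec[OF conjunct2[OF spec[OF \<phi>]]]]) (use e in simp)
      then show "\<bar>e * \<phi> k x\<bar> \<le> e * 2" using e by (simp add: abs_mult)
    qed
    fix h v
    show "summable (\<lambda>k. LINT x:\<Omega>|lborel. matrix_form r h (levi_weight r \<omega> L (\<lambda>y. e * \<phi> (Suc k) y)) (multiplier_form (\<Gamma> (Suc k)) v) x * ?dens x)
      \<and> (\<Sum>J\<in>multi_indices r h. LINT x|lborel. (cmod (multiplier_form ?\<sigma> v J x))\<^sup>2) \<le> C' * ((LINT x:\<Omega>|lborel. matrix_form r h (levi \<gamma> L) (multiplier_form ?l v) x * ?dens x)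
        + (\<Sum>k. LINT x:\<Omega>|lborel. matrix_form r h (levi_weight r \<omega> L (\<lambda>y. e * \<phi> (Suc k) y)) (multiplier_form (\<Gamma> (Suc k)) v) x * ?dens x)
        + (\<Sum>J\<in>multi_indices r h. LINT x|lborel. (cmod (v J x))\<^sup>2))"
      if h: "1 \<le> h \<and> h \<le> r \<and> test_form r h {x \<in> V. \<psi> x \<in> U \<inter> W} v"
    proof -
      have "P (Qf (True, h)) (snd (True, h)) e C'" by (rule bspec[OF all]) (use h in simp)
      then have p: "P (matrix_form r h) h e C'" by (simp add: Qf_def)
      have a: "adm h v" by (rule adm) (use h in simp)
      show ?thesis by (rule p[unfolded P_def X_def I_def, rule_format, OF a])
    qed
    show "summable (\<lambda>k. LINT x:\<Omega>|lborel. trace_minus_form r h (levi_weight r \<omega> L (\<lambda>y. e * \<phi> (Suc k) y)) (multiplier_form (\<Gamma> (Suc k)) v) x * ?dens x)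
      \<and> (\<Sum>J\<in>multi_indices r h. LINT x|lborel. (cmod (multiplier_form ?\<sigma> v J x))\<^sup>2) \<le> C' * ((LINT x:\<Omega>|lborel. trace_minus_form r h (levi \<gamma> L) (multiplier_form ?l v) x * ?dens x)
        + (\<Sum>k. LINT x:\<Omega>|lborel. trace_minus_form r h (levi_weight r \<omega> L (\<lambda>y. e * \<phi> (Suc k) y)) (multiplier_form (\<Gamma> (Suc k)) v) x * ?dens x)
        + (\<Sum>J\<in>multi_indices r h. LINT x|lborel. (cmod (v J x))\<^sup>2))"
      if h: "h < r \<and> test_form r h {x \<in> V. \<psi> x \<in> U \<inter> W} v"
    proof -
      have "P (Qf (False, h)) (snd (False, h)) e C'" by (rule bspec[OF all]) (use h in simp)
      then have p: "P (trace_minus_form r h) h e C'" by (simp add: Qf_def)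
      have a: "adm h v" by (rule adm) (use h in simp)
      show ?thesis by (rule p[unfolded P_def X_def I_def, rule_format, OF a])
    qed
  qed (use C' in simp_all)
qed

end
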